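(* Let $\mathfrak g$ be a restricted Lie algebra, $M$ a finite dimensional $\mathfrak u(\mathfrak g)$-module, and $r,j$ positive integers with $j\le(p-1)r$. Let $Z=\mathbb R\mathrm{ad}^j(r,\mathfrak g)_M$ (resp. $Z=\mathbb S\mathrm{oc}^j(r,\mathfrak g)_M$) and let $X=\mathbb E(r,\mathfrak g)\setminus Z$, a Zariski open subset of $\mathbb E(r,\mathfrak g)$. Then $\mathcal{I}m^{j,X}(M)=\mathcal{I}m^{j,\mathbb E(r,\mathfrak g)}(M)_{|X}$ (resp. $\mathcal{K}er^{j,X}(M)=\mathcal{K}er^{j,\mathbb E(r,\mathfrak g)}(M)_{|X}$) is an algebraic vector bundle on $X$. Moreover, the fiber of $\mathcal{I}m^{j,X}(M)$ (resp. $\mathcal{K}er^{j,X}(M)$) at any $\epsilon\in X$ is naturally identified with $\operatorname{Rad}^j(\epsilon^*M)$ (resp. $\operatorname{Soc}^j(\epsilon^*M)$).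
   Context: Let $k$ be an algebraically closed field of characteristic $p>0$. Lie algebras are finite dimensional restricted Lie algebras over $k$ with $p$-operation $(-)^{[p]}$; $\mathfrak u(\mathfrak g)$ is the restricted enveloping algebra. An elementary subalgebra of $\mathfrak g$ is an abelian Lie subalgebra $\epsilon$ with $x^{[p]}=0$ for all $x\in\epsilon$. For $0<r<\dim\mathfrak g$, $\mathbb E(r,\mathfrak g)\subset\operatorname{Grass}(r,\mathfrak g)$ is the closed subvariety of $r$-dimensional elementary subalgebras. $\epsilon^*M$ is the restriction of $M$ to $\epsilon$; $\operatorname{Rad}^j(\epsilon^*M)=J^jM$ and $\operatorname{Soc}^j(\epsilon^*M)=\{m\in M:J^jm=0\}$, where $J$ is the Jacobson radical of $\mathfrak u(\epsilon)$. Define closed subvarieties of $\mathbb E(r,\mathfrak g)$: $$\mathbb R\mathrm{ad}^j(r,\mathfrak g)_M=\{\epsilon:\dim\operatorname{Rad}^j(\epsilon^*M)<\max_{\epsilon'}\dim\operatorname{Rad}^j(\epsilon'^*M)\},$$ $$\mathbb S\mathrm{oc}^j(r,\mathfrak g)_M=\{\epsilon:\dim\operatorname{Soc}^j(\epsilon^*M)>\min_{\epsilon'}\dim\operatorname{Soc}^j(\epsilon'^*M)\},$$ with $\epsilon'$ ranging over $\mathbb E(r,\mathfrak g)$. Image and kernel sheaves. Let $\mathcal C^o$ be the quasi-projective variety of linearly independent $r$-tuples $(X_1,\dots,X_r)$ of pairwise commuting elements of $\mathfrak g$ with $X_s^{[p]}=0$; sending a tuple to its span makes $\mathcal C^o\to\mathbb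 E(r,\mathfrak g)$ a $\mathrm{GL}_r$-torsor. Fix a basis $x_1,\dots,x_n$ of $\mathfrak g$ and let $Y_{i,s}$ be the function on $\mathcal C^o$ giving the $i$-th coordinate of $X_s$. For a locally closed subvariety $X\subset\mathbb E(r,\mathfrak g)$ let $q:\widetilde X\to X$ be the restriction of this torsor. Let $\Theta_s:M\otimes\mathcal O_{\widetilde X}\to M\otimes\mathcal O_{\widetilde X}$, $m\otimes f\mapsto\sum_i x_im\otimes Y_{i,s}f$. For $1\le j\le(p-1)r$, the sum of the images of all $\Theta_1^{j_1}\cdots\Theta_r^{j_r}$ with $j_1+\dots+j_r=j$, $j_\ell\ge0$, and the intersection of the kernels of these operators, are $\mathrm{GL}_r$-invariant coherent subsheaves of $M\otimes\mathcal O_{\widetilde X}$; by descent along $q$ they are the pull-backs of unique coherent subsheaves $\mathcal{I}m^{j,X}(M)$ and $\mathcal{K}er^{j,X}(M)$ of $M\otimes\mathcal O_X$. *)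

theory Defs
  imports
    "HOL-Analysis.Abstract_Topology"
    "HOL-Algebra.QuotRing"
    "HOL-Algebra.Ideal_Product"
    "HOL-Computational_Algebra.Polynomial"
    "HOL-Library.Function_Algebras"
begin

section \<open>Restricted Lie algebras\<close>

text \<open>A Lie algebra occupies a whole type. The characteristic of the ground field enters only as
  \<open>CHAR('k)\<close>, which is assumed to be positive in the theorem.\<close>

record ('k, 'g) lie_data =
  lscale :: "'k \<Rightarrow> 'g \<Rightarrow> 'g"
  bracket :: "'g \<Rightarrow> 'g \<Rightarrow> 'g"
  pmap :: "'g \<Rightarrow> 'g"

text \<open>\<open>ad_coeff g x y n i\<close> is the coefficient of \<open>t ^ i\<close> in \<open>(ad (t x + y)) ^ n (x)\<close>.\<close>

fun ad_coeff :: "('k, 'g::ab_group_add) lie_data \<Rightarrow> 'g \<Rightarrow> 'g \<Rightarrow> nat \<Rightarrow> nat \<Rightarrow> 'g" where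
  "ad_coeff g x y 0 i = (if i = 0 then x else 0)"
| "ad_coeff g x y (Suc n) i =
     (case i of 0 \<Rightarrow> 0 | Suc i' \<Rightarrow> bracket g x (ad_coeff g x y n i')) + bracket g y (ad_coeff g x y n i)"

definition lie_algebra :: "('k::field, 'g::ab_group_add) lie_data \<Rightarrow> bool" where
  "lie_algebra g \<longleftrightarrow>
     vector_space (lscale g) \<and>
     (\<forall>x. Vector_Spaces.linear (lscale g) (lscale g) (bracket g x)) \<and>
     (\<forall>y. Vector_Spaces.linear (lscale g) (lscale g) (\<lambda>x. bracket g x y)) \<and>
     (\<forall>x. bracket g x x = 0) \<and>
     (\<forall>x y z. bracket g x (bracket g y z) + bracket g y (bracket g z x)
              + bracket g z (bracket g x y) = 0)"

text \<open>Jacobson's axioms for the \<open>p\<close>-operation; \<open>s_i(x,y)\<close> is defined by requiring that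
  \<open>i s_i(x,y)\<close> is the coefficient of \<open>t ^ (i - 1)\<close> in \<open>(ad (t x + y)) ^ (p - 1) (x)\<close>.\<close>

definition restricted_lie_algebra :: "('k::field, 'g::ab_group_add) lie_data \<Rightarrow> bool" where
  "restricted_lie_algebra g \<longleftrightarrow>
     lie_algebra g \<and>
     (\<forall>x. (bracket g x ^^ CHAR('k)) = bracket g (pmap g x)) \<and>
     (\<forall>c x. pmap g (lscale g c x) = lscale g (c ^ CHAR('k)) (pmap g x)) \<and>
     (\<forall>x y. pmap g (x + y) = pmap g x + pmap g y
        + (\<Sum>i = 1..<CHAR('k). lscale g (inverse (of_nat i)) (ad_coeff g x y (CHAR('k) - 1) (i - 1))))"


section \<open>Restricted enveloping algebras and their modules\<close>

text \<open>The free associative \<open>k\<close>-algebra on the set \<open>S\<close>: finitely supported functions on words, with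
  the product induced by concatenation of words.\<close>

definition fa_const :: "'k::zero \<Rightarrow> 'g list \<Rightarrow> 'k" where
  "fa_const c = (\<lambda>w. if w = [] then c else 0)"

definition fa_gen :: "'g \<Rightarrow> 'g list \<Rightarrow> 'k::zero_neq_one" where
  "fa_gen x = (\<lambda>w. if w = [x] then 1 else 0)"

definition free_alg :: "'g set \<Rightarrow> ('g list \<Rightarrow> 'k::field) ring" where
  "free_alg S =
     \<lparr> carrier = {f. finite {w. f w \<noteq> 0} \<and> (\<forall>w. f w \<noteq> 0 \<longrightarrow> set w \<subseteq> S)},
       monoid.mult = (\<lambda>f h w. \<Sum>i\<le>length w. f (take i w) * h (drop i w)),
       one = fa_const 1,
       zero = (\<lambda>w. 0),
       add = (\<lambda>f h w. f w + h w) \<rparr>"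

text \<open>For a restricted subalgebra \<open>L\<close> of \<open>g\<close>, the restricted enveloping algebra of \<open>L\<close> is the free
  algebra on the set \<open>L\<close> modulo linearity of the generators (which yields the tensor algebra),
  \<open>xy - yx = [x,y]\<close> and \<open>x ^ p = pmap x\<close>.\<close>

definition uenv_relations :: "('k::field, 'g::ab_group_add) lie_data \<Rightarrow> 'g set \<Rightarrow> ('g list \<Rightarrow> 'k) set" where
  "uenv_relations g L =
     (let A = free_alg L in
       {fa_gen (x + y) \<ominus>\<^bsub>A\<^esub> (fa_gen x \<oplus>\<^bsub>A\<^esub> fa_gen y) | x y. x \<in> L \<and> y \<in> L} \<union>
       {fa_gen (lscale g c x) \<ominus>\<^bsub>A\<^esub> fa_const c \<otimes>\<^bsub>A\<^esub> fa_gen x | c x. x \<in> L} \<union>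
       {(fa_gen x \<otimes>\<^bsub>A\<^esub> fa_gen y \<ominus>\<^bsub>A\<^esub> fa_gen y \<otimes>\<^bsub>A\<^esub> fa_gen x) \<ominus>\<^bsub>A\<^esub> fa_gen (bracket g x y)
          | x y. x \<in> L \<and> y \<in> L} \<union>
       {fa_gen x [^]\<^bsub>A\<^esub> CHAR('k) \<ominus>\<^bsub>A\<^esub> fa_gen (pmap g x) | x. x \<in> L})"

definition uenv_ideal :: "('k::field, 'g::ab_group_add) lie_data \<Rightarrow> 'g set \<Rightarrow> ('g list \<Rightarrow> 'k) set" where
  "uenv_ideal g L = genideal (free_alg L) (uenv_relations g L)"

definition uenv :: "('k::field, 'g::ab_group_add) lie_data \<Rightarrow> 'g set \<Rightarrow> (('g list \<Rightarrow> 'k) set) ring" where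
  "uenv g L = free_alg L Quot uenv_ideal g L"

definition uenv_class ::
    "('k::field, 'g::ab_group_add) lie_data \<Rightarrow> 'g set \<Rightarrow> ('g list \<Rightarrow> 'k) \<Rightarrow> ('g list \<Rightarrow> 'k) set" where
  "uenv_class g L f = uenv_ideal g L +>\<^bsub>free_alg L\<^esub> f"

record ('k, 'g, 'm) mod_data =
  mscale :: "'k \<Rightarrow> 'm \<Rightarrow> 'm"
  uact :: "('g list \<Rightarrow> 'k) set \<Rightarrow> 'm \<Rightarrow> 'm"

definition uenv_module ::
    "('k::field, 'g::ab_group_add) lie_data \<Rightarrow> ('k, 'g, 'm::ab_group_add) mod_data \<Rightarrow> bool" where
  "uenv_module g M \<longleftrightarrow>
     (let U = uenv g UNIV in
       vector_space (mscale M) \<and>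
       (\<forall>a\<in>carrier U. \<forall>m n. uact M a (m + n) = uact M a m + uact M a n) \<and>
       (\<forall>a\<in>carrier U. \<forall>b\<in>carrier U. \<forall>m. uact M (a \<oplus>\<^bsub>U\<^esub> b) m = uact M a m + uact M b m) \<and>
       (\<forall>a\<in>carrier U. \<forall>b\<in>carrier U. \<forall>m. uact M (a \<otimes>\<^bsub>U\<^esub> b) m = uact M a (uact M b m)) \<and>
       (\<forall>c m. uact M (uenv_class g UNIV (fa_const c)) m = mscale M c m))"

definition lie_act ::
    "('k::field, 'g::ab_group_add) lie_data \<Rightarrow> ('k, 'g, 'm) mod_data \<Rightarrow> 'g \<Rightarrow> 'm \<Rightarrow> 'm" where
  "lie_act g M x = uact M (uenv_class g UNIV (fa_gen x))"

text \<open>The action of \<open>u(L)\<close> on the restriction of \<open>M\<close> to \<open>L\<close>: the union below is the image of the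
  coset \<open>a\<close> under the homomorphism \<open>u(L) \<rightarrow> u(g)\<close> induced by the inclusion.\<close>

definition restr_act ::
    "('k::field, 'g::ab_group_add) lie_data \<Rightarrow> ('k, 'g, 'm) mod_data \<Rightarrow> ('g list \<Rightarrow> 'k) set \<Rightarrow> 'm \<Rightarrow> 'm" where
  "restr_act g M a = uact M (\<Union>f\<in>a. uenv_class g UNIV f)"


section \<open>Radical and socle layers\<close>

definition left_ideal :: "'a set \<Rightarrow> ('a, 'b) ring_scheme \<Rightarrow> bool" where
  "left_ideal I R \<longleftrightarrow> additive_subgroup I R \<and> (\<forall>a\<in>carrier R. \<forall>x\<in>I. a \<otimes>\<^bsub>R\<^esub> x \<in> I)"

definition maximal_left_ideal :: "'a set \<Rightarrow> ('a, 'b) ring_scheme \<Rightarrow> bool" where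
  "maximal_left_ideal I R \<longleftrightarrow>
     left_ideal I R \<and> I \<noteq> carrier R \<and>
     (\<forall>K. left_ideal K R \<and> I \<subseteq> K \<longrightarrow> K = I \<or> K = carrier R)"

definition jacobson_radical :: "('a, 'b) ring_scheme \<Rightarrow> 'a set" where
  "jacobson_radical R = carrier R \<inter> \<Inter>{I. maximal_left_ideal I R}"

fun ideal_power :: "('a, 'b) ring_scheme \<Rightarrow> 'a set \<Rightarrow> nat \<Rightarrow> 'a set" where
  "ideal_power R J 0 = carrier R"
| "ideal_power R J (Suc n) = ideal_prod R J (ideal_power R J n)"

definition Rad ::
    "('k::field, 'g::ab_group_add) lie_data \<Rightarrow> ('k, 'g, 'm::ab_group_add) mod_data \<Rightarrow> nat \<Rightarrow> 'g set \<Rightarrow> 'm set" where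
  "Rad g M j \<epsilon> =
     module.span (mscale M)
       {restr_act g M a m | a m. a \<in> ideal_power (uenv g \<epsilon>) (jacobson_radical (uenv g \<epsilon>)) j}"

definition Soc ::
    "('k::field, 'g::ab_group_add) lie_data \<Rightarrow> ('k, 'g, 'm::ab_group_add) mod_data \<Rightarrow> nat \<Rightarrow> 'g set \<Rightarrow> 'm set" where
  "Soc g M j \<epsilon> =
     {m. \<forall>a \<in> ideal_power (uenv g \<epsilon>) (jacobson_radical (uenv g \<epsilon>)) j. restr_act g M a m = 0}"


section \<open>Elementary subalgebras\<close>

definition elementary :: "('k::field, 'g::ab_group_add) lie_data \<Rightarrow> 'g set \<Rightarrow> bool" where
  "elementary g \<epsilon> \<longleftrightarrow>
     module.subspace (lscale g) \<epsilon> \<and> (\<forall>x\<in>\<epsilon>. \<forall>y\<in>\<epsilon>. bracket g x y = 0) \<and> (\<forall>x\<in>\<epsilon>. pmap g x = 0)"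

definition Elem :: "nat \<Rightarrow> ('k::field, 'g::ab_group_add) lie_data \<Rightarrow> 'g set set" where
  "Elem r g = {\<epsilon>. elementary g \<epsilon> \<and> vector_space.dim (lscale g) \<epsilon> = r}"

definition Rad_locus ::
    "nat \<Rightarrow> nat \<Rightarrow> ('k::field, 'g::ab_group_add) lie_data \<Rightarrow> ('k, 'g, 'm::ab_group_add) mod_data \<Rightarrow> 'g set set" where
  "Rad_locus j r g M =
     {\<epsilon> \<in> Elem r g. vector_space.dim (mscale M) (Rad g M j \<epsilon>)
        < Max ((\<lambda>\<epsilon>'. vector_space.dim (mscale M) (Rad g M j \<epsilon>')) ` Elem r g)}"

definition Soc_locus ::
    "nat \<Rightarrow> nat \<Rightarrow> ('k::field, 'g::ab_group_add) lie_data \<Rightarrow> ('k, 'g, 'm::ab_group_add) mod_data \<Rightarrow> 'g set set" where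
  "Soc_locus j r g M =
     {\<epsilon> \<in> Elem r g. vector_space.dim (mscale M) (Soc g M j \<epsilon>)
        > Min ((\<lambda>\<epsilon>'. vector_space.dim (mscale M) (Soc g M j \<epsilon>')) ` Elem r g)}"


section \<open>Varieties as spaces with functions\<close>

text \<open>A variety over the algebraically closed field \<open>k\<close> is given by its Zariski topology and its
  regular functions. Sections over an open set \<open>U\<close> (regular functions, and later sections of
  sheaves) are represented by total functions whose values outside \<open>U\<close> are irrelevant: sets of
  sections over \<open>U\<close> are closed under changing the values off \<open>U\<close>, and restriction to a
  smaller open set is the identity on representatives. The value of \<open>reg\<close> matters only on open
  sets.\<close>

record ('x, 'k) fspace =
  zar :: "'x topology"
  reg :: "'x set \<Rightarrow> ('x \<Rightarrow> 'k) set"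

text \<open>Locally closed subvarieties carry the induced (reduced) structure.\<close>

definition subvariety :: "('x, 'k) fspace \<Rightarrow> 'x set \<Rightarrow> ('x, 'k) fspace" where
  "subvariety X S =
     \<lparr> zar = subtopology (zar X) S,
       reg = (\<lambda>U. {f. \<forall>x\<in>U. \<exists>V h. openin (zar X) V \<and> x \<in> V \<and> h \<in> reg X V \<and> (\<forall>y\<in>V \<inter> U. f y = h y)}) \<rparr>"

definition quotient_variety :: "('x, 'k) fspace \<Rightarrow> ('x \<Rightarrow> 'y) \<Rightarrow> ('y, 'k) fspace" where
  "quotient_variety X q =
     \<lparr> zar = topology (\<lambda>U. U \<subseteq> q ` topspace (zar X) \<and> openin (zar X) {x \<in> topspace (zar X). q x \<in> U}),
       reg = (\<lambda>U. {f. (\<lambda>x. f (q x)) \<in> reg X {x \<in> topspace (zar X). q x \<in> U}}) \<rparr>"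

lemma openin_quotient_variety:
  "openin (zar (quotient_variety X q)) U \<longleftrightarrow>
     U \<subseteq> q ` topspace (zar X) \<and> openin (zar X) {x \<in> topspace (zar X). q x \<in> U}"
proof -
  let ?P = "\<lambda>x U. x \<in> topspace (zar X) \<and> q x \<in> U"
  have "istopology (\<lambda>U. U \<subseteq> q ` topspace (zar X) \<and> openin (zar X) {x. ?P x U})"
    unfolding istopology_def
  proof (intro conjI allI impI)
    fix S T
    assume S: "S \<subseteq> q ` topspace (zar X) \<and> openin (zar X) {x. ?P x S}"
      and T: "T \<subseteq> q ` topspace (zar X) \<and> openin (zar X) {x. ?P x T}"
    have "{x. ?P x (S \<inter> T)} = {x. ?P x S} \<inter> {x. ?P x T}" by auto
    then show "openin (zar X) {x. ?P x (S \<inter> T)}" using S T by auto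
    show "S \<inter> T \<subseteq> q ` topspace (zar X)" using S by auto
  next
    fix K
    assume K: "\<forall>S\<in>K. S \<subseteq> q ` topspace (zar X) \<and> openin (zar X) {x. ?P x S}"
    have "{x. ?P x (\<Union>K)} = \<Union>((\<lambda>S. {x. ?P x S}) ` K)" by auto
    moreover have "openin (zar X) (\<Union>((\<lambda>S. {x. ?P x S}) ` K))" using K by (intro openin_Union) auto
    ultimately show "openin (zar X) {x. ?P x (\<Union>K)}" by (simp only:)
    show "\<Union>K \<subseteq> q ` topspace (zar X)" using K by auto
  qed
  then show ?thesis unfolding quotient_variety_def by simp
qed

text \<open>The affine space \<open>g ^ r\<close>: points are lists of length \<open>r\<close>, and its coordinate ring is
  generated by the linear functionals of the \<open>r\<close> components.\<close>

inductive_set polyfun :: "('k::field, 'g::ab_group_add) lie_data \<Rightarrow> nat \<Rightarrow> ('g list \<Rightarrow> 'k) set"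
  for g r where
  polyfun_const: "(\<lambda>X. c) \<in> polyfun g r"
| polyfun_coord: "\<lbrakk>Vector_Spaces.linear (lscale g) (*) \<phi>; s < r\<rbrakk> \<Longrightarrow> (\<lambda>X. \<phi> (X ! s)) \<in> polyfun g r"
| polyfun_add: "\<lbrakk>P \<in> polyfun g r; Q \<in> polyfun g r\<rbrakk> \<Longrightarrow> (\<lambda>X. P X + Q X) \<in> polyfun g r"
| polyfun_mult: "\<lbrakk>P \<in> polyfun g r; Q \<in> polyfun g r\<rbrakk> \<Longrightarrow> (\<lambda>X. P X * Q X) \<in> polyfun g r"

definition affine_topology :: "('k::field, 'g::ab_group_add) lie_data \<Rightarrow> nat \<Rightarrow> 'g list topology" where
  "affine_topology g r =
     topology_generated_by {{X. length X = r \<and> P X \<noteq> 0} | P. P \<in> polyfun g r}"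

definition affine_variety :: "('k::field, 'g::ab_group_add) lie_data \<Rightarrow> nat \<Rightarrow> ('g list, 'k) fspace" where
  "affine_variety g r =
     \<lparr> zar = affine_topology g r,
       reg = (\<lambda>U. {f. \<forall>x\<in>U. \<exists>V P Q. openin (affine_topology g r) V \<and> x \<in> V \<and> V \<subseteq> U \<and>
                 P \<in> polyfun g r \<and> Q \<in> polyfun g r \<and> (\<forall>y\<in>V. Q y \<noteq> 0 \<and> f y = P y / Q y)}) \<rparr>"

definition frames :: "('k::field, 'g::ab_group_add) lie_data \<Rightarrow> nat \<Rightarrow> 'g list set" where
  "frames g r = {X. length X = r \<and> distinct X \<and> \<not> module.dependent (lscale g) (set X)}"

abbreviation lspan :: "('k::field, 'g::ab_group_add) lie_data \<Rightarrow> 'g list \<Rightarrow> 'g set" where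
  "lspan g X \<equiv> module.span (lscale g) (set X)"

text \<open>The Grassmannian as the quotient of the variety of all frames (linearly independent
  \<open>r\<close>-tuples) by \<open>GL_r\<close>: two frames have the same image iff they lie in one \<open>GL_r\<close>-orbit.\<close>

definition Grass :: "nat \<Rightarrow> ('k::field, 'g::ab_group_add) lie_data \<Rightarrow> ('g set, 'k) fspace" where
  "Grass r g = quotient_variety (subvariety (affine_variety g r) (frames g r)) (lspan g)"

definition comm_frames :: "('k::field, 'g::ab_group_add) lie_data \<Rightarrow> nat \<Rightarrow> 'g list set" where
  "comm_frames g r =
     {X \<in> frames g r. (\<forall>x\<in>set X. \<forall>y\<in>set X. bracket g x y = 0) \<and> (\<forall>x\<in>set X. pmap g x = 0)}"

definition Evar :: "nat \<Rightarrow> ('k::field, 'g::ab_group_add) lie_data \<Rightarrow> 'g set set \<Rightarrow> ('g set, 'k) fspace" where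
  "Evar r g X = subvariety (Grass r g) X"

text \<open>\<open>torsor_var r g X\<close> is the restriction to \<open>X \<subseteq> Elem r g\<close> of the \<open>GL_r\<close>-torsor
  \<open>comm_frames g r \<rightarrow> Elem r g\<close>; its structure map is \<open>lspan g\<close>.\<close>

definition torsor_var :: "nat \<Rightarrow> ('k::field, 'g::ab_group_add) lie_data \<Rightarrow> 'g set set \<Rightarrow> ('g list, 'k) fspace" where
  "torsor_var r g X = subvariety (affine_variety g r) {Y \<in> comm_frames g r. lspan g Y \<in> X}"


section \<open>Sheaves\<close>

text \<open>Throughout, \<open>scl\<close> is the scalar multiplication of a finite dimensional space \<open>M\<close>.
  \<open>trivial_sheaf scl X\<close> is \<open>M \<otimes> O_X\<close>. Every sheaf below takes the value \<open>{}\<close> on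
  sets that are not open, so that equality of sheaves is equality of functions.\<close>

definition trivial_sheaf ::
    "('k \<Rightarrow> 'm \<Rightarrow> 'm::ab_group_add) \<Rightarrow> ('x, 'k) fspace \<Rightarrow> 'x set \<Rightarrow> ('x \<Rightarrow> 'm) set" where
  "trivial_sheaf scl X U =
     (if openin (zar X) U
      then {s. \<exists>A f. finite A \<and> (\<forall>m\<in>A. f m \<in> reg X U) \<and> (\<forall>x\<in>U. s x = (\<Sum>m\<in>A. scl (f m x) m))}
      else {})"

definition subsheaf ::
    "('k::field \<Rightarrow> 'm \<Rightarrow> 'm::ab_group_add) \<Rightarrow> ('x, 'k) fspace \<Rightarrow> ('x set \<Rightarrow> ('x \<Rightarrow> 'm) set) \<Rightarrow> bool" where
  "subsheaf scl X F \<longleftrightarrow>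
     (\<forall>U. F U \<subseteq> trivial_sheaf scl X U) \<and>
     (\<forall>U s t. s \<in> F U \<and> (\<forall>x\<in>U. s x = t x) \<longrightarrow> t \<in> F U) \<and>
     (\<forall>U V s. openin (zar X) V \<and> V \<subseteq> U \<and> s \<in> F U \<longrightarrow> s \<in> F V) \<and>
     (\<forall>U s. openin (zar X) U \<and> (\<forall>x\<in>U. \<exists>V. openin (zar X) V \<and> x \<in> V \<and> V \<subseteq> U \<and> s \<in> F V) \<longrightarrow> s \<in> F U) \<and>
     (\<forall>U. openin (zar X) U \<longrightarrow> (\<lambda>x. 0) \<in> F U) \<and>
     (\<forall>U s t. s \<in> F U \<and> t \<in> F U \<longrightarrow> (\<lambda>x. s x + t x) \<in> F U) \<and>
     (\<forall>U f s. f \<in> reg X U \<and> s \<in> F U \<longrightarrow> (\<lambda>x. scl (f x) (s x)) \<in> F U)"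

text \<open>\<open>finite_type scl X A F\<close>: the restriction of \<open>F\<close> to the open set \<open>A\<close> is locally generated by
  finitely many sections, i.e. it is locally the image of a morphism of sheaves \<open>O ^ n \<rightarrow> F\<close>.\<close>

definition finite_type ::
    "('k::field \<Rightarrow> 'm \<Rightarrow> 'm::ab_group_add) \<Rightarrow> ('x, 'k) fspace \<Rightarrow> 'x set \<Rightarrow> ('x set \<Rightarrow> ('x \<Rightarrow> 'm) set) \<Rightarrow> bool" where
  "finite_type scl X A F \<longleftrightarrow>
     (\<forall>x\<in>A. \<exists>U (n::nat) s. openin (zar X) U \<and> x \<in> U \<and> U \<subseteq> A \<and> (\<forall>i<n. s i \<in> F U) \<and>
       (\<forall>V t. openin (zar X) V \<and> V \<subseteq> U \<and> t \<in> F V \<longrightarrow>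
         (\<forall>y\<in>V. \<exists>W f. openin (zar X) W \<and> y \<in> W \<and> W \<subseteq> V \<and> (\<forall>i<n. f i \<in> reg X W) \<and>
            (\<forall>z\<in>W. t z = (\<Sum>i<n. scl (f i z) (s i z))))))"

text \<open>The kernel of the morphism \<open>O ^ n \<rightarrow> F\<close> given by sections \<open>s i\<close>, \<open>i < n\<close>; sections of
  \<open>O ^ n\<close> have values in \<open>nat \<Rightarrow> 'k\<close>, vanishing at indices \<open>\<ge> n\<close>.\<close>

definition relation_sheaf ::
    "('k::field \<Rightarrow> 'm \<Rightarrow> 'm::ab_group_add) \<Rightarrow> ('x, 'k) fspace \<Rightarrow> nat \<Rightarrow> (nat \<Rightarrow> 'x \<Rightarrow> 'm) \<Rightarrow>
      'x set \<Rightarrow> ('x \<Rightarrow> nat \<Rightarrow> 'k) set" where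
  "relation_sheaf scl X n s U =
     {h. (\<forall>i<n. (\<lambda>x. h x i) \<in> reg X U) \<and> (\<forall>x\<in>U. \<forall>i\<ge>n. h x i = 0) \<and>
         (\<forall>x\<in>U. (\<Sum>i<n. scl (h x i) (s i x)) = 0)}"

definition coherent_subsheaf ::
    "('k::field \<Rightarrow> 'm \<Rightarrow> 'm::ab_group_add) \<Rightarrow> ('x, 'k) fspace \<Rightarrow> ('x set \<Rightarrow> ('x \<Rightarrow> 'm) set) \<Rightarrow> bool" where
  "coherent_subsheaf scl X F \<longleftrightarrow>
     subsheaf scl X F \<and> finite_type scl X (topspace (zar X)) F \<and>
     (\<forall>U n s. openin (zar X) U \<and> (\<forall>i<n. s i \<in> F U) \<longrightarrow>
        finite_type (\<lambda>c v i. c * v i) X U (relation_sheaf scl X n s))"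

definition restrict_sheaf ::
    "('x, 'k) fspace \<Rightarrow> 'x set \<Rightarrow> ('x set \<Rightarrow> ('x \<Rightarrow> 'm) set) \<Rightarrow> 'x set \<Rightarrow> ('x \<Rightarrow> 'm) set" where
  "restrict_sheaf X A F U = (if openin (zar X) U \<and> U \<subseteq> A then F U else {})"

text \<open>For \<open>q : Y \<rightarrow> X\<close>, the image of the pull-back of \<open>F\<close> in the pull-back \<open>M \<otimes> O_Y\<close> of
  \<open>M \<otimes> O_X\<close>; this is the pull-back itself when \<open>q\<close> is flat.\<close>

definition pullback_subsheaf ::
    "('k::field \<Rightarrow> 'm \<Rightarrow> 'm::ab_group_add) \<Rightarrow> ('y, 'k) fspace \<Rightarrow> ('y \<Rightarrow> 'x) \<Rightarrow> ('x, 'k) fspace \<Rightarrow>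
      ('x set \<Rightarrow> ('x \<Rightarrow> 'm) set) \<Rightarrow> 'y set \<Rightarrow> ('y \<Rightarrow> 'm) set" where
  "pullback_subsheaf scl Y q X F U =
     {s \<in> trivial_sheaf scl Y U. \<forall>y\<in>U. \<exists>V W (n::nat) f t.
        openin (zar Y) V \<and> y \<in> V \<and> V \<subseteq> U \<and> openin (zar X) W \<and> q ` V \<subseteq> W \<and>
        (\<forall>i<n. f i \<in> reg Y V \<and> t i \<in> F W) \<and>
        (\<forall>z\<in>V. s z = (\<Sum>i<n. scl (f i z) (t i (q z))))}"

definition vector_bundle ::
    "('k::field \<Rightarrow> 'm \<Rightarrow> 'm::ab_group_add) \<Rightarrow> ('x, 'k) fspace \<Rightarrow> ('x set \<Rightarrow> ('x \<Rightarrow> 'm) set) \<Rightarrow> bool" where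
  "vector_bundle scl X F \<longleftrightarrow>
     coherent_subsheaf scl X F \<and>
     (\<forall>x\<in>topspace (zar X). \<exists>U (n::nat) s. openin (zar X) U \<and> x \<in> U \<and> (\<forall>i<n. s i \<in> F U) \<and>
       (\<forall>V. openin (zar X) V \<and> V \<subseteq> U \<longrightarrow>
         (\<forall>t\<in>F V. \<exists>f. (\<forall>i<n. f i \<in> reg X V) \<and> (\<forall>y\<in>V. t y = (\<Sum>i<n. scl (f i y) (s i y)))) \<and>
         (\<forall>f. (\<forall>i<n. f i \<in> reg X V) \<and> (\<forall>y\<in>V. (\<Sum>i<n. scl (f i y) (s i y)) = 0) \<longrightarrow>
              (\<forall>i<n. \<forall>y\<in>V. f i y = 0))))"

text \<open>The fibre of \<open>F\<close> at \<open>x\<close> is the quotient of the stalk of \<open>F\<close> at \<open>x\<close> by the submodule generated by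
  the maximal ideal of the local ring; both quotients are taken in one step, from pairs \<open>(U, s)\<close> with
  \<open>s\<close> a section over the neighbourhood \<open>U\<close>.\<close>

definition local_sections ::
    "('x, 'k) fspace \<Rightarrow> ('x set \<Rightarrow> ('x \<Rightarrow> 'm) set) \<Rightarrow> 'x \<Rightarrow> ('x set \<times> ('x \<Rightarrow> 'm)) set" where
  "local_sections X F x = {(U, s). openin (zar X) U \<and> x \<in> U \<and> s \<in> F U}"

definition fibre_rel ::
    "('k::field \<Rightarrow> 'm \<Rightarrow> 'm::ab_group_add) \<Rightarrow> ('x, 'k) fspace \<Rightarrow> ('x set \<Rightarrow> ('x \<Rightarrow> 'm) set) \<Rightarrow> 'x \<Rightarrow>
      (('x set \<times> ('x \<Rightarrow> 'm)) \<times> ('x set \<times> ('x \<Rightarrow> 'm))) set" where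
  "fibre_rel scl X F x =
     {((U, s), (V, t)). (U, s) \<in> local_sections X F x \<and> (V, t) \<in> local_sections X F x \<and>
        (\<exists>W (n::nat) f u. openin (zar X) W \<and> x \<in> W \<and> W \<subseteq> U \<inter> V \<and>
           (\<forall>i<n. f i \<in> reg X W \<and> f i x = 0 \<and> u i \<in> F W) \<and>
           (\<forall>y\<in>W. s y - t y = (\<Sum>i<n. scl (f i y) (u i y))))}"

definition fibre ::
    "('k::field \<Rightarrow> 'm \<Rightarrow> 'm::ab_group_add) \<Rightarrow> ('x, 'k) fspace \<Rightarrow> ('x set \<Rightarrow> ('x \<Rightarrow> 'm) set) \<Rightarrow> 'x \<Rightarrow>
      ('x set \<times> ('x \<Rightarrow> 'm)) set set" where
  "fibre scl X F x = local_sections X F x // fibre_rel scl X F x"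

definition fibre_add where
  "fibre_add scl X F x A B =
     (\<Union>(U, s)\<in>A. \<Union>(V, t)\<in>B. fibre_rel scl X F x `` {(U \<inter> V, \<lambda>y. s y + t y)})"

definition fibre_scale where
  "fibre_scale scl X F x c A = (\<Union>(U, s)\<in>A. fibre_rel scl X F x `` {(U, \<lambda>y. scl c (s y))})"

text \<open>The map from the fibre of \<open>F\<close> to the fibre \<open>M\<close> of \<open>M \<otimes> O_X\<close> induced by the inclusion
  of \<open>F\<close>.\<close>

definition fibre_map :: "'x \<Rightarrow> ('x set \<times> ('x \<Rightarrow> 'm)) set \<Rightarrow> 'm" where
  "fibre_map x A = the_elem ((\<lambda>(U, s). s x) ` A)"

text \<open>The natural map identifies the fibre of \<open>F\<close> at \<open>x\<close> with the subspace \<open>N\<close> of \<open>M\<close>.\<close>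

definition fibre_identified ::
    "('k::field \<Rightarrow> 'm \<Rightarrow> 'm::ab_group_add) \<Rightarrow> ('x, 'k) fspace \<Rightarrow> ('x set \<Rightarrow> ('x \<Rightarrow> 'm) set) \<Rightarrow> 'x \<Rightarrow>
      'm set \<Rightarrow> bool" where
  "fibre_identified scl X F x N \<longleftrightarrow>
     (\<forall>A\<in>fibre scl X F x. \<forall>(U, s)\<in>A. fibre_map x A = s x) \<and>
     (\<forall>A\<in>fibre scl X F x. \<forall>B\<in>fibre scl X F x.
        fibre_add scl X F x A B \<in> fibre scl X F x \<and>
        fibre_map x (fibre_add scl X F x A B) = fibre_map x A + fibre_map x B) \<and>
     (\<forall>c. \<forall>A\<in>fibre scl X F x.
        fibre_scale scl X F x c A \<in> fibre scl X F x \<and>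
        fibre_map x (fibre_scale scl X F x c A) = scl c (fibre_map x A)) \<and>
     bij_betw (fibre_map x) (fibre scl X F x) N"


section \<open>Image and kernel sheaves\<close>

text \<open>\<open>B\<close> is the chosen basis of \<open>g\<close>, and \<open>Ycoord g B b s\<close> is the coordinate function \<open>Y_{b,s}\<close>. The indices
  \<open>s\<close> run through \<open>0, \<dots>, r - 1\<close>.\<close>

definition Ycoord :: "('k::field, 'g::ab_group_add) lie_data \<Rightarrow> 'g set \<Rightarrow> 'g \<Rightarrow> nat \<Rightarrow> 'g list \<Rightarrow> 'k" where
  "Ycoord g B b s X = module.representation (lscale g) B (X ! s) b"

definition Theta ::
    "('k::field, 'g::ab_group_add) lie_data \<Rightarrow> 'g set \<Rightarrow> ('k, 'g, 'm::ab_group_add) mod_data \<Rightarrow> nat \<Rightarrow>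
      ('g list \<Rightarrow> 'm) \<Rightarrow> ('g list \<Rightarrow> 'm)" where
  "Theta g B M s t = (\<lambda>X. \<Sum>b\<in>B. mscale M (Ycoord g B b s X) (lie_act g M b (t X)))"

definition Theta_pow ::
    "('k::field, 'g::ab_group_add) lie_data \<Rightarrow> 'g set \<Rightarrow> ('k, 'g, 'm::ab_group_add) mod_data \<Rightarrow> nat list \<Rightarrow>
      ('g list \<Rightarrow> 'm) \<Rightarrow> ('g list \<Rightarrow> 'm)" where
  "Theta_pow g B M js = foldr (\<circ>) (map (\<lambda>s. Theta g B M s ^^ (js ! s)) [0..<length js]) id"

definition exponents :: "nat \<Rightarrow> nat \<Rightarrow> nat list set" where
  "exponents r j = {js. length js = r \<and> sum_list js = j}"

definition Im_torsor ::
    "('k::field, 'g::ab_group_add) lie_data \<Rightarrow> 'g set \<Rightarrow> ('k, 'g, 'm::ab_group_add) mod_data \<Rightarrow> nat \<Rightarrow> nat \<Rightarrow>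
      'g set set \<Rightarrow> 'g list set \<Rightarrow> ('g list \<Rightarrow> 'm) set" where
  "Im_torsor g B M r j X U =
     {s \<in> trivial_sheaf (mscale M) (torsor_var r g X) U. \<forall>x\<in>U. \<exists>V t.
        openin (zar (torsor_var r g X)) V \<and> x \<in> V \<and> V \<subseteq> U \<and>
        (\<forall>js\<in>exponents r j. t js \<in> trivial_sheaf (mscale M) (torsor_var r g X) V) \<and>
        (\<forall>y\<in>V. s y = (\<Sum>js\<in>exponents r j. Theta_pow g B M js (t js) y))}"

definition Ker_torsor ::
    "('k::field, 'g::ab_group_add) lie_data \<Rightarrow> 'g set \<Rightarrow> ('k, 'g, 'm::ab_group_add) mod_data \<Rightarrow> nat \<Rightarrow> nat \<Rightarrow>
      'g set set \<Rightarrow> 'g list set \<Rightarrow> ('g list \<Rightarrow> 'm) set" where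
  "Ker_torsor g B M r j X U =
     {s \<in> trivial_sheaf (mscale M) (torsor_var r g X) U.
        \<forall>js\<in>exponents r j. \<forall>y\<in>U. Theta_pow g B M js s y = 0}"

definition descended_sheaf ::
    "('k::field, 'g::ab_group_add) lie_data \<Rightarrow> ('k, 'g, 'm::ab_group_add) mod_data \<Rightarrow> nat \<Rightarrow> 'g set set \<Rightarrow>
      ('g list set \<Rightarrow> ('g list \<Rightarrow> 'm) set) \<Rightarrow> 'g set set \<Rightarrow> ('g set \<Rightarrow> 'm) set" where
  "descended_sheaf g M r X G =
     (THE F. coherent_subsheaf (mscale M) (Evar r g X) F \<and>
             pullback_subsheaf (mscale M) (torsor_var r g X) (lspan g) (Evar r g X) F = G)"

definition Im_sheaf ::
    "('k::field, 'g::ab_group_add) lie_data \<Rightarrow> 'g set \<Rightarrow> ('k, 'g, 'm::ab_group_add) mod_data \<Rightarrow> nat \<Rightarrow> nat \<Rightarrow>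
      'g set set \<Rightarrow> 'g set set \<Rightarrow> ('g set \<Rightarrow> 'm) set" where
  "Im_sheaf g B M r j X = descended_sheaf g M r X (Im_torsor g B M r j X)"

definition Ker_sheaf ::
    "('k::field, 'g::ab_group_add) lie_data \<Rightarrow> 'g set \<Rightarrow> ('k, 'g, 'm::ab_group_add) mod_data \<Rightarrow> nat \<Rightarrow> nat \<Rightarrow>
      'g set set \<Rightarrow> 'g set set \<Rightarrow> ('g set \<Rightarrow> 'm) set" where
  "Ker_sheaf g B M r j X = descended_sheaf g M r X (Ker_torsor g B M r j X)"

end

theory Submission
  imports Defs
begin

text \<open>In an elementary subalgebra the generators are nilpotent and commute, so the Jacobson radical of
  \<open>u(\<epsilon>)\<close> is the augmentation ideal, and \<open>Rad\<close> and \<open>Soc\<close> are the joint image and the joint kernel of the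
  monomials of degree \<open>j\<close> in any frame of \<open>\<epsilon>\<close>. The torsor has local sections, given by frames normalised
  against \<open>r\<close> functionals; through them the sheaf of the \<open>s\<close> whose pull-back lies in the image or
  kernel on the torsor is coherent (by Hilbert's basis theorem) and is the unique descent. For the
  kernel this needs that a section on the torsor is a combination of pulled-back sections, which
  follows by interpolating, for a polynomial section \<open>K\<close>, the functions \<open>A \<mapsto> K (Y A)\<close> on \<open>GL_r\<close> by finitely
  many translates. Sections that are independent at a point stay independent nearby, with
  coefficients given by Cramer's rule. So the dimension of \<open>Rad\<close> can only rise and that of \<open>Soc\<close>
  only drop near a point; where it is constant, a basis at one point spreads to a local frame of
  the sheaf, whose values at each nearby point form a basis of \<open>Rad\<close> or \<open>Soc\<close>, and such a frame
  trivialises the bundle and computes the fibres.\<close>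

section \<open>Spaces with functions\<close>

text \<open>Varieties are sets of points with honest functions, so a section is determined by its
  values. The two sheaves then pose opposite problems. Membership in the kernel is a condition at
  each point, namely that the value lies in the socle, but no generators are at hand: finiteness has
  to come from a Noetherian ring and descent from interpolation. The image has explicit generators,
  the monomials at a normal frame applied to a basis of \<open>M\<close>, but membership refers to
  local preimages and not to values alone; it is controlled by rewriting monomials under a change of
  frame with regular coefficients. The Noetherian arguments take place in the ring of polynomial
  functions on all \<open>r\<close>-tuples: a chart section pulls these back to regular functions,
  and finitely many regular functions become polynomial after multiplication by one denominator.
  That denominator is chosen to vanish off the open set in question, so that a further factor of it
  makes linear conditions on the values hold everywhere. Both bundles finally follow from one
  criterion, \<open>bundle_fibres\<close>, which asks at each point for as many independent sections
  as the dimension of the nearby spaces allows.\<close>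

text \<open>What is used of regular functions: they form a sheaf of \<open>k\<close>-algebras, with
  open non-vanishing sets on which they are invertible. The last two axioms supply division after
  shrinking, and the whole list passes from affine space to subvarieties and to quotients.\<close>

locale fsp =
  fixes S :: "('x, 'k::field) fspace"
  assumes reg_const: "openin (zar S) U \<Longrightarrow> (\<lambda>x. c) \<in> reg S U"
    and reg_add: "openin (zar S) U \<Longrightarrow> f \<in> reg S U \<Longrightarrow> h \<in> reg S U \<Longrightarrow> (\<lambda>x. f x + h x) \<in> reg S U"
    and reg_mult: "openin (zar S) U \<Longrightarrow> f \<in> reg S U \<Longrightarrow> h \<in> reg S U \<Longrightarrow> (\<lambda>x. f x * h x) \<in> reg S U"
    and reg_restr: "openin (zar S) U \<Longrightarrow> openin (zar S) V \<Longrightarrow> V \<subseteq> U \<Longrightarrow> f \<in> reg S U \<Longrightarrow> f \<in> reg S V"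
    and reg_local: "openin (zar S) U \<Longrightarrow>
      (\<And>x. x \<in> U \<Longrightarrow> \<exists>V h. openin (zar S) V \<and> x \<in> V \<and> V \<subseteq> U \<and> h \<in> reg S V \<and> (\<forall>y\<in>V. f y = h y)) \<Longrightarrow>
      f \<in> reg S U"
    and openin_nonzero: "openin (zar S) U \<Longrightarrow> f \<in> reg S U \<Longrightarrow> openin (zar S) {x \<in> U. f x \<noteq> 0}"
    and reg_inverse: "openin (zar S) U \<Longrightarrow> f \<in> reg S U \<Longrightarrow> (\<lambda>x. inverse (f x)) \<in> reg S {x \<in> U. f x \<noteq> 0}"
begin

lemma reg_cong:
  assumes "openin (zar S) U" "f \<in> reg S U" "\<And>x. x \<in> U \<Longrightarrow> f x = h x"
  shows "h \<in> reg S U"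
  by (rule reg_local[OF assms(1)], rule exI[of _ U], rule exI[of _ f]) (use assms in auto)

lemma reg_uminus:
  assumes "openin (zar S) U" "f \<in> reg S U"
  shows "(\<lambda>x. - f x) \<in> reg S U"
  using reg_mult[OF assms(1) reg_const[OF assms(1), of "-1"] assms(2)] by simp

lemma reg_diff:
  assumes "openin (zar S) U" "f \<in> reg S U" "h \<in> reg S U"
  shows "(\<lambda>x. f x - h x) \<in> reg S U"
  using reg_add[OF assms(1,2) reg_uminus[OF assms(1,3)]] by simp

lemma reg_sum:
  assumes "openin (zar S) U" "\<And>i. i \<in> I \<Longrightarrow> f i \<in> reg S U"
  shows "(\<lambda>x. \<Sum>i\<in>I. f i x) \<in> reg S U"
  using assms(2)
  by (induction I rule: infinite_finite_induct) (auto intro: reg_const reg_add assms(1))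

lemma reg_divide:
  assumes "openin (zar S) U" "f \<in> reg S U" "h \<in> reg S U"
    and "openin (zar S) V" "V \<subseteq> U" "\<And>x. x \<in> V \<Longrightarrow> h x \<noteq> 0"
  shows "(\<lambda>x. f x / h x) \<in> reg S V"
proof -
  have "{x \<in> V. h x \<noteq> 0} = V" using assms(6) by auto
  then have "(\<lambda>x. inverse (h x)) \<in> reg S V"
    using reg_inverse[OF assms(4) reg_restr[OF assms(1,4,5,3)]] by simp
  then have "(\<lambda>x. f x * inverse (h x)) \<in> reg S V"
    using assms reg_restr reg_mult by blast
  then show ?thesis by (simp add: field_class.field_divide_inverse)
qed

end

lemma openin_zar_subvariety:
  "openin (zar (subvariety S A)) U \<longleftrightarrow> (\<exists>T. openin (zar S) T \<and> U = T \<inter> A)"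
  by (simp add: subvariety_def openin_subtopology)

lemma topspace_zar_subvariety [simp]: "topspace (zar (subvariety S A)) = topspace (zar S) \<inter> A"
  by (simp add: subvariety_def)

lemma reg_subvariety:
  "f \<in> reg (subvariety S A) U \<longleftrightarrow>
    (\<forall>x\<in>U. \<exists>V h. openin (zar S) V \<and> x \<in> V \<and> h \<in> reg S V \<and> (\<forall>y\<in>V \<inter> U. f y = h y))"
  by (simp add: subvariety_def)

lemma openin_subvarietyE:
  assumes "openin (zar (subvariety S A)) U"
  obtains T where "openin (zar S) T" "U = T \<inter> A"
  using assms openin_zar_subvariety by metis

lemma reg_subvarietyE:
  assumes "f \<in> reg (subvariety S A) U" "x \<in> U"
  obtains V h where "openin (zar S) V" "x \<in> V" "h \<in> reg S V" "\<forall>y\<in>V \<inter> U. f y = h y"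
proof -
  have "\<exists>V h. openin (zar S) V \<and> x \<in> V \<and> h \<in> reg S V \<and> (\<forall>y\<in>V \<inter> U. f y = h y)"
    using assms unfolding reg_subvariety by (rule bspec)
  then show thesis using that by (elim exE conjE)
qed

lemma reg_affineE:
  assumes "f \<in> reg (affine_variety g r) U" "x \<in> U"
  obtains V P Q where "openin (affine_topology g r) V" "x \<in> V" "V \<subseteq> U"
     "P \<in> polyfun g r" "Q \<in> polyfun g r" "\<forall>y\<in>V. Q y \<noteq> 0 \<and> f y = P y / Q y"
proof -
  have "\<exists>V P Q. openin (affine_topology g r) V \<and> x \<in> V \<and> V \<subseteq> U \<and>
     P \<in> polyfun g r \<and> Q \<in> polyfun g r \<and> (\<forall>y\<in>V. Q y \<noteq> 0 \<and> f y = P y / Q y)"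
    using assms unfolding affine_variety_def by auto
  then show thesis using that by (elim exE conjE)
qed

lemma fsp_subvariety:
  assumes "fsp S"
  shows "fsp (subvariety S A)"
proof -
  interpret fsp S by fact
  let ?Z = "subvariety S A"
  \<comment> \<open>Both ring operations at once: extend \<open>f\<close> and \<open>h\<close> to
    the ambient space near \<open>x\<close> and operate on the extensions over a common
    neighbourhood.\<close>
  have loc2: "(\<lambda>x. F (f x) (h x)) \<in> reg ?Z U"
    if F: "\<And>V f' h'. openin (zar S) V \<Longrightarrow> f' \<in> reg S V \<Longrightarrow> h' \<in> reg S V \<Longrightarrow> (\<lambda>x. F (f' x) (h' x)) \<in> reg S V"
      and f: "f \<in> reg ?Z U" and h: "h \<in> reg ?Z U" for F f h U
    unfolding reg_subvariety
  proof
    fix x assume x: "x \<in> U"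
    obtain V f' where V: "openin (zar S) V" "x \<in> V" "f' \<in> reg S V" "\<forall>y\<in>V \<inter> U. f y = f' y"
      using reg_subvarietyE[OF f x] .
    obtain W h' where W: "openin (zar S) W" "x \<in> W" "h' \<in> reg S W" "\<forall>y\<in>W \<inter> U. h y = h' y"
      using reg_subvarietyE[OF h x] .
    have VW: "openin (zar S) (V \<inter> W)" using V W by auto
    have "(\<lambda>x. F (f' x) (h' x)) \<in> reg S (V \<inter> W)"
      using V W VW by (intro F) (auto intro: reg_restr)
    then show "\<exists>V h''. openin (zar S) V \<and> x \<in> V \<and> h'' \<in> reg S V \<and> (\<forall>y\<in>V \<inter> U. F (f y) (h y) = h'' y)"
      using V W VW by (intro exI[of _ "V \<inter> W"] exI[of _ "\<lambda>x. F (f' x) (h' x)"]) auto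
  qed
  \<comment> \<open>An ambient extension of \<open>f\<close> may have zeros near \<open>x\<close>;
    cutting down to its non-vanishing set gives one that can be inverted in the ambient
    space.\<close>
  have nz: "\<exists>V h. openin (zar S) V \<and> x \<in> V \<and> h \<in> reg S V \<and> (\<forall>y\<in>V \<inter> U. f y = h y) \<and> (\<forall>y\<in>V. h y \<noteq> 0)"
    if f: "f \<in> reg ?Z U" and x': "x \<in> {x \<in> U. f x \<noteq> 0}" for f U x
  proof -
    have x: "x \<in> U" "f x \<noteq> 0" using x' by auto
    obtain V h where V: "openin (zar S) V" "x \<in> V" "h \<in> reg S V" "\<forall>y\<in>V \<inter> U. f y = h y"
      using reg_subvarietyE[OF f x(1)] .
    have W: "openin (zar S) {x \<in> V. h x \<noteq> 0}" using V openin_nonzero by blast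
    moreover have "h \<in> reg S {x \<in> V. h x \<noteq> 0}" using reg_restr[OF V(1) W _ V(3)] by auto
    ultimately show ?thesis using V x by (intro exI[of _ "{x \<in> V. h x \<noteq> 0}"] exI[of _ h]) auto
  qed
  show ?thesis
  proof
    fix U c assume "openin (zar ?Z) U"
    then show "(\<lambda>x. c) \<in> reg ?Z U"
      unfolding reg_subvariety openin_zar_subvariety using reg_const by blast
  next
    fix U f h assume fh: "f \<in> reg ?Z U" "h \<in> reg ?Z U"
    show "(\<lambda>x. f x + h x) \<in> reg ?Z U" by (rule loc2[of "(+)", OF reg_add fh])
    show "(\<lambda>x. f x * h x) \<in> reg ?Z U" by (rule loc2[of "(*)", OF reg_mult fh])
  next
    fix U V f assume "V \<subseteq> U" "f \<in> reg ?Z U"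
    then show "f \<in> reg ?Z V" unfolding reg_subvariety Ball_def Int_iff subset_iff by meson
  next
    fix U f
    assume U: "openin (zar ?Z) U"
      and ex: "\<And>x. x \<in> U \<Longrightarrow> \<exists>V h. openin (zar ?Z) V \<and> x \<in> V \<and> V \<subseteq> U \<and> h \<in> reg ?Z V \<and> (\<forall>y\<in>V. f y = h y)"
    show "f \<in> reg ?Z U"
      unfolding reg_subvariety
    proof
      fix x assume x: "x \<in> U"
      obtain V h where V: "openin (zar ?Z) V" "x \<in> V" "V \<subseteq> U" "h \<in> reg ?Z V" "\<forall>y\<in>V. f y = h y"
        using ex[OF x] by (elim exE conjE) (rule that)
      obtain T where T: "openin (zar S) T" "V = T \<inter> A" using openin_subvarietyE[OF V(1)] .
      obtain W h' where W: "openin (zar S) W" "x \<in> W" "h' \<in> reg S W" "\<forall>y\<in>W \<inter> V. h y = h' y"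
        using reg_subvarietyE[OF V(4,2)] .
      have o: "openin (zar S) (W \<inter> T)" using W T by auto
      have "h' \<in> reg S (W \<inter> T)" using reg_restr[OF W(1) o] W by auto
      moreover have "U \<subseteq> A" using openin_subvarietyE[OF U] by blast
      ultimately show "\<exists>V h. openin (zar S) V \<and> x \<in> V \<and> h \<in> reg S V \<and> (\<forall>y\<in>V \<inter> U. f y = h y)"
        using o V W T by (intro exI[of _ "W \<inter> T"] exI[of _ h']) auto
    qed
  next
    fix U f assume U: "openin (zar ?Z) U" and f: "f \<in> reg ?Z U"
    show "openin (zar ?Z) {x \<in> U. f x \<noteq> 0}"
    proof (subst openin_subopen, intro ballI)
      fix x assume x: "x \<in> {x \<in> U. f x \<noteq> 0}"
      obtain V h where V: "openin (zar S) V" "x \<in> V" "\<forall>y\<in>V \<inter> U. f y = h y" "\<forall>y\<in>V. h y \<noteq> 0"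
        using nz[OF f x] by (elim exE conjE) (rule that)
      obtain T where T: "openin (zar S) T" "U = T \<inter> A" using openin_subvarietyE[OF U] .
      have "openin (zar ?Z) (V \<inter> U)" unfolding openin_zar_subvariety using V T by (intro exI[of _ "V \<inter> T"]) auto
      then show "\<exists>T. openin (zar ?Z) T \<and> x \<in> T \<and> T \<subseteq> {x \<in> U. f x \<noteq> 0}"
        using V x by (intro exI[of _ "V \<inter> U"]) auto
    qed
    show "(\<lambda>x. inverse (f x)) \<in> reg ?Z {x \<in> U. f x \<noteq> 0}"
      unfolding reg_subvariety
    proof
      fix x assume x: "x \<in> {x \<in> U. f x \<noteq> 0}"
      obtain V h where V: "openin (zar S) V" "x \<in> V" "h \<in> reg S V" "\<forall>y\<in>V \<inter> U. f y = h y" "\<forall>y\<in>V. h y \<noteq> 0"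
        using nz[OF f x] by (elim exE conjE) (rule that)
      have "{x \<in> V. h x \<noteq> 0} = V" using V by auto
      then have "(\<lambda>x. inverse (h x)) \<in> reg S V" using reg_inverse[OF V(1,3)] by simp
      then show "\<exists>V h. openin (zar S) V \<and> x \<in> V \<and> h \<in> reg S V \<and>
          (\<forall>y\<in>V \<inter> {x \<in> U. f x \<noteq> 0}. inverse (f y) = h y)"
        using V by (intro exI[of _ V] exI[of _ "\<lambda>x. inverse (h x)"]) auto
    qed
  qed
qed

lemma openin_quot: "openin (zar (quotient_variety S q)) U \<Longrightarrow> openin (zar S) {x \<in> topspace (zar S). q x \<in> U}"
  by (simp add: openin_quotient_variety)

lemma topspace_quotient_variety [simp]:
  "topspace (zar (quotient_variety S q)) = q ` topspace (zar S)"
proof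
  have "{x \<in> topspace (zar S). q x \<in> q ` topspace (zar S)} = topspace (zar S)" by auto
  then have "openin (zar (quotient_variety S q)) (q ` topspace (zar S))"
    unfolding openin_quotient_variety by simp
  then show "q ` topspace (zar S) \<subseteq> topspace (zar (quotient_variety S q))" by (rule openin_subset)
  have "openin (zar (quotient_variety S q)) (topspace (zar (quotient_variety S q)))" by simp
  then show "topspace (zar (quotient_variety S q)) \<subseteq> q ` topspace (zar S)"
    unfolding openin_quotient_variety by (rule conjunct1)
qed

lemma reg_quotient:
  "f \<in> reg (quotient_variety S q) U \<longleftrightarrow> (\<lambda>x. f (q x)) \<in> reg S {x \<in> topspace (zar S). q x \<in> U}"
  by (simp add: quotient_variety_def)

lemma fsp_quotient_variety:
  assumes "fsp S"
  shows "fsp (quotient_variety S q)"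
proof -
  interpret fsp S by fact
  let ?Q = "quotient_variety S q"
  let ?p = "\<lambda>U. {x \<in> topspace (zar S). q x \<in> U}"
  have op: "openin (zar S) (?p U)" if "openin (zar ?Q) U" for U
    using that openin_quot by blast
  show ?thesis
  proof
    fix U V f assume U: "openin (zar ?Q) U" "openin (zar ?Q) V" "V \<subseteq> U" "f \<in> reg ?Q U"
    have "?p V \<subseteq> ?p U" using U(3) by auto
    then show "f \<in> reg ?Q V"
      using U(4) unfolding reg_quotient by (rule reg_restr[OF op[OF U(1)] op[OF U(2)]])
  next
    fix U f
    assume U: "openin (zar ?Q) U"
      and ex: "\<And>x. x \<in> U \<Longrightarrow> \<exists>V h. openin (zar ?Q) V \<and> x \<in> V \<and> V \<subseteq> U \<and> h \<in> reg ?Q V \<and> (\<forall>y\<in>V. f y = h y)"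
    show "f \<in> reg ?Q U" unfolding reg_quotient
    proof (rule reg_local[OF op[OF U]])
      fix x assume x: "x \<in> ?p U"
      then have "q x \<in> U" by simp
      from ex[OF this] obtain V h where "openin (zar ?Q) V" "q x \<in> V" "V \<subseteq> U" "h \<in> reg ?Q V" "\<forall>y\<in>V. f y = h y"
        by (elim exE conjE) (rule that)
      then show "\<exists>V h. openin (zar S) V \<and> x \<in> V \<and> V \<subseteq> ?p U \<and> h \<in> reg S V \<and> (\<forall>y\<in>V. f (q y) = h y)"
        using op x by (intro exI[of _ "?p V"] exI[of _ "\<lambda>x. h (q x)"]) (auto simp: reg_quotient)
    qed
  next
    fix U f assume U: "openin (zar ?Q) U" and f: "f \<in> reg ?Q U"
    have e: "?p {x \<in> U. f x \<noteq> 0} = {x \<in> ?p U. f (q x) \<noteq> 0}" by auto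
    show "openin (zar ?Q) {x \<in> U. f x \<noteq> 0}"
      unfolding openin_quotient_variety e using U f op openin_nonzero[OF op[OF U]]
      by (auto simp: reg_quotient openin_quotient_variety)
    show "(\<lambda>x. inverse (f x)) \<in> reg ?Q {x \<in> U. f x \<noteq> 0}"
      unfolding reg_quotient e using reg_inverse[OF op[OF U]] f by (simp add: reg_quotient)
  next
    fix U c assume "openin (zar ?Q) U"
    then show "(\<lambda>x. c) \<in> reg ?Q U" unfolding reg_quotient by (intro reg_const op)
  next
    fix U f h assume "openin (zar ?Q) U" "f \<in> reg ?Q U" "h \<in> reg ?Q U"
    then show "(\<lambda>x. f x + h x) \<in> reg ?Q U" and "(\<lambda>x. f x * h x) \<in> reg ?Q U"
      unfolding reg_quotient by (simp_all add: op reg_add reg_mult)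
  qed
qed


section \<open>Morphisms of spaces with functions\<close>

text \<open>The open domain \<open>U\<close> is part of the data because chart sections exist only
  locally.\<close>

definition morph ::
    "('x, 'k::field) fspace \<Rightarrow> 'x set \<Rightarrow> ('y, 'k) fspace \<Rightarrow> ('x \<Rightarrow> 'y) \<Rightarrow> bool" where
  "morph S U Y f \<longleftrightarrow> openin (zar S) U \<and> f ` U \<subseteq> topspace (zar Y) \<and>
     (\<forall>V. openin (zar Y) V \<longrightarrow> openin (zar S) {x \<in> U. f x \<in> V} \<and>
        (\<forall>h\<in>reg Y V. (\<lambda>x. h (f x)) \<in> reg S {x \<in> U. f x \<in> V}))"

lemma morphD:
  assumes "morph S U Y f"
  shows "openin (zar S) U" "x \<in> U \<Longrightarrow> f x \<in> topspace (zar Y)"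
    "openin (zar Y) V \<Longrightarrow> openin (zar S) {x \<in> U. f x \<in> V}"
    "openin (zar Y) V \<Longrightarrow> h \<in> reg Y V \<Longrightarrow> (\<lambda>x. h (f x)) \<in> reg S {x \<in> U. f x \<in> V}"
  using assms unfolding morph_def by auto

lemma morph_restr:
  assumes "fsp S" "morph S U Y f" "openin (zar S) W" "W \<subseteq> U"
  shows "morph S W Y f"
proof -
  interpret fsp S by fact
  have e: "{x \<in> W. f x \<in> V} = W \<inter> {x \<in> U. f x \<in> V}" for V using assms(4) by auto
  have o: "openin (zar S) {x \<in> W. f x \<in> V}" if V: "openin (zar Y) V" for V
    unfolding e using assms(3) morphD(3)[OF assms(2) V] by auto
  show ?thesis unfolding morph_def
  proof (intro conjI allI impI ballI)
    show "openin (zar S) W" by fact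
    show "f ` W \<subseteq> topspace (zar Y)" using assms(2,4) unfolding morph_def by auto
    fix V h assume V: "openin (zar Y) V"
    show "openin (zar S) {x \<in> W. f x \<in> V}" by (rule o[OF V])
    assume "h \<in> reg Y V"
    then show "(\<lambda>x. h (f x)) \<in> reg S {x \<in> W. f x \<in> V}"
      by (intro reg_restr[OF morphD(3)[OF assms(2) V] o[OF V] _ morphD(4)[OF assms(2) V]]) (simp_all add: e)
  qed
qed

text \<open>Open sets and regular functions of a subvariety are induced, so a morphism that lands in
  \<open>A\<close> factors through it. Regularity is checked near each point, where \<open>h\<close>
  extends to \<open>Y\<close>.\<close>

lemma morph_into_subvariety:
  assumes "fsp S" "morph S U Y f" "f ` U \<subseteq> A"
  shows "morph S U (subvariety Y A) f"
  unfolding morph_def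
proof (intro conjI allI impI ballI)
  interpret fsp S by fact
  note m = morphD[OF assms(2)]
  show "openin (zar S) U" by (rule m)
  show "f ` U \<subseteq> topspace (zar (subvariety Y A))" using assms(3) m by auto
  fix V h assume V: "openin (zar (subvariety Y A)) V"
  obtain T where T: "openin (zar Y) T" "V = T \<inter> A" by (rule openin_subvarietyE[OF V])
  have "{x \<in> U. f x \<in> V} = {x \<in> U. f x \<in> T}" using T assms(3) by auto
  then show o: "openin (zar S) {x \<in> U. f x \<in> V}" using m(3)[OF T(1)] by simp
  assume h: "h \<in> reg (subvariety Y A) V"
  show "(\<lambda>x. h (f x)) \<in> reg S {x \<in> U. f x \<in> V}"
  proof (rule reg_local[OF o])
    fix x assume x: "x \<in> {x \<in> U. f x \<in> V}"
    then obtain W h' where W: "openin (zar Y) W" "f x \<in> W" "h' \<in> reg Y W" "\<forall>y\<in>W \<inter> V. h y = h' y"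
      using reg_subvarietyE[OF h, of "f x"] by blast
    let ?W = "{x \<in> U. f x \<in> W} \<inter> {x \<in> U. f x \<in> V}"
    have W': "openin (zar S) ?W" using o m(3)[OF W(1)] by auto
    then have "(\<lambda>x. h' (f x)) \<in> reg S ?W"
      using reg_restr[OF m(3)[OF W(1)] W' _ m(4)[OF W(1,3)]] by auto
    then show "\<exists>V' h'. openin (zar S) V' \<and> x \<in> V' \<and> V' \<subseteq> {x \<in> U. f x \<in> V} \<and> h' \<in> reg S V' \<and> (\<forall>y\<in>V'. h (f y) = h' y)"
      using W W' x by (intro exI[of _ ?W] exI[of _ "\<lambda>x. h' (f x)"]) auto
  qed
qed

lemma morph_from_subvariety:
  assumes "fsp S" "morph S U Y f"
  shows "morph (subvariety S A) (U \<inter> A) Y f"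
  unfolding morph_def
proof (intro conjI allI impI ballI)
  note m = morphD[OF assms(2)]
  show "openin (zar (subvariety S A)) (U \<inter> A)" unfolding openin_zar_subvariety using m(1) by auto
  show "f ` (U \<inter> A) \<subseteq> topspace (zar Y)" using m(2) by auto
  fix V h assume V: "openin (zar Y) V"
  have e: "{x \<in> U \<inter> A. f x \<in> V} = {x \<in> U. f x \<in> V} \<inter> A" by auto
  show "openin (zar (subvariety S A)) {x \<in> U \<inter> A. f x \<in> V}"
    unfolding openin_zar_subvariety e using m(3)[OF V] by auto
  assume h: "h \<in> reg Y V"
  show "(\<lambda>x. h (f x)) \<in> reg (subvariety S A) {x \<in> U \<inter> A. f x \<in> V}"
    unfolding reg_subvariety
    using m(3)[OF V] m(4)[OF V h] by (intro ballI exI[of _ "{x \<in> U. f x \<in> V}"] exI[of _ "\<lambda>x. h (f x)"]) auto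
qed

text \<open>The universal property of the quotient structure: openness and regularity downstairs are
  defined by pulling back along \<open>q\<close>. It reduces maps out of the Grassmannian to
  computations with frames.\<close>

lemma morph_from_quotient:
  assumes "U \<subseteq> q ` topspace (zar S)" "morph S {x \<in> topspace (zar S). q x \<in> U} Y (\<lambda>x. f (q x))"
  shows "morph (quotient_variety S q) U Y f"
  unfolding morph_def
proof (intro conjI allI impI ballI)
  note m = morphD[OF assms(2)]
  show "openin (zar (quotient_variety S q)) U" unfolding openin_quotient_variety using m(1) assms(1) by auto
  show "f ` U \<subseteq> topspace (zar Y)" using m(2) assms(1) by auto
  fix V h assume V: "openin (zar Y) V"
  have e: "{x \<in> topspace (zar S). q x \<in> {x \<in> U. f x \<in> V}} = {x \<in> {x \<in> topspace (zar S). q x \<in> U}. f (q x) \<in> V}"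
    by auto
  show "openin (zar (quotient_variety S q)) {x \<in> U. f x \<in> V}"
    unfolding openin_quotient_variety e using m(3)[OF V] assms(1) by auto
  assume "h \<in> reg Y V"
  then show "(\<lambda>x. h (f x)) \<in> reg (quotient_variety S q) {x \<in> U. f x \<in> V}"
    unfolding reg_quotient e using m(4)[OF V] by auto
qed


section \<open>Affine space\<close>

lemma polyfun_sum:
  assumes "\<And>i. i \<in> I \<Longrightarrow> P i \<in> polyfun g r"
  shows "(\<lambda>X. \<Sum>i\<in>I. P i X) \<in> polyfun g r"
  using assms
  by (induction I rule: infinite_finite_induct) (auto intro: polyfun_const polyfun_add)

text \<open>A product is non-zero exactly when both factors are, so the non-vanishing sets are
  closed under finite intersection and the generating sets already form a basis.\<close>

lemma openin_affine_iff:
  "openin (affine_topology g r) V \<longleftrightarrow> V \<subseteq> {X. length X = r} \<and>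
    (\<forall>x\<in>V. \<exists>P\<in>polyfun g r. P x \<noteq> 0 \<and> {X. length X = r \<and> P X \<noteq> 0} \<subseteq> V)" (is "_ \<longleftrightarrow> ?R V")
proof
  assume "openin (affine_topology g r) V"
  then have "generate_topology_on {{X. length X = r \<and> P X \<noteq> 0} | P. P \<in> polyfun g r} V"
    unfolding affine_topology_def by (simp add: openin_topology_generated_by_iff)
  then show "?R V"
  proof induction
    case Empty then show ?case by auto
  next
    case (Int a b)
    show ?case
    proof (intro conjI ballI)
      fix x assume x: "x \<in> a \<inter> b"
      obtain P where P: "P \<in> polyfun g r" "P x \<noteq> 0" "{X. length X = r \<and> P X \<noteq> 0} \<subseteq> a"
        using Int(3) x by auto
      obtain Q where Q: "Q \<in> polyfun g r" "Q x \<noteq> 0" "{X. length X = r \<and> Q X \<noteq> 0} \<subseteq> b"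
        using Int(4) x by auto
      show "\<exists>P\<in>polyfun g r. P x \<noteq> 0 \<and> {X. length X = r \<and> P X \<noteq> 0} \<subseteq> a \<inter> b"
        by (rule bexI[OF _ polyfun_mult[OF P(1) Q(1)]]) (use P Q in auto)
    qed (use Int in auto)
  next
    case (UN K)
    show ?case
    proof (intro conjI ballI)
      show "\<Union>K \<subseteq> {X. length X = r}" using UN by auto
      fix x assume "x \<in> \<Union>K"
      then obtain k where k: "k \<in> K" "x \<in> k" by auto
      then obtain P where "P \<in> polyfun g r" "P x \<noteq> 0" "{X. length X = r \<and> P X \<noteq> 0} \<subseteq> k"
        using UN(2)[OF k(1)] by auto
      then show "\<exists>P\<in>polyfun g r. P x \<noteq> 0 \<and> {X. length X = r \<and> P X \<noteq> 0} \<subseteq> \<Union>K"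
        using k(1) by (intro bexI[of _ P]) auto
    qed
  next
    case (Basis s) then show ?case by auto
  qed
next
  assume R: "?R V"
  show "openin (affine_topology g r) V"
  proof (subst openin_subopen, intro ballI)
    fix x assume x: "x \<in> V"
    then obtain P where P: "P \<in> polyfun g r" "P x \<noteq> 0" "{X. length X = r \<and> P X \<noteq> 0} \<subseteq> V"
      using R by auto
    moreover have "openin (affine_topology g r) {X. length X = r \<and> P X \<noteq> 0}"
      unfolding affine_topology_def by (rule topology_generated_by_Basis) (use P in auto)
    ultimately show "\<exists>T. openin (affine_topology g r) T \<and> x \<in> T \<and> T \<subseteq> V"
      using x R by (intro exI[of _ "{X. length X = r \<and> P X \<noteq> 0}"]) auto
  qed
qed

lemma zar_affine [simp]: "zar (affine_variety g r) = affine_topology g r"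
  by (simp add: affine_variety_def)

lemma topspace_affine [simp]: "topspace (affine_topology g r) = {X. length X = r}"
proof
  have "openin (affine_topology g r) {X. length X = r}"
    unfolding openin_affine_iff by (auto intro!: bexI[OF _ polyfun_const[of 1]])
  then show "{X. length X = r} \<subseteq> topspace (affine_topology g r)" by (rule openin_subset)
  have "openin (affine_topology g r) (topspace (affine_topology g r))" by simp
  then show "topspace (affine_topology g r) \<subseteq> {X. length X = r}"
    unfolding openin_affine_iff by (rule conjunct1)
qed

lemma reg_affine:
  "f \<in> reg (affine_variety g r) U \<longleftrightarrow> (\<forall>x\<in>U. \<exists>V P Q. openin (affine_topology g r) V \<and> x \<in> V \<and> V \<subseteq> U \<and>
     P \<in> polyfun g r \<and> Q \<in> polyfun g r \<and> (\<forall>y\<in>V. Q y \<noteq> 0 \<and> f y = P y / Q y))"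
  by (simp add: affine_variety_def)

lemma openin_affine_nonzero:
  assumes "openin (affine_topology g r) V" "P \<in> polyfun g r"
  shows "openin (affine_topology g r) {x \<in> V. P x \<noteq> 0}"
proof -
  have o: "openin (affine_topology g r) {X. length X = r \<and> P X \<noteq> 0}"
    unfolding openin_affine_iff using assms by auto
  have "V \<subseteq> {X. length X = r}" using assms(1) unfolding openin_affine_iff by (rule conjunct1)
  then have "V \<inter> {X. length X = r \<and> P X \<noteq> 0} = {x \<in> V. P x \<noteq> 0}" by auto
  then show ?thesis using openin_Int[OF assms(1) o] by simp
qed

lemma fsp_affine: "fsp (affine_variety g r)"
proof -
  let ?A = "affine_variety g r"
  have two: "\<exists>V P Q P' Q'. openin (affine_topology g r) V \<and> x \<in> V \<and> V \<subseteq> U \<and>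
     P \<in> polyfun g r \<and> Q \<in> polyfun g r \<and> P' \<in> polyfun g r \<and> Q' \<in> polyfun g r \<and>
     (\<forall>y\<in>V. Q y \<noteq> 0 \<and> f y = P y / Q y \<and> Q' y \<noteq> 0 \<and> h y = P' y / Q' y)"
    if fhx: "f \<in> reg ?A U" "h \<in> reg ?A U" "x \<in> U" for f h U x
  proof -
    obtain V P Q where V: "openin (affine_topology g r) V" "x \<in> V" "V \<subseteq> U"
     "P \<in> polyfun g r" "Q \<in> polyfun g r" "\<forall>y\<in>V. Q y \<noteq> 0 \<and> f y = P y / Q y"
      using reg_affineE[OF fhx(1,3)] .
    obtain V' P' Q' where V': "openin (affine_topology g r) V'" "x \<in> V'" "V' \<subseteq> U"
     "P' \<in> polyfun g r" "Q' \<in> polyfun g r" "\<forall>y\<in>V'. Q' y \<noteq> 0 \<and> h y = P' y / Q' y"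
      using reg_affineE[OF fhx(2,3)] .
    show ?thesis by (rule exI[of _ "V \<inter> V'"], rule exI[of _ P], rule exI[of _ Q], rule exI[of _ P'], rule exI[of _ Q']) (use V V' in auto)
  qed
  \<comment> \<open>Cutting \<open>V\<close> down by \<open>P x \<noteq> 0\<close> keeps it inside
    the set where \<open>f\<close> does not vanish; there the inverse is
    \<open>Q / P\<close>.\<close>
  have nz: "\<exists>V P Q. openin (affine_topology g r) V \<and> x \<in> V \<and> V \<subseteq> {x \<in> U. f x \<noteq> 0} \<and>
     P \<in> polyfun g r \<and> Q \<in> polyfun g r \<and> (\<forall>y\<in>V. Q y \<noteq> 0 \<and> f y = P y / Q y)"
    if fx: "f \<in> reg ?A U" "x \<in> {x \<in> U. f x \<noteq> 0}" for f U x
  proof -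
    obtain V P Q where V: "openin (affine_topology g r) V" "x \<in> V" "V \<subseteq> U"
     "P \<in> polyfun g r" "Q \<in> polyfun g r" "\<forall>y\<in>V. Q y \<noteq> 0 \<and> f y = P y / Q y"
      using reg_affineE[OF fx(1), of x] fx(2) by blast
    show ?thesis
      by (rule exI[of _ "{x \<in> V. P x \<noteq> 0}"], rule exI[of _ P], rule exI[of _ Q])
        (use V fx openin_affine_nonzero in auto)
  qed
  show ?thesis
  proof
    fix U c assume U: "openin (zar ?A) U"
    show "(\<lambda>x. c) \<in> reg ?A U" unfolding reg_affine
      by (rule ballI, rule exI[of _ U], rule exI[of _ "\<lambda>x. c"], rule exI[of _ "\<lambda>x. 1"]) (use U in \<open>auto intro: polyfun_const\<close>)
  next
    fix U f h assume f: "f \<in> reg ?A U" "h \<in> reg ?A U"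
    show "(\<lambda>x. f x + h x) \<in> reg ?A U" unfolding reg_affine
    proof
      fix x assume x: "x \<in> U"
      obtain V P Q P' Q' where V: "openin (affine_topology g r) V" "x \<in> V" "V \<subseteq> U"
        "P \<in> polyfun g r" "Q \<in> polyfun g r" "P' \<in> polyfun g r" "Q' \<in> polyfun g r"
        "\<forall>y\<in>V. Q y \<noteq> 0 \<and> f y = P y / Q y \<and> Q' y \<noteq> 0 \<and> h y = P' y / Q' y"
        using two[OF f x] by (elim exE conjE) (rule that)
      show "\<exists>V P Q. openin (affine_topology g r) V \<and> x \<in> V \<and> V \<subseteq> U \<and> P \<in> polyfun g r \<and> Q \<in> polyfun g r \<and>
         (\<forall>y\<in>V. Q y \<noteq> 0 \<and> f y + h y = P y / Q y)"
        by (rule exI[of _ V], rule exI[of _ "\<lambda>x. P x * Q' x + P' x * Q x"], rule exI[of _ "\<lambda>x. Q x * Q' x"])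
          (use V in \<open>auto intro!: polyfun_add polyfun_mult simp: add_frac_eq\<close>)
    qed
    show "(\<lambda>x. f x * h x) \<in> reg ?A U" unfolding reg_affine
    proof
      fix x assume x: "x \<in> U"
      obtain V P Q P' Q' where V: "openin (affine_topology g r) V" "x \<in> V" "V \<subseteq> U"
        "P \<in> polyfun g r" "Q \<in> polyfun g r" "P' \<in> polyfun g r" "Q' \<in> polyfun g r"
        "\<forall>y\<in>V. Q y \<noteq> 0 \<and> f y = P y / Q y \<and> Q' y \<noteq> 0 \<and> h y = P' y / Q' y"
        using two[OF f x] by (elim exE conjE) (rule that)
      show "\<exists>V P Q. openin (affine_topology g r) V \<and> x \<in> V \<and> V \<subseteq> U \<and> P \<in> polyfun g r \<and> Q \<in> polyfun g r \<and>
         (\<forall>y\<in>V. Q y \<noteq> 0 \<and> f y * h y = P y / Q y)"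
        by (rule exI[of _ V], rule exI[of _ "\<lambda>x. P x * P' x"], rule exI[of _ "\<lambda>x. Q x * Q' x"])
          (use V in \<open>auto intro!: polyfun_add polyfun_mult\<close>)
    qed
  next
    fix U V f assume V: "openin (zar ?A) V" "V \<subseteq> U" "f \<in> reg ?A U"
    show "f \<in> reg ?A V" unfolding reg_affine
    proof
      fix x assume x: "x \<in> V"
      then obtain W P Q where W: "openin (affine_topology g r) W" "x \<in> W" "W \<subseteq> U"
       "P \<in> polyfun g r" "Q \<in> polyfun g r" "\<forall>y\<in>W. Q y \<noteq> 0 \<and> f y = P y / Q y"
        using reg_affineE[OF V(3), of x] V(2) by blast
      show "\<exists>W P Q. openin (affine_topology g r) W \<and> x \<in> W \<and> W \<subseteq> V \<and> P \<in> polyfun g r \<and> Q \<in> polyfun g r \<and>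
          (\<forall>y\<in>W. Q y \<noteq> 0 \<and> f y = P y / Q y)"
        by (rule exI[of _ "V \<inter> W"], rule exI[of _ P], rule exI[of _ Q]) (use V W x in auto)
    qed
  next
    fix U f
    assume ex: "\<And>x. x \<in> U \<Longrightarrow> \<exists>V h. openin (zar ?A) V \<and> x \<in> V \<and> V \<subseteq> U \<and> h \<in> reg ?A V \<and> (\<forall>y\<in>V. f y = h y)"
    show "f \<in> reg ?A U" unfolding reg_affine
    proof
      fix x assume "x \<in> U"
      from ex[OF this] obtain V h where V: "x \<in> V" "V \<subseteq> U" "h \<in> reg ?A V" "\<forall>y\<in>V. f y = h y"
        by (elim exE conjE) (rule that)
      obtain W P Q where W: "openin (affine_topology g r) W" "x \<in> W" "W \<subseteq> V"
          "P \<in> polyfun g r" "Q \<in> polyfun g r" "\<forall>y\<in>W. Q y \<noteq> 0 \<and> h y = P y / Q y"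
        using reg_affineE[OF V(3,1)] .
      show "\<exists>V P Q. openin (affine_topology g r) V \<and> x \<in> V \<and> V \<subseteq> U \<and> P \<in> polyfun g r \<and> Q \<in> polyfun g r \<and>
          (\<forall>y\<in>V. Q y \<noteq> 0 \<and> f y = P y / Q y)"
        by (rule exI[of _ W], rule exI[of _ P], rule exI[of _ Q]) (use V W in auto)
    qed
  next
    fix U f assume U: "openin (zar ?A) U" and f: "f \<in> reg ?A U"
    show "openin (zar ?A) {x \<in> U. f x \<noteq> 0}"
    proof (subst openin_subopen, intro ballI)
      fix x assume x: "x \<in> {x \<in> U. f x \<noteq> 0}"
      from nz[OF f x] show "\<exists>T. openin (zar ?A) T \<and> x \<in> T \<and> T \<subseteq> {x \<in> U. f x \<noteq> 0}"
        by (elim exE conjE, intro exI conjI) (simp_all only: zar_affine)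
    qed
    show "(\<lambda>x. inverse (f x)) \<in> reg ?A {x \<in> U. f x \<noteq> 0}"
      unfolding reg_affine
    proof
      fix x assume x: "x \<in> {x \<in> U. f x \<noteq> 0}"
      obtain V P Q where V: "openin (affine_topology g r) V" "x \<in> V" "V \<subseteq> {x \<in> U. f x \<noteq> 0}"
       "P \<in> polyfun g r" "Q \<in> polyfun g r" "\<forall>y\<in>V. Q y \<noteq> 0 \<and> f y = P y / Q y"
        using nz[OF f x] by (elim exE conjE) (rule that)
      have "\<forall>y\<in>V. P y \<noteq> 0"
      proof
        fix y assume "y \<in> V"
        then have "f y \<noteq> 0" "f y = P y / Q y" using V by auto
        then show "P y \<noteq> 0" by auto
      qed
      then show "\<exists>V P Q. openin (affine_topology g r) V \<and> x \<in> V \<and> V \<subseteq> {x \<in> U. f x \<noteq> 0} \<and>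
         P \<in> polyfun g r \<and> Q \<in> polyfun g r \<and> (\<forall>y\<in>V. Q y \<noteq> 0 \<and> inverse (f y) = P y / Q y)"
        by - (rule exI[of _ V], rule exI[of _ Q], rule exI[of _ P], use V in auto)
    qed
  qed
qed

lemma polyfun_reg:
  assumes "openin (affine_topology g r) V" "P \<in> polyfun g r"
  shows "P \<in> reg (affine_variety g r) V"
  unfolding reg_affine
  by (rule ballI, rule exI[of _ V], rule exI[of _ P], rule exI[of _ "\<lambda>x. 1"])
    (use assms in \<open>auto intro: polyfun_const\<close>)

lemma polyfun_pull:
  assumes "fsp S" "openin (zar S) U" "P \<in> polyfun g r"
    and "\<And>\<phi> s. Vector_Spaces.linear (lscale g) (*) \<phi> \<Longrightarrow> s < r \<Longrightarrow> (\<lambda>x. \<phi> (f x ! s)) \<in> reg S U"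
  shows "(\<lambda>x. P (f x)) \<in> reg S U"
  using assms(3)
proof induction
  case (polyfun_const c) show ?case by (rule fsp.reg_const[OF assms(1,2)])
next
  case (polyfun_add P Q) then show ?case by (intro fsp.reg_add[OF assms(1,2)])
next
  case (polyfun_mult P Q) then show ?case by (intro fsp.reg_mult[OF assms(1,2)])
qed (use assms in auto)

text \<open>It suffices to test linear coordinates: polynomials in them pull back to regular
  functions by \<open>polyfun_pull\<close>, basic open sets to non-vanishing sets, and fractions to
  fractions.\<close>

lemma morph_into_affine:
  assumes "fsp S" "openin (zar S) U" "\<And>x. x \<in> U \<Longrightarrow> length (f x) = r"
    and "\<And>\<phi> s. Vector_Spaces.linear (lscale g) (*) \<phi> \<Longrightarrow> s < r \<Longrightarrow> (\<lambda>x. \<phi> (f x ! s)) \<in> reg S U"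
  shows "morph S U (affine_variety g r) f"
  unfolding morph_def
proof (intro conjI allI impI ballI)
  interpret fsp S by fact
  have P: "(\<lambda>x. P (f x)) \<in> reg S U" if "P \<in> polyfun g r" for P
    by (rule polyfun_pull[where f = f, OF assms(1,2) that assms(4)])
  have o: "openin (zar S) {x \<in> U. f x \<in> V}" if V: "openin (zar (affine_variety g r)) V" for V
  proof (subst openin_subopen, intro ballI)
    fix x assume x: "x \<in> {x \<in> U. f x \<in> V}"
    then obtain Q where Q: "Q \<in> polyfun g r" "Q (f x) \<noteq> 0" "{X. length X = r \<and> Q X \<noteq> 0} \<subseteq> V"
      using V by (auto simp: openin_affine_iff)
    then show "\<exists>T. openin (zar S) T \<and> x \<in> T \<and> T \<subseteq> {x \<in> U. f x \<in> V}"
      using openin_nonzero[OF assms(2) P[OF Q(1)]] x assms(3)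
      by (intro exI[of _ "{x \<in> U. Q (f x) \<noteq> 0}"]) auto
  qed
  show "openin (zar S) U" by fact
  show "f ` U \<subseteq> topspace (zar (affine_variety g r))" using assms(3) by auto
  fix V h assume V: "openin (zar (affine_variety g r)) V"
  show "openin (zar S) {x \<in> U. f x \<in> V}" by (rule o[OF V])
  assume h: "h \<in> reg (affine_variety g r) V"
  show "(\<lambda>x. h (f x)) \<in> reg S {x \<in> U. f x \<in> V}"
  proof (rule reg_local[OF o[OF V]])
    fix x assume x: "x \<in> {x \<in> U. f x \<in> V}"
    then obtain W A Q where W: "openin (affine_topology g r) W" "f x \<in> W" "W \<subseteq> V"
       "A \<in> polyfun g r" "Q \<in> polyfun g r" "\<forall>y\<in>W. Q y \<noteq> 0 \<and> h y = A y / Q y"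
      using reg_affineE[OF h, of "f x"] by blast
    have oW: "openin (zar S) {x \<in> U. f x \<in> W}" using o W(1) by simp
    have "(\<lambda>x. A (f x) / Q (f x)) \<in> reg S {x \<in> U. f x \<in> W}"
      by (rule reg_divide[OF assms(2) P P oW]) (use W in auto)
    then show "\<exists>V' h'. openin (zar S) V' \<and> x \<in> V' \<and> V' \<subseteq> {x \<in> U. f x \<in> V} \<and> h' \<in> reg S V' \<and> (\<forall>y\<in>V'. h (f y) = h' y)"
      using oW W x by (intro exI[of _ "{x \<in> U. f x \<in> W}"] exI[of _ "\<lambda>x. A (f x) / Q (f x)"]) auto
  qed
qed

section \<open>Linear algebra with regular coefficients\<close>

text \<open>At \<open>x0\<close> the matrix is the identity, so elimination needs no row exchanges: the pivot stays
  invertible near \<open>x0\<close> and the Schur complement is again the identity at \<open>x0\<close>.\<close>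

lemma (in fsp) local_inverse:
  fixes n :: nat
  assumes "openin (zar S) U" "x0 \<in> U" "\<And>i j. i < n \<Longrightarrow> j < n \<Longrightarrow> a i j \<in> reg S U"
    and "\<And>i j. i < n \<Longrightarrow> j < n \<Longrightarrow> a i j x0 = (if i = j then 1 else 0)"
  shows "\<exists>W c. openin (zar S) W \<and> x0 \<in> W \<and> W \<subseteq> U \<and> (\<forall>i<n. \<forall>j<n. c i j \<in> reg S W) \<and>
    (\<forall>x\<in>W. \<forall>y z. (\<forall>i<n. (\<Sum>j<n. a i j x * y j) = z i) \<longleftrightarrow> (\<forall>i<n. y i = (\<Sum>j<n. c i j x * z j)))"
  using assms
proof (induction n arbitrary: a U)
  case 0
  then show ?case by (intro exI[of _ U]) auto
next
  case (Suc n)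
  define V where "V = {x \<in> U. a n n x \<noteq> 0}"
  have V: "openin (zar S) V" "x0 \<in> V" "V \<subseteq> U" and nz: "\<And>x. x \<in> V \<Longrightarrow> a n n x \<noteq> 0"
    unfolding V_def using openin_nonzero Suc.prems by auto
  have aV: "a i j \<in> reg S V" if "i < Suc n" "j < Suc n" for i j
    using reg_restr[OF Suc.prems(1) V(1,3) Suc.prems(3)] that by auto
  define b where "b i j = (\<lambda>x. a i j x - a i n x * (a n j x / a n n x))" for i j
  have q: "(\<lambda>x. a i j x / a n n x) \<in> reg S V" if "i < Suc n" "j < Suc n" for i j
    by (rule reg_divide[OF V(1) aV aV V(1)]) (use that nz in auto)
  have "\<exists>W c. openin (zar S) W \<and> x0 \<in> W \<and> W \<subseteq> V \<and> (\<forall>i<n. \<forall>j<n. c i j \<in> reg S W) \<and>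
    (\<forall>x\<in>W. \<forall>y z. (\<forall>i<n. (\<Sum>j<n. b i j x * y j) = z i) \<longleftrightarrow> (\<forall>i<n. y i = (\<Sum>j<n. c i j x * z j)))"
  proof (rule Suc.IH[OF V(1,2)])
    fix i j assume "i < n" "j < n"
    then show "b i j \<in> reg S V" unfolding b_def by (intro reg_diff reg_mult V aV q) auto
    show "b i j x0 = (if i = j then 1 else 0)"
      unfolding b_def using Suc.prems(4) \<open>i < n\<close> \<open>j < n\<close> by auto
  qed
  then obtain W c where W0: "openin (zar S) W" "x0 \<in> W" "W \<subseteq> V" "\<forall>i<n. \<forall>j<n. c i j \<in> reg S W"
    and c0: "\<forall>x\<in>W. \<forall>y z. (\<forall>i<n. (\<Sum>j<n. b i j x * y j) = z i) \<longleftrightarrow> (\<forall>i<n. y i = (\<Sum>j<n. c i j x * z j))"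
    by (elim exE conjE) (rule that)
  have W: "openin (zar S) W" "x0 \<in> W" "W \<subseteq> V" "\<And>i j. i < n \<Longrightarrow> j < n \<Longrightarrow> c i j \<in> reg S W"
    using W0 by auto
  note c = bspec[OF c0, THEN spec, THEN spec]
  have qW: "(\<lambda>x. a i j x / a n n x) \<in> reg S W" if "i < Suc n" "j < Suc n" for i j
    by (rule reg_restr[OF V(1) W(1,3) q[OF that]])
  define cn where "cn i = (\<lambda>x. - (\<Sum>k<n. c i k x * (a k n x / a n n x)))" for i
  \<comment> \<open>The four blocks of the inverse of a bordered matrix: \<open>c\<close> inverts
    the Schur complement, \<open>cn\<close> is the last column, and the last row and the corner come
    from back substitution.\<close>
  define d where "d i j = (if i < n then (if j < n then c i j else cn i)
     else if j < n then (\<lambda>x. - (\<Sum>k<n. (a n k x / a n n x) * c k j x))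
     else (\<lambda>x. inverse (a n n x) - (\<Sum>k<n. (a n k x / a n n x) * cn k x)))" for i j
  have cn: "cn i \<in> reg S W" if "i < n" for i
    unfolding cn_def by (intro reg_uminus reg_sum reg_mult W qW) (use that in auto)
  have nnW: "a n n \<in> reg S W" by (rule reg_restr[OF V(1) W(1,3) aV]) auto
  have "{x \<in> W. a n n x \<noteq> 0} = W" using nz W by auto
  then have inv: "(\<lambda>x. inverse (a n n x)) \<in> reg S W" using reg_inverse[OF W(1) nnW] by simp
  have d: "d i j \<in> reg S W" if "i < Suc n" "j < Suc n" for i j
  proof -
    have "(\<lambda>x. - (\<Sum>k<n. (a n k x / a n n x) * c k j x)) \<in> reg S W" if "j < n"
      by (intro reg_uminus reg_sum reg_mult W qW) (use that in auto)
    moreover have "(\<lambda>x. inverse (a n n x) - (\<Sum>k<n. (a n k x / a n n x) * cn k x)) \<in> reg S W"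
      by (intro reg_diff inv reg_sum reg_mult W qW cn) auto
    ultimately show ?thesis unfolding d_def using W(4) cn by simp
  qed
  \<comment> \<open>The inverse is characterised by solving the system for all \<open>y\<close> and
    \<open>z\<close> instead of by matrix products. This suits the elimination of one unknown, and
    each direction of the equivalence has its own application: Cramer's rule and the construction of
    normal frames.\<close>
  have main: "(\<forall>i<Suc n. (\<Sum>j<Suc n. a i j x * y j) = z i) \<longleftrightarrow> (\<forall>i<Suc n. y i = (\<Sum>j<Suc n. d i j x * z j))"
    if x: "x \<in> W" for x y z
  proof -
    let ?p = "a n n x"
    have p: "?p \<noteq> 0" using nz x W by auto
    have e1: "(\<Sum>j<n. b i j x * y j) = (\<Sum>j<n. a i j x * y j) - a i n x / ?p * (\<Sum>j<n. a n j x * y j)" for i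
      unfolding b_def by (simp add: algebra_simps sum_subtractf sum_distrib_left)
    have e2: "(\<Sum>j<n. c i j x * (z j - a j n x / ?p * z n)) = (\<Sum>j<n. c i j x * z j) + cn i x * z n" for i
      unfolding cn_def by (simp add: algebra_simps sum_subtractf sum_distrib_left)
    have "(\<forall>i<Suc n. (\<Sum>j<Suc n. a i j x * y j) = z i) \<longleftrightarrow>
       (\<forall>i<n. (\<Sum>j<n. a i j x * y j) + a i n x * y n = z i) \<and> y n = (z n - (\<Sum>j<n. a n j x * y j)) / ?p"
      using p by (auto simp: All_less_Suc field_simps)
    also have "\<dots> \<longleftrightarrow> (\<forall>i<n. (\<Sum>j<n. b i j x * y j) = z i - a i n x / ?p * z n) \<and>
        y n = (z n - (\<Sum>j<n. a n j x * y j)) / ?p"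
    proof -
      have "(\<Sum>j<n. a i j x * y j) + a i n x * y n = z i \<longleftrightarrow> (\<Sum>j<n. b i j x * y j) = z i - a i n x / ?p * z n"
        if yn: "y n = (z n - (\<Sum>j<n. a n j x * y j)) / ?p" for i
      proof -
        have "a i n x * y n = a i n x / ?p * z n - a i n x / ?p * (\<Sum>j<n. a n j x * y j)"
          unfolding yn using p by (simp add: field_simps)
        moreover have "(L + A = w) = (L - D = w - A')" if "A = A' - D" for L A w D A' :: 'k
          using that by (auto simp: algebra_simps)
        ultimately show ?thesis unfolding e1 by blast
      qed
      then show ?thesis by blast
    qed
    also have "\<dots> \<longleftrightarrow> (\<forall>i<n. y i = (\<Sum>j<n. c i j x * z j) + cn i x * z n) \<and>
        y n = (z n - (\<Sum>j<n. a n j x * y j)) / ?p"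
      unfolding c[OF x] e2 ..
    also have "\<dots> \<longleftrightarrow> (\<forall>i<n. y i = (\<Sum>j<Suc n. d i j x * z j)) \<and> y n = (\<Sum>j<Suc n. d n j x * z j)"
    proof -
      have m1: "(z n - (\<Sum>j<n. a n j x * y j)) / ?p = (\<Sum>j<Suc n. d n j x * z j)"
        if y: "\<forall>i<n. y i = (\<Sum>j<n. c i j x * z j) + cn i x * z n"
      proof -
        have "(\<Sum>i<n. a n i x * y i) = (\<Sum>i<n. \<Sum>j<n. a n i x * c i j x * z j) + (\<Sum>i<n. a n i x * cn i x) * z n"
          using y by (simp add: algebra_simps sum.distrib sum_distrib_left)
        also have "(\<Sum>i<n. \<Sum>j<n. a n i x * c i j x * z j) = (\<Sum>j<n. (\<Sum>i<n. a n i x * c i j x) * z j)"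
          by (subst sum.swap) (simp add: sum_distrib_right)
        finally have e: "(\<Sum>i<n. a n i x * y i) =
           (\<Sum>j<n. (\<Sum>i<n. a n i x * c i j x) * z j) + (\<Sum>i<n. a n i x * cn i x) * z n" .
        have "(z n - (\<Sum>j<n. a n j x * y j)) / ?p =
           (z n - (\<Sum>i<n. a n i x * cn i x) * z n) / ?p - (\<Sum>j<n. (\<Sum>i<n. a n i x * c i j x) * z j) / ?p"
          unfolding e by (simp add: diff_divide_distrib add_divide_distrib)
        also have "(z n - (\<Sum>i<n. a n i x * cn i x) * z n) / ?p = d n n x * z n"
          unfolding d_def by (simp add: divide_inverse algebra_simps sum_distrib_left)
        also have "(\<Sum>j<n. (\<Sum>i<n. a n i x * c i j x) * z j) / ?p = (\<Sum>j<n. - d n j x * z j)"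
          unfolding d_def sum_divide_distrib
          by (intro sum.cong) (simp_all add: sum_distrib_right sum_distrib_left sum_divide_distrib)
        finally show ?thesis by (simp add: sum_negf)
      qed
      have "(\<Sum>j<Suc n. d i j x * z j) = (\<Sum>j<n. c i j x * z j) + cn i x * z n" if "i < n" for i
        using that by (simp add: d_def)
      then have m2: "(\<forall>i<n. y i = (\<Sum>j<Suc n. d i j x * z j)) \<longleftrightarrow>
          (\<forall>i<n. y i = (\<Sum>j<n. c i j x * z j) + cn i x * z n)"
        by (simp del: sum.lessThan_Suc)
      show ?thesis unfolding m2 by (intro conj_cong refl arg_cong[where f = "(=) (y n)"] m1)
    qed
    finally show ?thesis by (simp only: All_less_Suc conj_commute)
  qed
  show ?case
    by (rule exI[of _ W], rule exI[of _ d]) (use W V d main in auto)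
qed


subsection \<open>Independent families\<close>

text \<open>Families instead of sets, because the vectors will move with a point: fixed labels keep
  the coefficients meaningful as functions of the point, and a repeated vector counts as a
  dependence.\<close>

definition indep_fam :: "('k::field \<Rightarrow> 'm \<Rightarrow> 'm::ab_group_add) \<Rightarrow> nat \<Rightarrow> (nat \<Rightarrow> 'm) \<Rightarrow> bool" where
  "indep_fam scl n t \<longleftrightarrow> (\<forall>c. (\<Sum>i<n. scl (c i) (t i)) = 0 \<longrightarrow> (\<forall>i<n. c i = 0))"

lemma indep_famD: "indep_fam scl n t \<Longrightarrow> (\<Sum>i<n. scl (c i) (t i)) = 0 \<Longrightarrow> i < n \<Longrightarrow> c i = 0"
  unfolding indep_fam_def by blast

context vector_space
begin

lemma indep_fam_inj_on:
  assumes "indep_fam scale n t"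
  shows "inj_on t {..<n}"
proof (rule inj_onI, rule ccontr)
  fix i j assume ij: "i \<in> {..<n}" "j \<in> {..<n}" "t i = t j" "i \<noteq> j"
  define c where "c k = (if k = i then 1 else if k = j then - 1 else (0::'a))" for k
  have "(\<Sum>k<n. scale (c k) (t k)) = (\<Sum>k\<in>{i, j}. scale (c k) (t k))"
    by (rule sum.mono_neutral_right) (use ij in \<open>auto simp: c_def\<close>)
  also have "\<dots> = 0" using ij by (simp add: c_def)
  finally have "c i = 0" using indep_famD[OF assms] ij by blast
  then show False by (simp add: c_def)
qed

lemma indep_fam_independent:
  assumes t: "indep_fam scale n t"
  shows "independent (t ` {..<n})"
proof
  assume "dependent (t ` {..<n})"
  then obtain u v where u: "v \<in> t ` {..<n}" "u v \<noteq> 0" "(\<Sum>v\<in>t ` {..<n}. scale (u v) v) = 0"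
    unfolding dependent_finite[OF finite_imageI[OF finite_lessThan]] by auto
  have "(\<Sum>i<n. scale (u (t i)) (t i)) = 0"
    using u(3) sum.reindex[OF indep_fam_inj_on[OF t], of "\<lambda>v. scale (u v) v"] by simp
  then show False using indep_famD[OF t, of "\<lambda>i. u (t i)"] u(1,2) by auto
qed

lemma independent_indep_fam:
  assumes "independent B" "bij_betw t {..<n} B"
  shows "indep_fam scale n t"
  unfolding indep_fam_def
proof (intro allI impI)
  fix c i assume c: "(\<Sum>i<n. scale (c i) (t i)) = 0" and i: "i < n"
  let ?u = "\<lambda>v. c (inv_into {..<n} t v)"
  have inj: "inj_on t {..<n}" and B: "t ` {..<n} = B" using assms(2) by (auto simp: bij_betw_def)
  have "(\<Sum>v\<in>B. scale (?u v) v) = (\<Sum>i<n. scale (?u (t i)) (t i))"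
    unfolding B[symmetric] using sum.reindex[OF inj, of "\<lambda>v. scale (?u v) v"] by simp
  also have "\<dots> = (\<Sum>i<n. scale (c i) (t i))"
    by (rule sum.cong) (simp_all add: inv_into_f_f[OF inj])
  finally have "(\<Sum>v\<in>B. scale (?u v) v) = 0" using c by simp
  moreover have "finite B" using B by (metis finite_imageI finite_lessThan)
  ultimately have "?u (t i) = 0"
    using independentD[OF assms(1), of B ?u "t i"] B i by auto
  then show "c i = 0" using i by (simp add: inv_into_f_f[OF inj])
qed

lemma span_fam: "v \<in> span (t ` {..<n}) \<longleftrightarrow> (\<exists>c. v = (\<Sum>i<n. scale (c i) (t i)))" for n :: nat
proof
  assume "v \<in> span (t ` {..<n})"
  then show "\<exists>c. v = (\<Sum>i<n. scale (c i) (t i))"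
  proof (induction rule: span_induct_alt)
    case base then show ?case by (intro exI[of _ "\<lambda>_. 0"]) simp
  next
    case (step a x y)
    then obtain c i where c: "y = (\<Sum>i<n. scale (c i) (t i))" "x = t i" "i < n" by auto
    have "(\<Sum>k<n. scale ((if k = i then a else 0) + c k) (t k)) =
        (\<Sum>k<n. if k = i then scale a (t k) else 0) + y"
      unfolding c(1) by (simp add: scale_left_distrib sum.distrib if_distrib[of "\<lambda>z. scale z _"] cong: if_cong)
    also have "\<dots> = scale a x + y" using c by simp
    finally show ?case by (intro exI[of _ "\<lambda>k. (if k = i then a else 0) + c k"]) simp
  qed
next
  assume "\<exists>c. v = (\<Sum>i<n. scale (c i) (t i))"
  then show "v \<in> span (t ` {..<n})" by (auto intro!: span_sum span_scale intro: span_base)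
qed

text \<open>Each coordinate function on the independent set extends linearly to the whole space.
  Such functionals define the charts, and they turn a family of vectors into a matrix that is the
  identity at the base point.\<close>

lemma dual_functionals:
  assumes t: "indep_fam scale n t"
  shows "\<exists>\<psi>. \<forall>b<n. Vector_Spaces.linear scale (*) (\<psi> b) \<and> (\<forall>a<n. \<psi> b (t a) = (if a = b then 1 else 0))"
proof -
  interpret vector_space_pair scale "(*) :: 'a \<Rightarrow> 'a \<Rightarrow> 'a"
    by unfold_locales (simp_all add: algebra_simps)
  have "\<exists>g. Vector_Spaces.linear scale (*) g \<and> (\<forall>x\<in>t ` {..<n}. g x = (if x = t b then 1 else 0))" for b
    by (rule linear_independent_extend[OF indep_fam_independent[OF t]])
  then obtain \<psi> where \<psi>: "\<And>b. Vector_Spaces.linear scale (*) (\<psi> b)"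
      "\<And>b x. x \<in> t ` {..<n} \<Longrightarrow> \<psi> b x = (if x = t b then 1 else 0)"
    by metis
  have "\<psi> b (t a) = (if a = b then 1 else 0)" if "a < n" "b < n" for a b
    using \<psi>(2)[of "t a" b] inj_onD[OF indep_fam_inj_on[OF t], of a b] that by auto
  then show ?thesis using \<psi>(1) by blast
qed

end

context finite_dimensional_vector_space
begin

lemma indep_fam_le_dim:
  assumes "indep_fam scale n t" "\<And>i. i < n \<Longrightarrow> t i \<in> W"
  shows "n \<le> dim W"
  using independent_card_le_dim[OF _ indep_fam_independent[OF assms(1)], of W] assms(2)
    card_image[OF indep_fam_inj_on[OF assms(1)]] by auto

lemma indep_fam_spans:
  assumes "indep_fam scale n t" "\<And>i. i < n \<Longrightarrow> t i \<in> W" "dim W \<le> n" "v \<in> W"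
  shows "\<exists>c. v = (\<Sum>i<n. scale (c i) (t i))"
proof -
  have "W \<subseteq> span (t ` {..<n})"
    using card_ge_dim_independent[OF _ indep_fam_independent[OF assms(1)], of W] assms(2,3)
      card_image[OF indep_fam_inj_on[OF assms(1)]] by auto
  then show ?thesis using assms(4) span_fam by auto
qed

text \<open>The basis is extracted from the spanning set \<open>A\<close>, so its members keep the
  shape of the elements of \<open>A\<close>. For the radical these are values of operators, which
  can be moved to nearby points.\<close>

lemma subspace_indep_fam:
  assumes "W \<subseteq> span A" "A \<subseteq> W"
  obtains t where "indep_fam scale (dim W) t" "\<And>i. i < dim W \<Longrightarrow> t i \<in> A"
    "\<And>v. v \<in> W \<Longrightarrow> \<exists>c. v = (\<Sum>i<dim W. scale (c i) (t i))"
proof -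
  obtain B where B: "B \<subseteq> A" "independent B" "A \<subseteq> span B" "card B = dim A" using basis_exists by blast
  have "dim W = dim A" using assms by (metis dim_span dim_subset le_antisym)
  then have "card B = dim W" using B by simp
  then obtain t where t: "bij_betw t {..<dim W} B"
    using ex_bij_betw_nat_finite[OF finiteI_independent[OF B(2)]] by (auto simp: lessThan_atLeast0)
  have t': "t ` {..<dim W} = B" using t by (auto simp: bij_betw_def)
  have "W \<subseteq> span B" using assms(1) B(3) by (meson order_trans span_minimal subspace_span)
  then have "\<exists>c. v = (\<Sum>i<dim W. scale (c i) (t i))" if "v \<in> W" for v
    using span_fam[of v t "dim W"] t' that by auto
  then show thesis using that[of t] independent_indep_fam[OF B(2) t] B(1) t' by blast
qed

end


section \<open>Sections of the trivial sheaf\<close>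

lemma linear_functional_fam:
  assumes "Vector_Spaces.linear scl (*) \<psi>"
  shows "\<psi> (\<Sum>m\<in>A. scl (f m) (u m)) = (\<Sum>m\<in>A. f m * \<psi> (u m))"
proof -
  have a: "\<psi> (x + y) = \<psi> x + \<psi> y" "\<psi> (scl c x) = c * \<psi> x" for x y c
    using assms unfolding Vector_Spaces.linear_iff by auto
  have "\<psi> 0 = 0" using a(1)[of 0 0] by (metis add_0_right add_left_cancel)
  then show ?thesis by (induction A rule: infinite_finite_induct) (auto simp: a)
qed

locale fmod = fsp S + V: finite_dimensional_vector_space scl C
  for S :: "('x, 'k::field) fspace" and scl :: "'k \<Rightarrow> 'm \<Rightarrow> 'm::ab_group_add" and C
begin

lemma linear_representation: "Vector_Spaces.linear scl (*) (\<lambda>v. V.representation C v c)"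
  unfolding Vector_Spaces.linear_iff
  using V.vector_space_axioms
  by (auto simp: V.representation_add V.representation_scale V.independent_Basis V.span_Basis
      vector_space_def algebra_simps)

lemma representation_sum: "(\<Sum>c\<in>C. scl (V.representation C v c) c) = v"
  by (rule V.sum_representation_eq) (auto simp: V.independent_Basis V.span_Basis V.finite_Basis)

lemma triv_linear:
  assumes "openin (zar S) U" "t \<in> trivial_sheaf scl S U" "Vector_Spaces.linear scl (*) \<psi>"
  shows "(\<lambda>x. \<psi> (t x)) \<in> reg S U"
proof -
  obtain A f where A: "finite A" "\<forall>m\<in>A. f m \<in> reg S U" "\<forall>x\<in>U. t x = (\<Sum>m\<in>A. scl (f m x) m)"
    using assms(1,2) unfolding trivial_sheaf_def by auto
  have "(\<lambda>x. \<Sum>m\<in>A. f m x * \<psi> m) \<in> reg S U"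
    using A by (intro reg_sum reg_mult reg_const assms) auto
  then show ?thesis
    by (rule reg_cong[OF assms(1)]) (use A in \<open>simp add: linear_functional_fam[OF assms(3), of _ "\<lambda>m. m"]\<close>)
qed

lemma triv_open: "t \<in> trivial_sheaf scl S U \<Longrightarrow> openin (zar S) U"
  unfolding trivial_sheaf_def by (auto split: if_splits)

text \<open>The basis \<open>C\<close> serves as the finite set of vectors in
  \<open>trivial_sheaf\<close>. All closure properties of sections are thereby reduced to those of
  regular functions.\<close>

lemma trivI:
  assumes "openin (zar S) U" "\<And>c. c \<in> C \<Longrightarrow> (\<lambda>x. V.representation C (t x) c) \<in> reg S U"
  shows "t \<in> trivial_sheaf scl S U"
proof -
  have "\<exists>A f. finite A \<and> (\<forall>m\<in>A. f m \<in> reg S U) \<and> (\<forall>x\<in>U. t x = (\<Sum>m\<in>A. scl (f m x) m))"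
    by (rule exI[of _ C], rule exI[of _ "\<lambda>c x. V.representation C (t x) c"])
      (use assms in \<open>auto simp: V.finite_Basis representation_sum\<close>)
  then show ?thesis unfolding trivial_sheaf_def using assms(1) by simp
qed

lemma triv_rep:
  "openin (zar S) U \<Longrightarrow> t \<in> trivial_sheaf scl S U \<Longrightarrow> (\<lambda>x. V.representation C (t x) c) \<in> reg S U"
  by (rule triv_linear[OF _ _ linear_representation])

lemma triv_add:
  assumes "s \<in> trivial_sheaf scl S U" "t \<in> trivial_sheaf scl S U"
  shows "(\<lambda>x. s x + t x) \<in> trivial_sheaf scl S U"
proof (rule trivI[OF triv_open[OF assms(1)]])
  fix c
  show "(\<lambda>x. V.representation C (s x + t x) c) \<in> reg S U"
    using reg_add[OF triv_open[OF assms(1)] triv_rep triv_rep] assms triv_open[OF assms(1)]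
    by (simp add: V.representation_add V.independent_Basis V.span_Basis)
qed

lemma triv_scale:
  assumes "f \<in> reg S U" "t \<in> trivial_sheaf scl S U"
  shows "(\<lambda>x. scl (f x) (t x)) \<in> trivial_sheaf scl S U"
proof (rule trivI[OF triv_open[OF assms(2)]])
  fix c
  show "(\<lambda>x. V.representation C (scl (f x) (t x)) c) \<in> reg S U"
    using reg_mult[OF triv_open[OF assms(2)] assms(1) triv_rep] assms triv_open[OF assms(2)]
    by (simp add: V.representation_scale V.independent_Basis V.span_Basis)
qed

lemma triv_const: "openin (zar S) U \<Longrightarrow> (\<lambda>x. m) \<in> trivial_sheaf scl S U"
  by (intro trivI reg_const)

lemma triv_sum:
  assumes "openin (zar S) U" "\<And>i. i \<in> I \<Longrightarrow> t i \<in> trivial_sheaf scl S U"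
  shows "(\<lambda>x. \<Sum>i\<in>I. t i x) \<in> trivial_sheaf scl S U"
  using assms(2)
  by (induction I rule: infinite_finite_induct) (auto intro: triv_const triv_add assms(1))

lemma triv_restr:
  assumes "t \<in> trivial_sheaf scl S U" "openin (zar S) W" "W \<subseteq> U"
  shows "t \<in> trivial_sheaf scl S W"
  by (rule trivI[OF assms(2) reg_restr[OF triv_open[OF assms(1)] assms(2,3) triv_rep]])
    (use assms triv_open in auto)

lemma triv_cong:
  assumes "t \<in> trivial_sheaf scl S U" "\<And>x. x \<in> U \<Longrightarrow> s x = t x"
  shows "s \<in> trivial_sheaf scl S U"
  using assms unfolding trivial_sheaf_def by (auto split: if_splits)

text \<open>The definition of the trivial sheaf asks for one finite expression over all of
  \<open>U\<close>. Coordinates in a fixed basis are canonical, so the local expressions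
  glue.\<close>

lemma triv_local:
  assumes "openin (zar S) U"
    "\<And>x. x \<in> U \<Longrightarrow> \<exists>W. openin (zar S) W \<and> x \<in> W \<and> W \<subseteq> U \<and> t \<in> trivial_sheaf scl S W"
  shows "t \<in> trivial_sheaf scl S U"
proof (rule trivI[OF assms(1)], rule reg_local[OF assms(1)])
  fix c x assume "x \<in> U"
  from assms(2)[OF this] obtain W where W: "openin (zar S) W" "x \<in> W" "W \<subseteq> U" "t \<in> trivial_sheaf scl S W"
    by (elim exE conjE) (rule that)
  show "\<exists>W h. openin (zar S) W \<and> x \<in> W \<and> W \<subseteq> U \<and> h \<in> reg S W \<and> (\<forall>y\<in>W. V.representation C (t y) c = h y)"
    by (rule exI[of _ W], rule exI[of _ "\<lambda>x. V.representation C (t x) c"]) (use W triv_rep in auto)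
qed

lemma triv_map:
  assumes "openin (zar S) U" "t \<in> trivial_sheaf scl S U" "Vector_Spaces.linear scl scl T"
  shows "(\<lambda>x. T (t x)) \<in> trivial_sheaf scl S U"
proof (rule trivI[OF assms(1)], rule triv_linear[OF assms(1,2)])
  fix c show "Vector_Spaces.linear scl (*) (\<lambda>x. V.representation C (T x) c)"
    using assms(3) linear_representation unfolding Vector_Spaces.linear_iff by auto
qed

text \<open>Cramer's rule near \<open>x0\<close>, with \<open>\<psi>\<close> dual to the family at \<open>x0\<close>.\<close>

lemma indep_fam_local:
  assumes "openin (zar S) U" "x0 \<in> U" "\<And>i. i < n \<Longrightarrow> t i \<in> trivial_sheaf scl S U"
    and "indep_fam scl n (\<lambda>i. t i x0)"
  obtains W \<psi> c where "openin (zar S) W" "x0 \<in> W" "W \<subseteq> U"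
    "\<And>b. b < n \<Longrightarrow> Vector_Spaces.linear scl (*) (\<psi> b)"
    "\<And>a b. a < n \<Longrightarrow> b < n \<Longrightarrow> c a b \<in> reg S W"
    "\<And>x y v a. x \<in> W \<Longrightarrow> v = (\<Sum>a<n. scl (y a) (t a x)) \<Longrightarrow> a < n \<Longrightarrow> y a = (\<Sum>b<n. c a b x * \<psi> b v)"
proof -
  obtain \<psi> where \<psi>: "\<And>b. b < n \<Longrightarrow> Vector_Spaces.linear scl (*) (\<psi> b)"
      "\<And>a b. b < n \<Longrightarrow> a < n \<Longrightarrow> \<psi> b (t a x0) = (if a = b then 1 else 0)"
    using V.dual_functionals[OF assms(4)] by blast
  have "\<exists>W c. openin (zar S) W \<and> x0 \<in> W \<and> W \<subseteq> U \<and> (\<forall>i<n. \<forall>j<n. c i j \<in> reg S W) \<and>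
    (\<forall>x\<in>W. \<forall>y z. (\<forall>i<n. (\<Sum>j<n. \<psi> i (t j x) * y j) = z i) \<longleftrightarrow> (\<forall>i<n. y i = (\<Sum>j<n. c i j x * z j)))"
    by (rule local_inverse[OF assms(1,2)]) (use \<psi> assms(1,3) triv_linear in auto)
  then obtain W c where W0: "openin (zar S) W" "x0 \<in> W" "W \<subseteq> U" "\<forall>i<n. \<forall>j<n. c i j \<in> reg S W"
    and c0: "\<forall>x\<in>W. \<forall>y z. (\<forall>i<n. (\<Sum>j<n. \<psi> i (t j x) * y j) = z i) \<longleftrightarrow> (\<forall>i<n. y i = (\<Sum>j<n. c i j x * z j))"
    by (elim exE conjE) (rule that)
  have W: "openin (zar S) W" "x0 \<in> W" "W \<subseteq> U" "\<And>a b. a < n \<Longrightarrow> b < n \<Longrightarrow> c a b \<in> reg S W"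
    using W0 by auto
  note c = bspec[OF c0, THEN spec, THEN spec]
  have cr: "y a = (\<Sum>b<n. c a b x * \<psi> b v)" if "x \<in> W" "v = (\<Sum>a<n. scl (y a) (t a x))" "a < n" for x y v a
  proof -
    have "\<forall>i<n. (\<Sum>j<n. \<psi> i (t j x) * y j) = \<psi> i v"
      unfolding that(2) by (simp add: linear_functional_fam[OF \<psi>(1)] mult.commute)
    then have "\<forall>i<n. y i = (\<Sum>j<n. c i j x * \<psi> j v)" using c[OF that(1), of y "\<lambda>b. \<psi> b v"] by simp
    then show ?thesis using that(3) by simp
  qed
  show thesis by (rule that[of W \<psi> c]) (rule W \<psi>(1) cr; assumption?)+
qed

end

section \<open>Hilbert's basis theorem\<close>

text \<open>A subset of a ring type, because polynomial functions are to be viewed inside the ring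
  of all functions with pointwise operations.\<close>

definition subring :: "'a::comm_ring_1 set \<Rightarrow> bool" where
  "subring A \<longleftrightarrow> 1 \<in> A \<and> (\<forall>x\<in>A. - x \<in> A) \<and> (\<forall>x\<in>A. \<forall>y\<in>A. x + y \<in> A \<and> x * y \<in> A)"

lemma subringD:
  assumes "subring A"
  shows "1 \<in> A" "0 \<in> A" "x \<in> A \<Longrightarrow> - x \<in> A" "x \<in> A \<Longrightarrow> y \<in> A \<Longrightarrow> x + y \<in> A"
    "x \<in> A \<Longrightarrow> y \<in> A \<Longrightarrow> x * y \<in> A" "x \<in> A \<Longrightarrow> y \<in> A \<Longrightarrow> x - y \<in> A"
proof -
  have a: "\<And>x y. x \<in> A \<Longrightarrow> y \<in> A \<Longrightarrow> x + y \<in> A" "\<And>x. x \<in> A \<Longrightarrow> - x \<in> A" "1 \<in> A"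
    using assms unfolding subring_def by auto
  show "0 \<in> A" using a(1)[OF a(3) a(2)[OF a(3)]] by simp
  show "x \<in> A \<Longrightarrow> y \<in> A \<Longrightarrow> x - y \<in> A" using a(1)[of x "- y"] a(2)[of y] by simp
qed (use assms in \<open>auto simp: subring_def\<close>)

lemma subring_sum:
  assumes "subring A" "\<And>i. i \<in> I \<Longrightarrow> f i \<in> A"
  shows "sum f I \<in> A"
  using assms(2) by (induction I rule: infinite_finite_induct) (auto intro: subringD[OF assms(1)])

text \<open>The ascending chain condition in element form: the ideals generated by the initial
  segments of a sequence cannot grow at every step. In this form it applies directly to a sequence
  of leading coefficients.\<close>

definition noetherian :: "'a::comm_ring_1 set \<Rightarrow> bool" where
  "noetherian A \<longleftrightarrow> (\<forall>a :: nat \<Rightarrow> 'a. range a \<subseteq> A \<longrightarrow>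
     (\<exists>N u. (\<forall>i<N. u i \<in> A) \<and> a N = (\<Sum>i<N. u i * a i)))"

lemma noetherianD:
  assumes "noetherian A" "\<And>i::nat. a i \<in> A"
  obtains N u where "\<And>i. i < N \<Longrightarrow> u i \<in> A" "a N = (\<Sum>i<N. u i * a i)"
  using assms unfolding noetherian_def by (metis image_subsetI)

lemma noetherian_field:
  assumes "\<And>x. x \<in> A \<Longrightarrow> x \<noteq> 0 \<Longrightarrow> \<exists>y\<in>A. y * x = 1" "0 \<in> A" "subring A"
  shows "noetherian A"
  unfolding noetherian_def
proof (intro allI impI)
  fix a :: "nat \<Rightarrow> 'a" assume a: "range a \<subseteq> A"
  show "\<exists>N u. (\<forall>i<N. u i \<in> A) \<and> a N = (\<Sum>i<N. u i * a i)"
  proof (cases "a 0 = 0")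
    case True then show ?thesis by (intro exI[of _ 0]) auto
  next
    case False
    then obtain y where y: "y \<in> A" "y * a 0 = 1" using assms(1) a by blast
    have "a 1 \<in> A" using a by auto
    then have "a 1 * y \<in> A" by (rule subringD(5)[OF assms(3) _ y(1)])
    moreover have "a 1 = a 1 * y * a 0" using y by (simp add: mult.assoc)
    ultimately show ?thesis
      by (intro exI[of _ 1] exI[of _ "\<lambda>_. a 1 * y"]) auto
  qed
qed

text \<open>Hilbert's argument: a sequence of polynomials of minimal degree outside the ideal of their
  predecessors is cut off by a relation between the leading coefficients.\<close>

theorem noetherian_adjoin:
  fixes x :: "'a::comm_ring_1"
  assumes A: "subring A" "noetherian A"
  shows "noetherian {poly p x | p. \<forall>i. coeff p i \<in> A}" (is "noetherian ?B")
  unfolding noetherian_def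
proof (intro allI impI)
  fix b :: "nat \<Rightarrow> 'a" assume b: "range b \<subseteq> ?B"
  define P where "P = {p :: 'a poly. \<forall>i. coeff p i \<in> A}"
  have P_add: "p + q \<in> P" and P_diff: "p - q \<in> P" if "p \<in> P" "q \<in> P" for p q
    using that unfolding P_def by (auto intro: subringD[OF A(1)])
  have P_mult: "p * q \<in> P" if "p \<in> P" "q \<in> P" for p q
    using that unfolding P_def by (auto simp: coeff_mult intro!: subring_sum[OF A(1)] subringD(5)[OF A(1)])
  have P_monom: "monom c n \<in> P" if "c \<in> A" for c n
    using that unfolding P_def by (auto intro: subringD[OF A(1)])
  have P0: "0 \<in> P" unfolding P_def by (auto intro: subringD[OF A(1)])
  have P_sum: "(\<And>i. i \<in> I \<Longrightarrow> f i \<in> P) \<Longrightarrow> sum f I \<in> P" for f :: "nat \<Rightarrow> 'a poly" and I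
    by (induction I rule: infinite_finite_induct) (simp_all add: P0 P_add)
  obtain f where f: "\<And>i. f i \<in> P" "\<And>i. b i = poly (f i) x"
  proof -
    have "\<forall>i. \<exists>p. p \<in> P \<and> b i = poly p x" using b unfolding P_def by blast
    then show thesis using that by metis
  qed
  \<comment> \<open>Ideals of \<open>P\<close> as explicit finite combinations, so that the
    coefficients found at the end can be pushed through evaluation at \<open>x\<close>.\<close>
  define ide where "ide S = {q. \<exists>n (g :: nat \<Rightarrow> 'a poly) u. q = (\<Sum>i<n. u i * g i) \<and> (\<forall>i<n. g i \<in> S \<and> u i \<in> P)}"
    for S
  have ideI: "(\<Sum>i<n. u i * g i) \<in> ide S" if "\<And>i. i < n \<Longrightarrow> g i \<in> S" "\<And>i. i < n \<Longrightarrow> u i \<in> P"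
    for n :: nat and u g :: "nat \<Rightarrow> 'a poly" and S
    unfolding ide_def by (rule CollectI, rule exI[of _ n], rule exI[of _ g], rule exI[of _ u]) (use that in auto)
  have ide_add: "p + q \<in> ide S" if pq: "p \<in> ide S" "q \<in> ide S" for p q S
  proof -
    obtain n :: nat and g u where 1: "p = (\<Sum>i<n. u i * g i)" "\<forall>i<n. g i \<in> S \<and> u i \<in> P"
      using pq(1) unfolding ide_def by blast
    obtain m :: nat and h v where 2: "q = (\<Sum>i<m. v i * h i)" "\<forall>i<m. h i \<in> S \<and> v i \<in> P"
      using pq(2) unfolding ide_def by blast
    define w where "w i = (if i < n then u i else v (i - n))" for i
    define k where "k i = (if i < n then g i else h (i - n))" for i
    have "(\<Sum>i<n + m. w i * k i) = p + q"
      unfolding 1 2 w_def k_def by (induction m) simp_all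
    moreover have "(\<Sum>i<n + m. w i * k i) \<in> ide S"
      by (rule ideI) (use 1 2 in \<open>auto simp: w_def k_def\<close>)
    ultimately show ?thesis by simp
  qed
  have ide_mult: "c * p \<in> ide S" if pc: "p \<in> ide S" "c \<in> P" for p c S
  proof -
    obtain n :: nat and g u where 1: "p = (\<Sum>i<n. u i * g i)" "\<forall>i<n. g i \<in> S \<and> u i \<in> P"
      using pc unfolding ide_def by blast
    have "c * p = (\<Sum>i<n. (c * u i) * g i)" unfolding 1 by (simp add: sum_distrib_left mult.assoc)
    moreover have "\<forall>i<n. g i \<in> S \<and> c * u i \<in> P" using 1 pc P_mult by auto
    ultimately show ?thesis using ideI[of n g S "\<lambda>i. c * u i"] by simp
  qed
  have ide_base: "p \<in> ide S" if "p \<in> S" for p S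
    using ideI[of 1 "\<lambda>_. p" S "\<lambda>_. 1"] that P_monom[OF subringD(1)[OF A(1)], of 0] by simp
  have ide0: "0 \<in> ide S" for S using ideI[of 0 "\<lambda>_. 0" S "\<lambda>_. 0"] by simp
  have ide_sum: "(\<And>i. i \<in> I \<Longrightarrow> p i \<in> ide S) \<Longrightarrow> sum p I \<in> ide S" for p :: "nat \<Rightarrow> 'a poly" and I S
    by (induction I rule: infinite_finite_induct) (simp_all add: ide0 ide_add)
  have ide_P: "ide S \<subseteq> P" if "S \<subseteq> P" for S
  proof
    fix p assume "p \<in> ide S"
    then obtain n :: nat and g u where 1: "p = (\<Sum>i<n. u i * g i)" "\<forall>i<n. g i \<in> S \<and> u i \<in> P"
      unfolding ide_def by blast
    show "p \<in> P" unfolding 1(1)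
    proof (rule P_sum)
      fix i assume "i \<in> {..<n}"
      then have "u i \<in> P" "g i \<in> P" using 1(2) \<open>S \<subseteq> P\<close> by auto
      then show "u i * g i \<in> P" by (rule P_mult)
    qed
  qed
  have ide_ide: "ide T \<subseteq> ide S" if T: "T \<subseteq> ide S" for S T
  proof
    fix p assume "p \<in> ide T"
    then obtain n :: nat and g u where 1: "p = (\<Sum>i<n. u i * g i)" "\<forall>i<n. g i \<in> T \<and> u i \<in> P"
      unfolding ide_def by blast
    show "p \<in> ide S" unfolding 1(1)
    proof (rule ide_sum)
      fix i assume "i \<in> {..<n}"
      then have "g i \<in> ide S" "u i \<in> P" using 1(2) T by auto
      then show "u i * g i \<in> ide S" by (rule ide_mult)
    qed
  qed
  have ide_mono: "ide T \<subseteq> ide S" if "T \<subseteq> S" for S T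
  proof (rule ide_ide)
    show "T \<subseteq> ide S" using that ide_base by (meson subset_iff)
  qed
  let ?I = "ide (range f)"
  have fin: "\<exists>h. finite h \<and> h \<subseteq> ?I \<and> ?I \<subseteq> ide h"
  proof (rule ccontr)
    assume no: "\<not> ?thesis"
    define pick where "pick h = (ARG_MIN degree p. p \<in> ?I \<and> p \<notin> ide h)" for h
    have pick: "pick h \<in> ?I \<and> pick h \<notin> ide h" "\<And>p. p \<in> ?I \<Longrightarrow> p \<notin> ide h \<Longrightarrow> degree (pick h) \<le> degree p"
      if "finite h" "h \<subseteq> ?I" for h
    proof -
      let ?Q = "\<lambda>p. p \<in> ?I \<and> p \<notin> ide h"
      have "\<not> ?I \<subseteq> ide h" using no that by (meson)
      then obtain p where p: "?Q p" by (meson subsetI)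
      show "pick h \<in> ?I \<and> pick h \<notin> ide h"
        unfolding pick_def using arg_min_natI[of ?Q p degree] p by simp
      fix p assume "p \<in> ?I" "p \<notin> ide h"
      then have "?Q p" ..
      then show "degree (pick h) \<le> degree p"
        unfolding pick_def using arg_min_nat_le[of ?Q p degree] by simp
    qed
    define H where "H = rec_nat {} (\<lambda>_ h. insert (pick h) h)"
    have H_simps: "H 0 = {}" "H (Suc n) = insert (pick (H n)) (H n)" for n by (simp_all add: H_def)
    define e where "e n = pick (H n)" for n
    have H: "finite (H n) \<and> H n \<subseteq> ?I" for n
    proof (induction n)
      case 0 show ?case by (simp add: H_simps)
    next
      case (Suc n) then show ?case using pick(1)[of "H n"] by (simp add: H_simps)
    qed
    have He: "H n = e ` {..<n}" for n
      by (induction n) (auto simp: H_simps e_def lessThan_Suc)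
    have en: "pick (e ` {..<n}) = e n" for n unfolding e_def[of n] He ..
    have eI: "e n \<in> ?I" "e n \<notin> ide (e ` {..<n})" for n
      using pick(1)[of "H n"] H[of n] unfolding He en by auto
    have emin: "degree (e n) \<le> degree p" if "p \<in> ?I" "p \<notin> ide (e ` {..<n})" for n p
      using pick(2)[of "H n" p] H[of n] that unfolding He en by auto
    have eP: "e n \<in> P" for n using eI(1)[of n] ide_P f(1) by blast
    have mono: "degree (e i) \<le> degree (e n)" if "i \<le> n" for i n
    proof (rule emin[OF eI(1)])
      have "e ` {..<i} \<subseteq> e ` {..<n}" using that by (intro image_mono) auto
      then have "ide (e ` {..<i}) \<subseteq> ide (e ` {..<n})" by (rule ide_mono)
      then show "e n \<notin> ide (e ` {..<i})" using eI(2)[of n] by (meson subsetD)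
    qed
    have "lead_coeff (e i) \<in> A" for i using eP[of i] unfolding P_def by auto
    then obtain N :: nat and u where u: "\<And>i. i < N \<Longrightarrow> u i \<in> A" "lead_coeff (e N) = (\<Sum>i<N. u i * lead_coeff (e i))"
      using noetherianD[OF A(2), of "\<lambda>i. lead_coeff (e i)"] by blast
    \<comment> \<open>The relation \<open>u\<close> between leading coefficients, with each
      \<open>e i\<close> shifted up to the degree of \<open>e N\<close>, gives an element
      \<open>d\<close> with the leading term of \<open>e N\<close>. Minimality forces
      \<open>e N - d\<close> to have degree at least that of \<open>e N\<close>, where its
      coefficient vanishes; hence \<open>e N = d\<close>, which lies in the ideal of the
      predecessors.\<close>
    define d where "d = (\<Sum>i<N. monom (u i) (degree (e N) - degree (e i)) * e i)"
    have dI: "d \<in> ide (e ` {..<N})"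
      unfolding d_def by (intro ide_sum ide_mult ide_base P_monom u) auto
    have dI': "d \<in> ?I"
    proof -
      have "e ` {..<N} \<subseteq> ?I" using eI(1) by auto
      then show ?thesis using ide_ide dI by blast
    qed
    let ?p = "e N - d"
    have neg: "- 1 \<in> P" using P_diff[OF P0 P_monom[OF subringD(1)[OF A(1)], of 0]] by simp
    have "?p \<in> ?I" using ide_add[OF eI(1)[of N] ide_mult[OF dI' neg]] by simp
    moreover have "?p \<notin> ide (e ` {..<N})" using ide_add[OF _ dI, of ?p] eI(2)[of N] by auto
    ultimately have le: "degree (e N) \<le> degree ?p" by (rule emin)
    have cd: "coeff d (degree (e N)) = lead_coeff (e N)"
    proof -
      have "coeff (monom (u i) (degree (e N) - degree (e i)) * e i) (degree (e N)) = u i * lead_coeff (e i)"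
        if "i < N" for i
        using mono[of i N] that by (simp add: coeff_monom_mult)
      then show ?thesis unfolding d_def u(2) by (simp add: coeff_sum)
    qed
    have "degree d \<le> degree (e N)" unfolding d_def
    proof (rule degree_sum_le)
      fix i assume "i \<in> {..<N}"
      then show "degree (monom (u i) (degree (e N) - degree (e i)) * e i) \<le> degree (e N)"
        using mono[of i N] degree_mult_le[of "monom (u i) (degree (e N) - degree (e i))" "e i"]
          degree_monom_le[of "u i" "degree (e N) - degree (e i)"] by auto
    qed simp
    then have "degree ?p \<le> degree (e N)" by (intro degree_diff_le) auto
    then have deg: "degree ?p = degree (e N)" using le by simp
    have "lead_coeff ?p = 0" unfolding deg coeff_diff cd by simp
    then have "?p = 0" by (simp only: leading_coeff_0_iff)
    then have "e N = d" by simp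
    then show False using dI eI(2)[of N] by simp
  qed
  then obtain h where h: "finite h" "h \<subseteq> ?I" "?I \<subseteq> ide h" by blast
  \<comment> \<open>Back from finite generation to the chain condition: finitely many generators
    involve only finitely many of the \<open>f i\<close>, so some \<open>f N\<close> depends on its
    predecessors.\<close>
  have "\<exists>N. h \<subseteq> ide (f ` {..<N})" using h(1,2)
  proof (induction h rule: finite_induct)
    case (insert p h)
    then obtain N where N: "h \<subseteq> ide (f ` {..<N})" by auto
    obtain n :: nat and g u where 1: "p = (\<Sum>i<n. u i * g i)" "\<forall>i<n. g i \<in> range f \<and> u i \<in> P"
      using insert.prems unfolding ide_def by blast
    have "\<exists>M. \<forall>i<n. g i \<in> f ` {..<M}" using 1(2)
    proof (induction n)
      case (Suc n)
      then obtain M k where Mk: "\<forall>i<n. g i \<in> f ` {..<M}" "g n = f k" by auto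
      have "\<forall>i<Suc n. g i \<in> f ` {..<max M (Suc k)}"
      proof (intro allI impI)
        fix i assume "i < Suc n"
        then consider "i = n" | "i < n" by linarith
        then show "g i \<in> f ` {..<max M (Suc k)}"
        proof cases
          case 1 then show ?thesis using Mk(2) by auto
        next
          case 2
          then have "g i \<in> f ` {..<M}" using Mk(1) by simp
          then show ?thesis by (rule rev_subsetD) (intro image_mono, auto)
        qed
      qed
      then show ?case by blast
    qed auto
    then obtain M where M: "\<forall>i<n. g i \<in> f ` {..<M}" by blast
    have "p \<in> ide (f ` {..<M})" unfolding 1(1) by (rule ideI) (use 1 M in auto)
    moreover have "ide (f ` {..<M}) \<subseteq> ide (f ` {..<max M N})" by (intro ide_mono image_mono) auto
    moreover have "ide (f ` {..<N}) \<subseteq> ide (f ` {..<max M N})" by (intro ide_mono image_mono) auto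
    ultimately have "p \<in> ide (f ` {..<max M N})" "ide (f ` {..<N}) \<subseteq> ide (f ` {..<max M N})" by auto
    then show ?case using N by (intro exI[of _ "max M N"]) auto
  qed auto
  then obtain N where "h \<subseteq> ide (f ` {..<N})" by blast
  then have "f N \<in> ide (f ` {..<N})" using ide_ide[of h "f ` {..<N}"] h(3) ide_base[of "f N" "range f"] by auto
  then obtain n :: nat and g u where 1: "f N = (\<Sum>i<n. u i * g i)" "\<forall>i<n. g i \<in> f ` {..<N} \<and> u i \<in> P"
    unfolding ide_def by blast
  \<comment> \<open>The combination found so far may repeat or permute the \<open>f i\<close>;
    collecting terms gives one coefficient for each index below \<open>N\<close>.\<close>
  have "\<exists>w. (\<forall>i<N. w i \<in> P) \<and> (\<Sum>i<n. u i * g i) = (\<Sum>i<N. w i * f i)"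
    using 1(2)
  proof (induction n)
    case 0 then show ?case by (intro exI[of _ "\<lambda>_. 0"]) (auto intro: P0)
  next
    case (Suc n)
    then obtain w k where w: "\<forall>i<N. w i \<in> P" "(\<Sum>i<n. u i * g i) = (\<Sum>i<N. w i * f i)" "k < N" "g n = f k"
      by auto
    have "(\<Sum>i<N. (w i + (if i = k then u n else 0)) * f i) = (\<Sum>i<N. w i * f i) + (\<Sum>i<N. if i = k then u n * f i else 0)"
      by (simp add: distrib_right sum.distrib if_distrib[of "\<lambda>z. z * _"] cong: if_cong)
    also have "\<dots> = (\<Sum>i<Suc n. u i * g i)" using w by simp
    finally show ?case using w Suc.prems
      by (intro exI[of _ "\<lambda>i. w i + (if i = k then u n else 0)"]) (auto intro: P_add P0)
  qed
  then obtain w where w: "\<forall>i<N. w i \<in> P" "f N = (\<Sum>i<N. w i * f i)" using 1 by auto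
  have "b N = (\<Sum>i<N. poly (w i) x * b i)" unfolding f(2) w(2) by (simp add: poly_sum)
  moreover have "\<forall>i<N. poly (w i) x \<in> ?B" using w unfolding P_def by blast
  ultimately show "\<exists>N u. (\<forall>i<N. u i \<in> ?B) \<and> b N = (\<Sum>i<N. u i * b i)"
    by (intro exI[of _ N] exI[of _ "\<lambda>i. poly (w i) x"]) auto
qed


text \<open>Otherwise one can keep choosing elements of \<open>L\<close> outside the combinations of
  those already chosen, and the resulting sequence violates the chain condition.\<close>

lemma noetherian_fg:
  fixes A :: "'a::comm_ring_1 set"
  assumes A: "noetherian A" and L: "L \<subseteq> A"
  shows "\<exists>N (a :: nat \<Rightarrow> 'a). (\<forall>k<N. a k \<in> L) \<and>
    (\<forall>x\<in>L. \<exists>u. (\<forall>k<N. u k \<in> A) \<and> x = (\<Sum>k<N. u k * a k))"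
proof (rule ccontr)
  assume no: "\<not> ?thesis"
  define G where "G a N x \<longleftrightarrow> (\<exists>u. (\<forall>k<N. u k \<in> A) \<and> x = (\<Sum>k<N. u k * a k))"
    for a :: "nat \<Rightarrow> 'a" and N x
  have "\<exists>a. \<forall>n. a n \<in> L \<and> \<not> G a n (a n)"
  proof (rule dependent_wellorder_choice)
    fix r and f g :: "nat \<Rightarrow> 'a" and x
    assume "\<And>y. y < x \<Longrightarrow> f y = g y"
    then have "(\<Sum>k<x. u k * f k) = (\<Sum>k<x. u k * g k)" for u by (intro sum.cong) auto
    then show "(r \<in> L \<and> \<not> G f x r) = (r \<in> L \<and> \<not> G g x r)" unfolding G_def by simp
  next
    fix n and a :: "nat \<Rightarrow> 'a" assume "\<And>y. y < n \<Longrightarrow> a y \<in> L \<and> \<not> G a y (a y)"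
    then have "\<forall>k<n. a k \<in> L" by blast
    then show "\<exists>x. x \<in> L \<and> \<not> G a n x" using no unfolding G_def by blast
  qed
  then obtain a where a: "\<And>n. a n \<in> L" "\<And>n. \<not> G a n (a n)" by blast
  have "\<And>i. a i \<in> A" using a(1) L by blast
  then obtain N :: nat and u where "\<And>i. i < N \<Longrightarrow> u i \<in> A" "a N = (\<Sum>i<N. u i * a i)"
    using noetherianD[OF A] by blast
  then show False using a(2)[of N] unfolding G_def by blast
qed

text \<open>Induction on the rank: the last coordinates of \<open>V\<close> are generated by
  finitely many values, which are lifted to \<open>V\<close>; subtracting a combination of the lifts
  leaves a vector with last coordinate 0, to which the induction hypothesis applies. Vectors are
  functions on all of \<open>nat\<close>, considered only below \<open>n\<close>.\<close>

theorem noetherian_submodule: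
  fixes A :: "'a::comm_ring_1 set" and n :: nat
  assumes A: "subring A" "noetherian A"
    and V: "\<And>v i. v \<in> V \<Longrightarrow> i < n \<Longrightarrow> v i \<in> A"
      "\<And>v w a. v \<in> V \<Longrightarrow> w \<in> V \<Longrightarrow> a \<in> A \<Longrightarrow> (\<lambda>i. v i + a * w i) \<in> V"
  shows "\<exists>N (w :: nat \<Rightarrow> nat \<Rightarrow> 'a). (\<forall>k<N. w k \<in> V) \<and>
    (\<forall>v\<in>V. \<exists>u. (\<forall>k<N. u k \<in> A) \<and> (\<forall>i<n. v i = (\<Sum>k<N. u k * w k i)))"
  using V
proof (induction n arbitrary: V)
  case 0
  then show ?case by (intro exI[of _ 0]) auto
next
  case (Suc n)
  note Vcl = Suc.prems(2)
  have "(\<lambda>v. v n) ` V \<subseteq> A" using Suc.prems(1) by auto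
  from noetherian_fg[OF A(2) this] obtain N :: nat and a where a: "\<forall>k<N. a k \<in> (\<lambda>v. v n) ` V"
      "\<forall>x\<in>(\<lambda>v. v n) ` V. \<exists>u. (\<forall>k<N. u k \<in> A) \<and> x = (\<Sum>k<N. u k * a k)"
    by (elim exE conjE) (rule that)
  have "\<forall>k. \<exists>v. k < N \<longrightarrow> v \<in> V \<and> v n = a k"
  proof
    fix k
    show "\<exists>v. k < N \<longrightarrow> v \<in> V \<and> v n = a k"
    proof (cases "k < N")
      case True
      then have "a k \<in> (\<lambda>v. v n) ` V" using a(1) by blast
      then show ?thesis by (elim imageE) auto
    qed auto
  qed
  from choice[OF this] obtain w where w: "\<And>k. k < N \<Longrightarrow> w k \<in> V" "\<And>k. k < N \<Longrightarrow> w k n = a k" by auto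
  let ?V = "{v \<in> V. v n = 0}"
  have "\<exists>N (w :: nat \<Rightarrow> nat \<Rightarrow> 'a). (\<forall>k<N. w k \<in> ?V) \<and>
    (\<forall>v\<in>?V. \<exists>u. (\<forall>k<N. u k \<in> A) \<and> (\<forall>i<n. v i = (\<Sum>k<N. u k * w k i)))"
    by (rule Suc.IH) (use Suc.prems in auto)
  then obtain M :: nat and w' where w': "\<forall>k<M. w' k \<in> ?V"
      "\<forall>v\<in>?V. \<exists>u. (\<forall>k<M. u k \<in> A) \<and> (\<forall>i<n. v i = (\<Sum>k<M. u k * w' k i))"
    by (elim exE conjE) (rule that)
  define W where "W k = (if k < N then w k else w' (k - N))" for k
  have "\<forall>k<N + M. W k \<in> V" unfolding W_def using w w'(1) by auto
  moreover have "\<exists>u. (\<forall>k<N + M. u k \<in> A) \<and> (\<forall>i<Suc n. v i = (\<Sum>k<N + M. u k * W k i))" if v: "v \<in> V" for v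
  proof -
    obtain u where u: "\<forall>k<N. u k \<in> A" "v n = (\<Sum>k<N. u k * a k)" using a(2) v by auto
    \<comment> \<open>\<open>V\<close> is closed only under adding one multiple at a time, so the
      lifts are subtracted one after the other.\<close>
    have sub: "(\<lambda>i. v i - (\<Sum>k<m. u k * w k i)) \<in> V" if "m \<le> N" for m
      using that
    proof (induction m)
      case 0 then show ?case using v by simp
    next
      case (Suc m)
      have "(\<lambda>i. (v i - (\<Sum>k<m. u k * w k i)) + (- u m) * w m i) \<in> V"
        by (rule Vcl) (use Suc u w subringD(3)[OF A(1)] in auto)
      then show ?case by (simp add: algebra_simps)
    qed
    let ?v = "\<lambda>i. v i - (\<Sum>k<N. u k * w k i)"
    have "?v \<in> ?V" using sub[of N] u(2) w(2) by simp
    from bspec[OF w'(2) this] obtain u' where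
      u': "\<forall>k<M. u' k \<in> A" "\<forall>i<n. ?v i = (\<Sum>k<M. u' k * w' k i)"
      by (elim exE conjE) (rule that)
    define U where "U k = (if k < N then u k else u' (k - N))" for k
    have split: "(\<Sum>k<N + m. U k * W k i) = (\<Sum>k<N. u k * w k i) + (\<Sum>k<m. u' k * w' k i)" for m i
      by (induction m) (simp_all add: U_def W_def)
    have "v i = (\<Sum>k<N + M. U k * W k i)" if "i < Suc n" for i
    proof (cases "i = n")
      case True
      have "(\<Sum>k<M. u' k * w' k n) = 0" using w'(1) by (intro sum.neutral) auto
      then show ?thesis unfolding split True using u(2) w(2) by simp
    next
      case False
      then have "?v i = (\<Sum>k<M. u' k * w' k i)" using u'(2) that by auto
      then show ?thesis unfolding split by (simp add: algebra_simps)
    qed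
    moreover have "\<forall>k<N + M. U k \<in> A" unfolding U_def using u(1) u'(1) by auto
    ultimately show ?thesis by blast
  qed
  ultimately show ?case by blast
qed

section \<open>The ring of polynomial functions on \<open>r\<close>-tuples\<close>

lemma subring_adjoin:
  assumes "subring A"
  shows "subring {poly p x | p. \<forall>i. coeff p i \<in> A}" (is "subring ?B")
    and "A \<subseteq> {poly p x | p. \<forall>i. coeff p i \<in> A}"
    and "x \<in> {poly p x | p. \<forall>i. coeff p i \<in> A}"
proof -
  note A = subringD[OF assms]
  have mem: "y \<in> ?B" if "y = poly p x" "\<And>i. coeff p i \<in> A" for y p using that by blast
  show "subring ?B" unfolding subring_def
  proof (intro conjI ballI)
    show "1 \<in> ?B" by (rule mem[of _ 1]) (auto simp: coeff_1 intro: A(1,2))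
    fix a assume "a \<in> ?B"
    then obtain p where p: "a = poly p x" "\<And>i. coeff p i \<in> A" by blast
    show "- a \<in> ?B" by (rule mem[of _ "- p"]) (use p A(3) in auto)
    fix b assume "b \<in> ?B"
    then obtain q where q: "b = poly q x" "\<And>i. coeff q i \<in> A" by blast
    show "a + b \<in> ?B" by (rule mem[of _ "p + q"]) (use p q A(4) in auto)
    show "a * b \<in> ?B"
      by (rule mem[of _ "p * q"]) (use p q in \<open>auto simp: coeff_mult intro!: subring_sum[OF assms] A(5)\<close>)
  qed
  show "A \<subseteq> ?B"
  proof
    fix a assume "a \<in> A"
    then show "a \<in> ?B" by (intro mem[of _ "[:a:]"]) (auto simp: coeff_pCons A(2) split: nat.split)
  qed
  show "x \<in> ?B" by (rule mem[of _ "[:0, 1:]"]) (auto simp: coeff_pCons A(1,2) split: nat.split)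
qed

lemma sum_apply: "(\<Sum>i\<in>I. f i) x = (\<Sum>i\<in>I. f i x)" for f :: "'i \<Rightarrow> 'x \<Rightarrow> 'a::comm_monoid_add"
  by (induction I rule: infinite_finite_induct) simp_all

lemma polyfun_subring: "subring (polyfun g r)"
  unfolding subring_def
proof (intro conjI ballI)
  show "1 \<in> polyfun g r" using polyfun_const[of 1 g r] by (simp add: one_fun_def)
  fix P assume P: "P \<in> polyfun g r"
  show "- P \<in> polyfun g r" using polyfun_mult[OF polyfun_const[of "- 1"] P] by (simp add: fun_Compl_def)
  fix Q assume Q: "Q \<in> polyfun g r"
  show "P + Q \<in> polyfun g r" using polyfun_add[OF P Q] by (simp add: plus_fun_def)
  show "P * Q \<in> polyfun g r" using polyfun_mult[OF P Q] by (simp add: times_fun_def)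
qed

text \<open>The constants form a field; the finitely many basis coordinates of the \<open>r\<close>
  components are adjoined one by one. Every linear functional is a combination of basis coordinates,
  so the ring obtained contains all polynomial functions, and the inclusion carried through the
  induction makes it equal to them.\<close>

theorem polyfun_noetherian:
  fixes g :: "('k::field, 'g::ab_group_add) lie_data"
  assumes "finite_dimensional_vector_space (lscale g) B"
  shows "noetherian (polyfun g r)"
proof -
  interpret V: finite_dimensional_vector_space "lscale g" B by fact
  interpret K: vector_space "(*) :: 'k \<Rightarrow> 'k \<Rightarrow> 'k" by unfold_locales (simp_all add: algebra_simps)
  let ?G = "(\<lambda>(b, s) X. V.representation B (X ! s) b) ` (B \<times> {..<r})"
  have rep: "Vector_Spaces.linear (lscale g) (*) (\<lambda>v. V.representation B v b)" for b
    unfolding Vector_Spaces.linear_iff using V.vector_space_axioms K.vector_space_axioms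
    by (simp add: V.representation_add V.representation_scale V.independent_Basis V.span_Basis)
  have G: "finite ?G" "?G \<subseteq> polyfun g r"
    using V.finite_Basis by (auto intro: polyfun_coord[OF rep])
  have "\<exists>A. subring A \<and> noetherian A \<and> range (\<lambda>c X. c) \<subseteq> A \<and> G \<subseteq> A \<and> A \<subseteq> polyfun g r"
    if "finite G" "G \<subseteq> polyfun g r" for G
    using that
  proof (induction G rule: finite_induct)
    case empty
    let ?A = "range (\<lambda>c :: 'k. \<lambda>X :: 'g list. c)"
    have c: "(\<lambda>X. c) \<in> ?A" for c by blast
    have "subring ?A" unfolding subring_def
    proof (intro conjI ballI)
      show "1 \<in> ?A" using c[of 1] by (simp add: one_fun_def)
      fix a assume "a \<in> ?A"
      then obtain x where x: "a = (\<lambda>X. x)" by blast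
      show "- a \<in> ?A" using c[of "- x"] unfolding x by (simp add: fun_Compl_def)
      fix b assume "b \<in> ?A"
      then obtain y where y: "b = (\<lambda>X. y)" by blast
      show "a + b \<in> ?A" using c[of "x + y"] unfolding x y by (simp add: plus_fun_def)
      show "a * b \<in> ?A" using c[of "x * y"] unfolding x y by (simp add: times_fun_def)
    qed
    moreover have "noetherian ?A"
    proof (rule noetherian_field)
      fix a assume a: "a \<in> ?A" "a \<noteq> 0"
      then obtain x where x: "a = (\<lambda>X. x)" by blast
      then have "x \<noteq> 0" using a(2) by (auto simp: zero_fun_def)
      then have "(\<lambda>X. inverse x) * a = 1" unfolding x by (simp add: times_fun_def one_fun_def)
      then show "\<exists>y\<in>?A. y * a = 1" using c by blast
    qed (use subringD(2) calculation in auto)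
    ultimately show ?case using polyfun_const by blast
  next
    case (insert x G)
    then obtain A where A: "subring A" "noetherian A" "range (\<lambda>c X. c) \<subseteq> A" "G \<subseteq> A" "A \<subseteq> polyfun g r" by auto
    let ?B = "{poly p x | p. \<forall>i. coeff p i \<in> A}"
    have "?B \<subseteq> polyfun g r"
    proof
      fix y assume "y \<in> ?B"
      then obtain p where p: "y = poly p x" "\<And>i. coeff p i \<in> A" by blast
      have xp: "x ^ i \<in> polyfun g r" for i
      proof (induction i)
        case 0 show ?case unfolding power_0 by (rule subringD(1)[OF polyfun_subring])
      next
        case (Suc i) show ?case unfolding power_Suc
          by (rule subringD(5)[OF polyfun_subring _ Suc]) (use insert.prems in auto)
      qed
      show "y \<in> polyfun g r" unfolding p(1) poly_altdef
        by (intro subring_sum[OF polyfun_subring] subringD(5)[OF polyfun_subring] xp) (use p A(5) in auto)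
    qed
    moreover note subring_adjoin[OF A(1), of x] noetherian_adjoin[OF A(1,2), of x]
    ultimately show ?case using A(3,4) by (intro exI[of _ ?B]) auto
  qed
  from this[OF G] obtain A where A: "subring A" "noetherian A" "range (\<lambda>c X. c) \<subseteq> A" "?G \<subseteq> A" "A \<subseteq> polyfun g r"
    by (elim exE conjE) (rule that)
  have "P \<in> A" if "P \<in> polyfun g r" for P
    using that
  proof induction
    case (polyfun_const c) then show ?case using A(3) by blast
  next
    case (polyfun_coord \<phi> s)
    have lin: "\<phi> (x + y) = \<phi> x + \<phi> y" "\<phi> (lscale g c x) = c * \<phi> x" for x y c
      using polyfun_coord(1) unfolding Vector_Spaces.linear_iff by auto
    have lin0: "\<phi> 0 = 0" using lin(2)[of 0 0] by simp
    have sum: "\<phi> (\<Sum>b\<in>I. lscale g (c b) b) = (\<Sum>b\<in>I. c b * \<phi> b)" for I c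
      by (induction I rule: infinite_finite_induct) (simp_all add: lin lin0)
    have phi: "\<phi> v = (\<Sum>b\<in>B. V.representation B v b * \<phi> b)" for v
      using sum[of "V.representation B v" B] V.sum_representation_eq[of B v B]
      by (simp add: V.independent_Basis V.span_Basis V.finite_Basis)
    have "(\<lambda>X. \<phi> (X ! s)) = (\<Sum>b\<in>B. (\<lambda>X. V.representation B (X ! s) b) * (\<lambda>X. \<phi> b))"
      by (rule ext, subst phi) (simp add: sum_apply)
    also have "\<dots> \<in> A"
    proof (rule subring_sum[OF A(1)], rule subringD(5)[OF A(1)])
      fix b assume "b \<in> B"
      then have "(b, s) \<in> B \<times> {..<r}" using polyfun_coord(2) by simp
      from imageI[OF this, of "\<lambda>(b, s) X. V.representation B (X ! s) b"]
      have "(\<lambda>X. V.representation B (X ! s) b) \<in> ?G" by simp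
      then show "(\<lambda>X. V.representation B (X ! s) b) \<in> A" by (rule subsetD[OF A(4)])
      show "(\<lambda>X. \<phi> b) \<in> A" using A(3) by blast
    qed
    finally show ?case .
  next
    case (polyfun_add P Q) then show ?case using subringD(4)[OF A(1), of P Q] by (simp add: plus_fun_def)
  next
    case (polyfun_mult P Q) then show ?case using subringD(5)[OF A(1), of P Q] by (simp add: times_fun_def)
  qed
  then have "polyfun g r = A" using A(5) by blast
  then show ?thesis using A(2) by simp
qed

section \<open>The free algebra and its quotients\<close>

definition fa_mult :: "('g list \<Rightarrow> 'k::field) \<Rightarrow> ('g list \<Rightarrow> 'k) \<Rightarrow> 'g list \<Rightarrow> 'k" where
  "fa_mult f h = (\<lambda>w. \<Sum>i\<le>length w. f (take i w) * h (drop i w))"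

definition fa_word :: "'g list \<Rightarrow> 'g list \<Rightarrow> 'k::zero_neq_one" where
  "fa_word u = (\<lambda>w. if w = u then 1 else 0)"

lemma fa_gen_word: "fa_gen x = fa_word [x]"
  by (simp add: fa_gen_def fa_word_def)

lemma fa_const_1: "fa_const 1 = fa_word []"
  by (simp add: fa_const_def fa_word_def)

lemma free_alg_simps [simp]:
  "monoid.mult (free_alg S) = fa_mult" "one (free_alg S) = fa_word []" "zero (free_alg S) = (\<lambda>w. 0)"
  "add (free_alg S) = (\<lambda>f h w. f w + h w)"
  by (simp_all add: free_alg_def fa_mult_def[abs_def] fa_const_1)

lemma carrier_free_alg: "f \<in> carrier (free_alg S) \<longleftrightarrow> finite {w. f w \<noteq> 0} \<and> (\<forall>w. f w \<noteq> 0 \<longrightarrow> set w \<subseteq> S)"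
  by (simp add: free_alg_def)

lemma fa_mult_word_left: "fa_mult (fa_word u) h w = (if take (length u) w = u then h (drop (length u) w) else 0)"
proof (cases "take (length u) w = u")
  case True
  then have le: "length u \<le> length w" by (metis length_take min.absorb_iff1 min.commute)
  have "fa_mult (fa_word u) h w = (\<Sum>i\<le>length w. if i = length u then h (drop (length u) w) else 0)"
    unfolding fa_mult_def
    by (rule sum.cong) (use True in \<open>auto simp: fa_word_def dest: arg_cong[of _ _ length]\<close>)
  then show ?thesis using True le by simp
next
  case False
  have "fa_mult (fa_word u) h w = 0"
    unfolding fa_mult_def fa_word_def
  proof (rule sum.neutral, rule ballI)
    fix i assume "i \<in> {..length w}"
    then have "take i w \<noteq> u" using False by auto
    then show "(if take i w = u then 1 else 0) * h (drop i w) = 0" by simp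
  qed
  then show ?thesis using False by simp
qed

lemma fa_mult_word: "fa_mult (fa_word u) (fa_word v) = (fa_word (u @ v) :: 'g list \<Rightarrow> 'k::field)"
proof
  fix w :: "'g list"
  have "take (length u) w = u \<and> drop (length u) w = v \<longleftrightarrow> w = u @ v"
    by (metis append_eq_conv_conj append_take_drop_id)
  then show "fa_mult (fa_word u) (fa_word v) w = (fa_word (u @ v) w :: 'k)"
    unfolding fa_mult_word_left by (auto simp: fa_word_def)
qed

lemma fa_mult_one: "fa_mult (fa_word []) h = h" "fa_mult h (fa_word []) = h"
proof -
  show "fa_mult (fa_word []) h = h" by (rule ext) (simp add: fa_mult_word_left)
  show "fa_mult h (fa_word []) = h"
  proof
    fix w
    have "fa_mult h (fa_word []) w = (\<Sum>i\<le>length w. if i = length w then h w else 0)"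
      unfolding fa_mult_def by (rule sum.cong) (auto simp: fa_word_def)
    then show "fa_mult h (fa_word []) w = h w" by simp
  qed
qed

lemma fa_mult_const:
  fixes h :: "'g list \<Rightarrow> 'k::field"
  shows "fa_mult (fa_const c) h = (\<lambda>w. c * h w)" "fa_mult h (fa_const c) = (\<lambda>w. c * h w)"
proof -
  have e: "(fa_const c :: 'g list \<Rightarrow> 'k) = (\<lambda>w. c * fa_word [] w)" by (auto simp: fa_const_def fa_word_def)
  have "fa_mult (\<lambda>w. c * f w) h = (\<lambda>w. c * fa_mult f h w)" "fa_mult h (\<lambda>w. c * f w) = (\<lambda>w. c * fa_mult h f w)"
    for f h :: "'g list \<Rightarrow> 'k"
    by (auto simp: fa_mult_def sum_distrib_left mult_ac)
  then show "fa_mult (fa_const c) h = (\<lambda>w. c * h w)" "fa_mult h (fa_const c) = (\<lambda>w. c * h w)"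
    unfolding e by (simp_all add: fa_mult_one)
qed

lemma fa_mult_nonzeroE:
  assumes "fa_mult f h w \<noteq> 0"
  obtains u v where "w = u @ v" "f u \<noteq> 0" "h v \<noteq> 0"
proof -
  obtain i where "f (take i w) * h (drop i w) \<noteq> 0"
    using assms unfolding fa_mult_def by (meson sum.neutral)
  then show thesis using that[of "take i w" "drop i w"] by auto
qed

lemma fa_mult_closed:
  assumes "f \<in> carrier (free_alg S)" "h \<in> carrier (free_alg S)"
  shows "fa_mult f h \<in> carrier (free_alg S)"
proof -
  have "{w. fa_mult f h w \<noteq> 0} \<subseteq> (\<lambda>(u, v). u @ v) ` ({w. f w \<noteq> 0} \<times> {w. h w \<noteq> 0})"
    by (auto elim!: fa_mult_nonzeroE)
  moreover have "finite ((\<lambda>(u, v). u @ v) ` ({w. f w \<noteq> 0} \<times> {w. h w \<noteq> 0}))"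
    using assms by (auto simp: carrier_free_alg)
  moreover have "set w \<subseteq> S" if "fa_mult f h w \<noteq> 0" for w
    using that assms by (elim fa_mult_nonzeroE) (auto simp: carrier_free_alg)
  ultimately show ?thesis unfolding carrier_free_alg using finite_subset by blast
qed

lemma fa_mult_assoc:
  fixes f h k :: "'g list \<Rightarrow> 'k::field"
  shows "fa_mult (fa_mult f h) k = fa_mult f (fa_mult h k)"
proof
  fix w :: "'g list"
  let ?n = "length w"
  have "fa_mult (fa_mult f h) k w =
      (\<Sum>i\<le>?n. \<Sum>j\<le>i. f (take j w) * h (take (i - j) (drop j w)) * k (drop i w))"
    unfolding fa_mult_def sum_distrib_right
    by (intro sum.cong refl) (simp_all add: min_def drop_take)
  also have "\<dots> = (\<Sum>(i, j)\<in>Sigma {..?n} (\<lambda>i. {..i}). f (take j w) * h (take (i - j) (drop j w)) * k (drop i w))"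
    by (rule sum.Sigma) auto
  \<comment> \<open>A word is cut into three pieces. The end positions \<open>j \<le> i\<close> of
    the first two pieces are replaced by \<open>j\<close> and the length \<open>l = i - j\<close> of
    the middle piece.\<close>
  also have "\<dots> = (\<Sum>(j, l)\<in>Sigma {..?n} (\<lambda>j. {..?n - j}). f (take j w) * h (take l (drop j w)) * k (drop (j + l) w))"
    by (rule sum.reindex_bij_witness[of _ "\<lambda>(j, l). (j + l, j)" "\<lambda>(i, j). (j, i - j)"]) auto
  also have "\<dots> = (\<Sum>j\<le>?n. \<Sum>l\<le>?n - j. f (take j w) * h (take l (drop j w)) * k (drop (j + l) w))"
    by (rule sum.Sigma[symmetric]) auto
  also have "\<dots> = fa_mult f (fa_mult h k) w"
    unfolding fa_mult_def sum_distrib_left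
    by (intro sum.cong refl) (simp_all add: mult.assoc add.commute)
  finally show "fa_mult (fa_mult f h) k w = fa_mult f (fa_mult h k) w" .
qed

lemma fa_add_closed:
  assumes "f \<in> carrier (free_alg S)" "h \<in> carrier (free_alg S)"
  shows "(\<lambda>w. f w + h w) \<in> carrier (free_alg S)"
proof -
  have "{w. f w + h w \<noteq> 0} \<subseteq> {w. f w \<noteq> 0} \<union> {w. h w \<noteq> 0}" by auto
  moreover have "finite ({w. f w \<noteq> 0} \<union> {w. h w \<noteq> 0})" using assms by (simp add: carrier_free_alg)
  moreover have "set w \<subseteq> S" if "f w + h w \<noteq> 0" for w
  proof -
    have "f w \<noteq> 0 \<or> h w \<noteq> 0" using that by auto
    then show ?thesis using assms by (auto simp: carrier_free_alg)
  qed
  ultimately show ?thesis unfolding carrier_free_alg using finite_subset by blast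
qed

lemma fa_scale_closed:
  assumes "f \<in> carrier (free_alg S)"
  shows "(\<lambda>w. c * f w) \<in> carrier (free_alg S)"
proof -
  have "{w. c * f w \<noteq> 0} \<subseteq> {w. f w \<noteq> 0}" by auto
  then show ?thesis using assms finite_subset by (auto simp: carrier_free_alg)
qed

lemma fa_uminus_closed: "f \<in> carrier (free_alg S) \<Longrightarrow> (\<lambda>w. - f w) \<in> carrier (free_alg S)"
  using fa_scale_closed[of f S "- 1"] by simp

lemma fa_word_closed: "set u \<subseteq> S \<Longrightarrow> fa_word u \<in> carrier (free_alg S)"
  by (simp add: carrier_free_alg fa_word_def)

lemma fa_const_closed: "fa_const c \<in> carrier (free_alg S)"
  by (simp add: carrier_free_alg fa_const_def)

lemma fa_zero_closed: "(\<lambda>w. 0) \<in> carrier (free_alg S)"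
  by (simp add: carrier_free_alg)

lemma free_alg_ring: "ring (free_alg S :: ('g list \<Rightarrow> 'k::field) ring)"
proof (rule ringI)
  show "abelian_group (free_alg S :: ('g list \<Rightarrow> 'k) ring)"
  proof (rule abelian_groupI)
    fix f :: "'g list \<Rightarrow> 'k" assume "f \<in> carrier (free_alg S)"
    then show "\<exists>y\<in>carrier (free_alg S). y \<oplus>\<^bsub>free_alg S\<^esub> f = \<zero>\<^bsub>free_alg S\<^esub>"
      by (intro bexI[of _ "\<lambda>w. - f w"]) (simp_all add: fa_uminus_closed)
  qed (auto simp: fa_add_closed fa_zero_closed add.assoc add.commute)
  show "Group.monoid (free_alg S :: ('g list \<Rightarrow> 'k) ring)"
    by (rule monoidI) (auto simp: fa_mult_closed fa_word_closed fa_mult_assoc fa_mult_one)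
qed (auto simp: fa_mult_def algebra_simps sum.distrib)

lemma fa_minus:
  assumes "f \<in> carrier (free_alg S)" "h \<in> carrier (free_alg S)"
  shows "f \<ominus>\<^bsub>free_alg S\<^esub> h = (\<lambda>w. f w - h w)"
proof -
  interpret ring "free_alg S" by (rule free_alg_ring)
  have "\<ominus>\<^bsub>free_alg S\<^esub> h = (\<lambda>w. - h w)"
    by (rule minus_equality) (simp_all add: assms fa_uminus_closed)
  then show ?thesis by (simp add: a_minus_def)
qed

lemma fa_gen_pow: "fa_gen x [^]\<^bsub>free_alg S\<^esub> n = fa_word (replicate n x)" for n :: nat
proof (induction n)
  case 0 then show ?case by simp
next
  case (Suc n)
  then show ?case by (simp add: fa_gen_word fa_mult_word replicate_append_same)
qed

text \<open>The support is finite, so an element can be built from 0 by adding one scaled word at a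
  time.\<close>

lemma free_alg_induct [consumes 1, case_names zero step]:
  assumes f: "f \<in> carrier (free_alg S)"
    and zero: "P (\<lambda>w. 0)"
    and step: "\<And>c u f. set u \<subseteq> S \<Longrightarrow> f \<in> carrier (free_alg S) \<Longrightarrow> P f \<Longrightarrow> P (\<lambda>w. c * fa_word u w + f w)"
  shows "P f"
proof -
  let ?r = "\<lambda>W w. if w \<in> W then f w else 0"
  have "P (?r W) \<and> ?r W \<in> carrier (free_alg S)" if "finite W" "W \<subseteq> {w. f w \<noteq> 0}" for W
    using that
  proof (induction W rule: finite_induct)
    case empty then show ?case using zero by (simp add: fa_zero_closed)
  next
    case (insert u W)
    have u: "set u \<subseteq> S" using insert.prems f by (auto simp: carrier_free_alg)
    have e: "?r (insert u W) = (\<lambda>w. f u * fa_word u w + ?r W w)"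
      using insert.hyps by (auto simp: fa_word_def)
    show ?case unfolding e
      using insert u step[OF u, of "?r W" "f u"]
      by (auto intro!: fa_add_closed fa_scale_closed fa_word_closed)
  qed
  from this[of "{w. f w \<noteq> 0}"] have "P (?r {w. f w \<noteq> 0})" using f by (simp add: carrier_free_alg)
  moreover have "?r {w. f w \<noteq> 0} = f" by auto
  ultimately show ?thesis by simp
qed


subsection \<open>Restricted enveloping algebras\<close>

text \<open>The closure properties that keep every letter in the defining relations inside
  \<open>L\<close>. They hold for \<open>UNIV\<close> whatever the operations are, so
  \<open>u(g)\<close> and \<open>u(\<epsilon>)\<close> are treated alike.\<close>

definition restricted_closed :: "('k::field, 'g::ab_group_add) lie_data \<Rightarrow> 'g set \<Rightarrow> bool" where
  "restricted_closed g L \<longleftrightarrow> (\<forall>x\<in>L. \<forall>y\<in>L. x + y \<in> L \<and> bracket g x y \<in> L) \<and>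
     (\<forall>c. \<forall>x\<in>L. lscale g c x \<in> L) \<and> (\<forall>x\<in>L. pmap g x \<in> L)"

lemma restricted_closed_UNIV: "restricted_closed g UNIV"
  by (simp add: restricted_closed_def)

text \<open>As explicit functions on words the relations no longer mention the ring
  \<open>free_alg L\<close>, so those for different \<open>L\<close> can be compared.\<close>

lemma uenv_relations_alt:
  fixes g :: "('k::field, 'g::ab_group_add) lie_data"
  assumes "restricted_closed g L"
  shows "uenv_relations g L =
    {(\<lambda>w. fa_word [x + y] w - (fa_word [x] w + fa_word [y] w)) | x y. x \<in> L \<and> y \<in> L} \<union>
    {(\<lambda>w. fa_word [lscale g c x] w - c * fa_word [x] w) | c x. x \<in> L} \<union>
    {(\<lambda>w. fa_word [x, y] w - fa_word [y, x] w - fa_word [bracket g x y] w) | x y. x \<in> L \<and> y \<in> L} \<union>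
    {(\<lambda>w. fa_word (replicate CHAR('k) x) w - fa_word [pmap g x] w) | x. x \<in> L}"
proof -
  have L: "\<And>x y. x \<in> L \<Longrightarrow> y \<in> L \<Longrightarrow> x + y \<in> L" "\<And>x y. x \<in> L \<Longrightarrow> y \<in> L \<Longrightarrow> bracket g x y \<in> L"
      "\<And>c x. x \<in> L \<Longrightarrow> lscale g c x \<in> L" "\<And>x. x \<in> L \<Longrightarrow> pmap g x \<in> L"
    using assms by (auto simp: restricted_closed_def)
  have w: "(fa_word u :: 'g list \<Rightarrow> 'k) \<in> carrier (free_alg L)" if "set u \<subseteq> L" for u
    using that by (rule fa_word_closed)
  have 1: "fa_gen (x + y) \<ominus>\<^bsub>free_alg L\<^esub> (fa_gen x \<oplus>\<^bsub>free_alg L\<^esub> fa_gen y) =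
      (\<lambda>w. fa_word [x + y] w - (fa_word [x] w + fa_word [y] w) :: 'k)" if "x \<in> L" "y \<in> L" for x y
    unfolding fa_gen_word free_alg_simps
    by (rule fa_minus) (use that L in \<open>auto intro!: w fa_add_closed\<close>)
  have 2: "fa_gen (lscale g c x) \<ominus>\<^bsub>free_alg L\<^esub> fa_const c \<otimes>\<^bsub>free_alg L\<^esub> fa_gen x =
      (\<lambda>w. fa_word [lscale g c x] w - c * fa_word [x] w)" if "x \<in> L" for c x
    unfolding fa_gen_word free_alg_simps fa_mult_const
    by (rule fa_minus) (use that L in \<open>auto intro!: w fa_scale_closed\<close>)
  have 3: "(fa_gen x \<otimes>\<^bsub>free_alg L\<^esub> fa_gen y \<ominus>\<^bsub>free_alg L\<^esub> fa_gen y \<otimes>\<^bsub>free_alg L\<^esub> fa_gen x)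
        \<ominus>\<^bsub>free_alg L\<^esub> fa_gen (bracket g x y) =
      (\<lambda>w. fa_word [x, y] w - fa_word [y, x] w - fa_word [bracket g x y] w :: 'k)" if "x \<in> L" "y \<in> L" for x y
  proof -
    have a: "(fa_gen x \<otimes>\<^bsub>free_alg L\<^esub> fa_gen y \<ominus>\<^bsub>free_alg L\<^esub> fa_gen y \<otimes>\<^bsub>free_alg L\<^esub> fa_gen x) =
        (\<lambda>w. fa_word [x, y] w - fa_word [y, x] w :: 'k)"
      unfolding fa_gen_word free_alg_simps fa_mult_word append.simps
      by (rule fa_minus) (use that in \<open>auto intro!: w\<close>)
    have "(\<lambda>w. fa_word [x, y] w + (- fa_word [y, x] w) :: 'k) \<in> carrier (free_alg L)"
      by (intro fa_add_closed fa_uminus_closed w) (use that in auto)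
    then have "(\<lambda>w. fa_word [x, y] w - fa_word [y, x] w :: 'k) \<in> carrier (free_alg L)" by simp
    from fa_minus[OF this w[of "[bracket g x y]"]]
    show ?thesis unfolding a unfolding fa_gen_word using that L(2) by simp
  qed
  have 4: "fa_gen x [^]\<^bsub>free_alg L\<^esub> CHAR('k) \<ominus>\<^bsub>free_alg L\<^esub> fa_gen (pmap g x) =
      (\<lambda>w. fa_word (replicate CHAR('k) x) w - fa_word [pmap g x] w :: 'k)" if "x \<in> L" for x
    unfolding fa_gen_pow unfolding fa_gen_word
    by (rule fa_minus) (use that L in \<open>auto intro!: w\<close>)
  have e: "{F x y |x y. x \<in> L \<and> y \<in> L} = {F' x y |x y. x \<in> L \<and> y \<in> L}"
    if "\<And>x y. x \<in> L \<Longrightarrow> y \<in> L \<Longrightarrow> F x y = F' x y" for F F' :: "'g \<Rightarrow> 'g \<Rightarrow> 'g list \<Rightarrow> 'k"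
    using that by (metis (no_types, opaque_lifting))
  have e2: "{F c x |c x. x \<in> L} = {F' c x |c x. x \<in> L}"
    if "\<And>c x. x \<in> L \<Longrightarrow> F c x = F' c x" for F F' :: "'k \<Rightarrow> 'g \<Rightarrow> 'g list \<Rightarrow> 'k"
    using that by (metis (no_types, opaque_lifting))
  have e3: "{F x |x. x \<in> L} = {F' x |x. x \<in> L}"
    if "\<And>x. x \<in> L \<Longrightarrow> F x = F' x" for F F' :: "'g \<Rightarrow> 'g list \<Rightarrow> 'k"
    using that by (metis (no_types, opaque_lifting))
  show ?thesis unfolding uenv_relations_def Let_def
    by (intro arg_cong2[of _ _ _ _ "(\<union>)"] e e2 e3 1 2 3 4)
qed

lemma uenv_relations_carrier:
  assumes "restricted_closed g L"
  shows "uenv_relations g L \<subseteq> carrier (free_alg L)"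
proof -
  have L: "\<And>x y. x \<in> L \<Longrightarrow> y \<in> L \<Longrightarrow> x + y \<in> L" "\<And>x y. x \<in> L \<Longrightarrow> y \<in> L \<Longrightarrow> bracket g x y \<in> L"
      "\<And>c x. x \<in> L \<Longrightarrow> lscale g c x \<in> L" "\<And>x. x \<in> L \<Longrightarrow> pmap g x \<in> L"
    using assms by (auto simp: restricted_closed_def)
  have d: "(\<lambda>w. f w - h w) \<in> carrier (free_alg L)" if "f \<in> carrier (free_alg L)" "h \<in> carrier (free_alg L)"
    for f h :: "'b list \<Rightarrow> 'a"
    using fa_add_closed[OF that(1) fa_uminus_closed[OF that(2)]] by simp
  show ?thesis unfolding uenv_relations_alt[OF assms]
    by (auto intro!: d fa_add_closed fa_scale_closed fa_word_closed L)
qed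

lemma uenv_ideal_ideal:
  assumes "restricted_closed g L"
  shows "ideal (uenv_ideal g L) (free_alg L)" "uenv_relations g L \<subseteq> uenv_ideal g L"
  unfolding uenv_ideal_def
  by (intro ring.genideal_ideal ring.genideal_self free_alg_ring uenv_relations_carrier assms)+

lemma free_alg_idealI:
  assumes "I \<subseteq> carrier (free_alg L)" "(\<lambda>w. 0) \<in> I"
    "\<And>f h. f \<in> I \<Longrightarrow> h \<in> I \<Longrightarrow> (\<lambda>w. f w - h w) \<in> I"
    "\<And>f h. f \<in> I \<Longrightarrow> h \<in> carrier (free_alg L) \<Longrightarrow> fa_mult h f \<in> I"
    "\<And>f h. f \<in> I \<Longrightarrow> h \<in> carrier (free_alg L) \<Longrightarrow> fa_mult f h \<in> I"
  shows "ideal I (free_alg L :: ('g list \<Rightarrow> 'k::field) ring)"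
proof (rule idealI[OF free_alg_ring])
  interpret ring "free_alg L :: ('g list \<Rightarrow> 'k::field) ring" by (rule free_alg_ring)
  have neg: "(\<lambda>w. - f w) \<in> I" if "f \<in> I" for f using assms(3)[OF assms(2) that] by simp
  show "subgroup I (add_monoid (free_alg L))"
  proof (rule add.subgroupI)
    show "I \<subseteq> carrier (free_alg L)" "I \<noteq> {}" using assms by auto
    fix f assume f: "f \<in> I"
    have "\<ominus>\<^bsub>free_alg L\<^esub> f = (\<lambda>w. - f w)"
      by (rule minus_equality) (use f assms(1) in \<open>auto intro: fa_uminus_closed\<close>)
    then show "\<ominus>\<^bsub>free_alg L\<^esub> f \<in> I" using neg[OF f] by simp
    fix h assume h: "h \<in> I"
    show "f \<oplus>\<^bsub>free_alg L\<^esub> h \<in> I" using assms(3)[OF f neg[OF h]] by simp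
  qed
qed (use assms in auto)

text \<open>The part of \<open>uenv_ideal g UNIV\<close> supported on words over \<open>L\<close> is
  an ideal of \<open>free_alg L\<close> containing the relations of \<open>L\<close>, hence contains
  the smallest such ideal. This makes the map from \<open>u(L)\<close> to \<open>u(g)\<close> well
  defined.\<close>

lemma uenv_ideal_mono:
  fixes g :: "('k::field, 'g::ab_group_add) lie_data"
  assumes "restricted_closed g L"
  shows "uenv_ideal g L \<subseteq> uenv_ideal g UNIV"
proof -
  let ?I = "uenv_ideal g UNIV" and ?F = "carrier (free_alg L)"
  note U = uenv_ideal_ideal[OF restricted_closed_UNIV, of g]
  interpret ideal ?I "free_alg UNIV" by (rule U)
  have sub: "f \<in> carrier (free_alg UNIV)" if "f \<in> ?F" for f :: "'g list \<Rightarrow> 'k"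
    using that by (simp add: carrier_free_alg)
  have I_F: "f \<in> carrier (free_alg UNIV)" if "f \<in> ?I" for f using that by (rule Icarr)
  have "ideal (?I \<inter> ?F) (free_alg L)"
  proof (rule free_alg_idealI)
    show "(\<lambda>w. 0) \<in> ?I \<inter> ?F"
      using additive_subgroup.zero_closed[OF ideal.axioms(1)[OF U(1)]] by (simp add: fa_zero_closed)
    fix f h :: "'g list \<Rightarrow> 'k" assume f: "f \<in> ?I \<inter> ?F"
    { assume h: "h \<in> ?I \<inter> ?F"
      have "(\<lambda>w. - h w) \<in> ?I"
        using I_l_closed[of h "fa_const (- 1)"] h by (simp add: fa_const_closed fa_mult_const)
      then have "(\<lambda>w. f w - h w) \<in> ?I"
        using additive_subgroup.a_closed[OF ideal.axioms(1)[OF U(1)], of f "\<lambda>w. - h w"] f by simp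
      moreover have "(\<lambda>w. f w + (- h w)) \<in> ?F" using f h by (intro fa_add_closed fa_uminus_closed) auto
      ultimately show "(\<lambda>w. f w - h w) \<in> ?I \<inter> ?F" by simp }
    assume h: "h \<in> ?F"
    show "fa_mult h f \<in> ?I \<inter> ?F" "fa_mult f h \<in> ?I \<inter> ?F"
      using I_l_closed[of f h] I_r_closed[of f h] f h sub[of h] by (auto intro: fa_mult_closed)
  qed auto
  moreover have "uenv_relations g L \<subseteq> uenv_relations g UNIV"
    unfolding uenv_relations_alt[OF assms] uenv_relations_alt[OF restricted_closed_UNIV] by blast
  then have "uenv_relations g L \<subseteq> ?I \<inter> ?F" using U(2) uenv_relations_carrier[OF assms] by auto
  ultimately have "genideal (free_alg L) (uenv_relations g L) \<subseteq> ?I \<inter> ?F"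
    by (rule ring.genideal_minimal[OF free_alg_ring])
  then show ?thesis unfolding uenv_ideal_def[of g L] by simp
qed

text \<open>All words in the relations are non-empty, for the \<open>p\<close>-th power relation
  because \<open>p > 0\<close>, and vanishing at the empty word defines an ideal. So the constant
  term is well defined on \<open>u(L)\<close>.\<close>

lemma uenv_ideal_augmentation:
  fixes g :: "('k::field, 'g::ab_group_add) lie_data"
  assumes "restricted_closed g L" "CHAR('k) > 0" "f \<in> uenv_ideal g L"
  shows "f [] = 0"
proof -
  let ?I = "{f \<in> carrier (free_alg L). f [] = (0 :: 'k)}"
  have d: "(\<lambda>w. f w - h w) \<in> carrier (free_alg L)" if "f \<in> carrier (free_alg L)" "h \<in> carrier (free_alg L)"
    for f h :: "'g list \<Rightarrow> 'k"
    using fa_add_closed[OF that(1) fa_uminus_closed[OF that(2)]] by simp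
  have m: "fa_mult f h [] = f [] * h []" for f h :: "'g list \<Rightarrow> 'k" by (simp add: fa_mult_def)
  have "ideal ?I (free_alg L)"
    by (rule free_alg_idealI) (auto simp: fa_zero_closed m intro: d fa_mult_closed)
  moreover have "uenv_relations g L \<subseteq> ?I"
  proof -
    have "f [] = 0" if "f \<in> uenv_relations g L" for f
      using that assms(2) unfolding uenv_relations_alt[OF assms(1)] by (auto simp: fa_word_def)
    then show ?thesis using uenv_relations_carrier[OF assms(1)] by auto
  qed
  ultimately have "uenv_ideal g L \<subseteq> ?I"
    unfolding uenv_ideal_def by (rule ring.genideal_minimal[OF free_alg_ring])
  then show ?thesis using assms(3) by auto
qed

lemma uenv_ring: "restricted_closed g L \<Longrightarrow> ring (uenv g L)"
  unfolding uenv_def by (rule ideal.quotient_is_ring[OF uenv_ideal_ideal(1)])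

lemma uenv_class_hom: "restricted_closed g L \<Longrightarrow> uenv_class g L \<in> ring_hom (free_alg L) (uenv g L)"
  using ideal.rcos_ring_hom[OF uenv_ideal_ideal(1)[of g L]]
  unfolding uenv_def uenv_class_def[abs_def] .

lemma uenv_class_add:
  assumes "restricted_closed g L" "f \<in> carrier (free_alg L)" "h \<in> carrier (free_alg L)"
  shows "uenv_class g L (\<lambda>w. f w + h w) = uenv_class g L f \<oplus>\<^bsub>uenv g L\<^esub> uenv_class g L h"
  using ring_hom_add[OF uenv_class_hom[OF assms(1)] assms(2,3)] by simp

lemma uenv_class_mult:
  assumes "restricted_closed g L" "f \<in> carrier (free_alg L)" "h \<in> carrier (free_alg L)"
  shows "uenv_class g L (fa_mult f h) = uenv_class g L f \<otimes>\<^bsub>uenv g L\<^esub> uenv_class g L h"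
  using ring_hom_mult[OF uenv_class_hom[OF assms(1)] assms(2,3)] by simp

lemma uenv_class_closed:
  assumes "restricted_closed g L" "f \<in> carrier (free_alg L)"
  shows "uenv_class g L f \<in> carrier (uenv g L)"
  using ring_hom_closed[OF uenv_class_hom[OF assms(1)] assms(2)] .

lemma uenv_class_one: "restricted_closed g L \<Longrightarrow> uenv_class g L (fa_word []) = \<one>\<^bsub>uenv g L\<^esub>"
  using ring_hom_one[OF uenv_class_hom] by simp

lemma uenv_carrierE:
  assumes "a \<in> carrier (uenv g L)"
  obtains f where "f \<in> carrier (free_alg L)" "a = uenv_class g L f"
  using assms unfolding uenv_def FactRing_def uenv_class_def A_RCOSETS_def' by auto

lemma uenv_class_eq:
  assumes "restricted_closed g L" "f \<in> carrier (free_alg L)" "h \<in> carrier (free_alg L)"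
  shows "uenv_class g L f = uenv_class g L h \<longleftrightarrow> (\<lambda>w. f w - h w) \<in> uenv_ideal g L"
  using ring.quotient_eq_iff_same_a_r_cos[OF free_alg_ring uenv_ideal_ideal(1)[OF assms(1)] assms(2,3)]
  unfolding fa_minus[OF assms(2,3)] uenv_class_def by simp

lemma uenv_class_zero:
  assumes "restricted_closed g L"
  shows "uenv_class g L (\<lambda>w. 0) = \<zero>\<^bsub>uenv g L\<^esub>"
  using ring_hom_zero[OF uenv_class_hom[OF assms] free_alg_ring uenv_ring[OF assms]] by simp


section \<open>The action on a module\<close>

lemma lie_algebraD:
  assumes "lie_algebra g"
  shows "vector_space (lscale g)" "bracket g x x = 0"
  using assms unfolding lie_algebra_def by auto

locale umod =
  fixes g :: "('k::field, 'g::ab_group_add) lie_data" and M :: "('k, 'g, 'm::ab_group_add) mod_data"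
  assumes g: "lie_algebra g" and M: "uenv_module g M"
begin

sublocale G: vector_space "lscale g" by (rule lie_algebraD[OF g])

sublocale V: vector_space "mscale M" using M unfolding uenv_module_def Let_def by blast

abbreviation act :: "('g list \<Rightarrow> 'k) \<Rightarrow> 'm \<Rightarrow> 'm" where
  "act f \<equiv> uact M (uenv_class g UNIV f)"

abbreviation fa :: "('g list \<Rightarrow> 'k) set" where
  "fa \<equiv> carrier (free_alg UNIV)"

lemmas cl = restricted_closed_UNIV[of g]

lemma act_add_right: "f \<in> fa \<Longrightarrow> act f (m + n) = act f m + act f n"
  using M uenv_class_closed[OF cl, of f] unfolding uenv_module_def Let_def by blast

lemma act_add: "f \<in> fa \<Longrightarrow> h \<in> fa \<Longrightarrow> act (\<lambda>w. f w + h w) m = act f m + act h m"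
  using M uenv_class_closed[OF cl, of f] uenv_class_closed[OF cl, of h]
  unfolding uenv_class_add[OF cl] uenv_module_def Let_def by simp

lemma act_mult: "f \<in> fa \<Longrightarrow> h \<in> fa \<Longrightarrow> act (fa_mult f h) m = act f (act h m)"
  using M uenv_class_closed[OF cl, of f] uenv_class_closed[OF cl, of h]
  unfolding uenv_class_mult[OF cl] uenv_module_def Let_def by simp

lemma act_const: "act (fa_const c) m = mscale M c m"
  using M unfolding uenv_module_def Let_def by blast

lemma act_scale: "f \<in> fa \<Longrightarrow> act (\<lambda>w. c * f w) m = mscale M c (act f m)"
  using act_mult[of "fa_const c" f m] by (simp add: fa_const_closed act_const fa_mult_const)

lemma act_scale_right: "f \<in> fa \<Longrightarrow> act f (mscale M c m) = mscale M c (act f m)"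
  using act_mult[of f "fa_const c" m] act_scale[of f c m] by (simp add: fa_const_closed act_const fa_mult_const)

lemma act_zero: "act (\<lambda>w. 0) m = 0"
  using act_const[of 0 m] by (simp add: fa_const_def)

lemma act_word: "act (fa_word u) m = foldr (lie_act g M) u m"
proof (induction u)
  case Nil
  then show ?case using act_const[of 1 m] by (simp add: fa_const_1)
next
  case (Cons x u)
  have l: "lie_act g M x n = act (fa_word [x]) n" for n by (simp add: lie_act_def fa_gen_word)
  have "act (fa_word (x # u)) m = act (fa_mult (fa_word [x]) (fa_word u)) m" by (simp add: fa_mult_word)
  also have "\<dots> = act (fa_word [x]) (act (fa_word u) m)"
    by (rule act_mult) (simp_all add: fa_word_closed)
  also have "\<dots> = lie_act g M x (foldr (lie_act g M) u m)" unfolding Cons l ..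
  finally show ?case by simp
qed

lemma lie_act_word: "lie_act g M x m = act (fa_word [x]) m"
  by (simp add: act_word)

lemma lie_act_add_right: "lie_act g M x (m + n) = lie_act g M x m + lie_act g M x n"
  unfolding lie_act_word by (rule act_add_right) (simp add: fa_word_closed)

lemma lie_act_scale_right: "lie_act g M x (mscale M c m) = mscale M c (lie_act g M x m)"
  unfolding lie_act_word by (rule act_scale_right) (simp add: fa_word_closed)

lemma lie_act_linear: "Vector_Spaces.linear (mscale M) (mscale M) (lie_act g M x)"
  unfolding Vector_Spaces.linear_iff
  using V.vector_space_axioms lie_act_add_right lie_act_scale_right by blast

lemma act_eq:
  assumes "f \<in> fa" "h \<in> fa" "(\<lambda>w. f w - h w) \<in> uenv_ideal g UNIV"
  shows "act f m = act h m"
  using uenv_class_eq[OF cl assms(1,2)] assms(3) by simp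

lemma rel_in_ideal: "f \<in> uenv_relations g UNIV \<Longrightarrow> f \<in> uenv_ideal g UNIV"
  using uenv_ideal_ideal(2)[OF cl] by blast

lemma lie_act_add: "lie_act g M (x + y) m = lie_act g M x m + lie_act g M y m"
proof -
  have "act (fa_word [x + y]) m = act (\<lambda>w. fa_word [x] w + fa_word [y] w) m"
    by (rule act_eq, simp add: fa_word_closed, intro fa_add_closed fa_word_closed subset_UNIV, rule rel_in_ideal)
      (unfold uenv_relations_alt[OF cl], blast)
  then show ?thesis unfolding lie_act_word by (subst (asm) act_add) (simp_all add: fa_word_closed)
qed

lemma lie_act_scale: "lie_act g M (lscale g c x) m = mscale M c (lie_act g M x m)"
proof -
  have "act (fa_word [lscale g c x]) m = act (\<lambda>w. c * fa_word [x] w) m"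
    by (rule act_eq, simp add: fa_word_closed, intro fa_scale_closed fa_word_closed subset_UNIV, rule rel_in_ideal)
      (unfold uenv_relations_alt[OF cl], blast)
  then show ?thesis unfolding lie_act_word by (subst (asm) act_scale) (simp_all add: fa_word_closed)
qed

lemma lie_act_0: "lie_act g M 0 m = 0"
  using lie_act_scale[of 0 0 m] by simp

lemma lie_act_sum: "lie_act g M (\<Sum>i\<in>I. lscale g (c i) (x i)) m = (\<Sum>i\<in>I. mscale M (c i) (lie_act g M (x i) m))"
  by (induction I rule: infinite_finite_induct) (simp_all add: lie_act_0 lie_act_add lie_act_scale)

lemma lie_act_commute:
  assumes "bracket g x y = 0"
  shows "lie_act g M x (lie_act g M y m) = lie_act g M y (lie_act g M x m)"
proof -
  have "(\<lambda>w. fa_word [x, y] w - fa_word [y, x] w - fa_word [bracket g x y] w) \<in> uenv_ideal g UNIV"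
    by (rule rel_in_ideal) (unfold uenv_relations_alt[OF cl], blast)
  then have i: "(\<lambda>w. fa_word [x, y] w - (fa_word [y, x] w + fa_word [0] w)) \<in> uenv_ideal g UNIV"
    unfolding assms by (simp add: algebra_simps)
  have "act (fa_word [x, y]) m = act (\<lambda>w. fa_word [y, x] w + fa_word [0] w) m"
    by (rule act_eq[OF _ _ i]) (intro fa_add_closed fa_word_closed subset_UNIV)+
  also have "\<dots> = act (fa_word [y, x]) m + act (fa_word [0]) m"
    by (rule act_add) (intro fa_word_closed subset_UNIV)+
  finally show ?thesis by (simp add: act_word lie_act_0)
qed

lemma foldr_lie_act_linear: "Vector_Spaces.linear (mscale M) (mscale M) (foldr (lie_act g M) u)"
  unfolding Vector_Spaces.linear_iff
  by (induction u) (use V.vector_space_axioms in \<open>auto simp: lie_act_add_right lie_act_scale_right\<close>)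

text \<open>Expand \<open>f\<close> over its support and split each word. For the span the first
  \<open>j\<close> letters, which act last, are split off; for the vanishing the last
  \<open>j\<close> letters, which act first, already kill \<open>m\<close>.\<close>

lemma act_in_span:
  assumes "f \<in> carrier (free_alg L)" "\<And>w. f w \<noteq> 0 \<Longrightarrow> j \<le> length w"
  shows "act f m \<in> V.span {foldr (lie_act g M) w n | w n. set w \<subseteq> L \<and> length w = j}"
    and "(\<And>w. set w \<subseteq> L \<Longrightarrow> length w = j \<Longrightarrow> foldr (lie_act g M) w m = 0) \<Longrightarrow> act f m = 0"
proof -
  have fin: "finite {w. f w \<noteq> 0}" and L: "\<And>w. f w \<noteq> 0 \<Longrightarrow> set w \<subseteq> L" using assms(1) by (auto simp: carrier_free_alg)
  let ?r = "\<lambda>W w. if w \<in> W then f w else 0"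
  have "act (?r W) m = (\<Sum>w\<in>W. mscale M (f w) (foldr (lie_act g M) w m)) \<and> ?r W \<in> fa" if "finite W" for W
    using that
  proof (induction W rule: finite_induct)
    case empty then show ?case using act_zero by (simp add: fa_zero_closed)
  next
    case (insert u W)
    have e: "?r (insert u W) = (\<lambda>w. f u * fa_word u w + ?r W w)"
      using insert.hyps by (auto simp: fa_word_def)
    have c: "(\<lambda>w. f u * fa_word u w) \<in> fa" by (intro fa_scale_closed fa_word_closed subset_UNIV)
    have "act (\<lambda>w. f u * fa_word u w + ?r W w) m = act (\<lambda>w. f u * fa_word u w) m + act (?r W) m"
      by (rule act_add[OF c]) (use insert in auto)
    also have "act (\<lambda>w. f u * fa_word u w) m = mscale M (f u) (foldr (lie_act g M) u m)"
      by (subst act_scale) (simp_all add: act_word fa_word_closed)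
    finally show ?case unfolding e using insert fa_add_closed[OF c, of "?r W"] by simp
  qed
  from this[OF fin] have e: "act (?r {w. f w \<noteq> 0}) m = (\<Sum>w\<in>{w. f w \<noteq> 0}. mscale M (f w) (foldr (lie_act g M) w m))"
    by blast
  have r: "?r {w. f w \<noteq> 0} = f" by auto
  note e = e[unfolded r]
  show "act f m \<in> V.span {foldr (lie_act g M) w n | w n. set w \<subseteq> L \<and> length w = j}"
    unfolding e
  proof (intro V.span_sum V.span_scale V.span_base)
    fix w assume "w \<in> {w. f w \<noteq> 0}"
    then have w: "j \<le> length w" "set w \<subseteq> L" using assms(2) L by auto
    have "foldr (lie_act g M) w m = foldr (lie_act g M) (take j w) (foldr (lie_act g M) (drop j w) m)"
      by (metis append_take_drop_id foldr_append comp_apply)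
    moreover have "set (take j w) \<subseteq> L" "length (take j w) = j" using w set_take_subset[of j w] by auto
    ultimately show "foldr (lie_act g M) w m \<in> {foldr (lie_act g M) w n | w n. set w \<subseteq> L \<and> length w = j}"
      by blast
  qed
  assume z: "\<And>w. set w \<subseteq> L \<Longrightarrow> length w = j \<Longrightarrow> foldr (lie_act g M) w m = 0"
  show "act f m = 0" unfolding e
  proof (rule sum.neutral, rule ballI)
    fix w assume "w \<in> {w. f w \<noteq> 0}"
    then have w: "j \<le> length w" "set w \<subseteq> L" using assms(2) L by auto
    let ?k = "length w - j"
    have "foldr (lie_act g M) w m = foldr (lie_act g M) (take ?k w) (foldr (lie_act g M) (drop ?k w) m)"
      by (metis append_take_drop_id foldr_append comp_apply)
    also have "foldr (lie_act g M) (drop ?k w) m = 0" using z[of "drop ?k w"] w set_drop_subset[of ?k w] by auto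
    also have "foldr (lie_act g M) (take ?k w) 0 = 0"
      using foldr_lie_act_linear[of "take ?k w"] V.scale_zero_left[of 0]
      unfolding Vector_Spaces.linear_iff by (metis V.scale_zero_left)
    finally show "mscale M (f w) (foldr (lie_act g M) w m) = 0" by simp
  qed
qed

text \<open>Any two members of the coset differ by an element of \<open>uenv_ideal g L\<close>,
  hence of \<open>uenv_ideal g UNIV\<close>. So the union in \<open>restr_act\<close> is a single
  coset.\<close>

lemma restr_act_class:
  assumes "restricted_closed g L" "f \<in> carrier (free_alg L)"
  shows "restr_act g M (uenv_class g L f) = act f"
proof -
  have U: "f \<in> carrier (free_alg UNIV)" if "f \<in> carrier (free_alg L)" for f :: "'g list \<Rightarrow> 'k"
    using that by (simp add: carrier_free_alg)
  have c: "uenv_class g L f = {(\<lambda>w. i w + f w) | i. i \<in> uenv_ideal g L}"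
    unfolding uenv_class_def a_r_coset_def' by auto
  have "uenv_class g UNIV h = uenv_class g UNIV f" if h: "h \<in> uenv_class g L f" for h
  proof -
    obtain i where i: "h = (\<lambda>w. i w + f w)" "i \<in> uenv_ideal g L" using h unfolding c by blast
    have "i \<in> carrier (free_alg L)" using ideal.Icarr[OF uenv_ideal_ideal(1)[OF assms(1)] i(2)] .
    then have "h \<in> carrier (free_alg L)" unfolding i(1) using assms(2) by (rule fa_add_closed)
    moreover have "(\<lambda>w. h w - f w) \<in> uenv_ideal g UNIV"
      unfolding i(1) using uenv_ideal_mono[OF assms(1)] i(2) by auto
    ultimately show ?thesis using uenv_class_eq[OF cl, of h f] U assms(2) by blast
  qed
  moreover have "uenv_class g L f \<noteq> {}"
    unfolding c using additive_subgroup.zero_closed[OF ideal.axioms(1)[OF uenv_ideal_ideal(1)[OF assms(1)]]] by blast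
  ultimately have "(\<Union>h\<in>uenv_class g L f. uenv_class g UNIV h) = uenv_class g UNIV f" by auto
  then show ?thesis unfolding restr_act_def by simp
qed

end


section \<open>The Jacobson radical of an elementary subalgebra\<close>

lemma elementary_closed:
  assumes "lie_algebra g" "elementary g E"
  shows "restricted_closed g E" "0 \<in> E"
proof -
  interpret vector_space "lscale g" by (rule lie_algebraD[OF assms(1)])
  show "restricted_closed g E" "0 \<in> E"
    using assms(2) unfolding elementary_def subspace_def restricted_closed_def by auto
qed

text \<open>The generator attached to the vector 0 is the one-letter word \<open>[0]\<close>, not
  the zero of the free algebra; the scaling relation with factor 0 kills it. This is how
  \<open>[x,y] = 0\<close> and \<open>x^[p] = 0\<close> acquire their meaning in
  \<open>u(\<epsilon>)\<close>.\<close>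

lemma uenv_gen_0:
  assumes "lie_algebra g" "restricted_closed g E" "0 \<in> E"
  shows "uenv_class g E (fa_word [0]) = \<zero>\<^bsub>uenv g E\<^esub>"
proof -
  interpret vector_space "lscale g" by (rule lie_algebraD[OF assms(1)])
  have "(\<lambda>w. fa_word [lscale g 0 0] w - 0 * fa_word [0] w) \<in> uenv_relations g E"
    unfolding uenv_relations_alt[OF assms(2)] using assms(3) by blast
  then have "(\<lambda>w. fa_word [0] w - 0) \<in> uenv_ideal g E" using uenv_ideal_ideal(2)[OF assms(2)] by auto
  then have "uenv_class g E (fa_word [0]) = uenv_class g E (\<lambda>w. 0)"
    by (subst uenv_class_eq[OF assms(2)]) (simp_all add: fa_word_closed fa_zero_closed assms(3))
  then show ?thesis unfolding uenv_class_zero[OF assms(2)] .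
qed

text \<open>The bracket relation reads \<open>xy - yx = [0] = 0\<close> for two generators; it
  extends to words letter by letter and to all elements by linearity.\<close>

lemma uenv_gen_commute:
  assumes "lie_algebra g" "elementary g E" "x \<in> E" "r \<in> carrier (uenv g E)"
  shows "uenv_class g E (fa_word [x]) \<otimes>\<^bsub>uenv g E\<^esub> r = r \<otimes>\<^bsub>uenv g E\<^esub> uenv_class g E (fa_word [x])"
proof -
  note E = elementary_closed[OF assms(1,2)]
  let ?R = "uenv g E" and ?c = "uenv_class g E"
  interpret ring ?R by (rule uenv_ring[OF E(1)])
  note mult = uenv_class_mult[OF E(1)] and add = uenv_class_add[OF E(1)] and closed = uenv_class_closed[OF E(1)]
  have W: "fa_word u \<in> carrier (free_alg E)" if "set u \<subseteq> E" for u :: "'b list" using that by (rule fa_word_closed)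
  have X: "?c (fa_word [x]) \<in> carrier ?R" using closed[OF W] assms(3) by simp
  have wm: "?c (fa_word (u @ v)) = ?c (fa_word u) \<otimes>\<^bsub>?R\<^esub> ?c (fa_word v)" if "set u \<subseteq> E" "set v \<subseteq> E" for u v
    using mult[OF W[OF that(1)] W[OF that(2)]] by (simp add: fa_mult_word)
  have gen: "?c (fa_word [x]) \<otimes>\<^bsub>?R\<^esub> ?c (fa_word [y]) = ?c (fa_word [y]) \<otimes>\<^bsub>?R\<^esub> ?c (fa_word [x])" if y: "y \<in> E" for y
  proof -
    have "(\<lambda>w. fa_word [x, y] w - fa_word [y, x] w - fa_word [bracket g x y] w) \<in> uenv_ideal g E"
      using uenv_ideal_ideal(2)[OF E(1)] assms(3) y unfolding uenv_relations_alt[OF E(1)] by blast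
    moreover have "bracket g x y = 0" using assms(2,3) y unfolding elementary_def by blast
    ultimately have i: "(\<lambda>w. fa_word [x, y] w - (fa_word [y, x] w + fa_word [0] w)) \<in> uenv_ideal g E"
      by (simp add: algebra_simps)
    have "?c (fa_word [x, y]) = ?c (\<lambda>w. fa_word [y, x] w + fa_word [0] w)"
      by (subst uenv_class_eq[OF E(1)]) (use i assms(3) y E(2) in \<open>auto intro!: fa_add_closed W\<close>)
    also have "\<dots> = ?c (fa_word [y, x]) \<oplus>\<^bsub>?R\<^esub> ?c (fa_word [0])"
      by (rule add) (use assms(3) y E(2) in \<open>auto intro!: W\<close>)
    also have "\<dots> = ?c (fa_word [y, x])"
      unfolding uenv_gen_0[OF assms(1) E] using closed[OF W[of "[y, x]"]] assms(3) y by simp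
    finally show ?thesis using wm[of "[x]" "[y]"] wm[of "[y]" "[x]"] assms(3) y by simp
  qed
  have word: "?c (fa_word [x]) \<otimes>\<^bsub>?R\<^esub> ?c (fa_word u) = ?c (fa_word u) \<otimes>\<^bsub>?R\<^esub> ?c (fa_word [x])" if "set u \<subseteq> E" for u
    using that
  proof (induction u)
    case Nil then show ?case unfolding uenv_class_one[OF E(1)] using X by simp
  next
    case (Cons y u)
    have Y: "?c (fa_word [y]) \<in> carrier ?R" "?c (fa_word u) \<in> carrier ?R" using closed[OF W] Cons.prems by auto
    have "?c (fa_word (y # u)) = ?c (fa_word [y]) \<otimes>\<^bsub>?R\<^esub> ?c (fa_word u)"
      using wm[of "[y]" u] Cons.prems by simp
    moreover have "?c (fa_word [x]) \<otimes>\<^bsub>?R\<^esub> (?c (fa_word [y]) \<otimes>\<^bsub>?R\<^esub> ?c (fa_word u)) =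
        ?c (fa_word [y]) \<otimes>\<^bsub>?R\<^esub> (?c (fa_word [x]) \<otimes>\<^bsub>?R\<^esub> ?c (fa_word u))"
      using gen[of y] Cons.prems m_assoc[OF X Y] m_assoc[OF Y(1) X Y(2)] by simp
    moreover have "?c (fa_word [x]) \<otimes>\<^bsub>?R\<^esub> ?c (fa_word u) = ?c (fa_word u) \<otimes>\<^bsub>?R\<^esub> ?c (fa_word [x])"
      using Cons by simp
    ultimately show ?case using m_assoc[OF Y X] by simp
  qed
  obtain f where f: "f \<in> carrier (free_alg E)" "r = ?c f" using uenv_carrierE[OF assms(4)] .
  show ?thesis unfolding f(2) using f(1)
  proof (induction f rule: free_alg_induct)
    case zero then show ?case unfolding uenv_class_zero[OF E(1)] using X by simp
  next
    case (step c u f)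
    let ?a = "?c (fa_const c)" and ?u = "?c (fa_word u)"
    have a: "?a \<in> carrier ?R" "?u \<in> carrier ?R" "?c f \<in> carrier ?R"
      using closed[OF fa_const_closed] closed[OF W] closed[OF step(2)] step(1) by auto
    have e: "?c (\<lambda>w. c * fa_word u w + f w) = (?a \<otimes>\<^bsub>?R\<^esub> ?u) \<oplus>\<^bsub>?R\<^esub> ?c f"
      using add[OF fa_scale_closed[OF W[OF step(1)], of c] step(2)] mult[OF fa_const_closed[of c] W[OF step(1)]]
      by (simp add: fa_mult_const)
    have "?c (fa_word [x]) \<otimes>\<^bsub>?R\<^esub> ?a = ?a \<otimes>\<^bsub>?R\<^esub> ?c (fa_word [x])"
      using mult[OF W[of "[x]"] fa_const_closed[of c]] mult[OF fa_const_closed[of c] W[of "[x]"]] assms(3)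
      by (simp add: fa_mult_const)
    then have "?c (fa_word [x]) \<otimes>\<^bsub>?R\<^esub> (?a \<otimes>\<^bsub>?R\<^esub> ?u) = (?a \<otimes>\<^bsub>?R\<^esub> ?u) \<otimes>\<^bsub>?R\<^esub> ?c (fa_word [x])"
      using word[OF step(1)] m_assoc[OF X a(1,2)] m_assoc[OF a(1) X a(2)] m_assoc[OF a(1,2) X] by simp
    then show ?case unfolding e using step(3) a X by (simp add: l_distr r_distr)
  qed
qed

text \<open>If \<open>x\<close> were not in \<open>I\<close>, then \<open>I + R x\<close> would be
  everything and \<open>1 = i + r x\<close>. As \<open>x\<close> is central, multiplying by
  \<open>x^n\<close> gives \<open>x^n = x^n i + r x^(n+1)\<close>, so membership in \<open>I\<close>
  descends from \<open>x^p = 0\<close> through all powers down to 1.\<close>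

lemma gen_in_maximal_left_ideal:
  fixes g :: "('k::field, 'g::ab_group_add) lie_data"
  assumes "lie_algebra g" "elementary g E" "x \<in> E" "maximal_left_ideal I (uenv g E)"
  shows "uenv_class g E (fa_word [x]) \<in> I"
proof (rule ccontr)
  note E = elementary_closed[OF assms(1,2)]
  let ?R = "uenv g E" and ?c = "uenv_class g E"
  let ?x = "?c (fa_word [x])"
  interpret ring ?R by (rule uenv_ring[OF E(1)])
  assume no: "?x \<notin> I"
  have W: "?c (fa_word u) \<in> carrier ?R" if "set u \<subseteq> E" for u
    by (rule uenv_class_closed[OF E(1) fa_word_closed[OF that]])
  have X: "?x \<in> carrier ?R" using W[of "[x]"] assms(3) by simp
  have I: "additive_subgroup I ?R" "\<And>a y. a \<in> carrier ?R \<Longrightarrow> y \<in> I \<Longrightarrow> a \<otimes>\<^bsub>?R\<^esub> y \<in> I"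
      "I \<noteq> carrier ?R" "\<And>K. left_ideal K ?R \<Longrightarrow> I \<subseteq> K \<Longrightarrow> K = I \<or> K = carrier ?R"
    using assms(4) unfolding maximal_left_ideal_def left_ideal_def by auto
  interpret I: additive_subgroup I ?R by (rule I)
  let ?K = "{i \<oplus>\<^bsub>?R\<^esub> r \<otimes>\<^bsub>?R\<^esub> ?x | i r. i \<in> I \<and> r \<in> carrier ?R}"
  have mem: "z \<in> ?K" if "z = i \<oplus>\<^bsub>?R\<^esub> r \<otimes>\<^bsub>?R\<^esub> ?x" "i \<in> I" "r \<in> carrier ?R" for z i r
    using that by blast
  have "left_ideal ?K ?R"
    unfolding left_ideal_def
  proof (intro conjI ballI additive_subgroupI add.subgroupI)
    show "?K \<subseteq> carrier ?R" using X by auto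
    have "\<zero>\<^bsub>?R\<^esub> \<in> ?K" by (rule mem[of _ "\<zero>\<^bsub>?R\<^esub>" "\<zero>\<^bsub>?R\<^esub>"]) (use X in auto)
    then show "?K \<noteq> {}" by blast
    fix y assume "y \<in> ?K"
    then obtain i r where y: "y = i \<oplus>\<^bsub>?R\<^esub> r \<otimes>\<^bsub>?R\<^esub> ?x" "i \<in> I" "r \<in> carrier ?R" by blast
    note c = y(2,3) X I.a_Hcarr[OF y(2)]
    show "\<ominus>\<^bsub>?R\<^esub> y \<in> ?K"
      by (rule mem[of _ "\<ominus>\<^bsub>?R\<^esub> i" "\<ominus>\<^bsub>?R\<^esub> r"]) (use c in \<open>auto simp: y(1) minus_add l_minus\<close>)
    { fix z assume "z \<in> ?K"
      then obtain k s where z: "z = k \<oplus>\<^bsub>?R\<^esub> s \<otimes>\<^bsub>?R\<^esub> ?x" "k \<in> I" "s \<in> carrier ?R" by blast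
      note d = z(2,3) I.a_Hcarr[OF z(2)]
      show "y \<oplus>\<^bsub>?R\<^esub> z \<in> ?K"
        by (rule mem[of _ "i \<oplus>\<^bsub>?R\<^esub> k" "r \<oplus>\<^bsub>?R\<^esub> s"]) (use c d in \<open>auto simp: y(1) z(1) l_distr a_ac\<close>) }
    fix a assume a: "a \<in> carrier ?R"
    show "a \<otimes>\<^bsub>?R\<^esub> y \<in> ?K"
      by (rule mem[of _ "a \<otimes>\<^bsub>?R\<^esub> i" "a \<otimes>\<^bsub>?R\<^esub> r"]) (use c a I(2) in \<open>auto simp: y(1) r_distr m_assoc\<close>)
  qed
  moreover have "I \<subseteq> ?K"
  proof
    fix i assume i: "i \<in> I"
    show "i \<in> ?K" by (rule mem[of _ i "\<zero>\<^bsub>?R\<^esub>"]) (use i I.a_Hcarr[OF i] X in auto)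
  qed
  moreover have "?x \<in> ?K" by (rule mem[of _ "\<zero>\<^bsub>?R\<^esub>" "\<one>\<^bsub>?R\<^esub>"]) (use X in auto)
  ultimately have "\<one>\<^bsub>?R\<^esub> \<in> ?K" using I(4)[of ?K] no by (metis (no_types, lifting) one_closed)
  then obtain i r where ir: "\<one>\<^bsub>?R\<^esub> = i \<oplus>\<^bsub>?R\<^esub> r \<otimes>\<^bsub>?R\<^esub> ?x" "i \<in> I" "r \<in> carrier ?R" by blast
  define y where "y n = ?c (fa_word (replicate n x))" for n
  have Y: "y n \<in> carrier ?R" for n unfolding y_def by (rule W) (use assms(3) in auto)
  have yS: "y (Suc n) = y n \<otimes>\<^bsub>?R\<^esub> ?x" for n
  proof -
    have r: "set (replicate n x) \<subseteq> E" using assms(3) by auto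
    show ?thesis
      using uenv_class_mult[OF E(1) fa_word_closed[OF r] fa_word_closed[of "[x]" E]] assms(3)
      by (simp add: y_def fa_mult_word replicate_append_same)
  qed
  have yr: "y n \<otimes>\<^bsub>?R\<^esub> s = s \<otimes>\<^bsub>?R\<^esub> y n" if s: "s \<in> carrier ?R" for n s
  proof (induction n)
    case 0 then show ?case using s by (simp add: y_def uenv_class_one[OF E(1)])
  next
    case (Suc n)
    have "y (Suc n) \<otimes>\<^bsub>?R\<^esub> s = y n \<otimes>\<^bsub>?R\<^esub> (?x \<otimes>\<^bsub>?R\<^esub> s)" unfolding yS using Y X s by (simp add: m_assoc)
    also have "\<dots> = y n \<otimes>\<^bsub>?R\<^esub> s \<otimes>\<^bsub>?R\<^esub> ?x"
      unfolding uenv_gen_commute[OF assms(1-3) s] using Y X s by (simp add: m_assoc)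
    also have "\<dots> = s \<otimes>\<^bsub>?R\<^esub> y (Suc n)" unfolding Suc yS using Y X s by (simp add: m_assoc)
    finally show ?case .
  qed
  have down: "y n \<in> I" if "y (Suc n) \<in> I" for n
  proof -
    have "y n = y n \<otimes>\<^bsub>?R\<^esub> (i \<oplus>\<^bsub>?R\<^esub> r \<otimes>\<^bsub>?R\<^esub> ?x)" unfolding ir(1)[symmetric] using Y by simp
    also have "\<dots> = y n \<otimes>\<^bsub>?R\<^esub> i \<oplus>\<^bsub>?R\<^esub> (y n \<otimes>\<^bsub>?R\<^esub> r) \<otimes>\<^bsub>?R\<^esub> ?x"
      using Y X ir(2,3) I.a_Hcarr by (simp add: r_distr m_assoc)
    also have "(y n \<otimes>\<^bsub>?R\<^esub> r) \<otimes>\<^bsub>?R\<^esub> ?x = r \<otimes>\<^bsub>?R\<^esub> y (Suc n)"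
      unfolding yr[OF ir(3)] yS using Y X ir(3) by (simp add: m_assoc)
    finally have e: "y n = y n \<otimes>\<^bsub>?R\<^esub> i \<oplus>\<^bsub>?R\<^esub> r \<otimes>\<^bsub>?R\<^esub> y (Suc n)" .
    show ?thesis by (subst e) (intro I.a_closed I(2) Y ir that)
  qed
  have "y CHAR('k) = \<zero>\<^bsub>?R\<^esub>"
  proof -
    have "pmap g x = 0" using assms(2,3) unfolding elementary_def by blast
    moreover have "(\<lambda>w. fa_word (replicate CHAR('k) x) w - fa_word [pmap g x] w) \<in> uenv_ideal g E"
      using uenv_ideal_ideal(2)[OF E(1)] assms(3) unfolding uenv_relations_alt[OF E(1)] by blast
    ultimately have "y CHAR('k) = ?c (fa_word [0])"
      unfolding y_def by (subst uenv_class_eq[OF E(1)]) (use assms(3) E(2) in \<open>auto intro!: fa_word_closed\<close>)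
    then show ?thesis unfolding uenv_gen_0[OF assms(1) E] .
  qed
  then have "y CHAR('k) \<in> I" using I.zero_closed by simp
  moreover have "y n \<in> I \<Longrightarrow> y 0 \<in> I" for n by (induction n) (use down in auto)
  ultimately have "y 0 \<in> I" by blast
  then have "\<one>\<^bsub>?R\<^esub> \<in> I" unfolding y_def by (simp add: uenv_class_one[OF E(1)])
  then have "a \<in> I" if "a \<in> carrier ?R" for a using I(2)[OF that] that by fastforce
  then show False using I(3) I.a_Hcarr by blast
qed

text \<open>A larger left ideal contains some \<open>f\<close> with constant term
  \<open>b \<noteq> 0\<close>. Since \<open>b - f\<close> has constant term 0, the scalar
  \<open>b\<close> lies in it too, and so does 1. Properness holds because the constant term is well
  defined.\<close>

lemma augmentation_maximal:
  fixes g :: "('k::field, 'g::ab_group_add) lie_data"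
  assumes "restricted_closed g E" "CHAR('k) > 0"
  shows "maximal_left_ideal (uenv_class g E ` {f \<in> carrier (free_alg E). f [] = 0}) (uenv g E)"
proof -
  let ?R = "uenv g E" and ?c = "uenv_class g E" and ?A = "{f \<in> carrier (free_alg E). f [] = (0 :: 'k)}"
  interpret ring ?R by (rule uenv_ring[OF assms(1)])
  note closed = uenv_class_closed[OF assms(1)]
  have m: "fa_mult f h [] = f [] * h []" for f h :: "'g list \<Rightarrow> 'k" by (simp add: fa_mult_def)
  have left: "left_ideal (?c ` ?A) ?R"
    unfolding left_ideal_def
  proof (intro conjI ballI additive_subgroupI add.subgroupI)
    show "?c ` ?A \<subseteq> carrier ?R" using closed by auto
    have "(\<lambda>w. 0) \<in> ?A" by (simp add: fa_zero_closed)
    then show "?c ` ?A \<noteq> {}" by blast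
    fix y assume "y \<in> ?c ` ?A"
    then obtain f where f: "y = ?c f" "f \<in> carrier (free_alg E)" "f [] = 0" by auto
    have fn: "(\<lambda>w. - f w) \<in> ?A" using fa_uminus_closed[OF f(2)] f(3) by simp
    have "\<ominus>\<^bsub>?R\<^esub> y = ?c (\<lambda>w. - f w)"
    proof (rule minus_equality)
      show "?c (\<lambda>w. - f w) \<oplus>\<^bsub>?R\<^esub> y = \<zero>\<^bsub>?R\<^esub>"
        using uenv_class_add[OF assms(1) fa_uminus_closed[OF f(2)] f(2)] uenv_class_zero[OF assms(1)]
        by (simp add: f(1))
    qed (use closed f fa_uminus_closed[OF f(2)] in auto)
    then show "\<ominus>\<^bsub>?R\<^esub> y \<in> ?c ` ?A" using fn by blast
    { fix z assume "z \<in> ?c ` ?A"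
      then obtain h where h: "z = ?c h" "h \<in> carrier (free_alg E)" "h [] = 0" by auto
      have "(\<lambda>w. f w + h w) \<in> ?A" using fa_add_closed[OF f(2) h(2)] f(3) h(3) by simp
      moreover have "y \<oplus>\<^bsub>?R\<^esub> z = ?c (\<lambda>w. f w + h w)"
        using uenv_class_add[OF assms(1) f(2) h(2)] f(1) h(1) by simp
      ultimately show "y \<oplus>\<^bsub>?R\<^esub> z \<in> ?c ` ?A" by blast }
    fix a assume "a \<in> carrier ?R"
    then obtain h where h: "h \<in> carrier (free_alg E)" "a = ?c h" by (rule uenv_carrierE)
    have "fa_mult h f \<in> ?A" using fa_mult_closed[OF h(1) f(2)] f(3) by (simp add: m)
    moreover have "a \<otimes>\<^bsub>?R\<^esub> y = ?c (fa_mult h f)" using uenv_class_mult[OF assms(1) h(1) f(2)] f(1) h(2) by simp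
    ultimately show "a \<otimes>\<^bsub>?R\<^esub> y \<in> ?c ` ?A" by blast
  qed
  have "\<one>\<^bsub>?R\<^esub> \<notin> ?c ` ?A"
  proof
    assume "\<one>\<^bsub>?R\<^esub> \<in> ?c ` ?A"
    then obtain f where f: "?c (fa_word []) = ?c f" "f \<in> carrier (free_alg E)" "f [] = 0"
      using uenv_class_one[OF assms(1)] by auto
    have "(\<lambda>w. fa_word [] w - f w) \<in> uenv_ideal g E"
      using f(1) uenv_class_eq[OF assms(1) fa_word_closed[of "[]" E] f(2)] by simp
    from uenv_ideal_augmentation[OF assms this] show False using f(3) by (simp add: fa_word_def)
  qed
  then have ne: "?c ` ?A \<noteq> carrier ?R" by auto
  have "K = ?c ` ?A \<or> K = carrier ?R" if K: "left_ideal K ?R" "?c ` ?A \<subseteq> K" for K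
  proof (rule disjCI)
    interpret K: additive_subgroup K ?R using K(1) unfolding left_ideal_def by blast
    have Kl: "a \<otimes>\<^bsub>?R\<^esub> y \<in> K" if "a \<in> carrier ?R" "y \<in> K" for a y
      using K(1) that unfolding left_ideal_def by blast
    assume "K \<noteq> carrier ?R"
    show "K = ?c ` ?A"
    proof (rule ccontr)
      assume "K \<noteq> ?c ` ?A"
      then obtain k where k: "k \<in> K" "k \<notin> ?c ` ?A" using K(2) by blast
      obtain f where f: "f \<in> carrier (free_alg E)" "k = ?c f" using uenv_carrierE[OF K.a_Hcarr[OF k(1)]] .
      let ?b = "f []"
      have b: "?b \<noteq> 0" using k(2) f by auto
      have "(\<lambda>w. fa_const ?b w + (- f w)) \<in> ?A"
        using fa_add_closed[OF fa_const_closed fa_uminus_closed[OF f(1)]] by (simp add: fa_const_def)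
      then have "?c (\<lambda>w. fa_const ?b w + (- f w)) \<in> K" using K(2) by blast
      then have "?c (\<lambda>w. (fa_const ?b w + (- f w)) + f w) \<in> K"
        using uenv_class_add[OF assms(1) fa_add_closed[OF fa_const_closed fa_uminus_closed[OF f(1)]] f(1)] K.a_closed k(1) f(2)
        by simp
      then have bK: "?c (fa_const ?b) \<in> K" by simp
      have "?c (fa_mult (fa_const (inverse ?b)) (fa_const ?b)) \<in> K"
        using Kl[OF closed[OF fa_const_closed] bK] uenv_class_mult[OF assms(1) fa_const_closed fa_const_closed] by metis
      moreover have "fa_mult (fa_const (inverse ?b)) (fa_const ?b) = (fa_word [] :: 'g list \<Rightarrow> 'k)"
        unfolding fa_mult_const using b by (auto simp: fa_const_def fa_word_def)
      ultimately have "?c (fa_word []) \<in> K" by (simp only:)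
      then have "\<one>\<^bsub>?R\<^esub> \<in> K" unfolding uenv_class_one[OF assms(1)] .
      then have "a \<in> K" if "a \<in> carrier ?R" for a using Kl[OF that] that by fastforce
      then show False using \<open>K \<noteq> carrier ?R\<close> K.a_Hcarr by blast
    qed
  qed
  then show ?thesis unfolding maximal_left_ideal_def using left ne by blast
qed

text \<open>Every letter lies in all maximal left ideals, hence in the radical \<open>J\<close>.
  With \<open>ideal_power_lengthE\<close> this describes \<open>J^j\<close> by word length.\<close>

lemma ideal_power_word:
  assumes "lie_algebra g" "elementary g E" "set u \<subseteq> E"
  shows "uenv_class g E (fa_word u) \<in> ideal_power (uenv g E) (jacobson_radical (uenv g E)) (length u)"
  using assms(3)
proof (induction u)
  case Nil
  then show ?case using uenv_class_closed[OF elementary_closed(1)[OF assms(1,2)] fa_word_closed[of "[]" E]] by simp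
next
  case (Cons x u)
  note E = elementary_closed(1)[OF assms(1,2)]
  have x: "uenv_class g E (fa_word [x]) \<in> jacobson_radical (uenv g E)"
    unfolding jacobson_radical_def
    using gen_in_maximal_left_ideal[OF assms(1,2), of x] uenv_class_closed[OF E fa_word_closed[of "[x]" E]] Cons.prems
    by auto
  have "uenv_class g E (fa_word (x # u)) = uenv_class g E (fa_word [x]) \<otimes>\<^bsub>uenv g E\<^esub> uenv_class g E (fa_word u)"
    using uenv_class_mult[OF E fa_word_closed[of "[x]" E] fa_word_closed[of u E]] Cons.prems by (simp add: fa_mult_word)
  then show ?case using ideal_prod.prod[OF x Cons.IH] Cons.prems by simp
qed

text \<open>The augmentation ideal is one of the maximal left ideals, so each factor from the
  radical has a representative without constant term and contributes at least one letter.\<close>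

lemma ideal_power_lengthE:
  fixes g :: "('k::field, 'g::ab_group_add) lie_data"
  assumes "restricted_closed g E" "CHAR('k) > 0"
    and "a \<in> ideal_power (uenv g E) (jacobson_radical (uenv g E)) j"
  obtains f where "f \<in> carrier (free_alg E)" "a = uenv_class g E f" "\<And>w. f w \<noteq> 0 \<Longrightarrow> j \<le> length w"
proof -
  let ?J = "jacobson_radical (uenv g E)"
  have "\<exists>f. f \<in> carrier (free_alg E) \<and> a = uenv_class g E f \<and> (\<forall>w. f w \<noteq> 0 \<longrightarrow> j \<le> length w)"
    using assms(3)
  proof (induction j arbitrary: a)
    case 0
    then have "a \<in> carrier (uenv g E)" by simp
    then obtain f where "f \<in> carrier (free_alg E)" "a = uenv_class g E f" by (rule uenv_carrierE)
    then show ?case by blast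
  next
    case (Suc j)
    from Suc.prems have "a \<in> ideal_prod (uenv g E) ?J (ideal_power (uenv g E) ?J j)" by simp
    then show ?case
    proof (induction a rule: ideal_prod.induct)
      case (prod i b)
      have "i \<in> uenv_class g E ` {f \<in> carrier (free_alg E). f [] = 0}"
        using prod(1) augmentation_maximal[OF assms(1,2)] unfolding jacobson_radical_def by blast
      then obtain f where f: "i = uenv_class g E f" "f \<in> carrier (free_alg E)" "f [] = 0" by auto
      obtain h where h: "h \<in> carrier (free_alg E)" "b = uenv_class g E h" "\<forall>w. h w \<noteq> 0 \<longrightarrow> j \<le> length w"
        using Suc.IH[OF prod(2)] by blast
      have "Suc j \<le> length w" if w: "fa_mult f h w \<noteq> 0" for w
      proof -
        obtain u v where uv: "w = u @ v" "f u \<noteq> 0" "h v \<noteq> 0" using fa_mult_nonzeroE[OF w] .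
        then have "u \<noteq> []" "j \<le> length v" using f(3) h(3) by auto
        then show ?thesis unfolding uv(1) by (cases u) auto
      qed
      then show ?case using fa_mult_closed[OF f(2) h(1)] uenv_class_mult[OF assms(1) f(2) h(1)] f(1) h(2)
        by (intro exI[of _ "fa_mult f h"]) auto
    next
      case (sum a b)
      obtain f where f: "f \<in> carrier (free_alg E)" "a = uenv_class g E f" "\<forall>w. f w \<noteq> 0 \<longrightarrow> Suc j \<le> length w"
        using sum by blast
      obtain h where h: "h \<in> carrier (free_alg E)" "b = uenv_class g E h" "\<forall>w. h w \<noteq> 0 \<longrightarrow> Suc j \<le> length w"
        using sum by blast
      have "Suc j \<le> length w" if "f w + h w \<noteq> 0" for w
        using that f(3) h(3) by (cases "f w = 0") auto
      then show ?case using fa_add_closed[OF f(1) h(1)] uenv_class_add[OF assms(1) f(1) h(1)] f(2) h(2)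
        by (intro exI[of _ "\<lambda>w. f w + h w"]) auto
    qed
  qed
  then show thesis using that by blast
qed

text \<open>Here the Jacobson radical leaves the argument: elements of \<open>J^j\<close> have
  representatives supported on words of length at least \<open>j\<close>, and words of length
  exactly \<open>j\<close> lie in \<open>J^j\<close>.\<close>

theorem (in umod) Rad_words:
  assumes "elementary g E" "CHAR('k) > 0"
  shows "Rad g M j E = V.span {foldr (lie_act g M) w m | w m. set w \<subseteq> E \<and> length w = j}"
proof -
  note E = elementary_closed(1)[OF g assms(1)]
  let ?P = "ideal_power (uenv g E) (jacobson_radical (uenv g E)) j"
  let ?W = "{foldr (lie_act g M) w m | w m. set w \<subseteq> E \<and> length w = j}"
  have "{restr_act g M a m | a m. a \<in> ?P} \<subseteq> V.span ?W"
  proof clarify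
    fix a m assume "a \<in> ?P"
    then obtain f where f: "f \<in> carrier (free_alg E)" "a = uenv_class g E f" "\<And>w. f w \<noteq> 0 \<Longrightarrow> j \<le> length w"
      by (rule ideal_power_lengthE[OF E assms(2)]) blast
    show "restr_act g M a m \<in> V.span ?W"
      unfolding f(2) restr_act_class[OF E f(1)] by (rule act_in_span(1)[OF f(1,3)])
  qed
  moreover have "?W \<subseteq> {restr_act g M a m | a m. a \<in> ?P}"
  proof clarify
    fix w m assume w: "set w \<subseteq> E" "j = length w"
    have "foldr (lie_act g M) w m = restr_act g M (uenv_class g E (fa_word w)) m"
      unfolding restr_act_class[OF E fa_word_closed[OF w(1)]] act_word ..
    then show "\<exists>a m'. foldr (lie_act g M) w m = restr_act g M a m' \<and>
        a \<in> ideal_power (uenv g E) (jacobson_radical (uenv g E)) (length w)"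
      using ideal_power_word[OF g assms(1) w(1)] by blast
  qed
  ultimately show ?thesis unfolding Rad_def
    by (intro antisym V.span_minimal V.subspace_span V.span_mono) auto
qed

theorem (in umod) Soc_words:
  assumes "elementary g E" "CHAR('k) > 0"
  shows "Soc g M j E = {m. \<forall>w. set w \<subseteq> E \<and> length w = j \<longrightarrow> foldr (lie_act g M) w m = 0}"
proof -
  note E = elementary_closed(1)[OF g assms(1)]
  let ?P = "ideal_power (uenv g E) (jacobson_radical (uenv g E)) j"
  have "restr_act g M a m = 0"
    if z: "\<forall>w. set w \<subseteq> E \<and> length w = j \<longrightarrow> foldr (lie_act g M) w m = 0" and aP: "a \<in> ?P" for a m
  proof -
    obtain f where f: "f \<in> carrier (free_alg E)" "a = uenv_class g E f" "\<And>w. f w \<noteq> 0 \<Longrightarrow> j \<le> length w"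
      using aP by (rule ideal_power_lengthE[OF E assms(2)]) blast
    show ?thesis
      unfolding f(2) restr_act_class[OF E f(1)] by (rule act_in_span(2)[OF f(1,3)]) (use z in auto)
  qed
  moreover have "foldr (lie_act g M) w m = 0"
    if z: "\<forall>a\<in>?P. restr_act g M a m = 0" and w: "set w \<subseteq> E" "length w = j" for w m
  proof -
    have "restr_act g M (uenv_class g E (fa_word w)) m = 0"
      using z ideal_power_word[OF g assms(1) w(1)] w(2) by auto
    then show ?thesis unfolding restr_act_class[OF E fa_word_closed[OF w(1)]] act_word .
  qed
  ultimately show ?thesis unfolding Soc_def by blast
qed

section \<open>Charts of the Grassmannian\<close>

lemma nth_image_lessThan: "(!) X ` {..<length X} = set X"
  by (auto simp: set_conv_nth)

text \<open>An echelon condition: the matrix of the frame with respect to the functionals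
  \<open>\<phi>\<close> is the identity. It picks one representative from a
  \<open>GL_r\<close>-orbit.\<close>

definition normal_frame :: "nat \<Rightarrow> (nat \<Rightarrow> 'g \<Rightarrow> 'k::zero_neq_one) \<Rightarrow> 'g list \<Rightarrow> bool" where
  "normal_frame r \<phi> Y \<longleftrightarrow> length Y = r \<and> (\<forall>u<r. \<forall>s<r. \<phi> u (Y ! s) = (if u = s then 1 else 0))"

text \<open>The subspaces that are complementary to the common kernel of the functionals \<open>\<phi>\<close>, each with its
  basis dual to \<open>\<phi>\<close>.\<close>

definition chart_dom ::
    "('k::field, 'g::ab_group_add) lie_data \<Rightarrow> nat \<Rightarrow> (nat \<Rightarrow> 'g \<Rightarrow> 'k) \<Rightarrow> 'g set set" where
  "chart_dom g r \<phi> = {e. \<exists>Y. normal_frame r \<phi> Y \<and> lspan g Y = e}"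

definition chart_sec ::
    "('k::field, 'g::ab_group_add) lie_data \<Rightarrow> nat \<Rightarrow> (nat \<Rightarrow> 'g \<Rightarrow> 'k) \<Rightarrow> 'g set \<Rightarrow> 'g list" where
  "chart_sec g r \<phi> e = (SOME Y. normal_frame r \<phi> Y \<and> lspan g Y = e)"

lemma chart_sec:
  assumes "e \<in> chart_dom g r \<phi>"
  shows "normal_frame r \<phi> (chart_sec g r \<phi> e)" "lspan g (chart_sec g r \<phi> e) = e"
proof -
  obtain Y where "normal_frame r \<phi> Y \<and> lspan g Y = e" using assms unfolding chart_dom_def by blast
  then have "normal_frame r \<phi> (chart_sec g r \<phi> e) \<and> lspan g (chart_sec g r \<phi> e) = e"
    unfolding chart_sec_def by (rule someI)
  then show "normal_frame r \<phi> (chart_sec g r \<phi> e)" "lspan g (chart_sec g r \<phi> e) = e" by auto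
qed

lemma morph_smaller_subvariety:
  assumes "morph (subvariety S A) U Y f" "A' \<subseteq> A"
  shows "morph (subvariety S A') (U \<inter> A') Y f"
proof -
  note m = morphD[OF assms(1)]
  have o: "openin (zar (subvariety S A')) (V \<inter> A')" if V: "openin (zar (subvariety S A)) V" for V
  proof -
    obtain T where "openin (zar S) T" "V = T \<inter> A" using openin_subvarietyE[OF V] .
    then show ?thesis unfolding openin_zar_subvariety using assms(2) by (intro exI[of _ T]) auto
  qed
  show ?thesis unfolding morph_def
  proof (intro conjI allI impI ballI)
    show "openin (zar (subvariety S A')) (U \<inter> A')" by (rule o[OF m(1)])
    show "f ` (U \<inter> A') \<subseteq> topspace (zar Y)" using m(2) by auto
    fix V h assume V: "openin (zar Y) V"
    have e: "{x \<in> U \<inter> A'. f x \<in> V} = {x \<in> U. f x \<in> V} \<inter> A'" by auto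
    show "openin (zar (subvariety S A')) {x \<in> U \<inter> A'. f x \<in> V}" unfolding e by (rule o[OF m(3)[OF V]])
    assume h: "h \<in> reg Y V"
    show "(\<lambda>x. h (f x)) \<in> reg (subvariety S A') {x \<in> U \<inter> A'. f x \<in> V}"
      unfolding reg_subvariety
    proof
      fix x assume "x \<in> {x \<in> U \<inter> A'. f x \<in> V}"
      then have "x \<in> {x \<in> U. f x \<in> V}" by simp
      from reg_subvarietyE[OF m(4)[OF V h] this] obtain W k where
        "openin (zar S) W" "x \<in> W" "k \<in> reg S W" "\<forall>y\<in>W \<inter> {x \<in> U. f x \<in> V}. h (f y) = k y" .
      then show "\<exists>W k. openin (zar S) W \<and> x \<in> W \<and> k \<in> reg S W \<and> (\<forall>y\<in>W \<inter> {x \<in> U \<inter> A'. f x \<in> V}. h (f y) = k y)"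
        by (intro exI[of _ W] exI[of _ k]) auto
    qed
  qed
qed

lemma reg_smaller_subvariety:
  assumes "f \<in> reg (subvariety S A) U" "V \<subseteq> U"
  shows "f \<in> reg (subvariety S A') V"
  unfolding reg_subvariety
proof
  fix x assume "x \<in> V"
  then have "x \<in> U" using assms(2) by auto
  from reg_subvarietyE[OF assms(1) this] obtain W k where
    "openin (zar S) W" "x \<in> W" "k \<in> reg S W" "\<forall>y\<in>W \<inter> U. f y = k y" .
  then show "\<exists>W k. openin (zar S) W \<and> x \<in> W \<and> k \<in> reg S W \<and> (\<forall>y\<in>W \<inter> V. f y = k y)"
    using assms(2) by (intro exI[of _ W] exI[of _ k]) auto
qed

locale grass = G: finite_dimensional_vector_space "lscale g" B
  for g :: "('k::field, 'g::ab_group_add) lie_data" and B + fixes r :: nat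
begin

abbreviation Fr :: "('g list, 'k) fspace" where
  "Fr \<equiv> subvariety (affine_variety g r) (frames g r)"

lemma fsp_Fr: "fsp Fr" by (rule fsp_subvariety[OF fsp_affine])

lemma fsp_Grass: "fsp (Grass r g)" unfolding Grass_def by (rule fsp_quotient_variety[OF fsp_Fr])

lemma fsp_Evar: "fsp (Evar r g X)" unfolding Evar_def by (rule fsp_subvariety[OF fsp_Grass])

lemma fsp_torsor: "fsp (torsor_var r g X)" unfolding torsor_var_def by (rule fsp_subvariety[OF fsp_affine])

lemma frames_length [simp]: "{X. length X = r} \<inter> frames g r = frames g r"
  by (auto simp: frames_def)

lemma topspace_Grass: "topspace (zar (Grass r g)) = lspan g ` frames g r"
  unfolding Grass_def by simp

lemma frames_iff:
  "X \<in> frames g r \<longleftrightarrow> length X = r \<and> indep_fam (lscale g) r ((!) X)"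
proof
  assume X: "X \<in> frames g r"
  then have "bij_betw ((!) X) {..<r} (set X)" unfolding frames_def by (intro bij_betw_nth) auto
  then show "length X = r \<and> indep_fam (lscale g) r ((!) X)"
    using G.independent_indep_fam[of "set X" "(!) X" r] X unfolding frames_def by auto
next
  assume X: "length X = r \<and> indep_fam (lscale g) r ((!) X)"
  then have "inj_on ((!) X) {..<r}" using G.indep_fam_inj_on by blast
  then have "distinct X" using X by (auto simp: distinct_conv_nth inj_on_def)
  moreover have "(!) X ` {..<r} = set X" using X nth_image_lessThan[of X] by simp
  ultimately show "X \<in> frames g r" using X G.indep_fam_independent[of r "(!) X"] unfolding frames_def by auto
qed

lemma lspan_iff: "length X = r \<Longrightarrow> v \<in> lspan g X \<longleftrightarrow> (\<exists>c. v = (\<Sum>s<r. lscale g (c s) (X ! s)))"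
  using G.span_fam[of v "(!) X" r] nth_image_lessThan[of X] by simp

lemma nth_in_lspan: "length X = r \<Longrightarrow> s < r \<Longrightarrow> X ! s \<in> lspan g X"
  by (intro G.span_base nth_mem) simp

lemma dim_lspan: "X \<in> frames g r \<Longrightarrow> G.dim (lspan g X) = r"
  using G.dim_eq_card_independent[of "set X"] distinct_card[of X] unfolding frames_def by auto

lemma lspan_eqI:
  assumes "X \<in> frames g r" "Y \<in> frames g r" "set Y \<subseteq> lspan g X"
  shows "lspan g Y = lspan g X"
proof (rule G.subspace_dim_equal)
  show "lspan g Y \<subseteq> lspan g X" by (rule G.span_minimal[OF assms(3) G.subspace_span])
  show "G.dim (lspan g X) \<le> G.dim (lspan g Y)" using dim_lspan[OF assms(1)] dim_lspan[OF assms(2)] by simp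
qed (rule G.subspace_span)+

lemma normal_frame_frames:
  assumes "\<forall>u<r. Vector_Spaces.linear (lscale g) (*) (\<phi> u)" "normal_frame r \<phi> Y"
  shows "Y \<in> frames g r"
proof -
  have "c i = 0" if "(\<Sum>s<r. lscale g (c s) (Y ! s)) = 0" "i < r" for c i
  proof -
    have "\<phi> i 0 = 0"
      using assms(1)[rule_format, OF that(2)] unfolding Vector_Spaces.linear_iff by (metis G.scale_zero_left mult_zero_left)
    then have "0 = \<phi> i (\<Sum>s<r. lscale g (c s) (Y ! s))" using that by simp
    also have "\<dots> = (\<Sum>s<r. c s * \<phi> i (Y ! s))" by (rule linear_functional_fam[OF assms(1)[rule_format, OF that(2)]])
    also have "\<dots> = (\<Sum>s<r. if s = i then c s else 0)"
      using assms(2) that(2) unfolding normal_frame_def by (intro sum.cong) auto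
    finally show ?thesis using that(2) by simp
  qed
  then show ?thesis unfolding frames_iff indep_fam_def using assms(2) unfolding normal_frame_def by blast
qed

text \<open>On a normal frame \<open>\<phi> t\<close> isolates the \<open>t\<close>-th coefficient.
  So the same fixed functionals are coordinates on every subspace of the chart, and these
  coordinates depend on the point only through \<open>v\<close>.\<close>

lemma normal_coeff:
  assumes "\<forall>u<r. Vector_Spaces.linear (lscale g) (*) (\<phi> u)" "normal_frame r \<phi> Y" "v \<in> lspan g Y"
  shows "v = (\<Sum>t<r. lscale g (\<phi> t v) (Y ! t))"
proof -
  have l: "length Y = r" using assms(2) unfolding normal_frame_def by simp
  obtain c where c: "v = (\<Sum>s<r. lscale g (c s) (Y ! s))" using assms(3) lspan_iff[OF l] by blast
  have "\<phi> t v = c t" if "t < r" for t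
  proof -
    have "\<phi> t v = (\<Sum>s<r. c s * \<phi> t (Y ! s))" unfolding c by (rule linear_functional_fam[OF assms(1)[rule_format, OF that]])
    also have "\<dots> = (\<Sum>s<r. if s = t then c s else 0)"
      using assms(2) that unfolding normal_frame_def by (intro sum.cong) auto
    finally show ?thesis using that by simp
  qed
  then show ?thesis using c by (metis (no_types, lifting) lessThan_iff sum.cong)
qed

text \<open>Expanding the vectors of one frame in the other by \<open>normal_coeff\<close> gives the
  identity matrix. Hence the choice in \<open>chart_sec\<close> agrees with any normal frame
  computed explicitly.\<close>

lemma normal_frame_unique:
  assumes "\<forall>u<r. Vector_Spaces.linear (lscale g) (*) (\<phi> u)" "normal_frame r \<phi> Y" "normal_frame r \<phi> Y'"
    "lspan g Y = lspan g Y'"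
  shows "Y = Y'"
proof (rule nth_equalityI)
  have l: "length Y = r" "length Y' = r" using assms(2,3) unfolding normal_frame_def by auto
  then show "length Y = length Y'" by simp
  fix s assume "s < length Y"
  then have s: "s < r" using l by simp
  have "Y' ! s \<in> lspan g Y" unfolding assms(4) by (rule nth_in_lspan[OF l(2) s])
  from normal_coeff[OF assms(1,2) this]
  have "Y' ! s = (\<Sum>t<r. lscale g (\<phi> t (Y' ! s)) (Y ! t))" .
  also have "\<dots> = (\<Sum>t<r. if t = s then Y ! t else 0)"
    using assms(3) s unfolding normal_frame_def by (intro sum.cong) auto
  finally show "Y ! s = Y' ! s" using s by simp
qed

text \<open>The constant matrix \<open>D\<close> moves the frame \<open>X0\<close> to the normal frame of its span, so that the matrix
  to be inverted is the identity at \<open>X0\<close>.\<close>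

lemma chart_local:
  assumes \<phi>: "\<forall>u<r. Vector_Spaces.linear (lscale g) (*) (\<phi> u)"
    and X0: "X0 \<in> frames g r" "lspan g X0 \<in> chart_dom g r \<phi>"
  shows "\<exists>W c. openin (zar Fr) W \<and> X0 \<in> W \<and> (\<forall>t<r. \<forall>v<r. c t v \<in> reg Fr W) \<and>
    (\<forall>X\<in>W. lspan g X \<in> chart_dom g r \<phi>) \<and>
    (\<forall>X\<in>W. \<forall>v<r. chart_sec g r \<phi> (lspan g X) ! v = (\<Sum>t<r. lscale g (c t v X) (X ! t)))"
proof -
  interpret fsp Fr by (rule fsp_Fr)
  note \<phi>r = \<phi>[rule_format]
  let ?U = "frames g r" and ?Y0 = "chart_sec g r \<phi> (lspan g X0)"
  have U: "openin (zar Fr) ?U" using openin_topspace[of "zar Fr"] by simp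
  have l0: "length X0 = r" using X0(1) frames_iff by simp
  have lY0: "length ?Y0 = r" using chart_sec(1)[OF X0(2)] unfolding normal_frame_def by simp
  have "\<exists>D. ?Y0 ! s = (\<Sum>t<r. lscale g (D t) (X0 ! t))" if "s < r" for s
    using nth_in_lspan[OF lY0 that] unfolding chart_sec(2)[OF X0(2)] lspan_iff[OF l0] .
  then have "\<forall>s. \<exists>D. s < r \<longrightarrow> ?Y0 ! s = (\<Sum>t<r. lscale g (D t) (X0 ! t))" by blast
  from choice[OF this] obtain D where D: "\<And>s. s < r \<Longrightarrow> ?Y0 ! s = (\<Sum>t<r. lscale g (D s t) (X0 ! t))" by blast
  have coord: "(\<lambda>X. \<psi> (X ! t)) \<in> reg Fr ?U" if "Vector_Spaces.linear (lscale g) (*) \<psi>" "t < r" for \<psi> t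
  proof -
    have "(\<lambda>X. \<psi> (X ! t)) \<in> reg (affine_variety g r) (topspace (affine_topology g r))"
      by (rule polyfun_reg[OF openin_topspace polyfun_coord[OF that]])
    moreover have "openin (affine_topology g r) (topspace (affine_topology g r))" by (rule openin_topspace)
    ultimately show ?thesis unfolding reg_subvariety
      by (intro ballI exI[of _ "topspace (affine_topology g r)"] exI[of _ "\<lambda>X. \<psi> (X ! t)"]) (auto simp: frames_def)
  qed
  \<comment> \<open>The entry \<open>a u s X\<close> is \<open>\<phi> u\<close> of the
    \<open>s\<close>-th vector of the frame \<open>X\<close> moved by \<open>D\<close>; at
    \<open>X0\<close> that moved frame is already normal.\<close>
  define a where "a u s = (\<lambda>X. \<Sum>t<r. D s t * \<phi> u (X ! t))" for u s
  have a_eq: "a u s X = \<phi> u (\<Sum>t<r. lscale g (D s t) (X ! t))" if "u < r" for u s X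
    unfolding a_def by (rule linear_functional_fam[OF \<phi>r[OF that], symmetric])
  have "\<exists>W c. openin (zar Fr) W \<and> X0 \<in> W \<and> W \<subseteq> ?U \<and> (\<forall>i<r. \<forall>j<r. c i j \<in> reg Fr W) \<and>
    (\<forall>x\<in>W. \<forall>y z. (\<forall>i<r. (\<Sum>j<r. a i j x * y j) = z i) \<longleftrightarrow> (\<forall>i<r. y i = (\<Sum>j<r. c i j x * z j)))"
  proof (rule local_inverse[OF U X0(1)])
    fix u s assume us: "u < r" "s < r"
    show "a u s \<in> reg Fr ?U" unfolding a_def by (intro reg_sum reg_mult reg_const U coord \<phi>r) (use us in auto)
    show "a u s X0 = (if u = s then 1 else 0)"
      unfolding a_eq[OF us(1)] D[OF us(2), symmetric]
      using chart_sec(1)[OF X0(2)] us unfolding normal_frame_def by simp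
  qed
  then obtain W c where W: "openin (zar Fr) W" "X0 \<in> W" "W \<subseteq> ?U" "\<forall>i<r. \<forall>j<r. c i j \<in> reg Fr W"
    and c0: "\<forall>x\<in>W. \<forall>y z. (\<forall>i<r. (\<Sum>j<r. a i j x * y j) = z i) \<longleftrightarrow> (\<forall>i<r. y i = (\<Sum>j<r. c i j x * z j))"
    by (elim exE conjE) (rule that)
  \<comment> \<open>The product of \<open>D\<close> with the inverse matrix \<open>c\<close>: moving
    \<open>X\<close> by \<open>D\<close> and then by \<open>c\<close> makes its matrix under
    \<open>\<phi>\<close> the identity, so \<open>Y X\<close> is the normal frame of the span of
    \<open>X\<close>.\<close>
  define d where "d t v = (\<lambda>X. \<Sum>s<r. c s v X * D s t)" for t v
  define Y where "Y X = map (\<lambda>v. \<Sum>t<r. lscale g (d t v X) (X ! t)) [0..<r]" for X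
  have dreg: "d t v \<in> reg Fr W" if "t < r" "v < r" for t v
    unfolding d_def using W that by (intro reg_sum reg_mult reg_const) auto
  have main: "normal_frame r \<phi> (Y X) \<and> lspan g (Y X) = lspan g X" if X: "X \<in> W" for X
  proof -
    have XF: "X \<in> frames g r" using X W(3) by auto
    have "\<phi> u (Y X ! v) = (if u = v then 1 else 0)" if uv: "u < r" "v < r" for u v
    proof -
      have "(\<forall>i<r. c i v X = (\<Sum>j<r. c i j X * (if j = v then 1 else 0)))"
        using uv(2) by (simp add: if_distrib[of "\<lambda>z. _ * z"] cong: if_cong)
      then have "\<forall>i<r. (\<Sum>j<r. a i j X * c j v X) = (if i = v then 1 else 0)"
        using bspec[OF c0 X, THEN spec, THEN spec, of "\<lambda>i. c i v X" "\<lambda>i. if i = v then 1 else 0"] by blast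
      then have e: "(\<Sum>j<r. a u j X * c j v X) = (if u = v then 1 else 0)" using uv(1) by blast
      have "\<phi> u (Y X ! v) = (\<Sum>t<r. d t v X * \<phi> u (X ! t))"
        unfolding Y_def using uv by (simp add: linear_functional_fam[OF \<phi>r])
      also have "\<dots> = (\<Sum>t<r. \<Sum>s<r. c s v X * D s t * \<phi> u (X ! t))"
        unfolding d_def by (simp add: sum_distrib_right)
      also have "\<dots> = (\<Sum>s<r. \<Sum>t<r. c s v X * D s t * \<phi> u (X ! t))" by (rule sum.swap)
      also have "\<dots> = (\<Sum>j<r. a u j X * c j v X)"
        unfolding a_def by (simp add: sum_distrib_left sum_distrib_right mult_ac)
      finally show ?thesis using e by simp
    qed
    then have n: "normal_frame r \<phi> (Y X)" unfolding normal_frame_def Y_def by simp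
    have "set (Y X) \<subseteq> lspan g X"
      unfolding Y_def using frames_iff[of X] XF by (auto intro!: G.span_sum G.span_scale intro: G.span_base nth_mem)
    then show ?thesis using lspan_eqI[OF XF normal_frame_frames[OF \<phi> n]] n by blast
  qed
  have dom: "lspan g X \<in> chart_dom g r \<phi>" if "X \<in> W" for X
    unfolding chart_dom_def using main[OF that] by blast
  have sec: "chart_sec g r \<phi> (lspan g X) = Y X" if "X \<in> W" for X
    by (rule normal_frame_unique[OF \<phi> chart_sec(1)[OF dom[OF that]]])
      (use main[OF that] chart_sec(2)[OF dom[OF that]] in auto)
  have sec': "chart_sec g r \<phi> (lspan g X) ! v = (\<Sum>t<r. lscale g (d t v X) (X ! t))" if "X \<in> W" "v < r" for X v
    unfolding sec[OF that(1)] Y_def using that(2) by simp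
  show ?thesis by (rule exI[of _ W], rule exI[of _ d]) (use W dreg dom sec' in auto)
qed

text \<open>By the universal property of the quotient, the section is studied as a function of a
  frame. There \<open>chart_local\<close> shows both that the domain is open and that the normal
  frame has regular coefficients.\<close>

lemma chart_morph_affine:
  assumes \<phi>: "\<forall>u<r. Vector_Spaces.linear (lscale g) (*) (\<phi> u)"
  shows "morph (Grass r g) (chart_dom g r \<phi>) (affine_variety g r) (chart_sec g r \<phi>)"
proof -
  interpret fsp Fr by (rule fsp_Fr)
  let ?P = "{X \<in> topspace (zar Fr). lspan g X \<in> chart_dom g r \<phi>}"
  have P: "openin (zar Fr) ?P"
  proof (subst openin_subopen, rule ballI)
    fix X assume "X \<in> ?P"
    then have X: "X \<in> frames g r" "lspan g X \<in> chart_dom g r \<phi>" by auto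
    from chart_local[OF \<phi> X] obtain W c where W0: "openin (zar Fr) W" "X \<in> W" "\<forall>t<r. \<forall>v<r. c t v \<in> reg Fr W"
        "\<forall>X\<in>W. lspan g X \<in> chart_dom g r \<phi>"
        "\<forall>X\<in>W. \<forall>v<r. chart_sec g r \<phi> (lspan g X) ! v = (\<Sum>t<r. lscale g (c t v X) (X ! t))"
      by (elim exE conjE) (rule that)
    have W: "openin (zar Fr) W" "X \<in> W" "\<And>t v. t < r \<Longrightarrow> v < r \<Longrightarrow> c t v \<in> reg Fr W"
        "\<And>X. X \<in> W \<Longrightarrow> lspan g X \<in> chart_dom g r \<phi>"
        "\<And>X v. X \<in> W \<Longrightarrow> v < r \<Longrightarrow> chart_sec g r \<phi> (lspan g X) ! v = (\<Sum>t<r. lscale g (c t v X) (X ! t))"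
      using W0 by auto
    have "W \<subseteq> topspace (zar Fr)" using W(1) by (rule openin_subset)
    then show "\<exists>T. openin (zar Fr) T \<and> X \<in> T \<and> T \<subseteq> ?P" using W by (intro exI[of _ W]) auto
  qed
  have "morph Fr ?P (affine_variety g r) (\<lambda>X. chart_sec g r \<phi> (lspan g X))"
  proof (rule morph_into_affine[OF fsp_Fr P])
    fix X assume "X \<in> ?P"
    then show "length (chart_sec g r \<phi> (lspan g X)) = r"
      using chart_sec(1)[of "lspan g X" g r \<phi>] unfolding normal_frame_def by auto
  next
    fix \<psi> s assume \<psi>: "Vector_Spaces.linear (lscale g) (*) \<psi>" and s: "s < r"
    show "(\<lambda>X. \<psi> (chart_sec g r \<phi> (lspan g X) ! s)) \<in> reg Fr ?P"
    proof (rule reg_local[OF P])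
      fix X assume "X \<in> ?P"
      then have X: "X \<in> frames g r" "lspan g X \<in> chart_dom g r \<phi>" by auto
      from chart_local[OF \<phi> X] obtain W c where W0: "openin (zar Fr) W" "X \<in> W" "\<forall>t<r. \<forall>v<r. c t v \<in> reg Fr W"
          "\<forall>X\<in>W. lspan g X \<in> chart_dom g r \<phi>"
          "\<forall>X\<in>W. \<forall>v<r. chart_sec g r \<phi> (lspan g X) ! v = (\<Sum>t<r. lscale g (c t v X) (X ! t))"
        by (elim exE conjE) (rule that)
      have W: "openin (zar Fr) W" "X \<in> W" "\<And>t v. t < r \<Longrightarrow> v < r \<Longrightarrow> c t v \<in> reg Fr W"
          "\<And>X. X \<in> W \<Longrightarrow> lspan g X \<in> chart_dom g r \<phi>"
          "\<And>X v. X \<in> W \<Longrightarrow> v < r \<Longrightarrow> chart_sec g r \<phi> (lspan g X) ! v = (\<Sum>t<r. lscale g (c t v X) (X ! t))"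
        using W0 by auto
      have WF: "W \<subseteq> frames g r" using openin_subset[OF W(1)] by simp
      have coord: "(\<lambda>X. \<psi> (X ! t)) \<in> reg Fr W" if "t < r" for t
      proof -
        have o: "openin (affine_topology g r) (topspace (affine_topology g r))" by (rule openin_topspace)
        have "(\<lambda>X. \<psi> (X ! t)) \<in> reg (affine_variety g r) (topspace (affine_topology g r))"
          by (rule polyfun_reg[OF openin_topspace polyfun_coord[OF \<psi> that]])
        with o show ?thesis unfolding reg_subvariety using WF
          by (intro ballI exI[of _ "topspace (affine_topology g r)"] exI[of _ "\<lambda>X. \<psi> (X ! t)"]) (auto simp: frames_def)
      qed
      have "(\<lambda>X. \<Sum>t<r. c t s X * \<psi> (X ! t)) \<in> reg Fr W"
        by (intro reg_sum reg_mult W coord) (use s in auto)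
      moreover have "\<psi> (chart_sec g r \<phi> (lspan g X) ! s) = (\<Sum>t<r. c t s X * \<psi> (X ! t))" if "X \<in> W" for X
        unfolding W(5)[OF that s] by (rule linear_functional_fam[OF \<psi>])
      ultimately show "\<exists>V h. openin (zar Fr) V \<and> X \<in> V \<and> V \<subseteq> ?P \<and> h \<in> reg Fr V \<and>
          (\<forall>X\<in>V. \<psi> (chart_sec g r \<phi> (lspan g X) ! s) = h X)"
        using W(1,2,4) WF by (intro exI[of _ W] exI[of _ "\<lambda>X. \<Sum>t<r. c t s X * \<psi> (X ! t)"]) auto
    qed
  qed
  then show ?thesis unfolding Grass_def
  proof (rule morph_from_quotient[rotated])
    show "chart_dom g r \<phi> \<subseteq> lspan g ` topspace (zar Fr)"
      unfolding chart_dom_def using normal_frame_frames[OF \<phi>] by auto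
  qed
qed

section \<open>Commuting frames as a torsor with local sections over the elementary
  subalgebras\<close>

lemma Elem_frame:
  assumes "e \<in> Elem r g"
  obtains X where "X \<in> comm_frames g r" "lspan g X = e"
proof -
  have e: "G.subspace e" "\<forall>x\<in>e. \<forall>y\<in>e. bracket g x y = 0" "\<forall>x\<in>e. pmap g x = 0" "G.dim e = r"
    using assms unfolding Elem_def elementary_def by auto
  obtain A where A: "A \<subseteq> e" "G.independent A" "e \<subseteq> G.span A" "card A = G.dim e" using G.basis_exists by blast
  obtain X where X: "set X = A" "distinct X" using finite_distinct_list[OF G.finiteI_independent[OF A(2)]] by blast
  have "length X = r" using distinct_card[OF X(2)] X(1) A(4) e(4) by simp
  then have "X \<in> comm_frames g r" unfolding comm_frames_def frames_def using X A(1,2) e by auto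
  moreover have "lspan g X = e" using A(1,3) X(1) G.span_minimal[OF A(1) e(1)] by auto
  ultimately show thesis by (rule that)
qed

lemma comm_framesI:
  assumes "Y \<in> frames g r" "lspan g Y \<in> Elem r g"
  shows "Y \<in> comm_frames g r"
proof -
  have "set Y \<subseteq> lspan g Y" by (rule G.span_superset)
  then show ?thesis using assms unfolding comm_frames_def Elem_def elementary_def by blast
qed

lemma Elem_sub_Grass: "Elem r g \<subseteq> topspace (zar (Grass r g))"
proof
  fix e assume "e \<in> Elem r g"
  then obtain X where "X \<in> comm_frames g r" "lspan g X = e" by (rule Elem_frame)
  then show "e \<in> topspace (zar (Grass r g))" unfolding topspace_Grass comm_frames_def by auto
qed

lemma topspace_Evar: "X \<subseteq> Elem r g \<Longrightarrow> topspace (zar (Evar r g X)) = X"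
  unfolding Evar_def using Elem_sub_Grass by auto

lemma topspace_torsor: "topspace (zar (torsor_var r g X)) = {Y \<in> comm_frames g r. lspan g Y \<in> X}"
  unfolding torsor_var_def by (auto simp: comm_frames_def frames_def)

lemma lspan_morph:
  assumes "X \<subseteq> Elem r g"
  shows "morph (torsor_var r g X) (topspace (zar (torsor_var r g X))) (Evar r g X) (lspan g)"
proof -
  have m: "morph Fr (frames g r) (Grass r g) (lspan g)"
    unfolding morph_def
  proof (intro conjI allI impI ballI)
    show "openin (zar Fr) (frames g r)" using openin_topspace[of "zar Fr"] by simp
    show "lspan g ` frames g r \<subseteq> topspace (zar (Grass r g))" unfolding topspace_Grass ..
    fix V h assume "openin (zar (Grass r g)) V"
    then show "openin (zar Fr) {x \<in> frames g r. lspan g x \<in> V}"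
      unfolding Grass_def by (drule_tac openin_quot) simp
    assume "h \<in> reg (Grass r g) V"
    then show "(\<lambda>x. h (lspan g x)) \<in> reg Fr {x \<in> frames g r. lspan g x \<in> V}"
      unfolding Grass_def reg_quotient by simp
  qed
  let ?A = "{Y \<in> comm_frames g r. lspan g Y \<in> X}"
  have "?A \<subseteq> frames g r" unfolding comm_frames_def by auto
  from morph_smaller_subvariety[OF m this] have "morph (torsor_var r g X) (frames g r \<inter> ?A) (Grass r g) (lspan g)"
    unfolding torsor_var_def .
  moreover have "frames g r \<inter> ?A = topspace (zar (torsor_var r g X))"
    unfolding topspace_torsor comm_frames_def by auto
  ultimately have "morph (torsor_var r g X) (topspace (zar (torsor_var r g X))) (Grass r g) (lspan g)" by simp
  then show ?thesis unfolding Evar_def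
    by (rule morph_into_subvariety[OF fsp_torsor]) (auto simp: topspace_torsor)
qed

text \<open>The interface of a chart towards the sheaves. The last clause says that near any frame
  \<open>Y\<close> the normal frame of its span arises from \<open>Y\<close> by a matrix regular in
  \<open>Y\<close>; the opposite passage, from the normal frame to \<open>Y\<close>, has the matrix
  \<open>\<phi> t (Y ! s)\<close>.\<close>

definition is_chart ::
    "'g set set \<Rightarrow> 'g set set \<Rightarrow> (nat \<Rightarrow> 'g \<Rightarrow> 'k) \<Rightarrow> ('g set \<Rightarrow> 'g list) \<Rightarrow> bool" where
  "is_chart X U \<phi> \<sigma> \<longleftrightarrow> openin (zar (Evar r g X)) U \<and> U \<subseteq> X \<and> morph (Evar r g X) U (torsor_var r g X) \<sigma> \<and>
     (\<forall>e\<in>U. lspan g (\<sigma> e) = e) \<and> (\<forall>u<r. Vector_Spaces.linear (lscale g) (*) (\<phi> u)) \<and>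
     (\<forall>e\<in>U. normal_frame r \<phi> (\<sigma> e)) \<and>
     (\<forall>Y0\<in>comm_frames g r. lspan g Y0 \<in> U \<longrightarrow> (\<exists>W c. openin (zar (torsor_var r g X)) W \<and> Y0 \<in> W \<and>
       (\<forall>Y\<in>W. lspan g Y \<in> U) \<and> (\<forall>t<r. \<forall>v<r. c t v \<in> reg (torsor_var r g X) W) \<and>
       (\<forall>Y\<in>W. \<forall>v<r. \<sigma> (lspan g Y) ! v = (\<Sum>t<r. lscale g (c t v Y) (Y ! t)))))"

text \<open>Functionals dual to some frame of \<open>e\<close> make that frame normal, which puts
  \<open>e\<close> into the chart domain. Over \<open>X\<close> the normal frame of an elementary
  subalgebra is automatically a commuting one.\<close>

lemma chart:
  assumes X: "X \<subseteq> Elem r g" and e: "e \<in> X"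
  shows "\<exists>U \<phi> \<sigma>. e \<in> U \<and> is_chart X U \<phi> \<sigma>"
proof -
  let ?T = "torsor_var r g X" and ?S = "Evar r g X"
  obtain X0 where X0: "X0 \<in> comm_frames g r" "lspan g X0 = e" using Elem_frame[of e] X e by blast
  have X0f: "length X0 = r" "indep_fam (lscale g) r ((!) X0)" using X0(1) frames_iff unfolding comm_frames_def by auto
  obtain \<phi> where \<phi>': "\<forall>b<r. Vector_Spaces.linear (lscale g) (*) (\<phi> b) \<and> (\<forall>a<r. \<phi> b (X0 ! a) = (if a = b then 1 else 0))"
    using G.dual_functionals[OF X0f(2)] by blast
  then have \<phi>: "\<forall>u<r. Vector_Spaces.linear (lscale g) (*) (\<phi> u)" by blast
  let ?D = "chart_dom g r \<phi>" and ?\<sigma> = "chart_sec g r \<phi>"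
  have "normal_frame r \<phi> X0" unfolding normal_frame_def using X0f(1) \<phi>' by auto
  then have eD: "e \<in> ?D" unfolding chart_dom_def using X0(2) by blast
  have m: "morph ?S (?D \<inter> X) (affine_variety g r) ?\<sigma>"
    unfolding Evar_def by (rule morph_from_subvariety[OF fsp_Grass chart_morph_affine[OF \<phi>]])
  have "?\<sigma> ` (?D \<inter> X) \<subseteq> {Y \<in> comm_frames g r. lspan g Y \<in> X}"
  proof
    fix Y assume "Y \<in> ?\<sigma> ` (?D \<inter> X)"
    then obtain e' where e': "Y = ?\<sigma> e'" "e' \<in> ?D" "e' \<in> X" by blast
    have "Y \<in> frames g r" unfolding e'(1) by (rule normal_frame_frames[OF \<phi> chart_sec(1)[OF e'(2)]])
    moreover have "lspan g Y = e'" unfolding e'(1) by (rule chart_sec(2)[OF e'(2)])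
    ultimately show "Y \<in> {Y \<in> comm_frames g r. lspan g Y \<in> X}" using comm_framesI e'(3) X by auto
  qed
  then have mT: "morph ?S (?D \<inter> X) ?T ?\<sigma>"
    unfolding torsor_var_def by (rule morph_into_subvariety[OF fsp_Evar m])
  have "is_chart X (?D \<inter> X) \<phi> ?\<sigma>"
    unfolding is_chart_def
  proof (intro conjI ballI impI)
    show "openin (zar ?S) (?D \<inter> X)" by (rule morphD(1)[OF m])
    show "?D \<inter> X \<subseteq> X" by auto
    show "morph ?S (?D \<inter> X) ?T ?\<sigma>" by (rule mT)
    show "lspan g (?\<sigma> e) = e" "normal_frame r \<phi> (?\<sigma> e)" if "e \<in> ?D \<inter> X" for e
      using chart_sec[of e g r \<phi>] that by auto
    show "\<forall>u<r. Vector_Spaces.linear (lscale g) (*) (\<phi> u)" by (rule \<phi>)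
    fix Y0 assume Y0: "Y0 \<in> comm_frames g r" "lspan g Y0 \<in> ?D \<inter> X"
    then have Y0': "Y0 \<in> frames g r" "lspan g Y0 \<in> ?D" unfolding comm_frames_def by auto
    from chart_local[OF \<phi> Y0'] obtain W c where W0: "openin (zar Fr) W" "Y0 \<in> W" "\<forall>t<r. \<forall>v<r. c t v \<in> reg Fr W"
        "\<forall>X\<in>W. lspan g X \<in> chart_dom g r \<phi>"
        "\<forall>X\<in>W. \<forall>v<r. chart_sec g r \<phi> (lspan g X) ! v = (\<Sum>t<r. lscale g (c t v X) (X ! t))"
      by (elim exE conjE) (rule that)
    have W: "openin (zar Fr) W" "Y0 \<in> W" "\<And>t v. t < r \<Longrightarrow> v < r \<Longrightarrow> c t v \<in> reg Fr W"
        "\<And>X. X \<in> W \<Longrightarrow> lspan g X \<in> chart_dom g r \<phi>"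
        "\<And>X v. X \<in> W \<Longrightarrow> v < r \<Longrightarrow> chart_sec g r \<phi> (lspan g X) ! v = (\<Sum>t<r. lscale g (c t v X) (X ! t))"
      using W0 by auto
    let ?W = "W \<inter> topspace (zar ?T)"
    have "openin (zar ?T) ?W"
    proof -
      obtain A where A: "openin (zar (affine_variety g r)) A" "W = A \<inter> frames g r" using openin_subvarietyE[OF W(1)] .
      have "?W = A \<inter> {Y \<in> comm_frames g r. lspan g Y \<in> X}"
        unfolding topspace_torsor A(2) comm_frames_def by auto
      then show ?thesis unfolding torsor_var_def openin_zar_subvariety using A(1) unfolding torsor_var_def by blast
    qed
    moreover have "c t v \<in> reg ?T ?W" if "t < r" "v < r" for t v
      unfolding torsor_var_def by (rule reg_smaller_subvariety[OF W(3)[OF that]]) auto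
    moreover have "Y0 \<in> ?W" using W(2) Y0 by (simp add: topspace_torsor)
    moreover have "\<forall>Y\<in>?W. lspan g Y \<in> ?D \<inter> X" using W(4) by (auto simp: topspace_torsor)
    ultimately show "\<exists>W c. openin (zar ?T) W \<and> Y0 \<in> W \<and> (\<forall>Y\<in>W. lspan g Y \<in> ?D \<inter> X) \<and>
       (\<forall>t<r. \<forall>v<r. c t v \<in> reg ?T W) \<and>
       (\<forall>Y\<in>W. \<forall>v<r. ?\<sigma> (lspan g Y) ! v = (\<Sum>t<r. lscale g (c t v Y) (Y ! t)))"
      using W(5) by (intro exI[of _ ?W] exI[of _ c]) auto
  qed
  moreover have "e \<in> ?D \<inter> X" using eD e by simp
  ultimately show ?thesis by blast
qed

end

section \<open>The operators of a frame\<close>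

definition index_words :: "nat \<Rightarrow> nat \<Rightarrow> nat list set" where
  "index_words r n = {w. set w \<subseteq> {..<r} \<and> length w = n}"

lemma finite_index_words: "finite (index_words r n)"
  unfolding index_words_def by (rule finite_lists_length_eq) simp

lemma finite_exponents: "finite (exponents r j)"
proof (rule finite_subset)
  show "exponents r j \<subseteq> {js. set js \<subseteq> {..j} \<and> length js = r}"
    unfolding exponents_def by (auto dest: member_le_sum_list)
qed (rule finite_lists_length_eq, simp)

text \<open>The sorted word in which the index \<open>s\<close> occurs \<open>js ! s\<close> times,
  in the order in which \<open>Theta_pow\<close> composes its factors. Up to reordering,
  \<open>word_exponent\<close> is the inverse.\<close>

definition exponent_word :: "nat list \<Rightarrow> nat list" where
  "exponent_word js = concat (map (\<lambda>s. replicate (js ! s) s) [0..<length js])"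

definition word_exponent :: "nat \<Rightarrow> nat list \<Rightarrow> nat list" where
  "word_exponent r w = map (\<lambda>s. count (mset w) s) [0..<r]"

lemma exponent_word_index_words:
  assumes "js \<in> exponents r j"
  shows "exponent_word js \<in> index_words r j"
proof -
  have "map ((!) js) [0..<length js] = js" by (rule map_nth)
  then have "length (exponent_word js) = sum_list js"
    unfolding exponent_word_def length_concat by (simp add: comp_def)
  then show ?thesis using assms unfolding exponents_def index_words_def exponent_word_def by auto
qed

lemma mset_exponent_word:
  assumes "set w \<subseteq> {..<r}"
  shows "mset (exponent_word (word_exponent r w)) = mset w"
proof (rule multiset_eqI)
  fix x
  have "count (mset (concat (map (\<lambda>s. replicate (c s) s) [0..<n]))) x = (if x < n then c x else 0)"
    for c :: "nat \<Rightarrow> nat" and n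
    by (induction n) auto
  moreover have "exponent_word (word_exponent r w) = concat (map (\<lambda>s. replicate (count (mset w) s) s) [0..<r])"
    unfolding exponent_word_def word_exponent_def by (auto intro!: arg_cong[of _ _ concat])
  moreover have "count (mset w) x = 0" if "\<not> x < r" using assms that by (auto simp: count_eq_zero_iff)
  ultimately show "count (mset (exponent_word (word_exponent r w))) x = count (mset w) x" by auto
qed

lemma word_exponent_exponents:
  assumes "w \<in> index_words r j"
  shows "word_exponent r w \<in> exponents r j"
proof -
  have w: "set w \<subseteq> {..<r}" "length w = j" using assms unfolding index_words_def by auto
  let ?e = "word_exponent r w"
  have "map ((!) ?e) [0..<length ?e] = ?e" by (rule map_nth)
  then have "length (exponent_word ?e) = sum_list ?e"
    unfolding exponent_word_def length_concat by (simp add: comp_def)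
  moreover have "length (exponent_word ?e) = length w" using mset_exponent_word[OF w(1)] by (rule mset_eq_length)
  ultimately show ?thesis using w(2) unfolding exponents_def word_exponent_def by simp
qed

locale descent = umod g M + grass g B r + VF: finite_dimensional_vector_space "mscale M" C
  for g :: "('k::field, 'g::ab_group_add) lie_data" and M :: "('k, 'g, 'm::ab_group_add) mod_data"
    and B r C + fixes j :: nat
begin

abbreviation scl :: "'k \<Rightarrow> 'm \<Rightarrow> 'm" where "scl \<equiv> mscale M"

definition wact :: "'g list \<Rightarrow> nat list \<Rightarrow> 'm \<Rightarrow> 'm" where
  "wact Y w = foldr (lie_act g M) (map ((!) Y) w)"

definition op :: "nat list \<Rightarrow> 'g list \<Rightarrow> 'm \<Rightarrow> 'm" where
  "op js Y = wact Y (exponent_word js)"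

lemma wact_simps: "wact Y [] m = m" "wact Y (s # w) m = lie_act g M (Y ! s) (wact Y w m)"
  by (simp_all add: wact_def)

lemma wact_linear: "Vector_Spaces.linear scl scl (wact Y w)"
  unfolding wact_def by (rule foldr_lie_act_linear)

lemma op_linear: "Vector_Spaces.linear scl scl (op js Y)"
  unfolding op_def by (rule wact_linear)

lemma linear_sum_scale:
  assumes "Vector_Spaces.linear scl scl T"
  shows "T (\<Sum>i\<in>I. scl (c i) (m i)) = (\<Sum>i\<in>I. scl (c i) (T (m i)))"
proof -
  have a: "T (x + y) = T x + T y" "T (scl c x) = scl c (T x)" for x y c
    using assms unfolding Vector_Spaces.linear_iff by auto
  have "T 0 = 0" using a(2)[of 0 0] by simp
  then show ?thesis by (induction I rule: infinite_finite_induct) (auto simp: a)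
qed

text \<open>Summing the coordinate functions against the basis reassembles the vector
  \<open>Y ! s\<close>. So at the point \<open>Y\<close> the operator is just the action of the
  \<open>s\<close>-th vector of the frame, whatever the basis.\<close>

lemma Theta_eq: "Theta g B M s t Y = lie_act g M (Y ! s) (t Y)"
proof -
  have "(\<Sum>b\<in>B. lscale g (G.representation B (Y ! s) b) b) = Y ! s"
    by (rule G.sum_representation_eq) (auto simp: G.independent_Basis G.span_Basis G.finite_Basis)
  then show ?thesis
    unfolding Theta_def Ycoord_def using lie_act_sum[of "G.representation B (Y ! s)" "\<lambda>b. b" B "t Y"] by simp
qed

lemma Theta_funpow: "(Theta g B M s ^^ n) t Y = wact Y (replicate n s) (t Y)"
  by (induction n) (simp_all add: Theta_eq wact_simps)

lemma wact_append: "wact Y (u @ v) m = wact Y u (wact Y v m)"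
  by (simp add: wact_def)

lemma Theta_pow_eq: "Theta_pow g B M js t Y = op js Y (t Y)"
proof -
  have "foldr (\<circ>) (map (\<lambda>s. Theta g B M s ^^ (js ! s)) l) id t Y =
      wact Y (concat (map (\<lambda>s. replicate (js ! s) s) l)) (t Y)" for l
    by (induction l) (simp_all add: wact_simps wact_append Theta_funpow)
  then show ?thesis unfolding Theta_pow_def op_def exponent_word_def .
qed

text \<open>The vectors of a commuting frame act by commuting operators, so only the multiset of the
  indices in \<open>w\<close> matters.\<close>

lemma wact_word_exponent:
  assumes "Y \<in> comm_frames g r" "set w \<subseteq> {..<r}"
  shows "wact Y w = op (word_exponent r w) Y"
proof -
  let ?f = "\<lambda>s. lie_act g M (Y ! s)"
  have c: "?f s \<circ> ?f t = ?f t \<circ> ?f s" if "s < r" "t < r" for s t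
  proof -
    have "length Y = r" using assms(1) frames_iff unfolding comm_frames_def by auto
    then have "bracket g (Y ! s) (Y ! t) = 0" using assms(1) that unfolding comm_frames_def by auto
    then show ?thesis using lie_act_commute by (auto simp: fun_eq_iff)
  qed
  have fr: "wact Y u = fold ?f (rev u)" for u
    by (simp add: wact_def foldr_conv_fold rev_map fold_map comp_def)
  have "fold ?f (rev w) = fold ?f (rev (exponent_word (word_exponent r w)))"
    by (rule fold_multiset_equiv) (use c assms(2) mset_exponent_word[OF assms(2)] in auto)
  then show ?thesis unfolding op_def fr .
qed

text \<open>Each letter is expanded in the frame and the action is linear in every letter.\<close>

lemma word_in_span_wact:
  assumes "length Y = r" "set w \<subseteq> lspan g Y"
  shows "foldr (lie_act g M) w m \<in> V.span ((\<lambda>u. wact Y u m) ` index_words r (length w))"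
  using assms(2)
proof (induction w)
  case Nil
  have "wact Y [] m \<in> (\<lambda>u. wact Y u m) ` index_words r 0" by (rule imageI) (simp add: index_words_def)
  then show ?case by (auto simp: wact_simps intro: V.span_base)
next
  case (Cons x w)
  obtain c where c: "x = (\<Sum>s<r. lscale g (c s) (Y ! s))" using lspan_iff[OF assms(1)] Cons.prems by auto
  let ?S = "V.span ((\<lambda>u. wact Y u m) ` index_words r (length (x # w)))"
  have lin: "lie_act g M x (a + b) = lie_act g M x a + lie_act g M x b" for a b by (rule lie_act_add_right)
  have "foldr (lie_act g M) w m \<in> V.span ((\<lambda>u. wact Y u m) ` index_words r (length w))"
    using Cons by simp
  then have "lie_act g M x (foldr (lie_act g M) w m) \<in> ?S"
  proof (induction rule: V.span_induct_alt)
    case base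
    have "lie_act g M x 0 = 0" using lie_act_scale_right[of x 0 0] by simp
    then show ?case by (simp add: V.span_zero)
  next
    case (step a n n')
    then obtain u where u: "n = wact Y u m" "u \<in> index_words r (length w)" by auto
    have "lie_act g M x n = (\<Sum>s<r. scl (c s) (wact Y (s # u) m))"
      unfolding c lie_act_sum u(1) wact_simps ..
    also have "\<dots> \<in> ?S"
    proof (intro V.span_sum V.span_scale V.span_base imageI)
      fix s assume "s \<in> {..<r}"
      then show "s # u \<in> index_words r (length (x # w))" using u(2) by (simp add: index_words_def)
    qed
    finally show ?case unfolding lin lie_act_scale_right using step by (intro V.span_add V.span_scale)
  qed
  then show ?case by simp
qed

lemma op_word:
  assumes "length Y = r" "js \<in> exponents r j"
  shows "\<exists>w. set w \<subseteq> lspan g Y \<and> length w = j \<and> op js Y = foldr (lie_act g M) w"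
proof (intro exI conjI)
  have w: "exponent_word js \<in> index_words r j" by (rule exponent_word_index_words[OF assms(2)])
  show "set (map ((!) Y) (exponent_word js)) \<subseteq> lspan g Y"
    using w nth_in_lspan[OF assms(1)] unfolding index_words_def by auto
  show "length (map ((!) Y) (exponent_word js)) = j" using w unfolding index_words_def by simp
  show "op js Y = foldr (lie_act g M) (map ((!) Y) (exponent_word js))" unfolding op_def wact_def ..
qed

text \<open>Words of length \<open>j\<close> over the subalgebra expand multilinearly into words in
  the frame, and commutativity sorts these into the monomials \<open>op js Y\<close>; conversely
  each monomial is the action of such a word. In particular the span does not depend on the
  frame.\<close>

lemma Rad_frame:
  assumes "elementary g (lspan g Y)" "CHAR('k) > 0" "Y \<in> comm_frames g r"
  shows "Rad g M j (lspan g Y) = V.span {op js Y m | js m. js \<in> exponents r j}"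
proof -
  have l: "length Y = r" using assms(3) frames_iff unfolding comm_frames_def by auto
  let ?W = "{foldr (lie_act g M) w m | w m. set w \<subseteq> lspan g Y \<and> length w = j}"
  let ?O = "{op js Y m | js m. js \<in> exponents r j}"
  have "?W \<subseteq> V.span ?O"
  proof
    fix n assume "n \<in> ?W"
    then obtain w m where w: "n = foldr (lie_act g M) w m" "set w \<subseteq> lspan g Y" "length w = j" by blast
    have "(\<lambda>u. wact Y u m) ` index_words r (length w) \<subseteq> ?O"
    proof
      fix v assume "v \<in> (\<lambda>u. wact Y u m) ` index_words r (length w)"
      then obtain u where u: "v = wact Y u m" "u \<in> index_words r j" using w(3) by auto
      have "v = op (word_exponent r u) Y m"
        using wact_word_exponent[OF assms(3), of u] u unfolding index_words_def by simp
      then show "v \<in> ?O" using word_exponent_exponents[OF u(2)] by blast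
    qed
    from V.span_mono[OF this] show "n \<in> V.span ?O"
      unfolding w(1) using word_in_span_wact[OF l w(2), of m] by blast
  qed
  moreover have "?O \<subseteq> ?W" using op_word[OF l] by fastforce
  ultimately show ?thesis unfolding Rad_words[OF assms(1,2)]
    by (intro antisym V.span_minimal V.subspace_span V.span_mono) auto
qed

lemma Soc_frame:
  assumes "elementary g (lspan g Y)" "CHAR('k) > 0" "Y \<in> comm_frames g r"
  shows "Soc g M j (lspan g Y) = {m. \<forall>js\<in>exponents r j. op js Y m = 0}"
proof -
  have l: "length Y = r" using assms(3) frames_iff unfolding comm_frames_def by auto
  have "foldr (lie_act g M) w m = 0"
    if z: "\<forall>js\<in>exponents r j. op js Y m = 0" and w: "set w \<subseteq> lspan g Y" "length w = j" for w m
  proof -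
    have "(\<lambda>u. wact Y u m) ` index_words r (length w) \<subseteq> {0}"
    proof clarify
      fix u assume u: "u \<in> index_words r (length w)"
      have "wact Y u m = op (word_exponent r u) Y m"
        using wact_word_exponent[OF assms(3), of u] u unfolding index_words_def by simp
      then show "wact Y u m = 0" using word_exponent_exponents[OF u] z w(2) by simp
    qed
    from V.span_mono[OF this] show ?thesis using word_in_span_wact[OF l w(1), of m] by auto
  qed
  moreover have "op js Y m = 0"
    if z: "\<forall>w. set w \<subseteq> lspan g Y \<and> length w = j \<longrightarrow> foldr (lie_act g M) w m = 0" and js: "js \<in> exponents r j" for js m
    using op_word[OF l js] z by auto
  ultimately show ?thesis unfolding Soc_words[OF assms(1,2)] by blast
qed

text \<open>Substituting the frame \<open>Q\<close> into a monomial in \<open>P\<close> letter by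
  letter multiplies matrix entries together, so the coefficients stay regular. Both frames may
  depend on the point, because the result is used in both directions between a frame
  \<open>Y\<close> and the normal frame of its span.\<close>

lemma change_of_frame:
  assumes R: "fsp R" and U: "openin (zar R) U"
    and a: "\<And>s t. s < r \<Longrightarrow> t < r \<Longrightarrow> a t s \<in> reg R U"
    and PQ: "\<And>x s. x \<in> U \<Longrightarrow> s < r \<Longrightarrow> P x ! s = (\<Sum>t<r. lscale g (a t s x) (Q x ! t))"
    and Q: "\<And>x. x \<in> U \<Longrightarrow> Q x \<in> comm_frames g r"
    and js: "js \<in> exponents r j"
  shows "\<exists>f. (\<forall>js'\<in>exponents r j. f js' \<in> reg R U) \<and>
    (\<forall>x\<in>U. op js (P x) m = (\<Sum>js'\<in>exponents r j. scl (f js' x) (op js' (Q x) m)))"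
proof -
  interpret fsp R by (rule R)
  have words: "\<exists>f. (\<forall>w'\<in>index_words r (length w). f w' \<in> reg R U) \<and>
      (\<forall>x\<in>U. wact (P x) w m = (\<Sum>w'\<in>index_words r (length w). scl (f w' x) (wact (Q x) w' m)))"
    if "set w \<subseteq> {..<r}" for w
    using that
  proof (induction w)
    case Nil
    have "index_words r (length []) = {[]}" unfolding index_words_def by auto
    then show ?case by (intro exI[of _ "\<lambda>_ _. 1"]) (simp add: wact_simps reg_const[OF U])
  next
    case (Cons s w)
    then have s: "s < r" by simp
    have "set w \<subseteq> {..<r}" using Cons.prems by simp
    from Cons.IH[OF this] obtain f where f: "\<forall>w'\<in>index_words r (length w). f w' \<in> reg R U"
        "\<forall>x\<in>U. wact (P x) w m = (\<Sum>w'\<in>index_words r (length w). scl (f w' x) (wact (Q x) w' m))"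
      by (elim exE conjE) (rule that)
    \<comment> \<open>A new first letter \<open>t\<close> comes from expanding
      \<open>P x ! s\<close>, so the word \<open>t # u\<close> receives the old coefficient of
      \<open>u\<close> times the entry \<open>a t s\<close>.\<close>
    define h where "h w' = (\<lambda>x. f (tl w') x * a (hd w') s x)" for w'
    let ?n = "length w"
    have split: "(\<Sum>w'\<in>index_words r (Suc ?n). F w') = (\<Sum>u\<in>index_words r ?n. \<Sum>t<r. F (t # u))"
      for F :: "nat list \<Rightarrow> 'm"
    proof -
      have "(\<Sum>u\<in>index_words r ?n. \<Sum>t<r. F (t # u)) = (\<Sum>(u, t)\<in>index_words r ?n \<times> {..<r}. F (t # u))"
        by (rule sum.cartesian_product)
      also have "\<dots> = (\<Sum>w'\<in>index_words r (Suc ?n). F w')"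
        by (rule sum.reindex_bij_witness[of _ "\<lambda>w'. (tl w', hd w')" "\<lambda>(u, t). t # u"])
          (auto simp: index_words_def length_Suc_conv)
      finally show ?thesis ..
    qed
    have "h w' \<in> reg R U" if w': "w' \<in> index_words r (Suc ?n)" for w'
    proof -
      obtain t u where "w' = t # u" "t < r" "u \<in> index_words r ?n"
        using w' by (cases w') (auto simp: index_words_def)
      then show ?thesis unfolding h_def using f(1) a[OF s, of t] by (auto intro!: reg_mult U)
    qed
    moreover have "wact (P x) (s # w) m = (\<Sum>w'\<in>index_words r (Suc ?n). scl (h w' x) (wact (Q x) w' m))"
      if x: "x \<in> U" for x
    proof -
      have "wact (P x) (s # w) m = lie_act g M (P x ! s) (\<Sum>u\<in>index_words r ?n. scl (f u x) (wact (Q x) u m))"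
        unfolding wact_simps using f(2) x by simp
      also have "\<dots> = (\<Sum>u\<in>index_words r ?n. scl (f u x) (lie_act g M (P x ! s) (wact (Q x) u m)))"
        by (rule linear_sum_scale[OF lie_act_linear])
      also have "\<dots> = (\<Sum>u\<in>index_words r ?n. \<Sum>t<r. scl (h (t # u) x) (wact (Q x) (t # u) m))"
        unfolding PQ[OF x s] lie_act_sum wact_simps h_def by (simp add: V.scale_sum_right)
      finally show ?thesis unfolding split .
    qed
    ultimately show ?case by (intro exI[of _ h]) simp
  qed
  have w: "exponent_word js \<in> index_words r j" by (rule exponent_word_index_words[OF js])
  then have lw: "length (exponent_word js) = j" "set (exponent_word js) \<subseteq> {..<r}" unfolding index_words_def by auto
  from words[OF lw(2)] obtain f where f: "\<forall>w'\<in>index_words r j. f w' \<in> reg R U"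
      "\<forall>x\<in>U. wact (P x) (exponent_word js) m = (\<Sum>w'\<in>index_words r j. scl (f w' x) (wact (Q x) w' m))"
    unfolding lw(1) by (elim exE conjE) (rule that)
  \<comment> \<open>Words with the same exponent are the same operator on the commuting frame
    \<open>Q x\<close>, so their coefficients are added.\<close>
  define h where "h js' = (\<lambda>x. \<Sum>w'\<in>{w' \<in> index_words r j. word_exponent r w' = js'}. f w' x)" for js'
  have "h js' \<in> reg R U" for js' unfolding h_def using f(1) by (intro reg_sum U) auto
  moreover have "op js (P x) m = (\<Sum>js'\<in>exponents r j. scl (h js' x) (op js' (Q x) m))" if x: "x \<in> U" for x
  proof -
    have "op js (P x) m = (\<Sum>w'\<in>index_words r j. scl (f w' x) (wact (Q x) w' m))"
      unfolding op_def using f(2) x by simp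
    also have "\<dots> = (\<Sum>w'\<in>index_words r j. scl (f w' x) (op (word_exponent r w') (Q x) m))"
      using wact_word_exponent[OF Q[OF x]] by (intro sum.cong) (auto simp: index_words_def)
    also have "\<dots> = (\<Sum>js'\<in>exponents r j. \<Sum>w'\<in>{w' \<in> index_words r j. word_exponent r w' = js'}.
        scl (f w' x) (op (word_exponent r w') (Q x) m))"
      by (rule sum.group[symmetric, OF finite_index_words finite_exponents]) (auto intro: word_exponent_exponents)
    also have "\<dots> = (\<Sum>js'\<in>exponents r j. scl (h js' x) (op js' (Q x) m))"
      unfolding h_def V.scale_sum_left by (intro sum.cong) auto
    finally show ?thesis .
  qed
  ultimately show ?thesis by blast
qed


section \<open>Descent along the torsor\<close>

abbreviation Ev :: "'g set set \<Rightarrow> ('g set, 'k) fspace" where "Ev \<equiv> Evar r g"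
abbreviation To :: "'g set set \<Rightarrow> ('g list, 'k) fspace" where "To \<equiv> torsor_var r g"

definition qi :: "'g set set \<Rightarrow> 'g set set \<Rightarrow> 'g list set" where
  "qi X U = {Y \<in> topspace (zar (To X)). lspan g Y \<in> U}"

lemma fmod_Ev: "fmod (Ev X) scl C"
  by (intro fmod.intro fsp_Evar VF.finite_dimensional_vector_space_axioms)

lemma fmod_To: "fmod (To X) scl C"
  by (intro fmod.intro fsp_torsor VF.finite_dimensional_vector_space_axioms)

lemma triv_morph:
  assumes "fsp S" "fsp T" "morph S U T f" "t \<in> trivial_sheaf scl T V"
  shows "(\<lambda>x. t (f x)) \<in> trivial_sheaf scl S {x \<in> U. f x \<in> V}"
proof -
  interpret S: fmod S scl C by (intro fmod.intro assms VF.finite_dimensional_vector_space_axioms)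
  interpret T: fmod T scl C by (intro fmod.intro assms VF.finite_dimensional_vector_space_axioms)
  note V = T.triv_open[OF assms(4)]
  show ?thesis
    by (rule S.trivI[OF morphD(3)[OF assms(3) V]]) (rule morphD(4)[OF assms(3) V T.triv_rep[OF V assms(4)]])
qed

lemma qi_open: "X \<subseteq> Elem r g \<Longrightarrow> openin (zar (Ev X)) U \<Longrightarrow> openin (zar (To X)) (qi X U)"
  unfolding qi_def by (rule morphD(3)[OF lspan_morph])

lemma reg_qi:
  "X \<subseteq> Elem r g \<Longrightarrow> openin (zar (Ev X)) U \<Longrightarrow> f \<in> reg (Ev X) U \<Longrightarrow> (\<lambda>Y. f (lspan g Y)) \<in> reg (To X) (qi X U)"
  unfolding qi_def by (rule morphD(4)[OF lspan_morph])

lemma triv_qi: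
  assumes "X \<subseteq> Elem r g" "t \<in> trivial_sheaf scl (Ev X) U"
  shows "(\<lambda>Y. t (lspan g Y)) \<in> trivial_sheaf scl (To X) (qi X U)"
  unfolding qi_def by (rule triv_morph[OF fsp_torsor fsp_Evar lspan_morph[OF assms(1)] assms(2)])

lemma qi_mono: "U \<subseteq> V \<Longrightarrow> qi X U \<subseteq> qi X V"
  unfolding qi_def by auto

text \<open>The sections of the base that become sections of \<open>F\<close> upstairs. This is the
  largest candidate for a descent of \<open>F\<close>, and \<open>pullback_desc\<close> makes it the
  only one.\<close>

definition desc :: "'g set set \<Rightarrow> ('g list set \<Rightarrow> ('g list \<Rightarrow> 'm) set) \<Rightarrow> 'g set set \<Rightarrow> ('g set \<Rightarrow> 'm) set" where
  "desc X F U = {s \<in> trivial_sheaf scl (Ev X) U. (\<lambda>Y. s (lspan g Y)) \<in> F (qi X U)}"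

lemma subsheafD:
  assumes "subsheaf scl S F"
  shows "s \<in> F U \<Longrightarrow> s \<in> trivial_sheaf scl S U"
    "s \<in> F U \<Longrightarrow> (\<And>x. x \<in> U \<Longrightarrow> s x = t x) \<Longrightarrow> t \<in> F U"
    "openin (zar S) V \<Longrightarrow> V \<subseteq> U \<Longrightarrow> s \<in> F U \<Longrightarrow> s \<in> F V"
    "openin (zar S) U \<Longrightarrow> (\<And>x. x \<in> U \<Longrightarrow> \<exists>V. openin (zar S) V \<and> x \<in> V \<and> V \<subseteq> U \<and> s \<in> F V) \<Longrightarrow> s \<in> F U"
    "openin (zar S) U \<Longrightarrow> (\<lambda>x. 0) \<in> F U"
    "s \<in> F U \<Longrightarrow> t \<in> F U \<Longrightarrow> (\<lambda>x. s x + t x) \<in> F U"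
    "f \<in> reg S U \<Longrightarrow> s \<in> F U \<Longrightarrow> (\<lambda>x. scl (f x) (s x)) \<in> F U"
proof -
  note D = assms[unfolded subsheaf_def]
  note F1 = D[THEN conjunct1, THEN spec] and F2 = D[THEN conjunct2, THEN conjunct1, THEN spec, THEN spec, THEN spec]
  note D3 = D[THEN conjunct2, THEN conjunct2]
  note F3 = D3[THEN conjunct1, THEN spec, THEN spec, THEN spec]
    and F4 = D3[THEN conjunct2, THEN conjunct1, THEN spec, THEN spec]
  note D5 = D3[THEN conjunct2, THEN conjunct2]
  note F5 = D5[THEN conjunct1, THEN spec]
    and F6 = D5[THEN conjunct2, THEN conjunct1, THEN spec, THEN spec, THEN spec]
    and F7 = D5[THEN conjunct2, THEN conjunct2, THEN spec, THEN spec, THEN spec]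
  show "s \<in> F U \<Longrightarrow> s \<in> trivial_sheaf scl S U" using F1 by auto
  show "s \<in> F U \<Longrightarrow> (\<And>x. x \<in> U \<Longrightarrow> s x = t x) \<Longrightarrow> t \<in> F U" using F2[of s U t] by simp
  show "openin (zar S) V \<Longrightarrow> V \<subseteq> U \<Longrightarrow> s \<in> F U \<Longrightarrow> s \<in> F V" using F3[of V U s] by simp
  show "openin (zar S) U \<Longrightarrow> (\<And>x. x \<in> U \<Longrightarrow> \<exists>V. openin (zar S) V \<and> x \<in> V \<and> V \<subseteq> U \<and> s \<in> F V) \<Longrightarrow> s \<in> F U"
    using F4[of U s] by simp
  show "openin (zar S) U \<Longrightarrow> (\<lambda>x. 0) \<in> F U" using F5[of U] by simp
  show "s \<in> F U \<Longrightarrow> t \<in> F U \<Longrightarrow> (\<lambda>x. s x + t x) \<in> F U" using F6[of s U t] by simp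
  show "f \<in> reg S U \<Longrightarrow> s \<in> F U \<Longrightarrow> (\<lambda>x. scl (f x) (s x)) \<in> F U" using F7[of f U s] by simp
qed

lemma subsheaf_sum:
  assumes "subsheaf scl S F" "openin (zar S) U" "\<And>i. i \<in> I \<Longrightarrow> f i \<in> reg S U \<and> s i \<in> F U"
  shows "(\<lambda>x. \<Sum>i\<in>I. scl (f i x) (s i x)) \<in> F U"
  using assms(3)
proof (induction I rule: infinite_finite_induct)
  case (insert i I)
  then have "f i \<in> reg S U" "s i \<in> F U" "(\<lambda>x. \<Sum>i\<in>I. scl (f i x) (s i x)) \<in> F U" by auto
  then show ?case using insert(1,2) subsheafD(6)[OF assms(1) subsheafD(7)[OF assms(1)]] by simp
qed (simp_all add: subsheafD(5)[OF assms(1,2)])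

text \<open>A subsheaf is recovered from its pull-back. Restricted along a local section
  \<open>\<sigma>\<close>, an expression with coefficients on the torsor becomes one with
  coefficients \<open>f i (\<sigma> x)\<close> on the base, because
  \<open>lspan g (\<sigma> x) = x\<close>. This is the uniqueness half of descent.\<close>

lemma pullback_desc:
  assumes X: "X \<subseteq> Elem r g" and F: "subsheaf scl (Ev X) F" and s: "s \<in> trivial_sheaf scl (Ev X) U"
  shows "s \<in> F U \<longleftrightarrow> (\<lambda>Y. s (lspan g Y)) \<in> pullback_subsheaf scl (To X) (lspan g) (Ev X) F (qi X U)"
proof -
  interpret S: fmod "Ev X" scl C by (rule fmod_Ev)
  interpret T: fmod "To X" scl C by (rule fmod_To)
  note U = S.triv_open[OF s]
  show ?thesis
  proof
    assume sF: "s \<in> F U"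
    have "\<exists>V W (n::nat) f t. openin (zar (To X)) V \<and> y \<in> V \<and> V \<subseteq> qi X U \<and> openin (zar (Ev X)) W \<and>
        lspan g ` V \<subseteq> W \<and> (\<forall>i<n. f i \<in> reg (To X) V \<and> t i \<in> F W) \<and>
        (\<forall>z\<in>V. s (lspan g z) = (\<Sum>i<n. scl (f i z) (t i (lspan g z))))" if y: "y \<in> qi X U" for y
      by (rule exI[of _ "qi X U"], rule exI[of _ U], rule exI[of _ 1], rule exI[of _ "\<lambda>_ _. 1"], rule exI[of _ "\<lambda>_. s"])
        (use qi_open[OF X U] U y sF T.reg_const[OF qi_open[OF X U]] in \<open>auto simp: qi_def\<close>)
    then show "(\<lambda>Y. s (lspan g Y)) \<in> pullback_subsheaf scl (To X) (lspan g) (Ev X) F (qi X U)"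
      unfolding pullback_subsheaf_def using triv_qi[OF X s] by blast
  next
    assume p: "(\<lambda>Y. s (lspan g Y)) \<in> pullback_subsheaf scl (To X) (lspan g) (Ev X) F (qi X U)"
    show "s \<in> F U"
    proof (rule subsheafD(4)[OF F U])
      fix e assume e: "e \<in> U"
      have UX: "U \<subseteq> X" using openin_subset[OF U] topspace_Evar[OF X] by simp
      have "e \<in> X" using e UX by auto
      from chart[OF X this] obtain U0 \<phi> \<sigma> where "e \<in> U0" "is_chart X U0 \<phi> \<sigma>" by (elim exE conjE)
      then have ch: "openin (zar (Ev X)) U0" "e \<in> U0" "U0 \<subseteq> X" "morph (Ev X) U0 (To X) \<sigma>"
          "\<And>e. e \<in> U0 \<Longrightarrow> lspan g (\<sigma> e) = e"
        unfolding is_chart_def by auto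
      have "\<sigma> e \<in> qi X U" unfolding qi_def using morphD(2)[OF ch(4,2)] ch(5)[OF ch(2)] e by simp
      then have "\<exists>V W (n::nat) f t. openin (zar (To X)) V \<and> \<sigma> e \<in> V \<and> V \<subseteq> qi X U \<and> openin (zar (Ev X)) W \<and>
        lspan g ` V \<subseteq> W \<and> (\<forall>i<n. f i \<in> reg (To X) V \<and> t i \<in> F W) \<and>
        (\<forall>z\<in>V. s (lspan g z) = (\<Sum>i<n. scl (f i z) (t i (lspan g z))))"
        using p unfolding pullback_subsheaf_def by blast
      then obtain V W and n :: nat and f t where V: "openin (zar (To X)) V" "\<sigma> e \<in> V" "V \<subseteq> qi X U"
          "openin (zar (Ev X)) W" "lspan g ` V \<subseteq> W" "\<forall>i<n. f i \<in> reg (To X) V \<and> t i \<in> F W"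
          "\<forall>z\<in>V. s (lspan g z) = (\<Sum>i<n. scl (f i z) (t i (lspan g z)))"
        by (elim exE conjE) (rule that)
      let ?V = "{x \<in> U0. \<sigma> x \<in> V}"
      have o: "openin (zar (Ev X)) ?V" by (rule morphD(3)[OF ch(4) V(1)])
      have sub: "?V \<subseteq> W" "?V \<subseteq> U"
      proof -
        have "x \<in> W \<and> x \<in> U" if x: "x \<in> ?V" for x
        proof -
          have "lspan g (\<sigma> x) = x" using ch(5) x by simp
          moreover have "lspan g (\<sigma> x) \<in> W" using V(5) x by auto
          moreover have "lspan g (\<sigma> x) \<in> U" using V(3) x unfolding qi_def by auto
          ultimately show ?thesis by simp
        qed
        then show "?V \<subseteq> W" "?V \<subseteq> U" by auto
      qed
      have "(\<lambda>x. \<Sum>i<n. scl (f i (\<sigma> x)) (t i x)) \<in> F ?V"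
      proof (rule subsheaf_sum[OF F o], rule conjI)
        fix i assume "i \<in> {..<n}"
        then have i: "f i \<in> reg (To X) V" "t i \<in> F W" using V(6) by auto
        show "(\<lambda>x. f i (\<sigma> x)) \<in> reg (Ev X) ?V" by (rule morphD(4)[OF ch(4) V(1) i(1)])
        show "t i \<in> F ?V" by (rule subsheafD(3)[OF F o sub(1) i(2)])
      qed
      then have "s \<in> F ?V"
      proof (rule subsheafD(2)[OF F])
        fix x assume x: "x \<in> ?V"
        then have "lspan g (\<sigma> x) = x" using ch(5) by simp
        then show "(\<Sum>i<n. scl (f i (\<sigma> x)) (t i x)) = s x" using V(7) x by auto
      qed
      then show "\<exists>V. openin (zar (Ev X)) V \<and> e \<in> V \<and> V \<subseteq> U \<and> s \<in> F V"
        using o sub(2) V(2) ch(2) by (intro exI[of _ ?V]) auto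
    qed
  qed
qed

lemma desc_subsheaf:
  assumes X: "X \<subseteq> Elem r g" and F: "subsheaf scl (To X) F"
  shows "subsheaf scl (Ev X) (desc X F)"
proof -
  interpret S: fmod "Ev X" scl C by (rule fmod_Ev)
  have d: "s \<in> trivial_sheaf scl (Ev X) U" "(\<lambda>Y. s (lspan g Y)) \<in> F (qi X U)" "openin (zar (Ev X)) U"
    if "s \<in> desc X F U" for s U
    using that S.triv_open unfolding desc_def by auto
  show ?thesis unfolding subsheaf_def
  proof (intro conjI allI impI)
    fix U show "desc X F U \<subseteq> trivial_sheaf scl (Ev X) U" unfolding desc_def by auto
  next
    fix U s t assume st: "s \<in> desc X F U \<and> (\<forall>x\<in>U. s x = t x)"
    have "t \<in> trivial_sheaf scl (Ev X) U" by (rule S.triv_cong[OF d(1)[OF conjunct1[OF st]]]) (use st in auto)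
    moreover have "(\<lambda>Y. t (lspan g Y)) \<in> F (qi X U)"
      by (rule subsheafD(2)[OF F d(2)[OF conjunct1[OF st]]]) (use st in \<open>auto simp: qi_def\<close>)
    ultimately show "t \<in> desc X F U" unfolding desc_def by simp
  next
    fix U V s assume "openin (zar (Ev X)) V \<and> V \<subseteq> U \<and> s \<in> desc X F U"
    then have a: "openin (zar (Ev X)) V" "V \<subseteq> U" "s \<in> desc X F U" by auto
    have "s \<in> trivial_sheaf scl (Ev X) V" by (rule S.triv_restr[OF d(1)[OF a(3)] a(1,2)])
    moreover have "(\<lambda>Y. s (lspan g Y)) \<in> F (qi X V)"
      by (rule subsheafD(3)[OF F qi_open[OF X a(1)] qi_mono[OF a(2)] d(2)[OF a(3)]])
    ultimately show "s \<in> desc X F V" unfolding desc_def by simp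
  next
    fix U s assume a: "openin (zar (Ev X)) U \<and>
        (\<forall>x\<in>U. \<exists>V. openin (zar (Ev X)) V \<and> x \<in> V \<and> V \<subseteq> U \<and> s \<in> desc X F V)"
    then have U: "openin (zar (Ev X)) U"
      and ex: "\<And>x. x \<in> U \<Longrightarrow> \<exists>V. openin (zar (Ev X)) V \<and> x \<in> V \<and> V \<subseteq> U \<and> s \<in> desc X F V" by auto
    have "s \<in> trivial_sheaf scl (Ev X) U"
    proof (rule S.triv_local[OF U])
      fix x assume "x \<in> U"
      from ex[OF this] obtain V where "openin (zar (Ev X)) V" "x \<in> V" "V \<subseteq> U" "s \<in> desc X F V"
        by (elim exE conjE) (rule that)
      then show "\<exists>W. openin (zar (Ev X)) W \<and> x \<in> W \<and> W \<subseteq> U \<and> s \<in> trivial_sheaf scl (Ev X) W"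
        using d(1) by (intro exI[of _ V]) auto
    qed
    moreover have "(\<lambda>Y. s (lspan g Y)) \<in> F (qi X U)"
    proof (rule subsheafD(4)[OF F qi_open[OF X U]])
      fix Y assume Y: "Y \<in> qi X U"
      then have "lspan g Y \<in> U" unfolding qi_def by simp
      from ex[OF this] obtain V where V: "openin (zar (Ev X)) V" "lspan g Y \<in> V" "V \<subseteq> U" "s \<in> desc X F V"
        by (elim exE conjE) (rule that)
      show "\<exists>V. openin (zar (To X)) V \<and> Y \<in> V \<and> V \<subseteq> qi X U \<and> (\<lambda>Y. s (lspan g Y)) \<in> F V"
        by (rule exI[of _ "qi X V"])
          (use V Y qi_open[OF X V(1)] qi_mono[OF V(3)] d(2)[OF V(4)] in \<open>auto simp: qi_def\<close>)
    qed
    ultimately show "s \<in> desc X F U" unfolding desc_def by simp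
  next
    fix U assume U: "openin (zar (Ev X)) U"
    show "(\<lambda>x. 0) \<in> desc X F U"
      unfolding desc_def using S.triv_const[OF U] subsheafD(5)[OF F qi_open[OF X U]] by simp
  next
    fix U s t assume "s \<in> desc X F U \<and> t \<in> desc X F U"
    then have s: "s \<in> desc X F U" and t: "t \<in> desc X F U" by auto
    show "(\<lambda>x. s x + t x) \<in> desc X F U"
      using S.triv_add[OF d(1)[OF s] d(1)[OF t]] subsheafD(6)[OF F d(2)[OF s] d(2)[OF t]] unfolding desc_def by simp
  next
    fix U f s assume "f \<in> reg (Ev X) U \<and> s \<in> desc X F U"
    then have f: "f \<in> reg (Ev X) U" and s: "s \<in> desc X F U" by auto
    show "(\<lambda>x. scl (f x) (s x)) \<in> desc X F U"
      using S.triv_scale[OF f d(1)[OF s]] subsheafD(7)[OF F reg_qi[OF X d(3)[OF s] f] d(2)[OF s]]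
      unfolding desc_def by simp
  qed
qed

text \<open>That the pull-back is contained in \<open>F\<close> is formal. The content of existence
  is the hypothesis \<open>loc\<close>: locally every section of \<open>F\<close> is a combination
  of sections pulled back from the base.\<close>

lemma pullback_subsheafI:
  assumes X: "X \<subseteq> Elem r g" and F: "subsheaf scl (To X) F"
    and loc: "\<And>V s y. s \<in> F V \<Longrightarrow> y \<in> V \<Longrightarrow> \<exists>V' W (n::nat) f t. openin (zar (To X)) V' \<and> y \<in> V' \<and> V' \<subseteq> V \<and>
        openin (zar (Ev X)) W \<and> lspan g ` V' \<subseteq> W \<and> (\<forall>i<n. f i \<in> reg (To X) V' \<and> t i \<in> desc X F W) \<and>
        (\<forall>z\<in>V'. s z = (\<Sum>i<n. scl (f i z) (t i (lspan g z))))"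
  shows "pullback_subsheaf scl (To X) (lspan g) (Ev X) (desc X F) = F"
proof
  interpret T: fmod "To X" scl C by (rule fmod_To)
  fix U
  show "pullback_subsheaf scl (To X) (lspan g) (Ev X) (desc X F) U = F U"
  proof (intro equalityI subsetI)
    fix s assume s: "s \<in> pullback_subsheaf scl (To X) (lspan g) (Ev X) (desc X F) U"
    then have st: "s \<in> trivial_sheaf scl (To X) U" unfolding pullback_subsheaf_def by blast
    show "s \<in> F U"
    proof (rule subsheafD(4)[OF F T.triv_open[OF st]])
      fix y assume y: "y \<in> U"
      have "\<exists>V W (n::nat) f t. openin (zar (To X)) V \<and> y \<in> V \<and> V \<subseteq> U \<and> openin (zar (Ev X)) W \<and>
        lspan g ` V \<subseteq> W \<and> (\<forall>i<n. f i \<in> reg (To X) V \<and> t i \<in> desc X F W) \<and>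
        (\<forall>z\<in>V. s z = (\<Sum>i<n. scl (f i z) (t i (lspan g z))))"
        using s y unfolding pullback_subsheaf_def by blast
      then obtain V W and n :: nat and f t where V: "openin (zar (To X)) V" "y \<in> V" "V \<subseteq> U"
          "openin (zar (Ev X)) W" "lspan g ` V \<subseteq> W" "\<forall>i<n. f i \<in> reg (To X) V \<and> t i \<in> desc X F W"
          "\<forall>z\<in>V. s z = (\<Sum>i<n. scl (f i z) (t i (lspan g z)))"
        by (elim exE conjE) (rule that)
      have VW: "V \<subseteq> qi X W" unfolding qi_def using openin_subset[OF V(1)] V(5) by auto
      have "(\<lambda>z. \<Sum>i<n. scl (f i z) (t i (lspan g z))) \<in> F V"
      proof (rule subsheaf_sum[OF F V(1)], rule conjI)
        fix i assume "i \<in> {..<n}"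
        then have i: "f i \<in> reg (To X) V" "t i \<in> desc X F W" using V(6) by auto
        show "f i \<in> reg (To X) V" by (rule i)
        have "(\<lambda>Y. t i (lspan g Y)) \<in> F (qi X W)" using i(2) unfolding desc_def by simp
        then show "(\<lambda>Y. t i (lspan g Y)) \<in> F V" by (rule subsheafD(3)[OF F V(1) VW])
      qed
      then have "s \<in> F V" by (rule subsheafD(2)[OF F]) (use V(7) in auto)
      then show "\<exists>V. openin (zar (To X)) V \<and> y \<in> V \<and> V \<subseteq> U \<and> s \<in> F V" using V by (intro exI[of _ V]) simp
    qed
  next
    fix s assume s: "s \<in> F U"
    show "s \<in> pullback_subsheaf scl (To X) (lspan g) (Ev X) (desc X F) U"
      unfolding pullback_subsheaf_def using subsheafD(1)[OF F s] loc[OF s] by simp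
  qed
qed

text \<open>Resolves the definite description: any competitor \<open>H\<close> has the same
  pull-back, and by \<open>pullback_desc\<close> its sections are determined by that
  pull-back.\<close>

theorem descended_sheaf_eq:
  assumes X: "X \<subseteq> Elem r g" and coh: "coherent_subsheaf scl (Ev X) (desc X F)"
    and pb: "pullback_subsheaf scl (To X) (lspan g) (Ev X) (desc X F) = F"
  shows "descended_sheaf g M r X F = desc X F"
  unfolding descended_sheaf_def
proof (rule the_equality)
  show "coherent_subsheaf scl (Ev X) (desc X F) \<and>
      pullback_subsheaf scl (To X) (lspan g) (Ev X) (desc X F) = F" using coh pb by simp
  fix H assume H: "coherent_subsheaf scl (Ev X) H \<and> pullback_subsheaf scl (To X) (lspan g) (Ev X) H = F"
  then have sub: "subsheaf scl (Ev X) H" unfolding coherent_subsheaf_def by simp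
  have "s \<in> H U \<longleftrightarrow> s \<in> desc X F U" for U s
    using subsheafD(1)[OF sub, of s U] pullback_desc[OF X sub, of s U] H unfolding desc_def by auto
  then have "H U = desc X F U" for U by auto
  then show "H = desc X F" by (rule ext)
qed

end

section \<open>Shrinking charts and clearing denominators\<close>

context grass
begin

lemma is_chartD:
  assumes "is_chart X U \<phi> \<sigma>"
  shows "openin (zar (Evar r g X)) U" "U \<subseteq> X" "morph (Evar r g X) U (torsor_var r g X) \<sigma>"
    "e \<in> U \<Longrightarrow> lspan g (\<sigma> e) = e" "\<forall>u<r. Vector_Spaces.linear (lscale g) (*) (\<phi> u)"
    "e \<in> U \<Longrightarrow> normal_frame r \<phi> (\<sigma> e)"
    "Y0 \<in> comm_frames g r \<Longrightarrow> lspan g Y0 \<in> U \<Longrightarrow> \<exists>W c. openin (zar (torsor_var r g X)) W \<and> Y0 \<in> W \<and>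
       (\<forall>Y\<in>W. lspan g Y \<in> U) \<and> (\<forall>t<r. \<forall>v<r. c t v \<in> reg (torsor_var r g X) W) \<and>
       (\<forall>Y\<in>W. \<forall>v<r. \<sigma> (lspan g Y) ! v = (\<Sum>t<r. lscale g (c t v Y) (Y ! t)))"
proof -
  note D = assms[unfolded is_chart_def]
  show "openin (zar (Evar r g X)) U" "U \<subseteq> X" "morph (Evar r g X) U (torsor_var r g X) \<sigma>"
    "e \<in> U \<Longrightarrow> lspan g (\<sigma> e) = e" "\<forall>u<r. Vector_Spaces.linear (lscale g) (*) (\<phi> u)"
    "e \<in> U \<Longrightarrow> normal_frame r \<phi> (\<sigma> e)"
    using D by auto
  note L = D[THEN conjunct2, THEN conjunct2, THEN conjunct2, THEN conjunct2, THEN conjunct2, THEN conjunct2]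
  assume Y0: "Y0 \<in> comm_frames g r" "lspan g Y0 \<in> U"
  show "\<exists>W c. openin (zar (torsor_var r g X)) W \<and> Y0 \<in> W \<and>
       (\<forall>Y\<in>W. lspan g Y \<in> U) \<and> (\<forall>t<r. \<forall>v<r. c t v \<in> reg (torsor_var r g X) W) \<and>
       (\<forall>Y\<in>W. \<forall>v<r. \<sigma> (lspan g Y) ! v = (\<Sum>t<r. lscale g (c t v Y) (Y ! t)))"
    by (rule mp[OF bspec[OF L Y0(1)] Y0(2)])
qed

lemma is_chart_restrict:
  assumes X: "X \<subseteq> Elem r g" and ch: "is_chart X U \<phi> \<sigma>" and V: "openin (zar (Evar r g X)) V" "V \<subseteq> U"
  shows "is_chart X V \<phi> \<sigma>"
  unfolding is_chart_def
proof (intro conjI ballI impI)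
  note c = is_chartD[OF ch]
  let ?T = "torsor_var r g X"
  interpret T: fsp ?T by (rule fsp_torsor)
  show "openin (zar (Evar r g X)) V" by (rule V)
  show "V \<subseteq> X" using V(2) c(2) by auto
  show "morph (Evar r g X) V ?T \<sigma>" by (rule morph_restr[OF fsp_Evar c(3) V])
  show "\<forall>u<r. Vector_Spaces.linear (lscale g) (*) (\<phi> u)" by (rule c(5))
  show "lspan g (\<sigma> e) = e" "normal_frame r \<phi> (\<sigma> e)" if "e \<in> V" for e using c(4,6)[of e] that V(2) by auto
  fix Y0 assume Y0: "Y0 \<in> comm_frames g r" "lspan g Y0 \<in> V"
  then have "lspan g Y0 \<in> U" using V(2) by auto
  from c(7)[OF Y0(1) this] obtain W d where W: "openin (zar ?T) W" "Y0 \<in> W"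
      "\<forall>Y\<in>W. lspan g Y \<in> U" "\<forall>t<r. \<forall>v<r. d t v \<in> reg ?T W"
      "\<forall>Y\<in>W. \<forall>v<r. \<sigma> (lspan g Y) ! v = (\<Sum>t<r. lscale g (d t v Y) (Y ! t))"
    by (elim exE conjE) (rule that)
  let ?W = "{Y \<in> topspace (zar ?T). lspan g Y \<in> V} \<inter> W"
  have o: "openin (zar ?T) ?W" by (rule openin_Int[OF morphD(3)[OF lspan_morph[OF X] V(1)] W(1)])
  have "Y0 \<in> ?W" using W(1,2) Y0(2) openin_subset by auto
  moreover have "\<forall>t<r. \<forall>v<r. d t v \<in> reg ?T ?W" using T.reg_restr[OF W(1) o] W(4) by auto
  ultimately show "\<exists>W c. openin (zar ?T) W \<and> Y0 \<in> W \<and> (\<forall>Y\<in>W. lspan g Y \<in> V) \<and>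
      (\<forall>t<r. \<forall>v<r. c t v \<in> reg ?T W) \<and>
      (\<forall>Y\<in>W. \<forall>v<r. \<sigma> (lspan g Y) ! v = (\<Sum>t<r. lscale g (c t v Y) (Y ! t)))"
    using o W(5) by (intro exI[of _ ?W] exI[of _ d]) auto
qed

lemma chart_in:
  assumes X: "X \<subseteq> Elem r g" and V: "openin (zar (Evar r g X)) V" "e \<in> V"
  obtains U \<phi> \<sigma> where "e \<in> U" "U \<subseteq> V" "is_chart X U \<phi> \<sigma>"
proof -
  have "e \<in> X" using openin_subset[OF V(1)] topspace_Evar[OF X] V(2) by auto
  from chart[OF X this] obtain U \<phi> \<sigma> where U: "e \<in> U" "is_chart X U \<phi> \<sigma>" by (elim exE conjE)
  have "is_chart X (U \<inter> V) \<phi> \<sigma>"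
    by (rule is_chart_restrict[OF X U(2) openin_Int[OF is_chartD(1)[OF U(2)] V(1)]]) auto
  then show thesis using that[of "U \<inter> V"] U(1) V(2) by auto
qed

text \<open>One polynomial denominator for finitely many regular functions. It also detects
  \<open>V\<close>: a torsor point at which \<open>G\<close> does not vanish lies in
  \<open>V\<close>, so quantities multiplied by \<open>G\<close> can be taken as 0
  elsewhere.\<close>

lemma polyfun_local:
  fixes n :: nat
  assumes V: "openin (zar (torsor_var r g X)) V" "y \<in> V" and f: "\<forall>i<n. f i \<in> reg (torsor_var r g X) V"
  shows "\<exists>G P. G \<in> polyfun g r \<and> (\<forall>i<n. P i \<in> polyfun g r) \<and> G y \<noteq> 0 \<and>
    (\<forall>Y\<in>topspace (zar (torsor_var r g X)). G Y \<noteq> 0 \<longrightarrow> Y \<in> V \<and> (\<forall>i<n. f i Y = P i Y / G Y))"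
  using f
proof (induction n)
  case 0
  obtain A where A: "openin (affine_topology g r) A" "V = A \<inter> {Y \<in> comm_frames g r. lspan g Y \<in> X}"
    using openin_subvarietyE[OF V(1)[unfolded torsor_var_def]] by auto
  have "y \<in> A" using V(2) A(2) by simp
  then obtain P where P: "P \<in> polyfun g r" "P y \<noteq> 0" "{X. length X = r \<and> P X \<noteq> 0} \<subseteq> A"
    using A(1) unfolding openin_affine_iff by auto
  have "Y \<in> V" if "Y \<in> topspace (zar (torsor_var r g X))" "P Y \<noteq> 0" for Y
    using that P(3) frames_iff unfolding topspace_torsor A(2) comm_frames_def by auto
  then show ?case using P by (intro exI[of _ P]) auto
next
  case (Suc n)
  have "\<forall>i<n. f i \<in> reg (torsor_var r g X) V" using Suc.prems by simp
  from Suc.IH[OF this] obtain G P where G: "G \<in> polyfun g r" "\<forall>i<n. P i \<in> polyfun g r" "G y \<noteq> 0"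
      "\<forall>Y\<in>topspace (zar (torsor_var r g X)). G Y \<noteq> 0 \<longrightarrow> Y \<in> V \<and> (\<forall>i<n. f i Y = P i Y / G Y)"
    by (elim exE conjE) (rule that)
  have fn: "f n \<in> reg (torsor_var r g X) V" using Suc.prems by simp
  obtain A h where A: "openin (affine_topology g r) A" "y \<in> A" "h \<in> reg (affine_variety g r) A" "\<forall>Y\<in>A \<inter> V. f n Y = h Y"
    using reg_subvarietyE[OF fn[unfolded torsor_var_def] V(2)] by auto
  obtain A' P' Q where A': "openin (affine_topology g r) A'" "y \<in> A'" "A' \<subseteq> A" "P' \<in> polyfun g r" "Q \<in> polyfun g r"
      "\<forall>Y\<in>A'. Q Y \<noteq> 0 \<and> h Y = P' Y / Q Y"
    using reg_affineE[OF A(3,2)] .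
  obtain G' where G': "G' \<in> polyfun g r" "G' y \<noteq> 0" "{X. length X = r \<and> G' X \<noteq> 0} \<subseteq> A'"
    using A'(1,2) unfolding openin_affine_iff by auto
  \<comment> \<open>The old denominator, the denominator \<open>Q\<close> of the new function, and a
    factor \<open>G'\<close> whose non-vanishing keeps the point inside the set where the new
    fraction is valid.\<close>
  define G'' where "G'' = (\<lambda>Y. G Y * (G' Y * Q Y))"
  define P'' where "P'' i = (if i < n then (\<lambda>Y. P i Y * (G' Y * Q Y)) else (\<lambda>Y. P' Y * (G Y * G' Y)))" for i
  have "G'' \<in> polyfun g r" unfolding G''_def by (intro polyfun_mult G(1) G'(1) A'(5))
  moreover have "\<forall>i<Suc n. P'' i \<in> polyfun g r"
    unfolding P''_def using G(2) by (auto intro!: polyfun_mult G(1) G'(1) A'(4,5))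
  moreover have "G'' y \<noteq> 0" unfolding G''_def using G(3) G'(2) A'(2,6) by auto
  moreover have "Y \<in> V \<and> (\<forall>i<Suc n. f i Y = P'' i Y / G'' Y)"
    if Y: "Y \<in> topspace (zar (torsor_var r g X))" "G'' Y \<noteq> 0" for Y
  proof -
    have nz: "G Y \<noteq> 0" "G' Y \<noteq> 0" "Q Y \<noteq> 0" using Y(2) unfolding G''_def by auto
    have YV: "Y \<in> V" and fi: "\<forall>i<n. f i Y = P i Y / G Y" using G(4) Y(1) nz(1) by auto
    have "length Y = r" using Y(1) frames_iff unfolding topspace_torsor comm_frames_def by auto
    then have "Y \<in> A'" using G'(3) nz(2) by auto
    then have "f n Y = P' Y / Q Y" using A'(3,6) A(4) YV by auto
    then have "f i Y = P'' i Y / G'' Y" if "i < Suc n" for i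
      using fi nz that unfolding P''_def G''_def by (cases "i = n") (auto simp: field_simps)
    then show ?thesis using YV by simp
  qed
  ultimately show ?case by (intro exI[of _ G''] exI[of _ P'']) simp
qed

lemma coord_reg:
  assumes "openin (zar (torsor_var r g X)) V" "P \<in> polyfun g r"
  shows "P \<in> reg (torsor_var r g X) V"
proof -
  have o: "openin (affine_topology g r) (topspace (affine_topology g r))" by (rule openin_topspace)
  have "P \<in> reg (affine_variety g r) (topspace (affine_topology g r))" by (rule polyfun_reg[OF o assms(2)])
  moreover have "V \<subseteq> topspace (affine_topology g r)"
    using openin_subset[OF assms(1)] frames_iff unfolding topspace_torsor comm_frames_def by auto
  ultimately show ?thesis unfolding torsor_var_def reg_subvariety using o
    by (intro ballI exI[of _ "topspace (affine_topology g r)"] exI[of _ P]) auto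
qed

text \<open>Clearing denominators turns the sections in question into a submodule of a free module over the
  Noetherian ring of polynomial functions, so that nothing is needed on how the subspaces vary.\<close>

lemma chart_noetherian:
  fixes n :: nat
  assumes X: "X \<subseteq> Elem r g" and ch: "is_chart X U \<phi> \<sigma>"
    and P: "\<And>x v w a. x \<in> U \<Longrightarrow> P x v \<Longrightarrow> P x w \<Longrightarrow> P x (\<lambda>i. v i + a * w i)" "\<And>x. x \<in> U \<Longrightarrow> P x (\<lambda>i. 0)"
    and cong: "\<And>x v w. x \<in> U \<Longrightarrow> P x v \<Longrightarrow> (\<And>i. i < n \<Longrightarrow> v i = w i) \<Longrightarrow> P x w"
  shows "\<exists>(N::nat) s. (\<forall>k<N. (\<forall>i<n. (\<lambda>x. s k x i) \<in> reg (Evar r g X) U) \<and> (\<forall>x\<in>U. P x (s k x))) \<and>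
    (\<forall>V h. openin (zar (Evar r g X)) V \<and> V \<subseteq> U \<and> (\<forall>i<n. (\<lambda>x. h x i) \<in> reg (Evar r g X) V) \<and> (\<forall>x\<in>V. P x (h x)) \<longrightarrow>
      (\<forall>y\<in>V. \<exists>W f. openin (zar (Evar r g X)) W \<and> y \<in> W \<and> W \<subseteq> V \<and> (\<forall>k<N. f k \<in> reg (Evar r g X) W) \<and>
        (\<forall>z\<in>W. \<forall>i<n. h z i = (\<Sum>k<N. f k z * s k z i))))"
proof -
  let ?S = "Evar r g X" and ?T = "torsor_var r g X"
  interpret S: fsp ?S by (rule fsp_Evar)
  note c = is_chartD[OF ch]
  \<comment> \<open>Polynomial vectors on all \<open>r\<close>-tuples that satisfy the pointwise
    condition along the section \<open>\<sigma>\<close>: a module over the polynomial functions, to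
    which \<open>noetherian_submodule\<close> applies.\<close>
  let ?V = "{v :: nat \<Rightarrow> 'g list \<Rightarrow> 'k. (\<forall>i<n. v i \<in> polyfun g r) \<and> (\<forall>x\<in>U. P x (\<lambda>i. v i (\<sigma> x)))}"
  have "\<exists>N (w :: nat \<Rightarrow> nat \<Rightarrow> 'g list \<Rightarrow> 'k). (\<forall>k<N. w k \<in> ?V) \<and>
    (\<forall>v\<in>?V. \<exists>u. (\<forall>k<N. u k \<in> polyfun g r) \<and> (\<forall>i<n. v i = (\<Sum>k<N. u k * w k i)))"
  proof (rule noetherian_submodule[OF polyfun_subring polyfun_noetherian[OF G.finite_dimensional_vector_space_axioms]])
    fix v i assume "v \<in> ?V" "i < n" then show "v i \<in> polyfun g r" by simp
  next
    fix v w a assume v: "v \<in> ?V" and w: "w \<in> ?V" and a: "a \<in> polyfun g r"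
    have "v i + a * w i \<in> polyfun g r" if "i < n" for i
      using v w a that by (intro subringD(4,5)[OF polyfun_subring]) auto
    moreover have "P x (\<lambda>i. (v i + a * w i) (\<sigma> x))" if "x \<in> U" for x
      using P(1)[OF that, of "\<lambda>i. v i (\<sigma> x)" "\<lambda>i. w i (\<sigma> x)" "a (\<sigma> x)"] v w that by simp
    ultimately show "(\<lambda>i. v i + a * w i) \<in> ?V" by simp
  qed
  then obtain N :: nat and w where w: "\<forall>k<N. w k \<in> ?V"
      "\<forall>v\<in>?V. \<exists>u. (\<forall>k<N. u k \<in> polyfun g r) \<and> (\<forall>i<n. v i = (\<Sum>k<N. u k * w k i))"
    by (elim exE conjE) (rule that)
  have top: "openin (zar ?T) (topspace (zar ?T))" by (rule openin_topspace)
  have dom: "{x \<in> U. \<sigma> x \<in> topspace (zar ?T)} = U" using morphD(2)[OF c(3)] by auto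
  have pol: "(\<lambda>x. Q (\<sigma> x)) \<in> reg ?S U" if "Q \<in> polyfun g r" for Q
    using morphD(4)[OF c(3) top coord_reg[OF top that]] unfolding dom .
  have part2: "\<exists>W f. openin (zar ?S) W \<and> y \<in> W \<and> W \<subseteq> V \<and> (\<forall>k<N. f k \<in> reg ?S W) \<and>
        (\<forall>z\<in>W. \<forall>i<n. h z i = (\<Sum>k<N. f k z * w k i (\<sigma> z)))"
    if V: "openin (zar ?S) V" "V \<subseteq> U" and h: "\<forall>i<n. (\<lambda>x. h x i) \<in> reg ?S V" "\<forall>x\<in>V. P x (h x)" and y: "y \<in> V"
    for V h y
  proof -
    let ?V' = "{Y \<in> topspace (zar ?T). lspan g Y \<in> V}"
    have oV: "openin (zar ?T) ?V'" and hV: "\<forall>i<n. (\<lambda>Y. h (lspan g Y) i) \<in> reg ?T ?V'"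
      using morphD(3,4)[OF lspan_morph[OF X] V(1)] h(1) by auto
    have "\<sigma> y \<in> ?V'" using morphD(2)[OF c(3), of y] c(4)[of y] y V(2) by auto
    from polyfun_local[OF oV this, of n "\<lambda>i Y. h (lspan g Y) i", OF hV]
    obtain G Q where G: "G \<in> polyfun g r" "\<forall>i<n. Q i \<in> polyfun g r" "G (\<sigma> y) \<noteq> 0"
      "\<forall>Y\<in>topspace (zar ?T). G Y \<noteq> 0 \<longrightarrow> Y \<in> ?V' \<and> (\<forall>i<n. h (lspan g Y) i = Q i Y / G Y)"
      by (elim exE conjE) (rule that)
    \<comment> \<open>Along \<open>\<sigma>\<close> this equals \<open>G^2\<close> times
      \<open>h\<close> where \<open>G\<close> does not vanish, since \<open>h = Q / G\<close> there.
      The extra factor \<open>G\<close> makes it 0 at the remaining points, also those outside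
      \<open>V\<close>, so the linear condition holds on all of \<open>U\<close>. Hence the later
      division by \<open>G^2\<close>.\<close>
    let ?v = "\<lambda>i. G * Q i"
    have hx: "x \<in> V \<and> (\<forall>i<n. h x i = Q i (\<sigma> x) / G (\<sigma> x))" if "x \<in> U" "G (\<sigma> x) \<noteq> 0" for x
      using G(4) morphD(2)[OF c(3) that(1)] that(2) c(4)[OF that(1)] by auto
    have "P x (\<lambda>i. ?v i (\<sigma> x))" if x: "x \<in> U" for x
    proof (cases "G (\<sigma> x) = 0")
      case True then show ?thesis using P(2)[OF x] by simp
    next
      case False
      have "P x (\<lambda>i. 0 + (G (\<sigma> x) * G (\<sigma> x)) * h x i)"
        using P(1)[OF x P(2)[OF x], of "h x"] h(2) hx[OF x False] by blast
      then show ?thesis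
        by (rule cong[OF x]) (use hx[OF x False] False in \<open>simp add: field_simps\<close>)
    qed
    moreover have "\<forall>i<n. ?v i \<in> polyfun g r" using G(1,2) subringD(5)[OF polyfun_subring] by blast
    ultimately have "?v \<in> ?V" by simp
    from bspec[OF w(2) this] obtain u where u: "\<forall>k<N. u k \<in> polyfun g r" "\<forall>i<n. ?v i = (\<Sum>k<N. u k * w k i)"
      by (elim exE conjE) (rule that)
    let ?G = "\<lambda>x. G (\<sigma> x) * G (\<sigma> x)"
    have GU: "?G \<in> reg ?S U" by (intro S.reg_mult c(1) pol G(1))
    let ?W = "{x \<in> U. ?G x \<noteq> 0}"
    have W: "openin (zar ?S) ?W" by (rule S.openin_nonzero[OF c(1) GU])
    have WV: "?W \<subseteq> V" using hx by auto
    have "(\<lambda>x. u k (\<sigma> x) / ?G x) \<in> reg ?S ?W" if "k < N" for k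
      by (rule S.reg_divide[OF c(1) pol GU W]) (use u(1) that in auto)
    moreover have "h z i = (\<Sum>k<N. u k (\<sigma> z) / ?G z * w k i (\<sigma> z))" if z: "z \<in> ?W" "i < n" for z i
    proof -
      have "(\<Sum>k<N. u k (\<sigma> z) * w k i (\<sigma> z)) = (\<Sum>k<N. u k * w k i) (\<sigma> z)" by (simp add: sum_apply)
      also have "\<dots> = ?v i (\<sigma> z)" using u(2) z(2) by metis
      finally have e: "(\<Sum>k<N. u k (\<sigma> z) * w k i (\<sigma> z)) = G (\<sigma> z) * Q i (\<sigma> z)" by simp
      have "h z i = Q i (\<sigma> z) / G (\<sigma> z)" using hx[of z] z by auto
      also have "\<dots> = (\<Sum>k<N. u k (\<sigma> z) * w k i (\<sigma> z)) / ?G z" unfolding e using z(1) by simp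
      finally show ?thesis by (simp add: sum_divide_distrib)
    qed
    moreover have "y \<in> ?W" using y V(2) G(3) by auto
    ultimately show ?thesis using W WV
      by (intro exI[of _ ?W] exI[of _ "\<lambda>k x. u k (\<sigma> x) / ?G x"]) simp
  qed
  have part1: "\<forall>k<N. (\<forall>i<n. (\<lambda>x. w k i (\<sigma> x)) \<in> reg ?S U) \<and> (\<forall>x\<in>U. P x (\<lambda>i. w k i (\<sigma> x)))"
    using w(1) pol by auto
  show ?thesis
  proof (rule exI[of _ N], rule exI[of _ "\<lambda>k x i. w k i (\<sigma> x)"], intro conjI part1 allI impI ballI)
    fix V h y assume "openin (zar ?S) V \<and> V \<subseteq> U \<and> (\<forall>i<n. (\<lambda>x. h x i) \<in> reg ?S V) \<and> (\<forall>x\<in>V. P x (h x))" "y \<in> V"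
    then show "\<exists>W f. openin (zar ?S) W \<and> y \<in> W \<and> W \<subseteq> V \<and> (\<forall>k<N. f k \<in> reg ?S W) \<and>
        (\<forall>z\<in>W. \<forall>i<n. h z i = (\<Sum>k<N. f k z * w k i (\<sigma> z)))"
      by (elim conjE) (rule part2)
  qed
qed

end

context descent
begin

text \<open>At each point, being a relation between the vectors \<open>s i x\<close> is a linear
  condition on the coefficients, exactly the kind of condition that \<open>chart_noetherian\<close>
  treats. This settles the relation clause of coherence for every subsheaf at once.\<close>

lemma relation_finite_type:
  fixes n :: nat
  assumes X: "X \<subseteq> Elem r g" and U: "openin (zar (Ev X)) U"
  shows "finite_type (\<lambda>c v i. c * v i) (Ev X) U (relation_sheaf scl (Ev X) n s)"
  unfolding finite_type_def
proof
  fix x assume x: "x \<in> U"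
  interpret S: fsp "Ev X" by (rule fsp_Evar)
  obtain U' \<phi> \<sigma> where U': "x \<in> U'" "U' \<subseteq> U" "is_chart X U' \<phi> \<sigma>" by (rule chart_in[OF X U x])
  note oU' = is_chartD(1)[OF U'(3)]
  let ?P = "\<lambda>x v. (\<Sum>i<n. scl (v i) (s i x)) = 0"
  have "\<exists>(N::nat) d. (\<forall>k<N. (\<forall>i<n. (\<lambda>x. d k x i) \<in> reg (Ev X) U') \<and> (\<forall>x\<in>U'. ?P x (d k x))) \<and>
    (\<forall>V h. openin (zar (Ev X)) V \<and> V \<subseteq> U' \<and> (\<forall>i<n. (\<lambda>x. h x i) \<in> reg (Ev X) V) \<and> (\<forall>x\<in>V. ?P x (h x)) \<longrightarrow>
      (\<forall>y\<in>V. \<exists>W f. openin (zar (Ev X)) W \<and> y \<in> W \<and> W \<subseteq> V \<and> (\<forall>k<N. f k \<in> reg (Ev X) W) \<and>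
        (\<forall>z\<in>W. \<forall>i<n. h z i = (\<Sum>k<N. f k z * d k z i))))"
  proof (rule chart_noetherian[OF X U'(3), of ?P n])
    fix x v w a assume "?P x v" "?P x w"
    moreover have "(\<Sum>i<n. scl (v i + a * w i) (s i x)) = (\<Sum>i<n. scl (v i) (s i x)) + scl a (\<Sum>i<n. scl (w i) (s i x))"
      by (simp add: V.scale_left_distrib sum.distrib V.scale_sum_right)
    ultimately show "(\<Sum>i<n. scl (v i + a * w i) (s i x)) = 0" by simp
  qed auto
  then obtain N :: nat and d where d: "\<forall>k<N. (\<forall>i<n. (\<lambda>x. d k x i) \<in> reg (Ev X) U') \<and> (\<forall>x\<in>U'. ?P x (d k x))"
    and gen: "\<forall>V h. openin (zar (Ev X)) V \<and> V \<subseteq> U' \<and> (\<forall>i<n. (\<lambda>x. h x i) \<in> reg (Ev X) V) \<and> (\<forall>x\<in>V. ?P x (h x)) \<longrightarrow>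
      (\<forall>y\<in>V. \<exists>W f. openin (zar (Ev X)) W \<and> y \<in> W \<and> W \<subseteq> V \<and> (\<forall>k<N. f k \<in> reg (Ev X) W) \<and>
        (\<forall>z\<in>W. \<forall>i<n. h z i = (\<Sum>k<N. f k z * d k z i)))"
    by (elim exE conjE) (rule that)
  \<comment> \<open>Padding by 0, as sections of the relation sheaf must vanish at indices from
    \<open>n\<close> on.\<close>
  define d' where "d' k x i = (if i < n then d k x i else 0)" for k x i
  have d'mem: "d' k \<in> relation_sheaf scl (Ev X) n s U'" if "k < N" for k
    unfolding relation_sheaf_def d'_def using d that by auto
  have main: "\<exists>W f. openin (zar (Ev X)) W \<and> y \<in> W \<and> W \<subseteq> V \<and> (\<forall>k<N. f k \<in> reg (Ev X) W) \<and>
      (\<forall>z\<in>W. t z = (\<Sum>k<N. (\<lambda>i. f k z * d' k z i)))"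
    if V: "openin (zar (Ev X)) V" "V \<subseteq> U'" and t: "t \<in> relation_sheaf scl (Ev X) n s V" and y: "y \<in> V" for V t y
  proof -
    have t': "\<forall>i<n. (\<lambda>x. t x i) \<in> reg (Ev X) V" "\<forall>x\<in>V. \<forall>i\<ge>n. t x i = 0" "\<forall>x\<in>V. ?P x (t x)"
      using t unfolding relation_sheaf_def by auto
    have "openin (zar (Ev X)) V \<and> V \<subseteq> U' \<and> (\<forall>i<n. (\<lambda>x. t x i) \<in> reg (Ev X) V) \<and> (\<forall>x\<in>V. ?P x (t x))"
      using V t' by simp
    from bspec[OF mp[OF spec[OF spec[OF gen]] this] y] obtain W f where W:
      "openin (zar (Ev X)) W" "y \<in> W" "W \<subseteq> V" "\<forall>k<N. f k \<in> reg (Ev X) W"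
      "\<forall>z\<in>W. \<forall>i<n. t z i = (\<Sum>k<N. f k z * d k z i)"
      by (elim exE conjE) (rule that)
    have "t z = (\<Sum>k<N. (\<lambda>i. f k z * d' k z i))" if z: "z \<in> W" for z
    proof
      fix i
      show "t z i = (\<Sum>k<N. (\<lambda>i. f k z * d' k z i)) i"
        unfolding sum_apply using W(3,5) z t'(2) by (cases "i < n") (auto simp: d'_def)
    qed
    then show ?thesis using W(1-4) by (intro exI[of _ W] exI[of _ f]) simp
  qed
  show "\<exists>W (m::nat) d. openin (zar (Ev X)) W \<and> x \<in> W \<and> W \<subseteq> U \<and> (\<forall>i<m. d i \<in> relation_sheaf scl (Ev X) n s W) \<and>
     (\<forall>V t. openin (zar (Ev X)) V \<and> V \<subseteq> W \<and> t \<in> relation_sheaf scl (Ev X) n s V \<longrightarrow>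
       (\<forall>y\<in>V. \<exists>W f. openin (zar (Ev X)) W \<and> y \<in> W \<and> W \<subseteq> V \<and> (\<forall>i<m. f i \<in> reg (Ev X) W) \<and>
          (\<forall>z\<in>W. t z = (\<Sum>i<m. (\<lambda>k. f i z * d i z k)))))"
  proof (rule exI[of _ U'], rule exI[of _ N], rule exI[of _ d'], intro conjI allI impI ballI)
    fix V t y assume "openin (zar (Ev X)) V \<and> V \<subseteq> U' \<and> t \<in> relation_sheaf scl (Ev X) n s V" "y \<in> V"
    then show "\<exists>W f. openin (zar (Ev X)) W \<and> y \<in> W \<and> W \<subseteq> V \<and> (\<forall>i<N. f i \<in> reg (Ev X) W) \<and>
          (\<forall>z\<in>W. t z = (\<Sum>i<N. (\<lambda>k. f i z * d' i z k)))"
      by (elim conjE) (rule main)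
  qed (use U' oU' d'mem in auto)
qed

lemma coherentI:
  assumes X: "X \<subseteq> Elem r g" and "subsheaf scl (Ev X) F" "finite_type scl (Ev X) X F"
  shows "coherent_subsheaf scl (Ev X) F"
  unfolding coherent_subsheaf_def topspace_Evar[OF X]
  using assms(2,3) relation_finite_type[OF X] by blast


section \<open>The image sheaf\<close>

abbreviation ImT where "ImT \<equiv> Im_torsor g B M r j"
abbreviation KerT where "KerT \<equiv> Ker_torsor g B M r j"

lemma Im_torsor_iff:
  "s \<in> ImT X U \<longleftrightarrow> s \<in> trivial_sheaf scl (To X) U \<and> (\<forall>x\<in>U. \<exists>V t. openin (zar (To X)) V \<and> x \<in> V \<and> V \<subseteq> U \<and>
     (\<forall>js\<in>exponents r j. t js \<in> trivial_sheaf scl (To X) V) \<and>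
     (\<forall>y\<in>V. s y = (\<Sum>js\<in>exponents r j. op js y (t js y))))"
  unfolding Im_torsor_def Theta_pow_eq by simp

lemma Ker_torsor_iff:
  "s \<in> KerT X U \<longleftrightarrow> s \<in> trivial_sheaf scl (To X) U \<and> (\<forall>js\<in>exponents r j. \<forall>y\<in>U. op js y (s y) = 0)"
  unfolding Ker_torsor_def Theta_pow_eq by simp

lemma Im_torsorE:
  assumes "s \<in> ImT X U" "x \<in> U"
  obtains V t where "openin (zar (To X)) V" "x \<in> V" "V \<subseteq> U" "\<forall>js\<in>exponents r j. t js \<in> trivial_sheaf scl (To X) V"
     "\<forall>y\<in>V. s y = (\<Sum>js\<in>exponents r j. op js y (t js y))"
proof -
  note a = assms(1)[unfolded Im_torsor_iff]
  from bspec[OF conjunct2[OF a] assms(2)] show thesis by (elim exE conjE) (rule that)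
qed

lemma op_add: "op js Y (m + n) = op js Y m + op js Y n"
  and op_scale: "op js Y (scl c m) = scl c (op js Y m)"
  using op_linear[of js Y] unfolding Vector_Spaces.linear_iff by auto

lemma op_zero: "op js Y 0 = 0"
  using op_scale[of js Y 0 0] by simp

text \<open>The moving letters \<open>Y ! s\<close> are written in the fixed basis \<open>B\<close>;
  their coordinates are polynomial and the basis vectors act by constant linear maps.\<close>

lemma triv_op:
  assumes "openin (zar (To X)) U" "t \<in> trivial_sheaf scl (To X) U" "js \<in> exponents r j"
  shows "(\<lambda>Y. op js Y (t Y)) \<in> trivial_sheaf scl (To X) U"
proof -
  interpret T: fmod "To X" scl C by (rule fmod_To)
  have rep: "Vector_Spaces.linear (lscale g) (*) (\<lambda>v. G.representation B v b)" for b
  proof -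
    have "vector_space ((*) :: 'k \<Rightarrow> 'k \<Rightarrow> 'k)" by unfold_locales (simp_all add: algebra_simps)
    then show ?thesis unfolding Vector_Spaces.linear_iff using G.vector_space_axioms
      by (simp add: G.representation_add G.representation_scale G.independent_Basis G.span_Basis)
  qed
  have "(\<lambda>Y. wact Y w (t Y)) \<in> trivial_sheaf scl (To X) U" if "set w \<subseteq> {..<r}" for w
    using that
  proof (induction w)
    case Nil then show ?case using assms(2) by (simp add: wact_simps)
  next
    case (Cons s w)
    have s: "s < r" using Cons.prems by simp
    have IH: "(\<lambda>Y. wact Y w (t Y)) \<in> trivial_sheaf scl (To X) U" using Cons by simp
    have e: "wact Y (s # w) (t Y) = (\<Sum>b\<in>B. scl (G.representation B (Y ! s) b) (lie_act g M b (wact Y w (t Y))))" for Y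
      unfolding wact_simps using lie_act_sum[of "G.representation B (Y ! s)" "\<lambda>b. b" B "wact Y w (t Y)"]
        G.sum_representation_eq[of B "Y ! s" B]
      by (simp add: G.independent_Basis G.span_Basis G.finite_Basis)
    show ?case unfolding e
      by (intro T.triv_sum T.triv_scale T.triv_map[OF _ IH lie_act_linear] assms(1) coord_reg polyfun_coord[OF rep s])
  qed
  moreover have "set (exponent_word js) \<subseteq> {..<r}"
    using exponent_word_index_words[OF assms(3)] unfolding index_words_def by simp
  ultimately show ?thesis unfolding op_def by blast
qed

lemma Im_torsor_subsheaf: "subsheaf scl (To X) (ImT X)"
proof -
  interpret T: fmod "To X" scl C by (rule fmod_To)
  have I: "s \<in> ImT X U" if "s \<in> trivial_sheaf scl (To X) U"
    "\<And>x. x \<in> U \<Longrightarrow> \<exists>V t. openin (zar (To X)) V \<and> x \<in> V \<and> V \<subseteq> U \<and>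
     (\<forall>js\<in>exponents r j. t js \<in> trivial_sheaf scl (To X) V) \<and>
     (\<forall>y\<in>V. s y = (\<Sum>js\<in>exponents r j. op js y (t js y)))" for s U
    unfolding Im_torsor_iff using that by simp
  have T: "s \<in> trivial_sheaf scl (To X) U" if "s \<in> ImT X U" for s U using that unfolding Im_torsor_iff by simp
  show ?thesis unfolding subsheaf_def
  proof (intro conjI allI impI)
    fix U show "ImT X U \<subseteq> trivial_sheaf scl (To X) U" using T by auto
  next
    fix U s t assume "s \<in> ImT X U \<and> (\<forall>x\<in>U. s x = t x)"
    then have s: "s \<in> ImT X U" and st: "\<And>x. x \<in> U \<Longrightarrow> t x = s x" by auto
    show "t \<in> ImT X U"
    proof (rule I)
      show "t \<in> trivial_sheaf scl (To X) U" by (rule T.triv_cong[OF T[OF s] st])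
      fix x assume x: "x \<in> U"
      obtain V u where V: "openin (zar (To X)) V" "x \<in> V" "V \<subseteq> U" "\<forall>js\<in>exponents r j. u js \<in> trivial_sheaf scl (To X) V"
         "\<forall>y\<in>V. s y = (\<Sum>js\<in>exponents r j. op js y (u js y))" using Im_torsorE[OF s x] .
      show "\<exists>V u. openin (zar (To X)) V \<and> x \<in> V \<and> V \<subseteq> U \<and>
         (\<forall>js\<in>exponents r j. u js \<in> trivial_sheaf scl (To X) V) \<and>
         (\<forall>y\<in>V. t y = (\<Sum>js\<in>exponents r j. op js y (u js y)))"
        by (rule exI[of _ V], rule exI[of _ u]) (use V st in auto)
    qed
  next
    fix U W s assume "openin (zar (To X)) W \<and> W \<subseteq> U \<and> s \<in> ImT X U"
    then have W: "openin (zar (To X)) W" "W \<subseteq> U" and s: "s \<in> ImT X U" by auto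
    show "s \<in> ImT X W"
    proof (rule I)
      show "s \<in> trivial_sheaf scl (To X) W" by (rule T.triv_restr[OF T[OF s] W])
      fix x assume x: "x \<in> W"
      then have "x \<in> U" using W by auto
      from Im_torsorE[OF s this] obtain V u where V: "openin (zar (To X)) V" "x \<in> V" "V \<subseteq> U"
         "\<forall>js\<in>exponents r j. u js \<in> trivial_sheaf scl (To X) V"
         "\<forall>y\<in>V. s y = (\<Sum>js\<in>exponents r j. op js y (u js y))" .
      have o: "openin (zar (To X)) (V \<inter> W)" using V W by auto
      show "\<exists>V u. openin (zar (To X)) V \<and> x \<in> V \<and> V \<subseteq> W \<and>
         (\<forall>js\<in>exponents r j. u js \<in> trivial_sheaf scl (To X) V) \<and>
         (\<forall>y\<in>V. s y = (\<Sum>js\<in>exponents r j. op js y (u js y)))"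
        by (rule exI[of _ "V \<inter> W"], rule exI[of _ u]) (use V x o T.triv_restr[OF _ o] in auto)
    qed
  next
    fix U s assume "openin (zar (To X)) U \<and> (\<forall>x\<in>U. \<exists>V. openin (zar (To X)) V \<and> x \<in> V \<and> V \<subseteq> U \<and> s \<in> ImT X V)"
    then have U: "openin (zar (To X)) U"
      and ex: "\<And>x. x \<in> U \<Longrightarrow> \<exists>V. openin (zar (To X)) V \<and> x \<in> V \<and> V \<subseteq> U \<and> s \<in> ImT X V" by auto
    show "s \<in> ImT X U"
    proof (rule I)
      show "s \<in> trivial_sheaf scl (To X) U"
      proof (rule T.triv_local[OF U])
        fix x assume "x \<in> U"
        from ex[OF this] obtain V where "openin (zar (To X)) V" "x \<in> V" "V \<subseteq> U" "s \<in> ImT X V"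
          by (elim exE conjE) (rule that)
        then show "\<exists>W. openin (zar (To X)) W \<and> x \<in> W \<and> W \<subseteq> U \<and> s \<in> trivial_sheaf scl (To X) W"
          using T by (intro exI[of _ V]) auto
      qed
      fix x assume "x \<in> U"
      from ex[OF this] obtain V where V: "openin (zar (To X)) V" "x \<in> V" "V \<subseteq> U" "s \<in> ImT X V"
        by (elim exE conjE) (rule that)
      from Im_torsorE[OF V(4,2)] obtain V' u where V': "openin (zar (To X)) V'" "x \<in> V'" "V' \<subseteq> V"
         "\<forall>js\<in>exponents r j. u js \<in> trivial_sheaf scl (To X) V'"
         "\<forall>y\<in>V'. s y = (\<Sum>js\<in>exponents r j. op js y (u js y))" .
      show "\<exists>V u. openin (zar (To X)) V \<and> x \<in> V \<and> V \<subseteq> U \<and>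
         (\<forall>js\<in>exponents r j. u js \<in> trivial_sheaf scl (To X) V) \<and>
         (\<forall>y\<in>V. s y = (\<Sum>js\<in>exponents r j. op js y (u js y)))"
        by (rule exI[of _ V'], rule exI[of _ u]) (use V' V in auto)
    qed
  next
    fix U assume U: "openin (zar (To X)) U"
    show "(\<lambda>x. 0) \<in> ImT X U"
    proof (rule I[OF T.triv_const[OF U]])
      fix x assume "x \<in> U"
      then show "\<exists>V u. openin (zar (To X)) V \<and> x \<in> V \<and> V \<subseteq> U \<and>
         (\<forall>js\<in>exponents r j. u js \<in> trivial_sheaf scl (To X) V) \<and>
         (\<forall>y\<in>V. 0 = (\<Sum>js\<in>exponents r j. op js y (u js y)))"
        by - (rule exI[of _ U], rule exI[of _ "\<lambda>_ _. 0"], simp add: U T.triv_const op_zero)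
    qed
  next
    fix U s t assume "s \<in> ImT X U \<and> t \<in> ImT X U"
    then have s: "s \<in> ImT X U" and t: "t \<in> ImT X U" by auto
    show "(\<lambda>x. s x + t x) \<in> ImT X U"
    proof (rule I[OF T.triv_add[OF T[OF s] T[OF t]]])
      fix x assume x: "x \<in> U"
      obtain V u where V: "openin (zar (To X)) V" "x \<in> V" "V \<subseteq> U" "\<forall>js\<in>exponents r j. u js \<in> trivial_sheaf scl (To X) V"
         "\<forall>y\<in>V. s y = (\<Sum>js\<in>exponents r j. op js y (u js y))" using Im_torsorE[OF s x] .
      obtain W v where W: "openin (zar (To X)) W" "x \<in> W" "W \<subseteq> U" "\<forall>js\<in>exponents r j. v js \<in> trivial_sheaf scl (To X) W"
         "\<forall>y\<in>W. t y = (\<Sum>js\<in>exponents r j. op js y (v js y))" using Im_torsorE[OF t x] .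
      have o: "openin (zar (To X)) (V \<inter> W)" using V W by auto
      have "(\<lambda>y. u js y + v js y) \<in> trivial_sheaf scl (To X) (V \<inter> W)" if "js \<in> exponents r j" for js
        using V(4) W(4) that by (intro T.triv_add T.triv_restr[OF _ o]) auto
      then show "\<exists>V u. openin (zar (To X)) V \<and> x \<in> V \<and> V \<subseteq> U \<and>
         (\<forall>js\<in>exponents r j. u js \<in> trivial_sheaf scl (To X) V) \<and>
         (\<forall>y\<in>V. s y + t y = (\<Sum>js\<in>exponents r j. op js y (u js y)))"
        by - (rule exI[of _ "V \<inter> W"], rule exI[of _ "\<lambda>js y. u js y + v js y"],
          use V W o in \<open>auto simp: op_add sum.distrib\<close>)
    qed
  next
    fix U f s assume "f \<in> reg (To X) U \<and> s \<in> ImT X U"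
    then have f: "f \<in> reg (To X) U" and s: "s \<in> ImT X U" by auto
    show "(\<lambda>x. scl (f x) (s x)) \<in> ImT X U"
    proof (rule I[OF T.triv_scale[OF f T[OF s]]])
      fix x assume x: "x \<in> U"
      obtain V u where V: "openin (zar (To X)) V" "x \<in> V" "V \<subseteq> U" "\<forall>js\<in>exponents r j. u js \<in> trivial_sheaf scl (To X) V"
         "\<forall>y\<in>V. s y = (\<Sum>js\<in>exponents r j. op js y (u js y))" using Im_torsorE[OF s x] .
      have "f \<in> reg (To X) V" by (rule T.reg_restr[OF T.triv_open[OF T[OF s]] V(1,3) f])
      then have "\<forall>js\<in>exponents r j. (\<lambda>y. scl (f y) (u js y)) \<in> trivial_sheaf scl (To X) V"
        using V(4) T.triv_scale by blast
      then show "\<exists>V u. openin (zar (To X)) V \<and> x \<in> V \<and> V \<subseteq> U \<and>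
         (\<forall>js\<in>exponents r j. u js \<in> trivial_sheaf scl (To X) V) \<and>
         (\<forall>y\<in>V. scl (f y) (s y) = (\<Sum>js\<in>exponents r j. op js y (u js y)))"
        by - (rule exI[of _ V], rule exI[of _ "\<lambda>js y. scl (f y) (u js y)"],
          use V in \<open>auto simp: op_scale V.scale_sum_right\<close>)
    qed
  qed
qed

lemma qi_iff: "Y \<in> qi X U \<longleftrightarrow> Y \<in> comm_frames g r \<and> lspan g Y \<in> X \<and> lspan g Y \<in> U"
  unfolding qi_def topspace_torsor by auto

lemma section_comm_frame: "is_chart X U \<phi> \<sigma> \<Longrightarrow> e \<in> U \<Longrightarrow> \<sigma> e \<in> comm_frames g r"
  using morphD(2)[OF is_chartD(3), of X U \<phi> \<sigma> e] unfolding topspace_torsor by simp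

text \<open>The generators of the image sheaf: monomials at the normal frame, applied to constant
  vectors. Pulled back to a frame \<open>Y\<close> they still refer to the normal frame of its span,
  and \<open>change_of_frame\<close> rewrites them in monomials at \<open>Y\<close> itself.\<close>

lemma gen_in_desc:
  assumes X: "X \<subseteq> Elem r g" and ch: "is_chart X U \<phi> \<sigma>" and js: "js \<in> exponents r j"
  shows "(\<lambda>e. op js (\<sigma> e) c) \<in> desc X (ImT X) U"
proof -
  interpret T: fmod "To X" scl C by (rule fmod_To)
  note c = is_chartD[OF ch]
  have top: "openin (zar (To X)) (topspace (zar (To X)))" by (rule openin_topspace)
  have dom: "{x \<in> U. \<sigma> x \<in> topspace (zar (To X))} = U" using morphD(2)[OF c(3)] by auto
  have "(\<lambda>Y. op js Y c) \<in> trivial_sheaf scl (To X) (topspace (zar (To X)))"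
    using triv_op[OF top T.triv_const[OF top] js] .
  from triv_morph[OF fsp_Evar fsp_torsor c(3) this]
  have t: "(\<lambda>e. op js (\<sigma> e) c) \<in> trivial_sheaf scl (Ev X) U" unfolding dom .
  have "(\<lambda>Y. op js (\<sigma> (lspan g Y)) c) \<in> ImT X (qi X U)"
    unfolding Im_torsor_iff
  proof (intro conjI ballI)
    show "(\<lambda>Y. op js (\<sigma> (lspan g Y)) c) \<in> trivial_sheaf scl (To X) (qi X U)" by (rule triv_qi[OF X t])
    fix Y0 assume "Y0 \<in> qi X U"
    then have Y0: "Y0 \<in> comm_frames g r" "lspan g Y0 \<in> U" unfolding qi_iff by auto
    from c(7)[OF this] obtain W d where W: "openin (zar (To X)) W" "Y0 \<in> W" "\<forall>Y\<in>W. lspan g Y \<in> U"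
        "\<forall>t<r. \<forall>v<r. d t v \<in> reg (To X) W"
        "\<forall>Y\<in>W. \<forall>v<r. \<sigma> (lspan g Y) ! v = (\<Sum>t<r. lscale g (d t v Y) (Y ! t))"
      by (elim exE conjE) (rule that)
    have WT: "W \<subseteq> topspace (zar (To X))" by (rule openin_subset[OF W(1)])
    have "\<exists>f. (\<forall>js'\<in>exponents r j. f js' \<in> reg (To X) W) \<and>
      (\<forall>Y\<in>W. op js (\<sigma> (lspan g Y)) c = (\<Sum>js'\<in>exponents r j. scl (f js' Y) (op js' Y c)))"
      by (rule change_of_frame[OF fsp_torsor W(1), of d _ "\<lambda>Y. Y", OF _ _ _ js])
        (use W WT in \<open>auto simp: topspace_torsor\<close>)
    then obtain f where f: "\<forall>js'\<in>exponents r j. f js' \<in> reg (To X) W"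
      "\<forall>Y\<in>W. op js (\<sigma> (lspan g Y)) c = (\<Sum>js'\<in>exponents r j. scl (f js' Y) (op js' Y c))"
      by (elim exE conjE) (rule that)
    have "W \<subseteq> qi X U" using WT W(3) unfolding qi_def by auto
    moreover have "\<forall>js'\<in>exponents r j. (\<lambda>Y. scl (f js' Y) c) \<in> trivial_sheaf scl (To X) W"
      using f(1) T.triv_scale[OF _ T.triv_const[OF W(1)]] by blast
    ultimately show "\<exists>V u. openin (zar (To X)) V \<and> Y0 \<in> V \<and> V \<subseteq> qi X U \<and>
         (\<forall>js\<in>exponents r j. u js \<in> trivial_sheaf scl (To X) V) \<and>
         (\<forall>Y\<in>V. op js (\<sigma> (lspan g Y)) c = (\<Sum>js\<in>exponents r j. op js Y (u js Y)))"
      by - (rule exI[of _ W], rule exI[of _ "\<lambda>js' Y. scl (f js' Y) c"], use W(1,2) f(2) in \<open>auto simp: op_scale\<close>)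
  qed
  then show ?thesis unfolding desc_def using t by simp
qed

text \<open>Two expansions are combined: the local preimages in the basis \<open>C\<close>, with
  regular coordinates, and the monomials at \<open>Y\<close> in those at the normal frame, by
  \<open>change_of_frame\<close> with the matrix \<open>\<phi> t (Y ! s)\<close>.\<close>

lemma Im_gen_local:
  assumes X: "X \<subseteq> Elem r g" and ch: "is_chart X U \<phi> \<sigma>" and s: "s \<in> ImT X V" and y: "y \<in> V" "lspan g y \<in> U"
  shows "\<exists>W f. openin (zar (To X)) W \<and> y \<in> W \<and> W \<subseteq> V \<and> W \<subseteq> qi X U \<and>
    (\<forall>js\<in>exponents r j. \<forall>c\<in>C. f js c \<in> reg (To X) W) \<and>
    (\<forall>z\<in>W. s z = (\<Sum>js\<in>exponents r j. \<Sum>c\<in>C. scl (f js c z) (op js (\<sigma> (lspan g z)) c)))"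
proof -
  interpret T: fmod "To X" scl C by (rule fmod_To)
  note c = is_chartD[OF ch]
  obtain V' t where V': "openin (zar (To X)) V'" "y \<in> V'" "V' \<subseteq> V" "\<forall>js\<in>exponents r j. t js \<in> trivial_sheaf scl (To X) V'"
     "\<forall>y\<in>V'. s y = (\<Sum>js\<in>exponents r j. op js y (t js y))" using Im_torsorE[OF s y(1)] .
  let ?W = "V' \<inter> qi X U"
  have W: "openin (zar (To X)) ?W" using V'(1) qi_open[OF X c(1)] by auto
  have ex: "\<exists>f. (\<forall>js'\<in>exponents r j. f js' \<in> reg (To X) ?W) \<and>
      (\<forall>Y\<in>?W. op js Y m = (\<Sum>js'\<in>exponents r j. scl (f js' Y) (op js' (\<sigma> (lspan g Y)) m)))"
    if js: "js \<in> exponents r j" for js m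
  proof (rule change_of_frame[OF fsp_torsor W, where a = "\<lambda>t s Y. \<phi> t (Y ! s)"])
    show "(\<lambda>Y. \<phi> t (Y ! s)) \<in> reg (To X) ?W" if "s < r" "t < r" for s t
      by (rule coord_reg[OF W polyfun_coord[OF c(5)[rule_format, OF that(2)] that(1)]])
    fix Y assume "Y \<in> ?W"
    then have Y: "Y \<in> comm_frames g r" "lspan g Y \<in> U" by (auto simp: qi_iff)
    show "\<sigma> (lspan g Y) \<in> comm_frames g r" by (rule section_comm_frame[OF ch Y(2)])
    have l: "length Y = r" using Y(1) frames_iff unfolding comm_frames_def by auto
    show "Y ! s = (\<Sum>t<r. lscale g (\<phi> t (Y ! s)) (\<sigma> (lspan g Y) ! t))" if "s < r" for s
      by (rule normal_coeff[OF c(5) c(6)[OF Y(2)]]) (use nth_in_lspan[OF l that] c(4)[OF Y(2)] in simp)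
  qed (rule js)
  define a where "a js m = (SOME f. (\<forall>js'\<in>exponents r j. f js' \<in> reg (To X) ?W) \<and>
      (\<forall>Y\<in>?W. op js Y m = (\<Sum>js'\<in>exponents r j. scl (f js' Y) (op js' (\<sigma> (lspan g Y)) m))))" for js m
  have "(\<forall>js'\<in>exponents r j. a js m js' \<in> reg (To X) ?W) \<and>
      (\<forall>Y\<in>?W. op js Y m = (\<Sum>js'\<in>exponents r j. scl (a js m js' Y) (op js' (\<sigma> (lspan g Y)) m)))"
    if "js \<in> exponents r j" for js m
    unfolding a_def by (rule someI_ex[OF ex[OF that]])
  then have a: "\<And>js m js'. js \<in> exponents r j \<Longrightarrow> js' \<in> exponents r j \<Longrightarrow> a js m js' \<in> reg (To X) ?W"
      "\<And>js m Y. js \<in> exponents r j \<Longrightarrow> Y \<in> ?W \<Longrightarrow>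
         op js Y m = (\<Sum>js'\<in>exponents r j. scl (a js m js' Y) (op js' (\<sigma> (lspan g Y)) m))"
    by auto
  \<comment> \<open>The coefficient of the generator with exponent \<open>js'\<close> and basis
    vector \<open>c\<close>: over all \<open>js\<close>, the \<open>c\<close>-coordinate of the
    preimage times the change-of-frame coefficient.\<close>
  define f where "f js' c = (\<lambda>z. \<Sum>js\<in>exponents r j. V.representation C (t js z) c * a js c js' z)" for js' c
  have tW: "(\<lambda>z. V.representation C (t js z) c) \<in> reg (To X) ?W" if "js \<in> exponents r j" for js c
    by (rule T.triv_rep[OF W T.triv_restr[OF _ W]]) (use V'(4) that in auto)
  have "f js' c \<in> reg (To X) ?W" if "js' \<in> exponents r j" for js' c
    unfolding f_def by (intro T.reg_sum T.reg_mult W tW a(1) that)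
  moreover have "s z = (\<Sum>js\<in>exponents r j. \<Sum>c\<in>C. scl (f js c z) (op js (\<sigma> (lspan g z)) c))" if z: "z \<in> ?W" for z
  proof -
    have "op js z (t js z) = (\<Sum>js'\<in>exponents r j. \<Sum>c\<in>C.
        scl (V.representation C (t js z) c * a js c js' z) (op js' (\<sigma> (lspan g z)) c))" if js: "js \<in> exponents r j" for js
    proof -
      have "op js z (t js z) = op js z (\<Sum>c\<in>C. scl (V.representation C (t js z) c) c)"
        unfolding T.representation_sum ..
      also have "\<dots> = (\<Sum>c\<in>C. scl (V.representation C (t js z) c) (op js z c))" by (rule linear_sum_scale[OF op_linear])
      also have "\<dots> = (\<Sum>c\<in>C. \<Sum>js'\<in>exponents r j.
          scl (V.representation C (t js z) c * a js c js' z) (op js' (\<sigma> (lspan g z)) c))"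
        unfolding a(2)[OF js z] by (simp add: V.scale_sum_right)
      finally show ?thesis by (subst (asm) sum.swap)
    qed
    then have "s z = (\<Sum>js\<in>exponents r j. \<Sum>js'\<in>exponents r j. \<Sum>c\<in>C.
        scl (V.representation C (t js z) c * a js c js' z) (op js' (\<sigma> (lspan g z)) c))"
      using V'(5) z by simp
    also have "\<dots> = (\<Sum>js'\<in>exponents r j. \<Sum>js\<in>exponents r j. \<Sum>c\<in>C.
        scl (V.representation C (t js z) c * a js c js' z) (op js' (\<sigma> (lspan g z)) c))" by (rule sum.swap)
    also have "\<dots> = (\<Sum>js'\<in>exponents r j. \<Sum>c\<in>C. \<Sum>js\<in>exponents r j.
        scl (V.representation C (t js z) c * a js c js' z) (op js' (\<sigma> (lspan g z)) c))"
      by (intro sum.cong refl sum.swap)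
    finally show ?thesis unfolding f_def V.scale_sum_left .
  qed
  moreover have "y \<in> ?W" using V'(2) y subsetD[OF openin_subset[OF V'(1)]] unfolding qi_def by auto
  ultimately show ?thesis using W V'(3) by (intro exI[of _ ?W] exI[of _ f]) auto
qed

text \<open>The sheaf definitions count generators by an initial segment of \<open>nat\<close>,
  whereas here they are pairs of a monomial and a basis vector.\<close>

lemma exps_enum:
  "\<exists>(N::nat) e. (\<forall>i<N. fst (e i) \<in> exponents r j \<and> snd (e i) \<in> C) \<and>
    (\<forall>F :: nat list \<Rightarrow> 'm \<Rightarrow> 'm. (\<Sum>js\<in>exponents r j. \<Sum>c\<in>C. F js c) = (\<Sum>i<N. F (fst (e i)) (snd (e i))))"
proof -
  have fin: "finite (exponents r j \<times> C)" using finite_exponents VF.finite_Basis by auto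
  obtain e where e: "bij_betw e {..<card (exponents r j \<times> C)} (exponents r j \<times> C)"
    using ex_bij_betw_nat_finite[OF fin] by (auto simp: lessThan_atLeast0)
  show ?thesis
  proof (rule exI[of _ "card (exponents r j \<times> C)"], rule exI[of _ e], intro conjI allI impI)
    fix i assume "i < card (exponents r j \<times> C)"
    then have "e i \<in> exponents r j \<times> C" using bij_betwE[OF e] by auto
    then show "fst (e i) \<in> exponents r j" "snd (e i) \<in> C" by (auto simp: mem_Times_iff)
  next
    fix F :: "nat list \<Rightarrow> 'm \<Rightarrow> 'm"
    have "(\<Sum>js\<in>exponents r j. \<Sum>c\<in>C. F js c) = (\<Sum>p\<in>exponents r j \<times> C. F (fst p) (snd p))"
      unfolding sum.cartesian_product by (simp add: case_prod_beta)
    also have "\<dots> = (\<Sum>i<card (exponents r j \<times> C). F (fst (e i)) (snd (e i)))"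
      by (rule sum.reindex_bij_betw[OF e, symmetric])
    finally show "(\<Sum>js\<in>exponents r j. \<Sum>c\<in>C. F js c) = (\<Sum>i<card (exponents r j \<times> C). F (fst (e i)) (snd (e i)))" .
  qed
qed

text \<open>The local expression \<open>loc\<close> serves twice: on the torsor it shows that the
  pull-back is the whole image, and composed with \<open>\<sigma>\<close> it shows that the same
  generators generate the sheaf on the base.\<close>

theorem Im_sheaf_eq:
  assumes X: "X \<subseteq> Elem r g"
  shows "Im_sheaf g B M r j X = desc X (ImT X)" "coherent_subsheaf scl (Ev X) (desc X (ImT X))"
proof -
  obtain N :: nat and e where e: "\<And>i. i < N \<Longrightarrow> fst (e i) \<in> exponents r j \<and> snd (e i) \<in> C"
    and sum: "\<And>F :: nat list \<Rightarrow> 'm \<Rightarrow> 'm. (\<Sum>js\<in>exponents r j. \<Sum>c\<in>C. F js c) = (\<Sum>i<N. F (fst (e i)) (snd (e i)))"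
  proof -
    from exps_enum obtain N :: nat and e where e: "\<forall>i<N. fst (e i) \<in> exponents r j \<and> snd (e i) \<in> C"
      "\<forall>F :: nat list \<Rightarrow> 'm \<Rightarrow> 'm. (\<Sum>js\<in>exponents r j. \<Sum>c\<in>C. F js c) = (\<Sum>i<N. F (fst (e i)) (snd (e i)))"
      by (elim exE conjE) (rule that)
    show thesis by (rule that[of N e]) (use e in auto)
  qed
  have loc: "\<exists>W f. openin (zar (To X)) W \<and> y \<in> W \<and> W \<subseteq> V \<and> W \<subseteq> qi X U \<and> (\<forall>i<N. f i \<in> reg (To X) W) \<and>
    (\<forall>z\<in>W. s z = (\<Sum>i<N. scl (f i z) (op (fst (e i)) (\<sigma> (lspan g z)) (snd (e i)))))"
    if ch: "is_chart X U \<phi> \<sigma>" and s: "s \<in> ImT X V" and y: "y \<in> V" "lspan g y \<in> U" for U \<phi> \<sigma> s V y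
  proof -
    from Im_gen_local[OF X ch s y] obtain W f where W: "openin (zar (To X)) W" "y \<in> W" "W \<subseteq> V" "W \<subseteq> qi X U"
      "\<forall>js\<in>exponents r j. \<forall>c\<in>C. f js c \<in> reg (To X) W"
      "\<forall>z\<in>W. s z = (\<Sum>js\<in>exponents r j. \<Sum>c\<in>C. scl (f js c z) (op js (\<sigma> (lspan g z)) c))"
      by (elim exE conjE) (rule that)
    show ?thesis
      by (rule exI[of _ W], rule exI[of _ "\<lambda>i. f (fst (e i)) (snd (e i))"]) (use W e in \<open>auto simp: sum\<close>)
  qed
  have gen: "(\<lambda>x. op (fst (e i)) (\<sigma> x) (snd (e i))) \<in> desc X (ImT X) U" if "is_chart X U \<phi> \<sigma>" "i < N" for U \<phi> \<sigma> i
    using gen_in_desc[OF X that(1)] e[OF that(2)] by blast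
  have pb: "pullback_subsheaf scl (To X) (lspan g) (Ev X) (desc X (ImT X)) = ImT X"
  proof (rule pullback_subsheafI[OF X Im_torsor_subsheaf])
    fix V s y assume s: "s \<in> ImT X V" and y: "y \<in> V"
    interpret T: fmod "To X" scl C by (rule fmod_To)
    have "V \<subseteq> topspace (zar (To X))" using s unfolding Im_torsor_iff by (intro openin_subset T.triv_open) (rule conjunct1)
    then have yX: "lspan g y \<in> X" using y unfolding topspace_torsor by auto
    from chart[OF X yX] obtain U \<phi> \<sigma> where U: "lspan g y \<in> U" "is_chart X U \<phi> \<sigma>" by (elim exE conjE)
    from loc[OF U(2) s y U(1)] obtain W f where W: "openin (zar (To X)) W" "y \<in> W" "W \<subseteq> V" "W \<subseteq> qi X U"
      "\<forall>i<N. f i \<in> reg (To X) W"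
      "\<forall>z\<in>W. s z = (\<Sum>i<N. scl (f i z) (op (fst (e i)) (\<sigma> (lspan g z)) (snd (e i))))"
      by (elim exE conjE) (rule that)
    show "\<exists>V' W (n::nat) f t. openin (zar (To X)) V' \<and> y \<in> V' \<and> V' \<subseteq> V \<and>
        openin (zar (Ev X)) W \<and> lspan g ` V' \<subseteq> W \<and> (\<forall>i<n. f i \<in> reg (To X) V' \<and> t i \<in> desc X (ImT X) W) \<and>
        (\<forall>z\<in>V'. s z = (\<Sum>i<n. scl (f i z) (t i (lspan g z))))"
      by (rule exI[of _ W], rule exI[of _ U], rule exI[of _ N], rule exI[of _ f],
          rule exI[of _ "\<lambda>i x. op (fst (e i)) (\<sigma> x) (snd (e i))"])
        (use W is_chartD(1)[OF U(2)] gen[OF U(2)] in \<open>auto simp: qi_def\<close>)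
  qed
  have ft: "finite_type scl (Ev X) X (desc X (ImT X))"
    unfolding finite_type_def
  proof
    fix x assume "x \<in> X"
    from chart[OF X this] obtain U \<phi> \<sigma> where U: "x \<in> U" "is_chart X U \<phi> \<sigma>" by (elim exE conjE)
    note c = is_chartD[OF U(2)]
    have main: "\<exists>W f. openin (zar (Ev X)) W \<and> y \<in> W \<and> W \<subseteq> V \<and> (\<forall>i<N. f i \<in> reg (Ev X) W) \<and>
        (\<forall>z\<in>W. t z = (\<Sum>i<N. scl (f i z) (op (fst (e i)) (\<sigma> z) (snd (e i)))))"
      if V: "openin (zar (Ev X)) V" "V \<subseteq> U" and t: "t \<in> desc X (ImT X) V" and y: "y \<in> V" for V t y
    proof -
      have yU: "y \<in> U" using V(2) y by auto
      have t': "(\<lambda>Y. t (lspan g Y)) \<in> ImT X (qi X V)" using t unfolding desc_def by simp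
      have "\<sigma> y \<in> qi X V" unfolding qi_def using morphD(2)[OF c(3) yU] c(4)[OF yU] y by simp
      from loc[OF U(2) t' this] obtain W f where W: "openin (zar (To X)) W" "\<sigma> y \<in> W" "W \<subseteq> qi X V"
        "\<forall>i<N. f i \<in> reg (To X) W"
        "\<forall>z\<in>W. t (lspan g z) = (\<Sum>i<N. scl (f i z) (op (fst (e i)) (\<sigma> (lspan g z)) (snd (e i))))"
        using c(4)[OF yU] yU by auto
      let ?W = "{x \<in> U. \<sigma> x \<in> W}"
      have "?W \<subseteq> V" using W(3) c(4) unfolding qi_def by auto
      moreover have "\<forall>i<N. (\<lambda>x. f i (\<sigma> x)) \<in> reg (Ev X) ?W" using morphD(4)[OF c(3) W(1)] W(4) by auto
      moreover have "t z = (\<Sum>i<N. scl (f i (\<sigma> z)) (op (fst (e i)) (\<sigma> z) (snd (e i))))" if "z \<in> ?W" for z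
        using bspec[OF W(5), of "\<sigma> z"] c(4)[of z] that by simp
      ultimately show ?thesis using morphD(3)[OF c(3) W(1)] W(2) yU
        by (intro exI[of _ ?W] exI[of _ "\<lambda>i x. f i (\<sigma> x)"]) auto
    qed
    show "\<exists>U (n::nat) s. openin (zar (Ev X)) U \<and> x \<in> U \<and> U \<subseteq> X \<and> (\<forall>i<n. s i \<in> desc X (ImT X) U) \<and>
       (\<forall>V t. openin (zar (Ev X)) V \<and> V \<subseteq> U \<and> t \<in> desc X (ImT X) V \<longrightarrow>
         (\<forall>y\<in>V. \<exists>W f. openin (zar (Ev X)) W \<and> y \<in> W \<and> W \<subseteq> V \<and> (\<forall>i<n. f i \<in> reg (Ev X) W) \<and>
            (\<forall>z\<in>W. t z = (\<Sum>i<n. scl (f i z) (s i z)))))"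
    proof (rule exI[of _ U], rule exI[of _ N], rule exI[of _ "\<lambda>i x. op (fst (e i)) (\<sigma> x) (snd (e i))"],
        intro conjI allI impI ballI)
      fix V t y assume "openin (zar (Ev X)) V \<and> V \<subseteq> U \<and> t \<in> desc X (ImT X) V" "y \<in> V"
      then show "\<exists>W f. openin (zar (Ev X)) W \<and> y \<in> W \<and> W \<subseteq> V \<and> (\<forall>i<N. f i \<in> reg (Ev X) W) \<and>
            (\<forall>z\<in>W. t z = (\<Sum>i<N. scl (f i z) (op (fst (e i)) (\<sigma> z) (snd (e i)))))"
        by (elim conjE) (rule main)
    qed (use c(1,2) U gen[OF U(2)] in auto)
  qed
  show coh: "coherent_subsheaf scl (Ev X) (desc X (ImT X))"
    by (rule coherentI[OF X desc_subsheaf[OF X Im_torsor_subsheaf] ft])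
  show "Im_sheaf g B M r j X = desc X (ImT X)"
    unfolding Im_sheaf_def by (rule descended_sheaf_eq[OF X coh pb])
qed

end

section \<open>The kernel sheaf\<close>

text \<open>Lagrange interpolation for a finite set of functions: the \<open>h i\<close> are dual to
  evaluation at the points \<open>a i\<close>. A new function is replaced by its interpolation
  error; if that vanishes on \<open>A\<close> nothing changes, otherwise a point where it is
  non-zero is adjoined. The class \<open>R\<close> records that the \<open>h i\<close> are
  combinations of the given functions.\<close>

lemma interpolation:
  fixes Fs :: "('a \<Rightarrow> 'k::field) set"
  assumes "finite Fs" "Fs \<subseteq> R"
    and R: "\<And>f h c. f \<in> R \<Longrightarrow> h \<in> R \<Longrightarrow> (\<lambda>x. f x + c * h x) \<in> R" "(\<lambda>x. 0) \<in> R"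
  shows "\<exists>(n::nat) a h. (\<forall>i<n. a i \<in> A \<and> h i \<in> R) \<and> (\<forall>i<n. \<forall>k<n. h i (a k) = (if i = k then 1 else 0)) \<and>
    (\<forall>f\<in>Fs. \<forall>x\<in>A. f x = (\<Sum>i<n. f (a i) * h i x))"
  using assms(1,2)
proof (induction Fs rule: finite_induct)
  case empty
  then show ?case by (intro exI[of _ 0]) simp
next
  case (insert f Fs)
  have "Fs \<subseteq> R" using insert.prems by simp
  from insert.IH[OF this] obtain n :: nat and a h where
    1: "\<forall>i<n. a i \<in> A \<and> h i \<in> R" and 2: "\<forall>i<n. \<forall>k<n. h i (a k) = (if i = k then 1 else 0)"
    and 3: "\<forall>f\<in>Fs. \<forall>x\<in>A. f x = (\<Sum>i<n. f (a i) * h i x)"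
    by (elim exE conjE) (rule that)
  define f' where "f' x = f x - (\<Sum>i<n. f (a i) * h i x)" for x
  have f'R: "f' \<in> R"
  proof -
    have "(\<lambda>x. f x - (\<Sum>i<m. f (a i) * h i x)) \<in> R" if "m \<le> n" for m
      using that
    proof (induction m)
      case 0 then show ?case using insert.prems by simp
    next
      case (Suc m)
      then have "(\<lambda>x. (f x - (\<Sum>i<m. f (a i) * h i x)) + (- f (a m)) * h m x) \<in> R" using 1 by (intro R) auto
      then show ?case by (simp add: algebra_simps)
    qed
    then show ?thesis unfolding f'_def[abs_def] by simp
  qed
  show ?case
  proof (cases "\<forall>x\<in>A. f' x = 0")
    case True
    then have "\<forall>x\<in>A. f x = (\<Sum>i<n. f (a i) * h i x)" unfolding f'_def by simp
    then show ?thesis using 1 2 3 by (intro exI[of _ n] exI[of _ a] exI[of _ h]) simp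
  next
    case False
    then obtain b where b: "b \<in> A" "f' b \<noteq> 0" by auto
    \<comment> \<open>The normalised error is 1 at \<open>b\<close> and 0 at the old points, so it
      becomes the new dual function; the old ones are corrected by a multiple of it so that they
      vanish at \<open>b\<close>.\<close>
    define e where "e x = f' x / f' b" for x
    define h' where "h' i x = (if i < n then h i x - h i b * e x else e x)" for i x
    define a' where "a' i = (if i < n then a i else b)" for i
    have eR: "e \<in> R"
      using R(1)[OF R(2) f'R, of "1 / f' b"] unfolding e_def[abs_def] by simp
    have ea: "e (a k) = 0" if "k < n" for k
    proof -
      have "(\<Sum>i<n. f (a i) * h i (a k)) = (\<Sum>i<n. if i = k then f (a i) else 0)"
        using 2 that by (intro sum.cong) auto
      then show ?thesis unfolding e_def f'_def using that by simp
    qed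
    have eb: "e b = 1" unfolding e_def using b by simp
    have "\<forall>i<Suc n. a' i \<in> A \<and> h' i \<in> R"
    proof (intro allI impI)
      fix i assume "i < Suc n"
      show "a' i \<in> A \<and> h' i \<in> R"
      proof (cases "i < n")
        case True
        have "(\<lambda>x. h i x + (- h i b) * e x) \<in> R" using 1 True by (intro R eR) auto
        then show ?thesis using 1 True unfolding a'_def h'_def[abs_def] by simp
      next
        case False
        then show ?thesis using b eR unfolding a'_def h'_def[abs_def] by simp
      qed
    qed
    moreover have "\<forall>i<Suc n. \<forall>k<Suc n. h' i (a' k) = (if i = k then 1 else 0)"
      unfolding a'_def h'_def using 2 ea eb by auto
    moreover have "\<forall>u\<in>insert f Fs. \<forall>x\<in>A. u x = (\<Sum>i<Suc n. u (a' i) * h' i x)"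
    proof (intro ballI)
      fix u x assume u: "u \<in> insert f Fs" and x: "x \<in> A"
      have s: "(\<Sum>i<Suc n. u (a' i) * h' i x) = (\<Sum>i<n. u (a i) * h i x) - (\<Sum>i<n. u (a i) * h i b) * e x + u b * e x"
        unfolding a'_def h'_def by (simp add: algebra_simps sum_subtractf sum_distrib_left)
      show "u x = (\<Sum>i<Suc n. u (a' i) * h' i x)"
      proof (cases "u \<in> Fs")
        case True
        then show ?thesis unfolding s using 3 x b(1) by (metis add.commute diff_add_cancel)
      next
        case False
        then have [simp]: "u = f" using u by simp
        have "(\<Sum>i<n. f (a i) * h i b) = f b - f' b" "(\<Sum>i<n. f (a i) * h i x) = f x - f' x"
          unfolding f'_def by simp_all
        moreover have "f' b * e x = f' x" unfolding e_def using b by simp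
        ultimately have "(\<Sum>i<n. f (a i) * h i x) - (\<Sum>i<n. f (a i) * h i b) * e x + f b * e x =
            (f x - f' x) - (f b - f' b) * e x + f b * e x" "(f b - f' b) * e x = f b * e x - f' x"
          by (simp_all add: left_diff_distrib)
        then show ?thesis unfolding s by simp
      qed
    qed
    ultimately show ?thesis by (intro exI[of _ "Suc n"] exI[of _ a'] exI[of _ h']) (rule conjI, assumption, rule conjI)
  qed
qed

section \<open>Invertible matrices acting on frames\<close>

context grass
begin

definition xmul :: "'g list \<Rightarrow> (nat \<Rightarrow> nat \<Rightarrow> 'k) \<Rightarrow> 'g list" where
  "xmul X A = map (\<lambda>s. \<Sum>t<r. lscale g (A t s) (X ! t)) [0..<r]"

text \<open>Invertibility of the \<open>r\<close> by \<open>r\<close> block, expressed by a right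
  inverse \<open>D\<close>. That is the form in which it acts: the frame is recovered from its
  translate by \<open>D\<close>.\<close>

definition GL :: "(nat \<Rightarrow> nat \<Rightarrow> 'k) set" where
  "GL = {A. \<exists>D. \<forall>t<r. \<forall>s<r. (\<Sum>u<r. A t u * D u s) = (if t = s then 1 else 0)}"

lemma xmul_simps: "length (xmul X A) = r" "s < r \<Longrightarrow> xmul X A ! s = (\<Sum>t<r. lscale g (A t s) (X ! t))"
  by (simp_all add: xmul_def)

text \<open>The right inverse expresses \<open>X\<close> in its translate, so both span the same
  subspace; \<open>r\<close> vectors spanning a space of dimension \<open>r\<close> form a
  frame.\<close>

lemma xmul_GL:
  assumes A: "A \<in> GL" and X: "X \<in> frames g r"
  shows "xmul X A \<in> frames g r" "lspan g (xmul X A) = lspan g X"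
proof -
  have l: "length X = r" using X frames_iff by simp
  let ?Z = "xmul X A"
  obtain D where D: "\<forall>t<r. \<forall>s<r. (\<Sum>u<r. A t u * D u s) = (if t = s then 1 else 0)" using A unfolding GL_def by blast
  have "set ?Z \<subseteq> lspan g X"
    unfolding xmul_def using l by (auto intro!: G.span_sum G.span_scale intro: G.span_base nth_mem)
  then have s1: "lspan g ?Z \<subseteq> lspan g X" by (rule G.span_minimal[OF _ G.subspace_span])
  have "X ! s = (\<Sum>u<r. lscale g (D u s) (?Z ! u))" if s: "s < r" for s
  proof -
    have "(\<Sum>u<r. lscale g (D u s) (?Z ! u)) = (\<Sum>u<r. \<Sum>t<r. lscale g (A t u * D u s) (X ! t))"
      by (simp add: xmul_simps G.scale_sum_right mult.commute)
    also have "\<dots> = (\<Sum>t<r. \<Sum>u<r. lscale g (A t u * D u s) (X ! t))" by (rule sum.swap)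
    also have "\<dots> = (\<Sum>t<r. lscale g (if t = s then 1 else 0) (X ! t))"
      using D s by (intro sum.cong) (auto simp: G.scale_sum_left[symmetric])
    also have "\<dots> = (\<Sum>t<r. if t = s then X ! t else 0)" by (intro sum.cong) auto
    finally show ?thesis using s by simp
  qed
  then have mem: "X ! s \<in> lspan g ?Z" if "s < r" for s
    unfolding lspan_iff[OF xmul_simps(1)] using that by (intro exI[of _ "\<lambda>u. D u s"]) simp
  have "set X \<subseteq> lspan g ?Z"
  proof
    fix v assume "v \<in> set X"
    then obtain s where "s < r" "v = X ! s" using l by (auto simp: in_set_conv_nth)
    then show "v \<in> lspan g ?Z" using mem by simp
  qed
  then have s2: "lspan g X \<subseteq> lspan g ?Z" by (rule G.span_minimal[OF _ G.subspace_span])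
  show e: "lspan g ?Z = lspan g X" using s1 s2 by simp
  have d: "G.dim (lspan g ?Z) = r" unfolding e by (rule dim_lspan[OF X])
  have "r \<le> card (set ?Z)" using G.dim_le_card[of "lspan g ?Z" "set ?Z"] d by simp
  then have c: "card (set ?Z) = r" using card_length[of ?Z] xmul_simps(1)[of X A] by simp
  have "distinct ?Z" using c xmul_simps(1)[of X A] by (simp add: card_distinct)
  moreover have "G.independent (set ?Z)"
    by (rule G.card_le_dim_spanning[of "set ?Z" "lspan g ?Z"]) (use c d in \<open>auto intro: G.span_superset[THEN subsetD]\<close>)
  ultimately show "?Z \<in> frames g r" unfolding frames_def using xmul_simps(1) by simp
qed

lemma xmul_polyfun: "P \<in> polyfun g r \<Longrightarrow> (\<lambda>X. P (xmul X A)) \<in> polyfun g r"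
proof (induction rule: polyfun.induct)
  case (polyfun_coord \<psi> s)
  have "\<psi> (xmul X A ! s) = (\<Sum>t<r. A t s * \<psi> (X ! t))" for X
    unfolding xmul_simps(2)[OF polyfun_coord(2)] by (rule linear_functional_fam[OF polyfun_coord(1)])
  then have "(\<lambda>X. \<psi> (xmul X A ! s)) = (\<lambda>X. \<Sum>t<r. A t s * \<psi> (X ! t))" by (intro ext)
  moreover have "(\<lambda>X. A t s * \<psi> (X ! t)) \<in> polyfun g r" if "t < r" for t
    by (rule polyfun_mult[OF polyfun.polyfun_const polyfun.polyfun_coord[OF polyfun_coord(1) that]])
  ultimately show ?case using polyfun_sum[of "{..<r}" "\<lambda>t X. A t s * \<psi> (X ! t)"] by simp
qed (auto intro: polyfun.intros)

text \<open>The trivialisation of the torsor over a chart: a frame is the normal frame of its span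
  translated by the matrix of its \<open>\<phi>\<close>-values. That matrix is invertible because
  the normal frame can in turn be written in \<open>Y\<close>.\<close>

lemma frame_matrix:
  assumes ch: "is_chart X U \<phi> \<sigma>" and Y: "Y \<in> comm_frames g r" "lspan g Y \<in> U"
  shows "xmul (\<sigma> (lspan g Y)) (\<lambda>t s. \<phi> t (Y ! s)) = Y" "(\<lambda>t s. \<phi> t (Y ! s)) \<in> GL"
proof -
  note c = is_chartD[OF ch]
  let ?Z = "\<sigma> (lspan g Y)"
  have l: "length Y = r" using Y(1) frames_iff unfolding comm_frames_def by auto
  have n: "normal_frame r \<phi> ?Z" by (rule c(6)[OF Y(2)])
  show "xmul ?Z (\<lambda>t s. \<phi> t (Y ! s)) = Y"
  proof (rule nth_equalityI)
    fix s assume "s < length (xmul ?Z (\<lambda>t s. \<phi> t (Y ! s)))"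
    then have s: "s < r" by (simp add: xmul_simps)
    have "Y ! s \<in> lspan g ?Z" using nth_in_lspan[OF l s] c(4)[OF Y(2)] by simp
    from normal_coeff[OF c(5) n this] show "xmul ?Z (\<lambda>t s. \<phi> t (Y ! s)) ! s = Y ! s"
      unfolding xmul_simps(2)[OF s] by simp
  qed (simp add: xmul_simps l)
  have lZ: "length ?Z = r" using n unfolding normal_frame_def by simp
  have "\<exists>d. ?Z ! s = (\<Sum>t<r. lscale g (d t) (Y ! t))" if "s < r" for s
    using nth_in_lspan[OF lZ that] unfolding c(4)[OF Y(2)] lspan_iff[OF l] .
  then have "\<forall>s. \<exists>d. s < r \<longrightarrow> ?Z ! s = (\<Sum>t<r. lscale g (d t) (Y ! t))" by blast
  from choice[OF this] obtain d where d: "\<And>s. s < r \<Longrightarrow> ?Z ! s = (\<Sum>t<r. lscale g (d s t) (Y ! t))" by blast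
  have "(\<Sum>u<r. \<phi> t (Y ! u) * d s u) = (if t = s then 1 else 0)" if "t < r" "s < r" for t s
  proof -
    have "(\<Sum>u<r. \<phi> t (Y ! u) * d s u) = \<phi> t (?Z ! s)"
      unfolding d[OF that(2)] linear_functional_fam[OF c(5)[rule_format, OF that(1)]] by (simp add: mult.commute)
    then show ?thesis using n that unfolding normal_frame_def by simp
  qed
  then show "(\<lambda>t s. \<phi> t (Y ! s)) \<in> GL" unfolding GL_def by (intro CollectI exI[of _ "\<lambda>u s. d s u"]) simp
qed

text \<open>For fixed \<open>P\<close>, the functions \<open>A \<mapsto> P (X A)\<close> with varying \<open>X\<close> span a finite-dimensional space, so
  they are interpolated by their values at finitely many invertible matrices.\<close>

lemma polyfun_interpolation:
  fixes n :: nat and P :: "nat \<Rightarrow> 'g list \<Rightarrow> 'k"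
  assumes \<phi>: "\<forall>u<r. Vector_Spaces.linear (lscale g) (*) (\<phi> u)" and P: "\<forall>i<n. P i \<in> polyfun g r"
  shows "\<exists>(N::nat) a h. (\<forall>k<N. a k \<in> GL \<and> (\<lambda>Y. h k (\<lambda>t s. \<phi> t (Y ! s))) \<in> polyfun g r) \<and>
    (\<forall>i<n. \<forall>X. \<forall>A\<in>GL. P i (xmul X A) = (\<Sum>k<N. P i (xmul X (a k)) * h k A))"
proof -
  \<comment> \<open>Functions of a matrix that turn into polynomial functions of the frame
    \<open>Y\<close> once the matrix is \<open>\<phi> t (Y ! s)\<close>. The interpolating functions
    must stay in this class to be usable as regular coefficients.\<close>
  define R where "R = {h :: (nat \<Rightarrow> nat \<Rightarrow> 'k) \<Rightarrow> 'k. (\<lambda>Y. h (\<lambda>t s. \<phi> t (Y ! s))) \<in> polyfun g r}"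
  interpret F: vector_space "\<lambda>(c::'k) (f :: (nat \<Rightarrow> nat \<Rightarrow> 'k) \<Rightarrow> 'k) A. c * f A"
    by unfold_locales (auto simp: algebra_simps)
  have Rc: "(\<lambda>A. c) \<in> R" for c unfolding R_def by (simp add: polyfun_const)
  have Rm: "(\<lambda>A. f A * h A) \<in> R" "(\<lambda>A. f A + h A) \<in> R" if "f \<in> R" "h \<in> R" for f h
    using that unfolding R_def by (auto intro: polyfun_mult polyfun_add)
  have prod: "(\<lambda>A. f A * h A) \<in> F.span ((\<lambda>(f, h) A. f A * h A) ` (Fs \<times> Gs))"
    if f: "f \<in> F.span Fs" and h: "h \<in> F.span Gs" for f h Fs Gs
    using f
  proof (induction f rule: F.span_induct_alt)
    case base
    have "(\<lambda>A. 0 * h A) = 0" by (auto simp: zero_fun_def)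
    then show ?case using F.span_zero by (simp add: zero_fun_def)
  next
    case (step c x y)
    have "(\<lambda>A. x A * h A) \<in> F.span ((\<lambda>(f, h) A. f A * h A) ` (Fs \<times> Gs))"
      using h
    proof (induction h rule: F.span_induct_alt)
      case base then show ?case using F.span_zero by (simp add: zero_fun_def)
    next
      case (step d x' y')
      have "(x, x') \<in> Fs \<times> Gs" using step(1) \<open>x \<in> Fs\<close> by simp
      from imageI[OF this, of "\<lambda>(f, h) A. f A * h A"]
      have "(\<lambda>A. x A * x' A) \<in> F.span ((\<lambda>(f, h) A. f A * h A) ` (Fs \<times> Gs))" by (intro F.span_base) simp
      from F.span_add[OF F.span_scale[OF this, of d] step(2)] show ?case
        by (simp add: plus_fun_def algebra_simps)
    qed
    from F.span_add[OF F.span_scale[OF this, of c] step(2)] show ?case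
      by (simp add: plus_fun_def algebra_simps)
  qed
  \<comment> \<open>One finite set \<open>Fs\<close> works for all \<open>X\<close>: matrix entries
    suffice for linear coordinates, unions serve for sums, and pairwise products serve for
    products.\<close>
  have expand: "\<exists>Fs. finite Fs \<and> Fs \<subseteq> R \<and> (\<forall>X. (\<lambda>A. Q (xmul X A)) \<in> F.span Fs)" if "Q \<in> polyfun g r" for Q
    using that
  proof (induction rule: polyfun.induct)
    case (polyfun_const c)
    have "(\<lambda>A. c * 1) \<in> F.span {\<lambda>A. 1}" by (rule F.span_scale[OF F.span_base]) simp
    then show ?case using Rc by (intro exI[of _ "{\<lambda>A. 1}"]) simp
  next
    case (polyfun_coord \<psi> s)
    let ?Fs = "(\<lambda>t A. A t s) ` {..<r}"
    have "(\<lambda>A. \<psi> (xmul X A ! s)) \<in> F.span ?Fs" for X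
    proof -
      have "\<psi> (xmul X A ! s) = (\<Sum>t<r. \<psi> (X ! t) * A t s)" for A
        unfolding xmul_simps(2)[OF polyfun_coord(2)] linear_functional_fam[OF polyfun_coord(1)]
        by (simp add: mult.commute)
      then have "(\<lambda>A. \<psi> (xmul X A ! s)) = (\<Sum>t<r. (\<lambda>A. \<psi> (X ! t) * A t s))" by (intro ext) (simp add: sum_apply)
      also have "\<dots> \<in> F.span ?Fs"
      proof (rule F.span_sum)
        fix t assume "t \<in> {..<r}"
        from F.span_scale[OF F.span_base[OF imageI[OF this]], of "\<psi> (X ! t)" "\<lambda>t A. A t s"]
        show "(\<lambda>A. \<psi> (X ! t) * A t s) \<in> F.span ?Fs" .
      qed
      finally show ?thesis .
    qed
    moreover have "?Fs \<subseteq> R"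
      unfolding R_def using polyfun_coord(2) \<phi> by (auto intro!: polyfun.polyfun_coord)
    ultimately show ?case by (intro exI[of _ ?Fs]) simp
  next
    case (polyfun_add P Q)
    then obtain Fs Gs where F: "finite Fs" "Fs \<subseteq> R" "\<forall>X. (\<lambda>A. P (xmul X A)) \<in> F.span Fs"
      and G: "finite Gs" "Gs \<subseteq> R" "\<forall>X. (\<lambda>A. Q (xmul X A)) \<in> F.span Gs" by auto
    have "(\<lambda>A. P (xmul X A) + Q (xmul X A)) \<in> F.span (Fs \<union> Gs)" for X
    proof -
      have "(\<lambda>A. P (xmul X A)) \<in> F.span (Fs \<union> Gs)" "(\<lambda>A. Q (xmul X A)) \<in> F.span (Fs \<union> Gs)"
        using F(3) G(3) F.span_mono[of Fs "Fs \<union> Gs"] F.span_mono[of Gs "Fs \<union> Gs"] by auto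
      from F.span_add[OF this] show ?thesis by (simp add: plus_fun_def)
    qed
    then show ?case using F(1,2) G(1,2) by (intro exI[of _ "Fs \<union> Gs"]) simp
  next
    case (polyfun_mult P Q)
    then obtain Fs Gs where F: "finite Fs" "Fs \<subseteq> R" "\<forall>X. (\<lambda>A. P (xmul X A)) \<in> F.span Fs"
      and G: "finite Gs" "Gs \<subseteq> R" "\<forall>X. (\<lambda>A. Q (xmul X A)) \<in> F.span Gs" by auto
    let ?H = "(\<lambda>(f, h) A. f A * h A) ` (Fs \<times> Gs)"
    have "(\<lambda>A. P (xmul X A) * Q (xmul X A)) \<in> F.span ?H" for X
      by (rule prod) (use F(3) G(3) in auto)
    moreover have "finite ?H" using F(1) G(1) by simp
    moreover have "?H \<subseteq> R" using F(2) G(2) by (auto intro!: Rm)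
    ultimately show ?case by (intro exI[of _ ?H]) simp
  qed
  have "\<exists>Fs. finite Fs \<and> Fs \<subseteq> R \<and> (\<forall>i<n. \<forall>X. (\<lambda>A. P i (xmul X A)) \<in> F.span Fs)"
    using P
  proof (induction n)
    case 0 then show ?case by (intro exI[of _ "{}"]) simp
  next
    case (Suc n)
    then obtain Fs where F: "finite Fs" "Fs \<subseteq> R" "\<forall>i<n. \<forall>X. (\<lambda>A. P i (xmul X A)) \<in> F.span Fs" by auto
    have "P n \<in> polyfun g r" using Suc.prems by simp
    from expand[OF this] obtain Gs where G: "finite Gs" "Gs \<subseteq> R" "\<forall>X. (\<lambda>A. P n (xmul X A)) \<in> F.span Gs" by auto
    have "(\<lambda>A. P i (xmul X A)) \<in> F.span (Fs \<union> Gs)" if "i < Suc n" for i X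
      using F(3) G(3) F.span_mono[of Fs "Fs \<union> Gs"] F.span_mono[of Gs "Fs \<union> Gs"] that
      by (cases "i = n") auto
    then show ?case using F(1,2) G(1,2) by (intro exI[of _ "Fs \<union> Gs"]) simp
  qed
  then obtain Fs where F: "finite Fs" "Fs \<subseteq> R" "\<forall>i<n. \<forall>X. (\<lambda>A. P i (xmul X A)) \<in> F.span Fs" by auto
  \<comment> \<open>The nodes are taken in \<open>GL\<close>, so that translating a frame by a node
    gives a frame of the same subspace.\<close>
  have "\<exists>(N::nat) a h. (\<forall>i<N. a i \<in> GL \<and> h i \<in> R) \<and> (\<forall>i<N. \<forall>k<N. h i (a k) = (if i = k then 1 else 0)) \<and>
    (\<forall>f\<in>Fs. \<forall>x\<in>GL. f x = (\<Sum>i<N. f (a i) * h i x))"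
    by (rule interpolation[OF F(1,2)]) (use Rc Rm in auto)
  then obtain N :: nat and a h where a: "\<forall>i<N. a i \<in> GL \<and> h i \<in> R"
    "\<forall>f\<in>Fs. \<forall>x\<in>GL. f x = (\<Sum>i<N. f (a i) * h i x)" by (elim exE conjE) (rule that)
  have ext: "\<forall>x\<in>GL. f x = (\<Sum>i<N. f (a i) * h i x)" if "f \<in> F.span Fs" for f
    using that
  proof (induction f rule: F.span_induct_alt)
    case base then show ?case by simp
  next
    case (step c u v)
    show ?case
    proof
      fix x assume x: "x \<in> GL"
      have "u x = (\<Sum>i<N. u (a i) * h i x)" "v x = (\<Sum>i<N. v (a i) * h i x)" using a(2) step x by auto
      then have "c * u x + v x = c * (\<Sum>i<N. u (a i) * h i x) + (\<Sum>i<N. v (a i) * h i x)" by (simp only:)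
      also have "\<dots> = (\<Sum>i<N. (c * u (a i) + v (a i)) * h i x)"
        by (simp add: distrib_right sum.distrib sum_distrib_left mult.assoc)
      finally show "((\<lambda>A. c * u A) + v) x = (\<Sum>i<N. ((\<lambda>A. c * u A) + v) (a i) * h i x)" by simp
    qed
  qed
  have "P i (xmul X A) = (\<Sum>k<N. P i (xmul X (a k)) * h k A)" if "i < n" "A \<in> GL" for i X A
    using bspec[OF ext that(2), of "\<lambda>A. P i (xmul X A)"] F(3) that(1) by simp
  then show ?thesis using a(1) unfolding R_def by (intro exI[of _ N] exI[of _ a] exI[of _ h]) simp
qed

end

section \<open>Descent of the kernel through its pointwise description by socles\<close>

locale descent_pos = descent g M B r C j
  for g :: "('k::field, 'g::ab_group_add) lie_data" and M :: "('k, 'g, 'm::ab_group_add) mod_data" and B r C j +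
  assumes char_pos: "CHAR('k) > 0"
begin

lemma Rad_op:
  assumes "Y \<in> comm_frames g r" "lspan g Y \<in> Elem r g"
  shows "Rad g M j (lspan g Y) = V.span {op js Y m | js m. js \<in> exponents r j}"
  using Rad_frame[OF _ char_pos assms(1)] assms(2) unfolding Elem_def by simp

lemma Soc_op:
  assumes "Y \<in> comm_frames g r" "lspan g Y \<in> Elem r g"
  shows "Soc g M j (lspan g Y) = {m. \<forall>js\<in>exponents r j. op js Y m = 0}"
  using Soc_frame[OF _ char_pos assms(1)] assms(2) unfolding Elem_def by simp

lemma Soc_subspace:
  assumes "e \<in> Elem r g"
  shows "V.subspace (Soc g M j e)"
proof -
  obtain Y where Y: "Y \<in> comm_frames g r" "lspan g Y = e" by (rule Elem_frame[OF assms])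
  show ?thesis using Soc_op[OF Y(1)] assms unfolding Y(2) V.subspace_def
    by (simp add: op_zero op_add op_scale)
qed

lemma Ker_torsor_Soc:
  assumes X: "X \<subseteq> Elem r g"
  shows "s \<in> KerT X U \<longleftrightarrow> s \<in> trivial_sheaf scl (To X) U \<and> (\<forall>Y\<in>U. s Y \<in> Soc g M j (lspan g Y))"
proof (cases "s \<in> trivial_sheaf scl (To X) U")
  case True
  interpret T: fmod "To X" scl C by (rule fmod_To)
  have "U \<subseteq> topspace (zar (To X))" by (rule openin_subset[OF T.triv_open[OF True]])
  then have "Soc g M j (lspan g Y) = {m. \<forall>js\<in>exponents r j. op js Y m = 0}" if "Y \<in> U" for Y
    using Soc_op[of Y] X that unfolding topspace_torsor by auto
  then show ?thesis unfolding Ker_torsor_iff using True by auto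
qed (simp add: Ker_torsor_iff)

text \<open>The kernel condition is tested at each frame and depends only on its span, and every
  subalgebra in \<open>U\<close> has a frame above it. So the descended sheaf can be discussed on
  the base alone.\<close>

lemma desc_Ker_iff:
  assumes X: "X \<subseteq> Elem r g"
  shows "s \<in> desc X (KerT X) U \<longleftrightarrow> s \<in> trivial_sheaf scl (Ev X) U \<and> (\<forall>e\<in>U. s e \<in> Soc g M j e)"
proof (cases "s \<in> trivial_sheaf scl (Ev X) U")
  case True
  interpret S: fmod "Ev X" scl C by (rule fmod_Ev)
  have UX: "U \<subseteq> X" using openin_subset[OF S.triv_open[OF True]] topspace_Evar[OF X] by simp
  have "\<exists>Y. Y \<in> qi X U \<and> lspan g Y = e" if "e \<in> U" for e
  proof -
    have "e \<in> Elem r g" using that UX X by auto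
    then obtain Y where "Y \<in> comm_frames g r" "lspan g Y = e" by (rule Elem_frame)
    then show ?thesis using that UX by (auto simp: qi_iff)
  qed
  then have "(\<forall>Y\<in>qi X U. s (lspan g Y) \<in> Soc g M j (lspan g Y)) \<longleftrightarrow> (\<forall>e\<in>U. s e \<in> Soc g M j e)"
    by (fastforce simp: qi_iff)
  then show ?thesis unfolding desc_def mem_Collect_eq Ker_torsor_Soc[OF X] using triv_qi[OF X True] True by simp
qed (simp add: desc_def)

lemma Ker_torsor_subsheaf:
  assumes X: "X \<subseteq> Elem r g"
  shows "subsheaf scl (To X) (KerT X)"
proof -
  interpret T: fmod "To X" scl C by (rule fmod_To)
  have K: "s \<in> trivial_sheaf scl (To X) U" "\<And>js Y. js \<in> exponents r j \<Longrightarrow> Y \<in> U \<Longrightarrow> op js Y (s Y) = 0"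
      "openin (zar (To X)) U" if "s \<in> KerT X U" for s U
    using that T.triv_open unfolding Ker_torsor_iff by auto
  show ?thesis unfolding subsheaf_def
  proof (intro conjI allI impI)
    fix U show "KerT X U \<subseteq> trivial_sheaf scl (To X) U" using K(1) by auto
  next
    fix U s t assume "s \<in> KerT X U \<and> (\<forall>x\<in>U. s x = t x)"
    then have s: "s \<in> KerT X U" and st: "\<And>x. x \<in> U \<Longrightarrow> t x = s x" by auto
    show "t \<in> KerT X U" using T.triv_cong[OF K(1)[OF s] st] K(2)[OF s] st unfolding Ker_torsor_iff by simp
  next
    fix U W s assume "openin (zar (To X)) W \<and> W \<subseteq> U \<and> s \<in> KerT X U"
    then have W: "openin (zar (To X)) W" "W \<subseteq> U" and s: "s \<in> KerT X U" by auto
    show "s \<in> KerT X W" using T.triv_restr[OF K(1)[OF s] W] K(2)[OF s] W(2) unfolding Ker_torsor_iff by auto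
  next
    fix U s assume "openin (zar (To X)) U \<and> (\<forall>x\<in>U. \<exists>V. openin (zar (To X)) V \<and> x \<in> V \<and> V \<subseteq> U \<and> s \<in> KerT X V)"
    then have U: "openin (zar (To X)) U"
      and ex: "\<And>x. x \<in> U \<Longrightarrow> \<exists>V. openin (zar (To X)) V \<and> x \<in> V \<and> V \<subseteq> U \<and> s \<in> KerT X V" by auto
    have "s \<in> trivial_sheaf scl (To X) U"
    proof (rule T.triv_local[OF U])
      fix x assume "x \<in> U"
      from ex[OF this] obtain V where "openin (zar (To X)) V" "x \<in> V" "V \<subseteq> U" "s \<in> KerT X V"
        by (elim exE conjE) (rule that)
      then show "\<exists>W. openin (zar (To X)) W \<and> x \<in> W \<and> W \<subseteq> U \<and> s \<in> trivial_sheaf scl (To X) W"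
        using K(1) by (intro exI[of _ V]) auto
    qed
    moreover have "op js x (s x) = 0" if js: "js \<in> exponents r j" and x: "x \<in> U" for js x
    proof -
      from ex[OF x] obtain V where "x \<in> V" "s \<in> KerT X V" by (elim exE conjE) (rule that)
      then show ?thesis using K(2) js by blast
    qed
    ultimately show "s \<in> KerT X U" unfolding Ker_torsor_iff by simp
  next
    fix U assume U: "openin (zar (To X)) U"
    show "(\<lambda>x. 0) \<in> KerT X U" unfolding Ker_torsor_iff using T.triv_const[OF U] op_zero by simp
  next
    fix U s t assume "s \<in> KerT X U \<and> t \<in> KerT X U"
    then have s: "s \<in> KerT X U" and t: "t \<in> KerT X U" by auto
    show "(\<lambda>x. s x + t x) \<in> KerT X U"
      using T.triv_add[OF K(1)[OF s] K(1)[OF t]] K(2)[OF s] K(2)[OF t] unfolding Ker_torsor_iff by (simp add: op_add)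
  next
    fix U f s assume "f \<in> reg (To X) U \<and> s \<in> KerT X U"
    then have f: "f \<in> reg (To X) U" and s: "s \<in> KerT X U" by auto
    show "(\<lambda>x. scl (f x) (s x)) \<in> KerT X U"
      using T.triv_scale[OF f K(1)[OF s]] K(2)[OF s] unfolding Ker_torsor_iff by (simp add: op_scale)
  qed
qed

lemma basis_enum:
  "\<exists>(n::nat) m. (\<forall>i<n. m i \<in> C) \<and> (\<forall>v. v = (\<Sum>i<n. scl (V.representation C v (m i)) (m i)))"
proof -
  obtain m where m: "bij_betw m {..<card C} C"
    using ex_bij_betw_nat_finite[OF VF.finite_Basis] by (auto simp: lessThan_atLeast0)
  have "v = (\<Sum>i<card C. scl (V.representation C v (m i)) (m i))" for v
  proof -
    have "v = (\<Sum>c\<in>C. scl (V.representation C v c) c)"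
      using V.sum_representation_eq[of C v C] by (simp add: VF.independent_Basis VF.span_Basis VF.finite_Basis)
    also have "\<dots> = (\<Sum>i<card C. scl (V.representation C v (m i)) (m i))"
      by (rule sum.reindex_bij_betw[OF m, symmetric])
    finally show ?thesis .
  qed
  moreover have "\<forall>i<card C. m i \<in> C" using bij_betwE[OF m] by auto
  ultimately show ?thesis by blast
qed

text \<open>After clearing denominators the section is a polynomial \<open>K\<close>. Writing a
  frame as its normal frame times a matrix, interpolation separates the two: values of
  \<open>K\<close> at fixed translates of the normal frame, which depend only on the span, with
  coefficients depending on the matrix. A translate by an invertible matrix spans the same
  subalgebra, so these values lie in the same socle.\<close>

lemma Ker_pullback_local:
  assumes X: "X \<subseteq> Elem r g" and s: "s \<in> KerT X V" and y: "y \<in> V"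
  shows "\<exists>V' W (n::nat) f t. openin (zar (To X)) V' \<and> y \<in> V' \<and> V' \<subseteq> V \<and> openin (zar (Ev X)) W \<and>
    lspan g ` V' \<subseteq> W \<and> (\<forall>i<n. f i \<in> reg (To X) V' \<and> t i \<in> desc X (KerT X) W) \<and>
    (\<forall>z\<in>V'. s z = (\<Sum>i<n. scl (f i z) (t i (lspan g z))))"
proof -
  interpret T: fmod "To X" scl C by (rule fmod_To)
  interpret S: fmod "Ev X" scl C by (rule fmod_Ev)
  have sT: "s \<in> trivial_sheaf scl (To X) V" and sS: "\<And>Y. Y \<in> V \<Longrightarrow> s Y \<in> Soc g M j (lspan g Y)"
    using s unfolding Ker_torsor_Soc[OF X] by auto
  note V = T.triv_open[OF sT]
  have "lspan g y \<in> X" using subsetD[OF openin_subset[OF V] y] unfolding topspace_torsor by simp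
  from chart[OF X this] obtain U \<phi> \<sigma> where U: "lspan g y \<in> U" "is_chart X U \<phi> \<sigma>" by (elim exE conjE)
  note c = is_chartD[OF U(2)]
  from basis_enum obtain n :: nat and m where m: "\<forall>v. v = (\<Sum>i<n. scl (V.representation C v (m i)) (m i))"
    by (elim exE conjE) (rule that)
  let ?V = "V \<inter> qi X U"
  have V': "openin (zar (To X)) ?V" using V qi_open[OF X c(1)] by auto
  have yV: "y \<in> ?V" using y U(1) subsetD[OF openin_subset[OF V] y] unfolding qi_def by simp
  have "\<forall>i<n. (\<lambda>Y. V.representation C (s Y) (m i)) \<in> reg (To X) ?V"
    using T.triv_rep[OF V' T.triv_restr[OF sT V']] by auto
  from polyfun_local[OF V' yV this] obtain G P where G: "G \<in> polyfun g r" "\<forall>i<n. P i \<in> polyfun g r" "G y \<noteq> 0"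
    "\<forall>Y\<in>topspace (zar (To X)). G Y \<noteq> 0 \<longrightarrow> Y \<in> ?V \<and> (\<forall>i<n. V.representation C (s Y) (m i) = P i Y / G Y)"
    by (elim exE conjE) (rule that)
  \<comment> \<open>The second factor \<open>G\<close> makes \<open>K\<close> vanish where
    \<open>G\<close> does, so \<open>K\<close> takes values in the socles on the whole torsor. This
    matters because the translates of a normal frame may leave the neighbourhood on which
    \<open>s\<close> is defined.\<close>
  define Q where "Q i = (\<lambda>Y. G Y * P i Y)" for i
  have Qpoly: "\<forall>i<n. Q i \<in> polyfun g r" unfolding Q_def using G(1,2) by (auto intro: polyfun_mult)
  define K where "K Y = (\<Sum>i<n. scl (Q i Y) (m i))" for Y
  have sK: "s Y = scl (1 / (G Y * G Y)) (K Y)" and KS: "K Y = scl (G Y * G Y) (s Y)"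
    if Y: "Y \<in> topspace (zar (To X))" "G Y \<noteq> 0" for Y
  proof -
    have "s Y = (\<Sum>i<n. scl (V.representation C (s Y) (m i)) (m i))" using m by blast
    also have "\<dots> = (\<Sum>i<n. scl (1 / (G Y * G Y)) (scl (Q i Y) (m i)))"
      using G(4) Y unfolding Q_def by (intro sum.cong) auto
    also have "\<dots> = scl (1 / (G Y * G Y)) (K Y)" unfolding K_def V.scale_sum_right ..
    finally show e: "s Y = scl (1 / (G Y * G Y)) (K Y)" .
    show "K Y = scl (G Y * G Y) (s Y)" unfolding e using Y(2) by simp
  qed
  have KSoc: "K Y \<in> Soc g M j (lspan g Y)" if Y: "Y \<in> topspace (zar (To X))" for Y
  proof -
    have sub: "V.subspace (Soc g M j (lspan g Y))"
      using Y X unfolding topspace_torsor by (intro Soc_subspace) auto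
    show ?thesis
    proof (cases "G Y = 0")
      case True
      then have "K Y = 0" unfolding K_def Q_def by simp
      then show ?thesis using V.subspace_0[OF sub] by simp
    next
      case False
      then have "Y \<in> V" using G(4) Y by blast
      then show ?thesis unfolding KS[OF Y False] using V.subspace_scale[OF sub sS] by simp
    qed
  qed
  from polyfun_interpolation[OF c(5) Qpoly] obtain N :: nat and a h where
    a: "\<forall>k<N. a k \<in> GL \<and> (\<lambda>Y. h k (\<lambda>t s. \<phi> t (Y ! s))) \<in> polyfun g r"
    and ip: "\<forall>i<n. \<forall>X. \<forall>A\<in>GL. Q i (xmul X A) = (\<Sum>k<N. Q i (xmul X (a k)) * h k A)"
    by (elim exE conjE) (rule that)
  \<comment> \<open>\<open>t k\<close> evaluates \<open>K\<close> at the \<open>k\<close>-th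
    translate of the normal frame, a function on the base; \<open>f k\<close> carries the matrix
    coefficient and undoes the factor \<open>G^2\<close>.\<close>
  define t where "t k e = K (xmul (\<sigma> e) (a k))" for k e
  define f where "f k = (\<lambda>Y. h k (\<lambda>t s. \<phi> t (Y ! s)) / (G Y * G Y))" for k
  have top: "openin (zar (To X)) (topspace (zar (To X)))" by (rule openin_topspace)
  have dom: "{x \<in> U. \<sigma> x \<in> topspace (zar (To X))} = U" using morphD(2)[OF c(3)] by auto
  have pol: "(\<lambda>x. P (\<sigma> x)) \<in> reg (Ev X) U" if "P \<in> polyfun g r" for P
    using morphD(4)[OF c(3) top coord_reg[OF top that]] unfolding dom .
  have tdesc: "t k \<in> desc X (KerT X) U" if k: "k < N" for k
    unfolding desc_Ker_iff[OF X]
  proof (intro conjI ballI)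
    show "t k \<in> trivial_sheaf scl (Ev X) U"
      unfolding t_def[abs_def] K_def
      by (intro S.triv_sum c(1) S.triv_scale S.triv_const pol xmul_polyfun) (use Qpoly in auto)
    fix e assume e: "e \<in> U"
    have \<sigma>: "\<sigma> e \<in> comm_frames g r" by (rule section_comm_frame[OF U(2) e])
    then have fr: "\<sigma> e \<in> frames g r" unfolding comm_frames_def by simp
    let ?Z = "xmul (\<sigma> e) (a k)"
    have sp: "lspan g ?Z = e" using xmul_GL(2)[OF _ fr, of "a k"] a k c(4)[OF e] by simp
    have "?Z \<in> comm_frames g r"
      by (rule comm_framesI) (use xmul_GL(1)[OF _ fr, of "a k"] a k sp e c(2) X in auto)
    then have "?Z \<in> topspace (zar (To X))" unfolding topspace_torsor using sp e c(2) by auto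
    from KSoc[OF this] show "t k e \<in> Soc g M j e" unfolding t_def sp .
  qed
  let ?W = "{Y \<in> ?V. G Y \<noteq> 0}"
  have GV: "G \<in> reg (To X) ?V" by (rule coord_reg[OF V' G(1)])
  have W: "openin (zar (To X)) ?W" by (rule T.openin_nonzero[OF V' GV])
  have freg: "f k \<in> reg (To X) ?W" if k: "k < N" for k
    unfolding f_def
  proof (rule T.reg_divide[OF V' _ T.reg_mult[OF V' GV GV] W])
    show "(\<lambda>Y. h k (\<lambda>t s. \<phi> t (Y ! s))) \<in> reg (To X) ?V" using a k by (intro coord_reg[OF V']) auto
  qed auto
  have main: "s z = (\<Sum>k<N. scl (f k z) (t k (lspan g z)))" if z: "z \<in> ?W" for z
  proof -
    have z': "z \<in> topspace (zar (To X))" "G z \<noteq> 0" "z \<in> comm_frames g r" "lspan g z \<in> U"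
      using z openin_subset[OF V] unfolding qi_def topspace_torsor by auto
    let ?A = "\<lambda>t s. \<phi> t (z ! s)"
    note fm = frame_matrix[OF U(2) z'(3,4)]
    have "K z = (\<Sum>i<n. scl (Q i (xmul (\<sigma> (lspan g z)) ?A)) (m i))" unfolding K_def fm(1) ..
    also have "\<dots> = (\<Sum>i<n. \<Sum>k<N. scl (h k ?A) (scl (Q i (xmul (\<sigma> (lspan g z)) (a k))) (m i)))"
      using ip fm(2) by (intro sum.cong refl) (simp add: V.scale_sum_left mult.commute)
    also have "\<dots> = (\<Sum>k<N. scl (h k ?A) (t k (lspan g z)))"
      unfolding t_def K_def V.scale_sum_right by (rule sum.swap)
    finally have Kz: "K z = (\<Sum>k<N. scl (h k ?A) (t k (lspan g z)))" .
    show ?thesis unfolding sK[OF z'(1,2)] Kz V.scale_sum_right f_def by simp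
  qed
  show ?thesis
    by (rule exI[of _ ?W], rule exI[of _ U], rule exI[of _ N], rule exI[of _ f], rule exI[of _ t])
      (use W yV G(3) c(1) freg tdesc main in \<open>auto simp: qi_def\<close>)
qed

text \<open>Generators are produced by \<open>chart_noetherian\<close> in coordinates with respect
  to a basis of \<open>M\<close>: for each point, lying in the socle is a linear condition on the
  coordinate vector.\<close>

theorem Ker_sheaf_eq:
  assumes X: "X \<subseteq> Elem r g"
  shows "Ker_sheaf g B M r j X = desc X (KerT X)" "coherent_subsheaf scl (Ev X) (desc X (KerT X))"
proof -
  interpret S: fmod "Ev X" scl C by (rule fmod_Ev)
  have pb: "pullback_subsheaf scl (To X) (lspan g) (Ev X) (desc X (KerT X)) = KerT X"
    by (rule pullback_subsheafI[OF X Ker_torsor_subsheaf[OF X] Ker_pullback_local[OF X]])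
  from basis_enum obtain n :: nat and m where m: "\<forall>v. v = (\<Sum>i<n. scl (V.representation C v (m i)) (m i))"
    by (elim exE conjE) (rule that)
  have ft: "finite_type scl (Ev X) X (desc X (KerT X))"
    unfolding finite_type_def
  proof
    fix x assume "x \<in> X"
    from chart[OF X this] obtain U \<phi> \<sigma> where U: "x \<in> U" "is_chart X U \<phi> \<sigma>" by (elim exE conjE)
    note c = is_chartD[OF U(2)]
    let ?P = "\<lambda>x v. (\<Sum>i<n. scl (v i) (m i)) \<in> Soc g M j x"
    have "\<exists>(N::nat) d. (\<forall>k<N. (\<forall>i<n. (\<lambda>x. d k x i) \<in> reg (Ev X) U) \<and> (\<forall>x\<in>U. ?P x (d k x))) \<and>
      (\<forall>V h. openin (zar (Ev X)) V \<and> V \<subseteq> U \<and> (\<forall>i<n. (\<lambda>x. h x i) \<in> reg (Ev X) V) \<and> (\<forall>x\<in>V. ?P x (h x)) \<longrightarrow>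
        (\<forall>y\<in>V. \<exists>W f. openin (zar (Ev X)) W \<and> y \<in> W \<and> W \<subseteq> V \<and> (\<forall>k<N. f k \<in> reg (Ev X) W) \<and>
          (\<forall>z\<in>W. \<forall>i<n. h z i = (\<Sum>k<N. f k z * d k z i))))"
    proof (rule chart_noetherian[OF X U(2), of ?P n])
      fix x v w a assume x: "x \<in> U" and vw: "?P x v" "?P x w"
      have sub: "V.subspace (Soc g M j x)" using x c(2) X by (intro Soc_subspace) auto
      have "(\<Sum>i<n. scl (v i + a * w i) (m i)) = (\<Sum>i<n. scl (v i) (m i)) + scl a (\<Sum>i<n. scl (w i) (m i))"
        by (simp add: V.scale_left_distrib sum.distrib V.scale_sum_right)
      then show "?P x (\<lambda>i. v i + a * w i)" using V.subspace_add[OF sub vw(1) V.subspace_scale[OF sub vw(2)]] by simp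
    next
      fix x assume x: "x \<in> U"
      have sub: "V.subspace (Soc g M j x)" using x c(2) X by (intro Soc_subspace) auto
      show "?P x (\<lambda>i. 0)" using V.subspace_0[OF sub] by simp
    next
      fix x v w assume "?P x v" "\<And>i. i < n \<Longrightarrow> v i = w i"
      then show "?P x w" by simp
    qed
    then obtain N :: nat and d where d: "\<forall>k<N. (\<forall>i<n. (\<lambda>x. d k x i) \<in> reg (Ev X) U) \<and> (\<forall>x\<in>U. ?P x (d k x))"
      and gen: "\<forall>V h. openin (zar (Ev X)) V \<and> V \<subseteq> U \<and> (\<forall>i<n. (\<lambda>x. h x i) \<in> reg (Ev X) V) \<and> (\<forall>x\<in>V. ?P x (h x)) \<longrightarrow>
        (\<forall>y\<in>V. \<exists>W f. openin (zar (Ev X)) W \<and> y \<in> W \<and> W \<subseteq> V \<and> (\<forall>k<N. f k \<in> reg (Ev X) W) \<and>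
          (\<forall>z\<in>W. \<forall>i<n. h z i = (\<Sum>k<N. f k z * d k z i)))"
      by (elim exE conjE) (rule that)
    define s where "s k = (\<lambda>x. \<Sum>i<n. scl (d k x i) (m i))" for k
    have sdesc: "s k \<in> desc X (KerT X) U" if "k < N" for k
    proof -
      have "s k \<in> trivial_sheaf scl (Ev X) U"
        unfolding s_def using d that by (intro S.triv_sum c(1) S.triv_scale S.triv_const) auto
      then show ?thesis unfolding desc_Ker_iff[OF X] using d that unfolding s_def by simp
    qed
    have main: "\<exists>W f. openin (zar (Ev X)) W \<and> y \<in> W \<and> W \<subseteq> V \<and> (\<forall>i<N. f i \<in> reg (Ev X) W) \<and>
            (\<forall>z\<in>W. t z = (\<Sum>i<N. scl (f i z) (s i z)))"
      if V: "openin (zar (Ev X)) V" "V \<subseteq> U" and t: "t \<in> desc X (KerT X) V" and y: "y \<in> V" for V t y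
    proof -
      let ?h = "\<lambda>x i. V.representation C (t x) (m i)"
      have t': "t \<in> trivial_sheaf scl (Ev X) V" "\<forall>x\<in>V. t x \<in> Soc g M j x" using t unfolding desc_Ker_iff[OF X] by auto
      have mt: "(\<Sum>i<n. scl (?h x i) (m i)) = t x" for x using m by metis
      have "openin (zar (Ev X)) V \<and> V \<subseteq> U \<and> (\<forall>i<n. (\<lambda>x. ?h x i) \<in> reg (Ev X) V) \<and> (\<forall>x\<in>V. ?P x (?h x))"
        unfolding mt using V t' S.triv_rep[OF V(1) t'(1)] by simp
      from bspec[OF mp[OF spec[OF spec[OF gen]] this] y] obtain W f where W:
        "openin (zar (Ev X)) W" "y \<in> W" "W \<subseteq> V" "\<forall>k<N. f k \<in> reg (Ev X) W"
        "\<forall>z\<in>W. \<forall>i<n. ?h z i = (\<Sum>k<N. f k z * d k z i)"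
        by (elim exE conjE) (rule that)
      have "t z = (\<Sum>k<N. scl (f k z) (s k z))" if z: "z \<in> W" for z
      proof -
        have "t z = (\<Sum>i<n. scl (?h z i) (m i))" unfolding mt ..
        also have "\<dots> = (\<Sum>i<n. \<Sum>k<N. scl (f k z) (scl (d k z i) (m i)))"
          using W(5) z by (intro sum.cong refl) (simp add: V.scale_sum_left)
        also have "\<dots> = (\<Sum>k<N. scl (f k z) (s k z))" unfolding s_def V.scale_sum_right by (rule sum.swap)
        finally show ?thesis .
      qed
      then show ?thesis using W(1-4) by (intro exI[of _ W] exI[of _ f]) simp
    qed
    show "\<exists>U (n::nat) s. openin (zar (Ev X)) U \<and> x \<in> U \<and> U \<subseteq> X \<and> (\<forall>i<n. s i \<in> desc X (KerT X) U) \<and>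
       (\<forall>V t. openin (zar (Ev X)) V \<and> V \<subseteq> U \<and> t \<in> desc X (KerT X) V \<longrightarrow>
         (\<forall>y\<in>V. \<exists>W f. openin (zar (Ev X)) W \<and> y \<in> W \<and> W \<subseteq> V \<and> (\<forall>i<n. f i \<in> reg (Ev X) W) \<and>
            (\<forall>z\<in>W. t z = (\<Sum>i<n. scl (f i z) (s i z)))))"
    proof (rule exI[of _ U], rule exI[of _ N], rule exI[of _ s], intro conjI allI impI ballI)
      fix V t y assume "openin (zar (Ev X)) V \<and> V \<subseteq> U \<and> t \<in> desc X (KerT X) V" "y \<in> V"
      then show "\<exists>W f. openin (zar (Ev X)) W \<and> y \<in> W \<and> W \<subseteq> V \<and> (\<forall>i<N. f i \<in> reg (Ev X) W) \<and>
            (\<forall>z\<in>W. t z = (\<Sum>i<N. scl (f i z) (s i z)))"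
        by (elim conjE) (rule main)
    qed (use c(1,2) U(1) sdesc in auto)
  qed
  show coh: "coherent_subsheaf scl (Ev X) (desc X (KerT X))"
    by (rule coherentI[OF X desc_subsheaf[OF X Ker_torsor_subsheaf[OF X]] ft])
  show "Ker_sheaf g B M r j X = desc X (KerT X)"
    unfolding Ker_sheaf_def by (rule descended_sheaf_eq[OF X coh pb])
qed

end

section \<open>Vector bundles and their fibres\<close>

context descent
begin

text \<open>Cramer's formula gives the coefficients of any combination as regular linear expressions
  in its value. Applied to the value 0 it yields independence near \<open>x0\<close>, applied to a
  section it yields regular coefficients.\<close>

lemma frame_local:
  assumes S: "fmod S scl C" and "openin (zar S) U" "x0 \<in> U" and t: "\<forall>i<n. t i \<in> trivial_sheaf scl S U"
    and ind0: "indep_fam scl n (\<lambda>i. t i x0)"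
  shows "\<exists>W. openin (zar S) W \<and> x0 \<in> W \<and> W \<subseteq> U \<and> (\<forall>x\<in>W. indep_fam scl n (\<lambda>i. t i x)) \<and>
    (\<forall>V v. openin (zar S) V \<and> V \<subseteq> W \<and> v \<in> trivial_sheaf scl S V \<and>
       (\<forall>x\<in>V. \<exists>c. v x = (\<Sum>i<n. scl (c i) (t i x))) \<longrightarrow>
       (\<exists>f. (\<forall>i<n. f i \<in> reg S V) \<and> (\<forall>x\<in>V. v x = (\<Sum>i<n. scl (f i x) (t i x)))))"
proof -
  interpret S: fmod S scl C by (rule S)
  from S.indep_fam_local[OF assms(2,3) t[rule_format] ind0] obtain W \<psi> c where W: "openin (zar S) W" "x0 \<in> W" "W \<subseteq> U"
    and \<psi>: "\<And>b. b < n \<Longrightarrow> Vector_Spaces.linear scl (*) (\<psi> b)"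
    and c: "\<And>a b. a < n \<Longrightarrow> b < n \<Longrightarrow> c a b \<in> reg S W"
    and cr: "\<And>x y v a. x \<in> W \<Longrightarrow> v = (\<Sum>a<n. scl (y a) (t a x)) \<Longrightarrow> a < n \<Longrightarrow> y a = (\<Sum>b<n. c a b x * \<psi> b v)"
    by blast
  have ind: "indep_fam scl n (\<lambda>i. t i x)" if x: "x \<in> W" for x
    unfolding indep_fam_def
  proof (intro allI impI)
    fix y a assume "(\<Sum>i<n. scl (y i) (t i x)) = 0" and a: "a < n"
    then have "y a = (\<Sum>b<n. c a b x * \<psi> b 0)" using cr[OF x _ a, of 0 y] by simp
    moreover have "\<psi> b 0 = 0" if "b < n" for b
      using linear_functional_fam[OF \<psi>[OF that], of _ _ "{}"] by simp
    ultimately show "y a = 0" by simp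
  qed
  have "\<exists>f. (\<forall>i<n. f i \<in> reg S V) \<and> (\<forall>x\<in>V. v x = (\<Sum>i<n. scl (f i x) (t i x)))"
    if V: "openin (zar S) V" "V \<subseteq> W" and v: "v \<in> trivial_sheaf scl S V"
      and comb: "\<forall>x\<in>V. \<exists>c. v x = (\<Sum>i<n. scl (c i) (t i x))" for V v
  proof -
    define f where "f a = (\<lambda>x. \<Sum>b<n. c a b x * \<psi> b (v x))" for a
    have "f a \<in> reg S V" if "a < n" for a
      unfolding f_def
      by (intro S.reg_sum S.reg_mult V(1) S.reg_restr[OF W(1) V c] S.triv_linear[OF V(1) v \<psi>]) (use that in auto)
    moreover have "v x = (\<Sum>i<n. scl (f i x) (t i x))" if x: "x \<in> V" for x
    proof -
      obtain y where y: "v x = (\<Sum>i<n. scl (y i) (t i x))" using comb x by blast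
      have xW: "x \<in> W" using x V(2) by auto
      have "y i = f i x" if "i < n" for i unfolding f_def by (rule cr[OF xW y that])
      then show ?thesis unfolding y by simp
    qed
    ultimately show ?thesis by (intro exI[of _ f]) simp
  qed
  then show ?thesis using W ind by (intro exI[of _ W]) simp
qed

text \<open>\<open>N e\<close> is the space of values allowed at \<open>e\<close>. Sections
  independent at \<open>x\<close> remain so nearby, and the dimension bound makes them a basis of
  \<open>N e\<close>, so they trivialise \<open>F\<close>. The fibre is then read off from values: a
  section vanishing at \<open>x\<close> has coefficients in the maximal ideal.\<close>

lemma bundle_fibres:
  fixes S :: "('x, 'k) fspace"
  assumes S: "fmod S scl C" and coh: "coherent_subsheaf scl S F"
    and N0: "\<forall>U t. t \<in> F U \<longrightarrow> (\<forall>e\<in>U. t e \<in> N e)"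
    and loc: "\<forall>x\<in>topspace (zar S). \<exists>U (n::nat) s. openin (zar S) U \<and> x \<in> U \<and> (\<forall>i<n. s i \<in> F U) \<and>
      indep_fam scl n (\<lambda>i. s i x) \<and> (\<forall>e\<in>U. V.dim (N e) \<le> n)"
  shows "vector_bundle scl S F" and "x \<in> topspace (zar S) \<Longrightarrow> fibre_identified scl S F x (N x)"
proof -
  interpret S: fmod S scl C by (rule S)
  have sub: "subsheaf scl S F" using coh unfolding coherent_subsheaf_def by simp
  note D = subsheafD[OF sub]
  have N: "t e \<in> N e" if "t \<in> F U" "e \<in> U" for U t e using N0 that by blast
  have frame: "\<exists>U (n::nat) s. openin (zar S) U \<and> x \<in> U \<and> (\<forall>i<n. s i \<in> F U) \<and>
      (\<forall>e\<in>U. indep_fam scl n (\<lambda>i. s i e)) \<and> (\<forall>e\<in>U. \<forall>v\<in>N e. \<exists>c. v = (\<Sum>i<n. scl (c i) (s i e))) \<and>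
      (\<forall>V t. openin (zar S) V \<and> V \<subseteq> U \<and> t \<in> F V \<longrightarrow>
         (\<exists>f. (\<forall>i<n. f i \<in> reg S V) \<and> (\<forall>y\<in>V. t y = (\<Sum>i<n. scl (f i y) (s i y)))))"
    if x: "x \<in> topspace (zar S)" for x
  proof -
    from bspec[OF loc x] obtain U and n :: nat and s where U: "openin (zar S) U" "x \<in> U" "\<forall>i<n. s i \<in> F U"
      "indep_fam scl n (\<lambda>i. s i x)" "\<forall>e\<in>U. V.dim (N e) \<le> n"
      by (elim exE conjE) (rule that)
    have "\<forall>i<n. s i \<in> trivial_sheaf scl S U" using D(1) U(3) by blast
    from frame_local[OF S U(1,2) this U(4)] obtain W where W: "openin (zar S) W" "x \<in> W" "W \<subseteq> U"
      and ind: "\<forall>x\<in>W. indep_fam scl n (\<lambda>i. s i x)"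
      and cr: "\<forall>V v. openin (zar S) V \<and> V \<subseteq> W \<and> v \<in> trivial_sheaf scl S V \<and>
       (\<forall>x\<in>V. \<exists>c. v x = (\<Sum>i<n. scl (c i) (s i x))) \<longrightarrow>
       (\<exists>f. (\<forall>i<n. f i \<in> reg S V) \<and> (\<forall>x\<in>V. v x = (\<Sum>i<n. scl (f i x) (s i x))))"
      by (elim exE conjE) (rule that)
    have sp: "\<exists>c. v = (\<Sum>i<n. scl (c i) (s i e))" if "e \<in> W" "v \<in> N e" for e v
      by (rule VF.indep_fam_spans[OF bspec[OF ind that(1)] _ _ that(2)]) (use N[OF U(3)[rule_format]] U(5) W(3) that in auto)
    have "\<exists>f. (\<forall>i<n. f i \<in> reg S V) \<and> (\<forall>y\<in>V. t y = (\<Sum>i<n. scl (f i y) (s i y)))"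
      if V: "openin (zar S) V" "V \<subseteq> W" and t: "t \<in> F V" for V t
    proof (rule cr[rule_format], intro conjI ballI)
      fix y assume y: "y \<in> V"
      then show "\<exists>c. t y = (\<Sum>i<n. scl (c i) (s i y))" using sp[of y "t y"] N[OF t y] V(2) by auto
    qed (use V D(1)[OF t] in auto)
    moreover have "\<forall>i<n. s i \<in> F W" using D(3)[OF W(1,3)] U(3) by auto
    ultimately show ?thesis using W(1,2) ind sp
      by (intro exI[of _ W], intro exI[of _ n], intro exI[of _ s]) simp
  qed
  show "vector_bundle scl S F"
    unfolding vector_bundle_def
  proof (intro conjI coh ballI)
    fix x assume "x \<in> topspace (zar S)"
    from frame[OF this] obtain U and n :: nat and s where U: "openin (zar S) U" "x \<in> U" "\<forall>i<n. s i \<in> F U"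
      "\<forall>e\<in>U. indep_fam scl n (\<lambda>i. s i e)"
      and f: "\<forall>V t. openin (zar S) V \<and> V \<subseteq> U \<and> t \<in> F V \<longrightarrow>
         (\<exists>f. (\<forall>i<n. f i \<in> reg S V) \<and> (\<forall>y\<in>V. t y = (\<Sum>i<n. scl (f i y) (s i y))))"
      by (elim exE conjE) (rule that)
    show "\<exists>U (n::nat) s. openin (zar S) U \<and> x \<in> U \<and> (\<forall>i<n. s i \<in> F U) \<and>
       (\<forall>V. openin (zar S) V \<and> V \<subseteq> U \<longrightarrow>
         (\<forall>t\<in>F V. \<exists>f. (\<forall>i<n. f i \<in> reg S V) \<and> (\<forall>y\<in>V. t y = (\<Sum>i<n. scl (f i y) (s i y)))) \<and>
         (\<forall>f. (\<forall>i<n. f i \<in> reg S V) \<and> (\<forall>y\<in>V. (\<Sum>i<n. scl (f i y) (s i y)) = 0) \<longrightarrow>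
              (\<forall>i<n. \<forall>y\<in>V. f i y = 0)))"
    proof (rule exI[of _ U], rule exI[of _ n], rule exI[of _ s], intro conjI allI impI ballI)
      fix V t assume "openin (zar S) V \<and> V \<subseteq> U" "t \<in> F V"
      then show "\<exists>f. (\<forall>i<n. f i \<in> reg S V) \<and> (\<forall>y\<in>V. t y = (\<Sum>i<n. scl (f i y) (s i y)))"
        by (intro f[rule_format]) simp
    next
      fix V f i y assume V: "openin (zar S) V \<and> V \<subseteq> U" and y: "y \<in> V" "i < n"
        and f: "(\<forall>i<n. f i \<in> reg S V) \<and> (\<forall>y\<in>V. (\<Sum>i<n. scl (f i y) (s i y)) = 0)"
      have "indep_fam scl n (\<lambda>i. s i y)" using U(4) V y by auto
      from indep_famD[OF this, of "\<lambda>i. f i y", OF _ y(2)] show "f i y = 0" using f y(1) by simp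
    qed (use U in auto)
  qed
  assume x: "x \<in> topspace (zar S)"
  let ?L = "local_sections S F x"
  from frame[OF x] obtain U0 and n :: nat and s0 where U0: "openin (zar S) U0" "x \<in> U0" "\<forall>i<n. s0 i \<in> F U0"
    "\<forall>e\<in>U0. indep_fam scl n (\<lambda>i. s0 i e)" "\<forall>e\<in>U0. \<forall>v\<in>N e. \<exists>c. v = (\<Sum>i<n. scl (c i) (s0 i e))"
    and f0: "\<forall>V t. openin (zar S) V \<and> V \<subseteq> U0 \<and> t \<in> F V \<longrightarrow>
         (\<exists>f. (\<forall>i<n. f i \<in> reg S V) \<and> (\<forall>y\<in>V. t y = (\<Sum>i<n. scl (f i y) (s0 i y))))"
    by (elim exE conjE) (rule that)
  have L: "(U, s) \<in> ?L \<longleftrightarrow> openin (zar S) U \<and> x \<in> U \<and> s \<in> F U" for U s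
    unfolding local_sections_def by simp
  \<comment> \<open>The fibre relation is equality of values at \<open>x\<close>. One direction
    evaluates the combination at \<open>x\<close>; for the other, the coefficients of the difference
    in the local frame vanish at \<open>x\<close> by independence.\<close>
  have rel: "((U, s), (V, t)) \<in> fibre_rel scl S F x \<longleftrightarrow> (U, s) \<in> ?L \<and> (V, t) \<in> ?L \<and> s x = t x" for U s V t
  proof
    assume "((U, s), (V, t)) \<in> fibre_rel scl S F x"
    then have a: "(U, s) \<in> ?L" "(V, t) \<in> ?L" and "\<exists>W (n::nat) f u. openin (zar S) W \<and> x \<in> W \<and> W \<subseteq> U \<inter> V \<and>
           (\<forall>i<n. f i \<in> reg S W \<and> f i x = 0 \<and> u i \<in> F W) \<and>
           (\<forall>y\<in>W. s y - t y = (\<Sum>i<n. scl (f i y) (u i y)))"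
      unfolding fibre_rel_def by auto
    from this(3) obtain W and m :: nat and f u where "x \<in> W" "\<forall>i<m. f i \<in> reg S W \<and> f i x = 0 \<and> u i \<in> F W"
        "\<forall>y\<in>W. s y - t y = (\<Sum>i<m. scl (f i y) (u i y))" by (elim exE conjE) (rule that)
    then have "s x - t x = 0" by simp
    then show "(U, s) \<in> ?L \<and> (V, t) \<in> ?L \<and> s x = t x" using a by simp
  next
    assume a: "(U, s) \<in> ?L \<and> (V, t) \<in> ?L \<and> s x = t x"
    then have U: "openin (zar S) U" "x \<in> U" "s \<in> F U" and V: "openin (zar S) V" "x \<in> V" "t \<in> F V" unfolding L by auto
    let ?W = "U \<inter> V \<inter> U0"
    have W: "openin (zar S) ?W" using U(1) V(1) U0(1) by auto
    have "s \<in> F ?W" "t \<in> F ?W" using D(3)[OF W _ U(3)] D(3)[OF W _ V(3)] by auto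
    from D(6)[OF this(1) D(7)[OF S.reg_const[OF W, of "- 1"] this(2)]]
    have st: "(\<lambda>y. s y - t y) \<in> F ?W" by simp
    from f0[rule_format, of ?W, OF conjI[OF W conjI[OF _ st]]] obtain f where
      f: "\<forall>i<n. f i \<in> reg S ?W" "\<forall>y\<in>?W. s y - t y = (\<Sum>i<n. scl (f i y) (s0 i y))" by auto
    have xW: "x \<in> ?W" using U V U0 by simp
    have "f i x = 0" if "i < n" for i
      by (rule indep_famD[OF bspec[OF U0(4,2)], of "\<lambda>i. f i x", OF _ that]) (use f(2) xW a in \<open>metis right_minus_eq\<close>)
    moreover have "\<forall>i<n. s0 i \<in> F ?W" using D(3)[OF W] U0(3) by auto
    ultimately have "\<exists>W (n::nat) f u. openin (zar S) W \<and> x \<in> W \<and> W \<subseteq> U \<inter> V \<and>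
           (\<forall>i<n. f i \<in> reg S W \<and> f i x = 0 \<and> u i \<in> F W) \<and>
           (\<forall>y\<in>W. s y - t y = (\<Sum>i<n. scl (f i y) (u i y)))"
      by - (rule exI[of _ ?W], rule exI[of _ n], rule exI[of _ f], rule exI[of _ s0], use W xW f in auto)
    then show "((U, s), (V, t)) \<in> fibre_rel scl S F x" unfolding fibre_rel_def using a by simp
  qed
  \<comment> \<open>The class attached to a value \<open>v\<close>. It is inverse to
    \<open>fibre_map x\<close> on \<open>N x\<close>, and the vector space operations on classes
    become those on values.\<close>
  define cl where "cl v = {(V, t). (V, t) \<in> ?L \<and> t x = v}" for v
  have cls: "fibre_rel scl S F x `` {(U, s)} = cl (s x)" if "(U, s) \<in> ?L" for U s
    unfolding cl_def using that rel by auto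
  have ne: "\<exists>U s. (U, s) \<in> ?L \<and> s x = v" if v: "v \<in> N x" for v
  proof -
    obtain c where c: "v = (\<Sum>i<n. scl (c i) (s0 i x))" using U0(2,5) v by blast
    have "(\<lambda>y. \<Sum>i<n. scl (c i) (s0 i y)) \<in> F U0"
      by (rule subsheaf_sum[OF sub U0(1)]) (use U0(3) S.reg_const[OF U0(1)] in auto)
    then show ?thesis unfolding L using U0(1,2) c by (intro exI[of _ U0] exI[of _ "\<lambda>y. \<Sum>i<n. scl (c i) (s0 i y)"]) simp
  qed
  have val: "s x \<in> N x" if "(U, s) \<in> ?L" for U s using that N unfolding L by blast
  have fib: "fibre scl S F x = cl ` N x"
  proof (intro equalityI subsetI)
    fix A assume "A \<in> fibre scl S F x"
    then obtain U s where "(U, s) \<in> ?L" "A = fibre_rel scl S F x `` {(U, s)}"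
      unfolding fibre_def quotient_def by auto
    then show "A \<in> cl ` N x" using cls val by auto
  next
    fix A assume "A \<in> cl ` N x"
    then obtain v where v: "v \<in> N x" "A = cl v" by auto
    then obtain U s where "(U, s) \<in> ?L" "s x = v" using ne by blast
    then show "A \<in> fibre scl S F x" unfolding fibre_def using cls v(2) by (metis quotientI)
  qed
  have map: "fibre_map x (cl v) = v" if v: "v \<in> N x" for v
  proof -
    obtain U s where "(U, s) \<in> ?L" "s x = v" using ne[OF v] by blast
    then have "(\<lambda>(U, s). s x) ` cl v = {v}" unfolding cl_def by force
    then show ?thesis unfolding fibre_map_def by simp
  qed
  have add: "fibre_add scl S F x (cl v) (cl w) = cl (v + w)" "v + w \<in> N x" if v: "v \<in> N x" and w: "w \<in> N x" for v w
  proof -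
    have 1: "(U \<inter> V, \<lambda>y. s y + t y) \<in> ?L" if "(U, s) \<in> ?L" "(V, t) \<in> ?L" for U s V t
    proof -
      from that have UV: "openin (zar S) U" "x \<in> U" "s \<in> F U" "openin (zar S) V" "x \<in> V" "t \<in> F V" unfolding L by auto
      have o: "openin (zar S) (U \<inter> V)" using UV by auto
      show ?thesis unfolding L using D(6)[OF D(3)[OF o _ UV(3)] D(3)[OF o _ UV(6)]] o UV by simp
    qed
    obtain U s V t where st: "(U, s) \<in> ?L" "s x = v" "(V, t) \<in> ?L" "t x = w" using ne[OF v] ne[OF w] by blast
    show "v + w \<in> N x" using val[OF 1[OF st(1,3)]] st by simp
    have 2: "fibre_rel scl S F x `` {(U \<inter> V, \<lambda>y. s y + t y)} = cl (v + w)"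
      if "(U, s) \<in> cl v" "(V, t) \<in> cl w" for U s V t
      using cls[OF 1, of U s V t] that unfolding cl_def by simp
    have 3: "(U, s) \<in> cl v" "(V, t) \<in> cl w" using st unfolding cl_def by auto
    show "fibre_add scl S F x (cl v) (cl w) = cl (v + w)"
      unfolding fibre_add_def
    proof (rule SUP_eq_const)
      show "cl v \<noteq> {}" using 3(1) by auto
      fix p assume p: "p \<in> cl v"
      obtain U s where Us: "p = (U, s)" by (cases p)
      have "(\<Union>(V, t)\<in>cl w. fibre_rel scl S F x `` {(U \<inter> V, \<lambda>y. s y + t y)}) = cl (v + w)"
      proof (rule SUP_eq_const)
        show "cl w \<noteq> {}" using 3(2) by auto
        fix q assume "q \<in> cl w"
        then show "(case q of (V, t) \<Rightarrow> fibre_rel scl S F x `` {(U \<inter> V, \<lambda>y. s y + t y)}) = cl (v + w)"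
          using 2 p unfolding Us by (cases q) simp
      qed
      then show "(case p of (U, s) \<Rightarrow> \<Union>(V, t)\<in>cl w. fibre_rel scl S F x `` {(U \<inter> V, \<lambda>y. s y + t y)}) = cl (v + w)"
        unfolding Us by simp
    qed
  qed
  have sc: "fibre_scale scl S F x c (cl v) = cl (scl c v)" "scl c v \<in> N x" if v: "v \<in> N x" for c v
  proof -
    have 1: "(U, \<lambda>y. scl c (s y)) \<in> ?L" if "(U, s) \<in> ?L" for U s
      using that D(7)[OF S.reg_const] unfolding L by auto
    obtain U s where st: "(U, s) \<in> ?L" "s x = v" using ne[OF v] by blast
    show "scl c v \<in> N x" using val[OF 1[OF st(1)]] st by simp
    have 2: "fibre_rel scl S F x `` {(U, \<lambda>y. scl c (s y))} = cl (scl c v)" if "(U, s) \<in> cl v" for U s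
      using cls[OF 1, of U s] that unfolding cl_def by simp
    have 3: "(U, s) \<in> cl v" using st unfolding cl_def by auto
    show "fibre_scale scl S F x c (cl v) = cl (scl c v)"
      unfolding fibre_scale_def
    proof (rule SUP_eq_const)
      show "cl v \<noteq> {}" using 3 by auto
      fix p assume "p \<in> cl v"
      then show "(case p of (U, s) \<Rightarrow> fibre_rel scl S F x `` {(U, \<lambda>y. scl c (s y))}) = cl (scl c v)"
        using 2 by (cases p) simp
    qed
  qed
  have cl_val: "s x = v" if "(U, s) \<in> cl v" for U s v using that unfolding cl_def by simp
  show "fibre_identified scl S F x (N x)"
    unfolding fibre_identified_def fib
  proof (intro conjI ballI allI)
    fix A p assume "A \<in> cl ` N x" "p \<in> A"
    then show "case p of (U, s) \<Rightarrow> fibre_map x A = s x" using map cl_val by (cases p) auto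
  next
    fix A A' assume "A \<in> cl ` N x" "A' \<in> cl ` N x"
    then obtain v w where vw: "v \<in> N x" "A = cl v" "w \<in> N x" "A' = cl w" by auto
    note a = add[OF vw(1,3)]
    show "fibre_add scl S F x A A' \<in> cl ` N x" unfolding vw(2,4) a(1) by (rule imageI[OF a(2)])
    show "fibre_map x (fibre_add scl S F x A A') = fibre_map x A + fibre_map x A'"
      unfolding vw(2,4) a(1) map[OF vw(1)] map[OF vw(3)] map[OF a(2)] ..
  next
    show "bij_betw (fibre_map x) (cl ` N x) (N x)"
      by (rule bij_betwI[where g = cl]) (use map in auto)
  next
    fix c A assume "A \<in> cl ` N x"
    then obtain v where v: "v \<in> N x" "A = cl v" by auto
    note a = sc[OF v(1), of c]
    show "fibre_scale scl S F x c A \<in> cl ` N x" unfolding v(2) a(1) by (rule imageI[OF a(2)])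
    show "fibre_map x (fibre_scale scl S F x c A) = scl c (fibre_map x A)"
      unfolding v(2) a(1) map[OF v(1)] map[OF a(2)] ..
  qed
qed

end

context descent_pos
begin

section \<open>Radicals and socles of constant dimension\<close>

text \<open>A local expression of the pulled-back section, evaluated at a single frame of
  \<open>e\<close>, is a sum of values of the monomials that span the radical.\<close>

lemma desc_Im_Rad:
  assumes X: "X \<subseteq> Elem r g" and t: "t \<in> desc X (ImT X) U" and e: "e \<in> U"
  shows "t e \<in> Rad g M j e"
proof -
  interpret S: fmod "Ev X" scl C by (rule fmod_Ev)
  have U: "openin (zar (Ev X)) U" using t S.triv_open unfolding desc_def by auto
  have eX: "e \<in> X" using openin_subset[OF U] topspace_Evar[OF X] e by auto
  obtain Y where Y: "Y \<in> comm_frames g r" "lspan g Y = e" using Elem_frame eX X by blast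
  have Yq: "Y \<in> qi X U" unfolding qi_iff using Y e eX by simp
  have tq: "(\<lambda>Y. t (lspan g Y)) \<in> ImT X (qi X U)" using t unfolding desc_def by simp
  obtain V u where "Y \<in> V" "\<forall>y\<in>V. t (lspan g y) = (\<Sum>js\<in>exponents r j. op js y (u js y))"
    using Im_torsorE[OF tq Yq] .
  then have "t e = (\<Sum>js\<in>exponents r j. op js Y (u js Y))" using Y(2) by auto
  moreover have "\<dots> \<in> V.span {op js Y m | js m. js \<in> exponents r j}"
    by (intro V.span_sum V.span_base) auto
  ultimately show ?thesis using Rad_op[OF Y(1)] Y(2) eX X by auto
qed

text \<open>A basis of the radical at \<open>x\<close> is chosen among the vectors
  \<open>op js (\<sigma> x) m\<close>. Keeping \<open>js\<close> and \<open>m\<close> and letting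
  the frame move along \<open>\<sigma>\<close> extends each of them to a section.\<close>

lemma Rad_sections:
  assumes X: "X \<subseteq> Elem r g" and x: "x \<in> X"
  shows "\<exists>U s. openin (zar (Ev X)) U \<and> x \<in> U \<and> (\<forall>i<V.dim (Rad g M j x). s i \<in> desc X (ImT X) U) \<and>
    indep_fam scl (V.dim (Rad g M j x)) (\<lambda>i. s i x)"
proof -
  from chart[OF X x] obtain U \<phi> \<sigma> where U: "x \<in> U" "is_chart X U \<phi> \<sigma>" by (elim exE conjE)
  note c = is_chartD[OF U(2)]
  let ?R = "Rad g M j x"
  let ?A = "{op js (\<sigma> x) m | js m. js \<in> exponents r j}"
  have R: "?R = V.span ?A"
    using Rad_op[OF section_comm_frame[OF U(2,1)]] c(4)[OF U(1)] x X by auto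
  obtain t where t: "indep_fam scl (V.dim ?R) t" "\<And>i. i < V.dim ?R \<Longrightarrow> t i \<in> ?A"
    by (rule VF.subspace_indep_fam[of ?R ?A]) (use R V.span_superset in auto)
  have "\<forall>i. \<exists>p. i < V.dim ?R \<longrightarrow> fst p \<in> exponents r j \<and> t i = op (fst p) (\<sigma> x) (snd p)"
  proof
    fix i
    show "\<exists>p. i < V.dim ?R \<longrightarrow> fst p \<in> exponents r j \<and> t i = op (fst p) (\<sigma> x) (snd p)"
    proof (cases "i < V.dim ?R")
      case True
      then obtain js m where "t i = op js (\<sigma> x) m" "js \<in> exponents r j" using t(2) by blast
      then show ?thesis by (intro exI[of _ "(js, m)"]) simp
    qed simp
  qed
  from choice[OF this] obtain p where
    p: "\<forall>i. i < V.dim ?R \<longrightarrow> fst (p i) \<in> exponents r j \<and> t i = op (fst (p i)) (\<sigma> x) (snd (p i))" ..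
  let ?s = "\<lambda>i e. op (fst (p i)) (\<sigma> e) (snd (p i))"
  have "indep_fam scl (V.dim ?R) (\<lambda>i. ?s i x)" using t(1) p unfolding indep_fam_def by simp
  moreover have "\<forall>i<V.dim ?R. ?s i \<in> desc X (ImT X) U" using gen_in_desc[OF X U(2)] p by blast
  ultimately show ?thesis using U(1) c(1) by - (rule exI[of _ U], rule exI[of _ ?s], simp)
qed

text \<open>The sections that form a basis at \<open>x\<close> stay independent nearby and still
  take values in the radicals there.\<close>

lemma Rad_dim_semicontinuous:
  assumes X: "X \<subseteq> Elem r g" and x: "x \<in> X"
  shows "\<exists>W. openin (zar (Ev X)) W \<and> x \<in> W \<and> (\<forall>e\<in>W. V.dim (Rad g M j x) \<le> V.dim (Rad g M j e))"
proof -
  let ?n = "V.dim (Rad g M j x)"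
  from Rad_sections[OF X x] obtain U s where U: "openin (zar (Ev X)) U" "x \<in> U"
    "\<forall>i<?n. s i \<in> desc X (ImT X) U" "indep_fam scl ?n (\<lambda>i. s i x)"
    by (elim exE conjE) (rule that)
  have "\<forall>i<?n. s i \<in> trivial_sheaf scl (Ev X) U" using U(3) unfolding desc_def by simp
  from frame_local[OF fmod_Ev U(1,2) this U(4)] obtain W where W: "openin (zar (Ev X)) W" "x \<in> W" "W \<subseteq> U"
    "\<forall>e\<in>W. indep_fam scl ?n (\<lambda>i. s i e)" by (elim exE conjE) (rule that)
  have "?n \<le> V.dim (Rad g M j e)" if e: "e \<in> W" for e
    by (rule VF.indep_fam_le_dim[OF bspec[OF W(4) e]]) (use desc_Im_Rad[OF X] U(3) W(3) e in blast)
  then show ?thesis using W(1,2) by blast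
qed

theorem Im_bundle:
  assumes X: "X \<subseteq> Elem r g" and d: "\<And>e. e \<in> X \<Longrightarrow> V.dim (Rad g M j e) = d"
  shows "vector_bundle scl (Ev X) (Im_sheaf g B M r j X)"
    and "x \<in> X \<Longrightarrow> fibre_identified scl (Ev X) (Im_sheaf g B M r j X) x (Rad g M j x)"
proof -
  note I = Im_sheaf_eq[OF X]
  have N: "\<forall>U t. t \<in> desc X (ImT X) U \<longrightarrow> (\<forall>e\<in>U. t e \<in> Rad g M j e)" using desc_Im_Rad[OF X] by blast
  have loc: "\<forall>x\<in>topspace (zar (Ev X)). \<exists>U (n::nat) s. openin (zar (Ev X)) U \<and> x \<in> U \<and>
      (\<forall>i<n. s i \<in> desc X (ImT X) U) \<and> indep_fam scl n (\<lambda>i. s i x) \<and> (\<forall>e\<in>U. V.dim (Rad g M j e) \<le> n)"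
  proof
    fix x assume "x \<in> topspace (zar (Ev X))"
    then have x: "x \<in> X" using topspace_Evar[OF X] by simp
    from Rad_sections[OF X x] obtain U s where U: "openin (zar (Ev X)) U" "x \<in> U"
      "\<forall>i<V.dim (Rad g M j x). s i \<in> desc X (ImT X) U" "indep_fam scl (V.dim (Rad g M j x)) (\<lambda>i. s i x)"
      by (elim exE conjE) (rule that)
    have "\<forall>e\<in>U. V.dim (Rad g M j e) \<le> V.dim (Rad g M j x)"
      using openin_subset[OF U(1)] topspace_Evar[OF X] d x by (metis order_refl subsetD)
    then show "\<exists>U (n::nat) s. openin (zar (Ev X)) U \<and> x \<in> U \<and>
      (\<forall>i<n. s i \<in> desc X (ImT X) U) \<and> indep_fam scl n (\<lambda>i. s i x) \<and> (\<forall>e\<in>U. V.dim (Rad g M j e) \<le> n)"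
      using U by (intro exI[of _ U], intro exI[of _ "V.dim (Rad g M j x)"], intro exI[of _ s]) simp
  qed
  show "vector_bundle scl (Ev X) (Im_sheaf g B M r j X)"
    unfolding I(1) by (rule bundle_fibres(1)[OF fmod_Ev I(2) N loc])
  show "fibre_identified scl (Ev X) (Im_sheaf g B M r j X) x (Rad g M j x)" if "x \<in> X"
    unfolding I(1) by (rule bundle_fibres(2)[OF fmod_Ev I(2) N loc]) (use that topspace_Evar[OF X] in simp_all)
qed

text \<open>Near \<open>x\<close> the operators restricted to a complement of the socle at \<open>x\<close> stay injective; \<open>m\<close> is a
  basis of that complement, and \<open>\<beta>\<close> comes from inverting the matrix of the operators on it.\<close>

lemma Soc_coordinates:
  assumes X: "X \<subseteq> Elem r g" and x: "x \<in> X"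
  shows "\<exists>W (n::nat) m \<beta>. openin (zar (Ev X)) W \<and> x \<in> W \<and> n + V.dim (Soc g M j x) = V.dim (UNIV :: 'm set) \<and>
    (\<forall>b<n. \<forall>v. (\<lambda>e. \<beta> b e v) \<in> reg (Ev X) W) \<and>
    (\<forall>e\<in>W. \<forall>b<n. Vector_Spaces.linear scl (*) (\<beta> b e) \<and> (\<forall>a<n. \<beta> b e (m a) = (if a = b then 1 else 0)) \<and>
      (\<forall>v\<in>Soc g M j e. \<beta> b e v = 0))"
proof -
  interpret S: fmod "Ev X" scl C by (rule fmod_Ev)
  from chart[OF X x] obtain U \<phi> \<sigma> where U: "x \<in> U" "is_chart X U \<phi> \<sigma>" by (elim exE conjE)
  note c = is_chartD[OF U(2)]
  have Soc: "Soc g M j e = {m. \<forall>js\<in>exponents r j. op js (\<sigma> e) m = 0}" if "e \<in> U" for e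
    using Soc_op[OF section_comm_frame[OF U(2) that]] c(4)[OF that] that c(2) X by auto
  let ?K = "Soc g M j x"
  have K: "V.subspace ?K" using Soc_subspace x X by blast
  obtain A where A: "A \<subseteq> ?K" "V.independent A" "?K \<subseteq> V.span A" "card A = V.dim ?K" using V.basis_exists by blast
  have KA: "?K = V.span A" using A(3) V.span_minimal[OF A(1) K] by blast
  let ?E = "V.extend_basis A"
  note E = V.extend_basis_superset[OF A(2)] V.independent_extend_basis[OF A(2)] V.span_extend_basis[OF A(2)]
  let ?D = "?E - A" and ?n = "card (?E - A)"
  have fin: "finite ?E" by (rule VF.finiteI_independent[OF E(2)])
  have "card ?E = V.dim (UNIV :: 'm set)" using V.dim_eq_card[of ?E UNIV] E(2,3) by simp
  moreover have "card ?E = ?n + card A" using card_Diff_subset[of A ?E] card_mono[OF fin E(1)] finite_subset[OF E(1) fin] E(1) by simp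
  ultimately have n: "?n + V.dim ?K = V.dim (UNIV :: 'm set)" using A(4) by simp
  have indD: "V.independent ?D" by (rule V.independent_mono[OF E(2)]) auto
  obtain m where m: "bij_betw m {..<?n} ?D"
    using ex_bij_betw_nat_finite[of ?D] fin by (auto simp: lessThan_atLeast0)
  have mD: "m ` {..<?n} = ?D" using m by (auto simp: bij_betw_def)
  have indm: "indep_fam scl ?n m" by (rule V.independent_indep_fam[OF indD m])
  \<comment> \<open>A dimension count: the two spans together give \<open>M\<close>, and their
    dimensions already add up to that of \<open>M\<close>.\<close>
  have int: "V.span A \<inter> V.span ?D \<subseteq> {0}"
  proof -
    have u: "A \<union> ?D = ?E" using E(1) by auto
    have "{x + y | x y. x \<in> V.span A \<and> y \<in> V.span ?D} = V.span (A \<union> ?D)" by (rule V.span_Un[symmetric])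
    also have "\<dots> = UNIV" unfolding u by (rule E(3))
    finally have "V.dim (UNIV :: 'm set) + V.dim (V.span A \<inter> V.span ?D) = V.dim (V.span A) + V.dim (V.span ?D)"
      using VF.dim_sums_Int[OF V.subspace_span[of A] V.subspace_span[of ?D]] by (simp only:)
    moreover have "V.dim (V.span A) = V.dim ?K" using KA by simp
    moreover have "V.dim (V.span ?D) = ?n" using V.dim_eq_card_independent[OF indD] by simp
    ultimately have "V.dim (V.span A \<inter> V.span ?D) = 0" using n by linarith
    then show ?thesis by (simp only: VF.dim_eq_0)
  qed
  \<comment> \<open>All monomials of degree \<open>j\<close> in one linear map, whose kernel at
    \<open>e\<close> is the socle. At \<open>x\<close> it is injective on the complement, so the
    vectors \<open>T x (m b)\<close> are independent and admit dual functionals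
    \<open>\<psi>\<close>.\<close>
  define T where "T e v = (\<lambda>js. if js \<in> exponents r j then op js (\<sigma> e) v else 0)" for e v
  interpret P: vector_space "\<lambda>(a::'k) (f :: nat list \<Rightarrow> 'm) js. scl a (f js)"
    by unfold_locales (auto simp: V.scale_right_distrib V.scale_left_distrib)
  have Tsum: "T e (\<Sum>i<k. scl (y i) (w i)) = (\<Sum>i<k. (\<lambda>js. scl (y i) (T e (w i) js)))" for e k y w
    by (rule ext) (simp add: T_def sum_apply linear_sum_scale[OF op_linear])
  have indT: "indep_fam (\<lambda>a f js. scl a (f js)) ?n (\<lambda>b. T x (m b))"
    unfolding indep_fam_def
  proof (intro allI impI)
    fix y b assume y: "(\<Sum>i<?n. (\<lambda>js. scl (y i) (T x (m i) js))) = 0" and b: "b < ?n"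
    let ?v = "\<Sum>i<?n. scl (y i) (m i)"
    have "T x ?v = 0" unfolding Tsum by (rule y)
    then have "?v \<in> ?K" unfolding Soc[OF U(1)] T_def by (auto simp: fun_eq_iff split: if_splits)
    moreover have "?v \<in> V.span ?D" using V.span_fam[of ?v m ?n] unfolding mD by blast
    ultimately have "?v = 0" using int KA by auto
    from indep_famD[OF indm this b] show "y b = 0" .
  qed
  from P.dual_functionals[OF indT] obtain \<psi> where
    \<psi>: "\<And>b. b < ?n \<Longrightarrow> Vector_Spaces.linear (\<lambda>a f js. scl a (f js)) (*) (\<psi> b)"
      "\<And>a b. b < ?n \<Longrightarrow> a < ?n \<Longrightarrow> \<psi> b (T x (m a)) = (if a = b then 1 else 0)" by blast
  have lin: "Vector_Spaces.linear scl (*) (\<lambda>v. \<psi> b (T e v))" if b: "b < ?n" for b e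
  proof -
    have "T e (v + w) = T e v + T e w" "T e (scl a v) = (\<lambda>js. scl a (T e v js))" for v w a
      unfolding T_def by (auto simp: fun_eq_iff op_add op_scale)
    then show ?thesis using \<psi>(1)[OF b] V.vector_space_axioms unfolding Vector_Spaces.linear_iff by simp
  qed
  \<comment> \<open>\<open>\<psi>\<close> lives on the space of all functions of exponents.
    Splitting \<open>T e v\<close> into its finitely many components turns it into functionals on
    \<open>M\<close>, to which regularity of the sections \<open>op js (\<sigma> e) v\<close>
    applies.\<close>
  have regT: "(\<lambda>e. \<psi> b (T e v)) \<in> reg (Ev X) U" if b: "b < ?n" for b v
  proof -
    let ?i = "\<lambda>js (w::'m) js'. if js' = js then w else 0"
    have e: "\<psi> b (T e v) = (\<Sum>js\<in>exponents r j. \<psi> b (?i js (op js (\<sigma> e) v)))" for e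
    proof -
      have "T e v = (\<Sum>js\<in>exponents r j. (\<lambda>js'. scl 1 (?i js (op js (\<sigma> e) v) js')))"
        by (rule ext) (simp add: T_def sum_apply finite_exponents)
      then have "\<psi> b (T e v) = (\<Sum>js\<in>exponents r j. 1 * \<psi> b (?i js (op js (\<sigma> e) v)))"
        by (simp only: linear_functional_fam[OF \<psi>(1)[OF b]])
      then show ?thesis by simp
    qed
    have l: "Vector_Spaces.linear scl (*) (\<lambda>w. \<psi> b (?i js w))" for js
    proof -
      have "?i js (v + w) = ?i js v + ?i js w" "?i js (scl a v) = (\<lambda>js'. scl a (?i js v js'))" for v w a
        by (auto simp: fun_eq_iff)
      then show ?thesis using \<psi>(1)[OF b] V.vector_space_axioms unfolding Vector_Spaces.linear_iff by simp
    qed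
    have "(\<lambda>e. op js (\<sigma> e) v) \<in> trivial_sheaf scl (Ev X) U" if "js \<in> exponents r j" for js
      using gen_in_desc[OF X U(2) that] unfolding desc_def by simp
    then show ?thesis unfolding e by (intro S.reg_sum c(1) S.triv_linear[OF c(1) _ l])
  qed
  have "\<exists>W d. openin (zar (Ev X)) W \<and> x \<in> W \<and> W \<subseteq> U \<and> (\<forall>i<?n. \<forall>k<?n. d i k \<in> reg (Ev X) W) \<and>
    (\<forall>e\<in>W. \<forall>y z. (\<forall>i<?n. (\<Sum>k<?n. \<psi> i (T e (m k)) * y k) = z i) \<longleftrightarrow> (\<forall>i<?n. y i = (\<Sum>k<?n. d i k e * z k)))"
    by (rule S.local_inverse[OF c(1) U(1), of ?n "\<lambda>i k e. \<psi> i (T e (m k))"]) (use regT \<psi>(2) in auto)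
  then obtain W d where W: "openin (zar (Ev X)) W" "x \<in> W" "W \<subseteq> U" "\<forall>i<?n. \<forall>k<?n. d i k \<in> reg (Ev X) W"
    and inv: "\<forall>e\<in>W. \<forall>y z. (\<forall>i<?n. (\<Sum>k<?n. \<psi> i (T e (m k)) * y k) = z i) \<longleftrightarrow> (\<forall>i<?n. y i = (\<Sum>k<?n. d i k e * z k))"
    by (elim exE conjE) (rule that)
  \<comment> \<open>The matrix of \<open>\<psi> i (T e (m k))\<close> is inverted near
    \<open>x\<close>, so these functionals become exactly dual to \<open>m\<close> at every nearby
    \<open>e\<close>; they kill the socle at \<open>e\<close> because they factor through
    \<open>T e\<close>.\<close>
  define \<beta> where "\<beta> b e v = (\<Sum>k<?n. d b k e * \<psi> k (T e v))" for b e v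
  have \<beta>reg: "(\<lambda>e. \<beta> b e v) \<in> reg (Ev X) W" if "b < ?n" for b v
    unfolding \<beta>_def using W(4) that
    by (intro S.reg_sum S.reg_mult W(1) S.reg_restr[OF c(1) W(1,3) regT]) auto
  have \<beta>lin: "Vector_Spaces.linear scl (*) (\<beta> b e)" for b e
    using lin V.vector_space_axioms S.linear_representation unfolding Vector_Spaces.linear_iff \<beta>_def
    by (auto simp: sum.distrib[symmetric] sum_distrib_left algebra_simps intro!: sum.cong)
  have \<beta>m: "\<beta> b e (m a) = (if a = b then 1 else 0)" if "e \<in> W" "a < ?n" "b < ?n" for e a b
  proof -
    let ?y = "\<lambda>k. if k = a then 1 else (0::'k)"
    have "(\<Sum>k<?n. \<psi> i (T e (m k)) * ?y k) = \<psi> i (T e (m a))" for i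
    proof -
      have "(\<Sum>k<?n. \<psi> i (T e (m k)) * ?y k) = (\<Sum>k<?n. if k = a then \<psi> i (T e (m k)) else 0)"
        by (rule sum.cong) auto
      then show ?thesis using that(2) by simp
    qed
    then have "\<forall>i<?n. ?y i = (\<Sum>k<?n. d i k e * \<psi> k (T e (m a)))"
      using bspec[OF inv that(1), THEN spec, THEN spec, of ?y "\<lambda>i. \<psi> i (T e (m a))"] by blast
    then show ?thesis unfolding \<beta>_def using that(3) by auto
  qed
  have \<beta>0: "\<beta> b e v = 0" if "e \<in> W" "v \<in> Soc g M j e" for b e v
  proof -
    have eU: "e \<in> U" using that(1) W(3) by auto
    have "T e v = T e (0::'m)" using that(2) unfolding Soc[OF eU] T_def by (auto simp: op_zero fun_eq_iff)
    moreover have "\<psi> k (T e 0) = 0" if "k < ?n" for k using linear_functional_fam[OF lin[OF that], of _ _ _ "{}"] by simp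
    ultimately show ?thesis unfolding \<beta>_def by simp
  qed
  show ?thesis
    by (rule exI[of _ W], rule exI[of _ ?n], rule exI[of _ m], rule exI[of _ \<beta>])
      (use W(1,2) n \<beta>reg \<beta>lin \<beta>m \<beta>0 in auto)
qed

end

context descent_pos
begin

text \<open>The vectors \<open>m\<close> are independent and their span meets the common kernel of
  the \<open>\<beta> b\<close> only in 0, because the \<open>\<beta> b\<close> read off the
  coefficients. Hence the common kernel has codimension at least \<open>n\<close>.\<close>

lemma complement_coordinates:
  fixes n :: nat
  assumes lin: "\<forall>b<n. Vector_Spaces.linear scl (*) (\<beta> b)" and dual: "\<forall>b<n. \<forall>a<n. \<beta> b (m a) = (if a = b then 1 else 0)"
  shows "V.subspace {v. \<forall>b<n. \<beta> b v = 0}" "n + V.dim {v. \<forall>b<n. \<beta> b v = 0} \<le> V.dim (UNIV :: 'm set)"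
proof -
  let ?Z = "{v. \<forall>b<n. \<beta> b v = 0}"
  have l: "\<beta> b (\<Sum>i\<in>I. scl (c i) (w i)) = (\<Sum>i\<in>I. c i * \<beta> b (w i))" if "b < n" for b c w and I :: "nat set"
    by (rule linear_functional_fam) (use lin that in blast)
  have "\<beta> b (v + w) = \<beta> b v + \<beta> b w" "\<beta> b (scl c v) = c * \<beta> b v" if "b < n" for b v w c
    using lin that unfolding Vector_Spaces.linear_iff by auto
  moreover have "\<beta> b 0 = 0" if "b < n" for b using l[OF that, of _ _ "{}"] by simp
  ultimately show Z: "V.subspace ?Z" unfolding V.subspace_def by simp
  have coeff: "\<beta> b (\<Sum>i<n. scl (c i) (m i)) = c b" if b: "b < n" for b c
  proof -
    have "(\<Sum>i<n. c i * \<beta> b (m i)) = (\<Sum>i<n. if i = b then c i else 0)"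
      using dual b by (intro sum.cong) auto
    then show ?thesis unfolding l[OF b] using b by simp
  qed
  have ind: "indep_fam scl n m"
    unfolding indep_fam_def
  proof (intro allI impI)
    fix c b assume "(\<Sum>i<n. scl (c i) (m i)) = 0" and b: "b < n"
    then show "c b = 0" using coeff[OF b, of c] l[OF b, of _ _ "{}"] by simp
  qed
  let ?D = "V.span (m ` {..<n})"
  have "?Z \<inter> ?D \<subseteq> {0}"
  proof
    fix v assume v: "v \<in> ?Z \<inter> ?D"
    then obtain c where c: "v = (\<Sum>i<n. scl (c i) (m i))" using V.span_fam by blast
    then have "c b = 0" if "b < n" for b using coeff[OF that, of c] v that by simp
    then show "v \<in> {0}" unfolding c by simp
  qed
  then have "V.dim (?Z \<inter> ?D) = 0" by (simp only: VF.dim_eq_0)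
  moreover have "V.dim ?D = n"
    using V.dim_eq_card_independent[OF V.indep_fam_independent[OF ind]] card_image[OF V.indep_fam_inj_on[OF ind]] by simp
  moreover have "V.dim {v + w | v w. v \<in> ?Z \<and> w \<in> ?D} \<le> V.dim (UNIV :: 'm set)" by (rule VF.dim_subset) simp
  ultimately show "n + V.dim ?Z \<le> V.dim (UNIV :: 'm set)"
    using VF.dim_sums_Int[OF Z V.subspace_span[of "m ` {..<n}"]] by linarith
qed

text \<open>Near \<open>x\<close> the socle lies in the common kernel of the
  \<open>\<beta> b\<close>, whose dimension is at most \<open>dim M - n\<close>, which is the
  dimension of the socle at \<open>x\<close>.\<close>

lemma Soc_dim_semicontinuous:
  assumes X: "X \<subseteq> Elem r g" and x: "x \<in> X"
  shows "\<exists>W. openin (zar (Ev X)) W \<and> x \<in> W \<and> (\<forall>e\<in>W. V.dim (Soc g M j e) \<le> V.dim (Soc g M j x))"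
proof -
  from Soc_coordinates[OF X x] obtain W and n :: nat and m \<beta> where W: "openin (zar (Ev X)) W" "x \<in> W"
    "n + V.dim (Soc g M j x) = V.dim (UNIV :: 'm set)"
    and \<beta>: "\<forall>e\<in>W. \<forall>b<n. Vector_Spaces.linear scl (*) (\<beta> b e) \<and> (\<forall>a<n. \<beta> b e (m a) = (if a = b then 1 else 0)) \<and>
      (\<forall>v\<in>Soc g M j e. \<beta> b e v = 0)"
    by (elim exE conjE) (rule that)
  have "V.dim (Soc g M j e) \<le> V.dim (Soc g M j x)" if e: "e \<in> W" for e
  proof -
    have "n + V.dim {v. \<forall>b<n. \<beta> b e v = 0} \<le> V.dim (UNIV :: 'm set)"
      by (rule complement_coordinates(2)[of n "\<lambda>b. \<beta> b e" m]) (use \<beta> e in auto)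
    moreover have "V.dim (Soc g M j e) \<le> V.dim {v. \<forall>b<n. \<beta> b e v = 0}"
      by (rule VF.dim_subset) (use \<beta> e in auto)
    ultimately show ?thesis using W(3) by linarith
  qed
  then show ?thesis using W(1,2) by blast
qed

text \<open>With constant dimension the socle near \<open>x\<close> equals the common kernel of the
  \<open>\<beta> b\<close>, so it is the image of a projection that varies regularly. Projecting a
  basis of the socle at \<open>x\<close> gives the sections.\<close>

lemma Soc_sections:
  assumes X: "X \<subseteq> Elem r g" and x: "x \<in> X" and d: "\<forall>e\<in>X. V.dim (Soc g M j e) = d"
  shows "\<exists>U s. openin (zar (Ev X)) U \<and> x \<in> U \<and> (\<forall>i<d. s i \<in> desc X (KerT X) U) \<and> indep_fam scl d (\<lambda>i. s i x)"
proof -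
  interpret S: fmod "Ev X" scl C by (rule fmod_Ev)
  from Soc_coordinates[OF X x] obtain W and n :: nat and m \<beta> where W: "openin (zar (Ev X)) W" "x \<in> W"
    "n + V.dim (Soc g M j x) = V.dim (UNIV :: 'm set)"
    and reg: "\<forall>b<n. \<forall>v. (\<lambda>e. \<beta> b e v) \<in> reg (Ev X) W"
    and \<beta>: "\<forall>e\<in>W. \<forall>b<n. Vector_Spaces.linear scl (*) (\<beta> b e) \<and> (\<forall>a<n. \<beta> b e (m a) = (if a = b then 1 else 0)) \<and>
      (\<forall>v\<in>Soc g M j e. \<beta> b e v = 0)"
    by (elim exE conjE) (rule that)
  have WX: "W \<subseteq> X" using openin_subset[OF W(1)] topspace_Evar[OF X] by simp
  have Soc: "Soc g M j e = {v. \<forall>b<n. \<beta> b e v = 0}" if e: "e \<in> W" for e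
  proof -
    have lin: "\<forall>b<n. Vector_Spaces.linear scl (*) (\<beta> b e)"
      and dual: "\<forall>b<n. \<forall>a<n. \<beta> b e (m a) = (if a = b then 1 else 0)" using \<beta> e by auto
    note cc = complement_coordinates[OF lin dual]
    have "V.dim (Soc g M j e) = d" "V.dim (Soc g M j x) = d" using d e x WX by auto
    then show ?thesis
      by (intro VF.subspace_dim_equal Soc_subspace cc(1)) (use cc(2) W(3) \<beta> e WX X in auto)
  qed
  obtain k where k: "indep_fam scl d k" "\<And>i. i < d \<Longrightarrow> k i \<in> Soc g M j x"
  proof (rule VF.subspace_indep_fam[of "Soc g M j x" "Soc g M j x"])
    fix t assume "indep_fam scl (V.dim (Soc g M j x)) t" "\<And>i. i < V.dim (Soc g M j x) \<Longrightarrow> t i \<in> Soc g M j x"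
    then show thesis using that[of t] d x by simp
  qed (rule V.span_superset, rule subset_refl)
  \<comment> \<open>The projection along the span of \<open>m\<close> onto the common kernel of the
    functionals; at \<open>x\<close> it fixes \<open>k i\<close>, as \<open>k i\<close> lies in the
    socle there.\<close>
  define s where "s i e = k i - (\<Sum>b<n. scl (\<beta> b e (k i)) (m b))" for i e
  have "s i \<in> desc X (KerT X) W" for i
    unfolding desc_Ker_iff[OF X]
  proof (intro conjI ballI)
    have "(\<lambda>e. k i + scl (- 1) (\<Sum>b<n. scl (\<beta> b e (k i)) (m b))) \<in> trivial_sheaf scl (Ev X) W"
      by (intro S.triv_add S.triv_scale S.triv_const S.triv_sum S.reg_const W(1)) (use reg in auto)
    then show "s i \<in> trivial_sheaf scl (Ev X) W" unfolding s_def by simp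
    fix e assume e: "e \<in> W"
    have "\<beta> a e (s i e) = 0" if a: "a < n" for a
    proof -
      have lin: "Vector_Spaces.linear scl (*) (\<beta> a e)" using \<beta> e a by blast
      have sub: "\<beta> a e (v - w) = \<beta> a e v - \<beta> a e w" for v w
      proof -
        have "\<beta> a e (v + scl (- 1) w) = \<beta> a e v + - 1 * \<beta> a e w"
          using lin unfolding Vector_Spaces.linear_iff by metis
        then show ?thesis by simp
      qed
      have "(\<Sum>b<n. \<beta> b e (k i) * \<beta> a e (m b)) = (\<Sum>b<n. if b = a then \<beta> b e (k i) else 0)"
        using \<beta> e a by (intro sum.cong) auto
      then show ?thesis unfolding s_def sub linear_functional_fam[OF lin] using a by simp
    qed
    then show "s i e \<in> Soc g M j e" unfolding Soc[OF e] by simp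
  qed
  moreover have "s i x = k i" if "i < d" for i
    using k(2)[OF that] unfolding Soc[OF W(2)] s_def by simp
  then have "indep_fam scl d (\<lambda>i. s i x)" using k(1) unfolding indep_fam_def by simp
  ultimately show ?thesis using W(1,2) by - (rule exI[of _ W], rule exI[of _ s], simp)
qed

theorem Ker_bundle:
  assumes X: "X \<subseteq> Elem r g" and d: "\<forall>e\<in>X. V.dim (Soc g M j e) = d"
  shows "vector_bundle scl (Ev X) (Ker_sheaf g B M r j X)"
    and "x \<in> X \<Longrightarrow> fibre_identified scl (Ev X) (Ker_sheaf g B M r j X) x (Soc g M j x)"
proof -
  note K = Ker_sheaf_eq[OF X]
  have N: "\<forall>U t. t \<in> desc X (KerT X) U \<longrightarrow> (\<forall>e\<in>U. t e \<in> Soc g M j e)" unfolding desc_Ker_iff[OF X] by blast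
  have loc: "\<forall>x\<in>topspace (zar (Ev X)). \<exists>U (n::nat) s. openin (zar (Ev X)) U \<and> x \<in> U \<and>
      (\<forall>i<n. s i \<in> desc X (KerT X) U) \<and> indep_fam scl n (\<lambda>i. s i x) \<and> (\<forall>e\<in>U. V.dim (Soc g M j e) \<le> n)"
  proof
    fix x assume "x \<in> topspace (zar (Ev X))"
    then have x: "x \<in> X" using topspace_Evar[OF X] by simp
    from Soc_sections[OF X x d] obtain U s where U: "openin (zar (Ev X)) U" "x \<in> U"
      "\<forall>i<d. s i \<in> desc X (KerT X) U" "indep_fam scl d (\<lambda>i. s i x)"
      by (elim exE conjE) (rule that)
    have "\<forall>e\<in>U. V.dim (Soc g M j e) \<le> d"
      using openin_subset[OF U(1)] topspace_Evar[OF X] d by auto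
    then show "\<exists>U (n::nat) s. openin (zar (Ev X)) U \<and> x \<in> U \<and>
      (\<forall>i<n. s i \<in> desc X (KerT X) U) \<and> indep_fam scl n (\<lambda>i. s i x) \<and> (\<forall>e\<in>U. V.dim (Soc g M j e) \<le> n)"
      using U by (intro exI[of _ U], intro exI[of _ d], intro exI[of _ s]) simp
  qed
  show "vector_bundle scl (Ev X) (Ker_sheaf g B M r j X)"
    unfolding K(1) by (rule bundle_fibres(1)[OF fmod_Ev K(2) N loc])
  show "fibre_identified scl (Ev X) (Ker_sheaf g B M r j X) x (Soc g M j x)" if "x \<in> X"
    unfolding K(1) by (rule bundle_fibres(2)[OF fmod_Ev K(2) N loc]) (use that topspace_Evar[OF X] in simp_all)
qed


end


section \<open>Restriction to open subsets\<close>

lemma openin_subvariety_open: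
  assumes "openin (zar (subvariety S A)) A'" "A' \<subseteq> A"
  shows "openin (zar (subvariety S A')) U \<longleftrightarrow> openin (zar (subvariety S A)) U \<and> U \<subseteq> A'"
proof
  assume "openin (zar (subvariety S A')) U"
  then obtain T where T: "openin (zar S) T" "U = T \<inter> A'" by (rule openin_subvarietyE)
  have "openin (zar (subvariety S A)) (T \<inter> A)" using T(1) openin_zar_subvariety by blast
  moreover have "U = (T \<inter> A) \<inter> A'" using T(2) assms(2) by auto
  ultimately show "openin (zar (subvariety S A)) U \<and> U \<subseteq> A'" using assms(1) by auto
next
  assume U: "openin (zar (subvariety S A)) U \<and> U \<subseteq> A'"
  then obtain T where "openin (zar S) T" "U = T \<inter> A" using openin_subvarietyE by blast
  then show "openin (zar (subvariety S A')) U" unfolding openin_zar_subvariety using U assms(2) by auto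
qed

lemma reg_subvariety_eq: "reg (subvariety S A) U = reg (subvariety S A') U"
  by (simp add: subvariety_def)

context descent_pos
begin

lemma
  assumes E: "E \<subseteq> Elem r g" and X: "openin (zar (Ev E)) X"
  shows openin_Ev_open: "openin (zar (Ev X)) U \<longleftrightarrow> openin (zar (Ev E)) U \<and> U \<subseteq> X"
    and openin_To_open: "openin (zar (To X)) V \<longleftrightarrow> openin (zar (To E)) V \<and> V \<subseteq> qi E X"
    and qi_restrict: "U \<subseteq> X \<Longrightarrow> qi X U = qi E U"
proof -
  have XE: "X \<subseteq> E" using openin_subset[OF X] topspace_Evar[OF E] by simp
  show "openin (zar (Ev X)) U \<longleftrightarrow> openin (zar (Ev E)) U \<and> U \<subseteq> X"
    unfolding Evar_def by (rule openin_subvariety_open[OF X[unfolded Evar_def] XE])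
  have q: "qi E X = {Y \<in> comm_frames g r. lspan g Y \<in> X}" unfolding qi_def topspace_torsor using XE by auto
  show "openin (zar (To X)) V \<longleftrightarrow> openin (zar (To E)) V \<and> V \<subseteq> qi E X"
    using openin_subvariety_open[of "affine_variety g r" "{Y \<in> comm_frames g r. lspan g Y \<in> E}" "qi E X" V]
      qi_open[OF E X] XE unfolding torsor_var_def q by auto
  show "qi X U = qi E U" if "U \<subseteq> X" unfolding qi_def topspace_torsor using that XE by auto
qed

text \<open>Inside the open set \<open>X\<close> the topologies, the regular functions and the
  preimages in the two torsors coincide, so both sides agree on open subsets of \<open>X\<close>; on
  all other sets both are empty by convention.\<close>

lemma desc_restrict:
  assumes E: "E \<subseteq> Elem r g" and X: "openin (zar (Ev E)) X"
    and F: "\<And>V. openin (zar (To E)) V \<Longrightarrow> V \<subseteq> qi E X \<Longrightarrow> F X V = F E V"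
  shows "desc X (F X) = restrict_sheaf (Ev E) X (desc E (F E))"
proof
  fix U
  show "desc X (F X) U = restrict_sheaf (Ev E) X (desc E (F E)) U"
  proof (cases "openin (zar (Ev E)) U \<and> U \<subseteq> X")
    case True
    then have "openin (zar (Ev X)) U" using openin_Ev_open[OF E X] by simp
    then have "trivial_sheaf scl (Ev X) U = trivial_sheaf scl (Ev E) U"
      using True unfolding trivial_sheaf_def Evar_def by (simp add: reg_subvariety_eq[of _ X _ E])
    moreover have "F X (qi X U) = F E (qi E U)"
      unfolding qi_restrict[OF E X conjunct2[OF True]]
      using F[OF qi_open[OF E conjunct1[OF True]] qi_mono] True by blast
    ultimately show ?thesis unfolding desc_def restrict_sheaf_def using True by simp
  next
    case False
    then have "\<not> openin (zar (Ev X)) U" using openin_Ev_open[OF E X] by simp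
    then show ?thesis unfolding desc_def restrict_sheaf_def trivial_sheaf_def using False by auto
  qed
qed

lemma triv_To_open:
  assumes E: "E \<subseteq> Elem r g" and X: "openin (zar (Ev E)) X" and V: "V \<subseteq> qi E X"
  shows "trivial_sheaf scl (To X) V = trivial_sheaf scl (To E) V"
  unfolding trivial_sheaf_def openin_To_open[OF E X] using V
  by (simp add: torsor_var_def reg_subvariety_eq[of _ "{Y \<in> comm_frames g r. lspan g Y \<in> X}" _ "{Y \<in> comm_frames g r. lspan g Y \<in> E}"])

text \<open>The local conditions behind the image on the torsor refer only to open subsets of
  \<open>V\<close>, where the torsors over \<open>X\<close> and \<open>E\<close> have the same
  sections.\<close>

lemma Im_sheaf_restrict:
  assumes E: "E \<subseteq> Elem r g" and X: "openin (zar (Ev E)) X"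
  shows "Im_sheaf g B M r j X = restrict_sheaf (Ev E) X (Im_sheaf g B M r j E)"
proof -
  have XE: "X \<subseteq> Elem r g" using openin_subset[OF X] topspace_Evar[OF E] E by simp
  have "ImT X V = ImT E V" if V: "V \<subseteq> qi E X" for V
  proof -
    have "openin (zar (To X)) V' \<and> x \<in> V' \<and> V' \<subseteq> V \<and>
        (\<forall>js\<in>exponents r j. t js \<in> trivial_sheaf scl (To X) V') \<and> Q \<longleftrightarrow>
      openin (zar (To E)) V' \<and> x \<in> V' \<and> V' \<subseteq> V \<and>
        (\<forall>js\<in>exponents r j. t js \<in> trivial_sheaf scl (To E) V') \<and> Q" for V' x t Q
    proof (cases "V' \<subseteq> V")
      case True
      then have "V' \<subseteq> qi E X" using V by auto
      then show ?thesis unfolding triv_To_open[OF E X \<open>V' \<subseteq> qi E X\<close>] openin_To_open[OF E X] by simp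
    qed simp
    then show ?thesis unfolding Im_torsor_def triv_To_open[OF E X V] by (simp only:)
  qed
  then show ?thesis unfolding Im_sheaf_eq(1)[OF XE] Im_sheaf_eq(1)[OF E] by (intro desc_restrict E X)
qed

lemma Ker_sheaf_restrict:
  assumes E: "E \<subseteq> Elem r g" and X: "openin (zar (Ev E)) X"
  shows "Ker_sheaf g B M r j X = restrict_sheaf (Ev E) X (Ker_sheaf g B M r j E)"
proof -
  have XE: "X \<subseteq> Elem r g" using openin_subset[OF X] topspace_Evar[OF E] E by simp
  have "KerT X V = KerT E V" if V: "V \<subseteq> qi E X" for V
    unfolding Ker_torsor_def triv_To_open[OF E X V] ..
  then show ?thesis unfolding Ker_sheaf_eq(1)[OF XE] Ker_sheaf_eq(1)[OF E] by (intro desc_restrict E X)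
qed


section \<open>The loci of extremal dimension\<close>

text \<open>Dimensions are bounded by that of \<open>M\<close>, so the maximum is taken over a
  finite set and the complement is where it is attained. Near such a point the dimension cannot
  drop, hence it stays maximal.\<close>

lemma Rad_locus_complement:
  fixes X defines "X \<equiv> Elem r g - Rad_locus j r g M"
  shows "openin (zar (Ev (Elem r g))) X" "\<exists>d. \<forall>e\<in>X. V.dim (Rad g M j e) = d"
proof -
  let ?d = "\<lambda>e. V.dim (Rad g M j e)" and ?E = "Elem r g"
  have "?d ` ?E \<subseteq> {..V.dim (UNIV :: 'm set)}" using VF.dim_subset[OF subset_UNIV] by blast
  then have fin: "finite (?d ` ?E)" by (rule finite_subset) simp
  have le: "?d e \<le> Max (?d ` ?E)" if "e \<in> ?E" for e using fin that by simp
  have X: "X = {e \<in> ?E. ?d e = Max (?d ` ?E)}"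
    unfolding X_def Rad_locus_def using le by (auto simp: order.antisym not_less)
  show "\<exists>d. \<forall>e\<in>X. ?d e = d" unfolding X by blast
  show "openin (zar (Ev ?E)) X"
  proof (subst openin_subopen, rule ballI)
    fix x assume x: "x \<in> X"
    then have "x \<in> ?E" unfolding X by simp
    from Rad_dim_semicontinuous[OF subset_refl this] obtain W where W: "openin (zar (Ev ?E)) W" "x \<in> W"
      "\<forall>e\<in>W. ?d x \<le> ?d e" by (elim exE conjE) (rule that)
    have "W \<subseteq> X"
    proof
      fix e assume e: "e \<in> W"
      then have "e \<in> ?E" using openin_subset[OF W(1)] topspace_Evar[OF subset_refl] by auto
      then show "e \<in> X" using W(3) e x le[of e] unfolding X by (auto intro: order.antisym)
    qed
    then show "\<exists>T. openin (zar (Ev ?E)) T \<and> x \<in> T \<and> T \<subseteq> X" using W(1,2) by blast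
  qed
qed

text \<open>The complement is where the minimum is attained, and near such a point the dimension of
  the socle cannot rise.\<close>

lemma Soc_locus_complement:
  fixes X defines "X \<equiv> Elem r g - Soc_locus j r g M"
  shows "openin (zar (Ev (Elem r g))) X" "\<exists>d. \<forall>e\<in>X. V.dim (Soc g M j e) = d"
proof -
  let ?d = "\<lambda>e. V.dim (Soc g M j e)" and ?E = "Elem r g"
  have "?d ` ?E \<subseteq> {..V.dim (UNIV :: 'm set)}" using VF.dim_subset[OF subset_UNIV] by blast
  then have fin: "finite (?d ` ?E)" by (rule finite_subset) simp
  have le: "Min (?d ` ?E) \<le> ?d e" if "e \<in> ?E" for e using fin that by simp
  have X: "X = {e \<in> ?E. ?d e = Min (?d ` ?E)}"
    unfolding X_def Soc_locus_def using le by (auto simp: order.antisym not_less)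
  show "\<exists>d. \<forall>e\<in>X. ?d e = d" unfolding X by blast
  show "openin (zar (Ev ?E)) X"
  proof (subst openin_subopen, rule ballI)
    fix x assume x: "x \<in> X"
    then have "x \<in> ?E" unfolding X by simp
    from Soc_dim_semicontinuous[OF subset_refl this] obtain W where W: "openin (zar (Ev ?E)) W" "x \<in> W"
      "\<forall>e\<in>W. ?d e \<le> ?d x" by (elim exE conjE) (rule that)
    have "W \<subseteq> X"
    proof
      fix e assume e: "e \<in> W"
      then have "e \<in> ?E" using openin_subset[OF W(1)] topspace_Evar[OF subset_refl] by auto
      then show "e \<in> X" using W(3) e x le[of e] unfolding X by (auto intro: order.antisym)
    qed
    then show "\<exists>T. openin (zar (Ev ?E)) T \<and> x \<in> T \<and> T \<subseteq> X" using W(1,2) by blast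
  qed
qed

end

theorem theorem3p2:
  fixes g :: "('k::alg_closed_field, 'g::ab_group_add) lie_data"
    and B :: "'g set"
    and M :: "('k, 'g, 'm::ab_group_add) mod_data"
    and r j :: nat
  assumes char_pos: "CHAR('k) > 0"
    and g: "restricted_lie_algebra g"
    and B: "finite_dimensional_vector_space (lscale g) B"
    and M: "uenv_module g M"
    and M_fin: "\<exists>C. finite_dimensional_vector_space (mscale M) C"
    and r: "0 < r" "r < vector_space.dim (lscale g) (UNIV :: 'g set)"
    and j: "0 < j" "j \<le> (CHAR('k) - 1) * r"
  shows
    "(let E = Elem r g; X = E - Rad_locus j r g M in
        openin (zar (Evar r g E)) X \<and>
        Im_sheaf g B M r j X = restrict_sheaf (Evar r g E) X (Im_sheaf g B M r j E) \<and>
        vector_bundle (mscale M) (Evar r g X) (Im_sheaf g B M r j X) \<and>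
        (\<forall>\<epsilon>\<in>X. fibre_identified (mscale M) (Evar r g X) (Im_sheaf g B M r j X) \<epsilon> (Rad g M j \<epsilon>))) \<and>
     (let E = Elem r g; X = E - Soc_locus j r g M in
        openin (zar (Evar r g E)) X \<and>
        Ker_sheaf g B M r j X = restrict_sheaf (Evar r g E) X (Ker_sheaf g B M r j E) \<and>
        vector_bundle (mscale M) (Evar r g X) (Ker_sheaf g B M r j X) \<and>
        (\<forall>\<epsilon>\<in>X. fibre_identified (mscale M) (Evar r g X) (Ker_sheaf g B M r j X) \<epsilon> (Soc g M j \<epsilon>)))"
proof -
  obtain C where C: "finite_dimensional_vector_space (mscale M) C" using M_fin ..
  \<comment> \<open>The basis \<open>C\<close> of \<open>M\<close> is an auxiliary choice for
    coordinates of sections; the sheaves themselves do not refer to it.\<close>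
  interpret descent_pos g M B r C j
    using char_pos g M B C
    by (intro descent_pos.intro descent.intro umod.intro grass.intro descent_pos_axioms.intro)
      (simp_all add: restricted_lie_algebra_def)
  have R: "\<exists>d. \<forall>e\<in>Elem r g - Rad_locus j r g M. V.dim (Rad g M j e) = d" by (rule Rad_locus_complement(2))
  have S: "\<exists>d. \<forall>e\<in>Elem r g - Soc_locus j r g M. V.dim (Soc g M j e) = d" by (rule Soc_locus_complement(2))
  note restr = Im_sheaf_restrict[OF subset_refl Rad_locus_complement(1)]
    Ker_sheaf_restrict[OF subset_refl Soc_locus_complement(1)]
  from R obtain d where Im: "\<And>e. e \<in> Elem r g - Rad_locus j r g M \<Longrightarrow> V.dim (Rad g M j e) = d" by blast
  from S obtain d' where Ker: "\<forall>e\<in>Elem r g - Soc_locus j r g M. V.dim (Soc g M j e) = d'" ..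
  show ?thesis
    unfolding Let_def
    by (intro conjI ballI Rad_locus_complement(1) Soc_locus_complement(1) restr
        Im_bundle[OF Diff_subset Im] Ker_bundle[OF Diff_subset Ker])
qed

end
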